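(* Let $B$ be a Hopf algebra with bijective antipode $S$. View $B^{*\mathrm{cop}}$ and $B$ as Yetter--Drinfeld $\mathcal D(B)$-module algebras with the actions $(\mu\otimes m)\triangleright\beta=\mu''(m\rightharpoonup\beta){S^*}^{-1}(\mu')$, $(\mu\otimes m)\triangleright b=(m'bS(m''))\leftharpoonup{S^*}^{-1}(\mu)$ and the coactions $\beta\mapsto(\beta''\otimes1)\otimes\beta'$, $b\mapsto(\varepsilon\otimes b')\otimes b''$. For $n\ge1$, consider the alternating multiple braided products (Heisenberg $n$-tuples, or chains) $$\mathcal H_{2n}=B^{*\mathrm{cop}}\bowtie B\bowtie B^{*\mathrm{cop}}\bowtie B\bowtie\dots\bowtie B,\qquad \mathcal H_{2n+1}=B^{*\mathrm{cop}}\bowtie B\bowtie\dots\bowtie B\bowtie B^{*\mathrm{cop}}$$ (with $2n$ and $2n+1$ factors, respectively), with diagonal $\mathcal D(B)$-action and codiagonal coaction. The following relations hold in them, where $\beta[2j+1]$ and $b[2i]$ denote the images of $\beta\in B^{*\mathrm{cop}}$ and $b\in B$ in the $(2j+1)$st and $(2i)$th factors: $$b[2i]\,\beta[2j+1]=(b'\rightharpoonup\beta)[2j+1]\,b''[2i]\quad\text{for all } i \text{ and } j,$$ $$\alpha[2i+1]\,\beta[2j+1]=(\alpha'''\beta\,{S^*}^{-1}(\alpha''))[2j+1]\,\alpha'[2i+1],\quad i\ge j,$$ $$a[2i]\,b[2j]=(a'\,b\,S(a''))[2j]\,a'''[2i],\quad i\ge j,$$ for all $a,b\in B$ and $\alpha,\beta\in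 B^{*\mathrm{cop}}$. Chains with the leftmost factor $B$ are defined entirely similarly, and the obvious embeddings allow defining one-sided or two-sided inductive limits of alternating chains. All the chains are Yetter--Drinfeld $\mathcal D(B)$-module algebras, but none with $\ge3$ factors are braided commutative in general.
   Context: Notation. Primes denote Sweedler components of the coproduct. $\langle\ ,\ \rangle$ is evaluation; $B^*$ is the dual Hopf algebra of $B$, with product $\langle\alpha\beta,b\rangle=\langle\alpha,b'\rangle\langle\beta,b''\rangle$, coproduct $\beta\mapsto\beta'\otimes\beta''$ with $\langle\beta',a\rangle\langle\beta'',b\rangle=\langle\beta,ab\rangle$, unit $\varepsilon$ (the counit of $B$), and antipode $S^*$; $B^{*\mathrm{cop}}$ is $B^*$ with the same product and opposite coproduct (Sweedler primes on elements of $B^*$ always refer to the coproduct of $B^*$). Regular actions: $b\rightharpoonup\beta=\langle\beta'',b\rangle\beta'$, $\ \beta\leftharpoonup m=\langle\beta',m\rangle\beta''$, $\ b\leftharpoonup\mu=\langle\mu,b'\rangle b''$. Drinfeld double: $\mathcal D(B)$ is the vector space $B^*\otimes B$ with product $(\mu\otimes m)(\nu\otimes n)=\mu(m'\rightharpoonup\nu\leftharpoonup S^{-1}(m'''))\otimes m''n$ and coproduct $\Delta(\mu\otimes m)=(\mu''\otimes m')\otimes(\mu'\otimes m'')$. A left--left Yetter--Drinfeld $H$-module algebra is an algebra $X$ that is a left $H$-module algebra (action $\triangleright$) and a left $H$-comodule algebra (coaction $\delta:X\to H\otimes X$, $\delta(x)=x_{(-1)}\otimes x_{(0)}$, an algebra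 homomorphism) such that $(h'\triangleright x)_{(-1)}h''\otimes(h'\triangleright x)_{(0)}=h'x_{(-1)}\otimes(h''\triangleright x_{(0)})$ for all $h\in H$, $x\in X$. It is braided commutative if $yx=(y_{(-1)}\triangleright x)\,y_{(0)}$ for all $x,y\in X$. Multiple braided product: for left--left Yetter--Drinfeld $H$-module algebras $X_1,\dots,X_N$, $X_1\bowtie\dots\bowtie X_N$ is $X_1\otimes\dots\otimes X_N$ with the diagonal action and codiagonal coaction of $H$, and with the product in which each $X_i$ embeds as a subalgebra ($x\mapsto x[i]$, with $1$ in the other factors), $x_1\otimes\dots\otimes x_N=x_1[1]\cdots x_N[N]$, and $x[i]\,y[j]=(x_{(-1)}\triangleright y)[j]\,x_{(0)}[i]$ for $x\in X_i$, $y\in X_j$, $i>j$. *)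

theory Defs
  imports Complex_Main "HOL-Library.FuncSet" "HOL-Library.Function_Algebras"
    "HOL-Library.Product_Plus"
begin

section \<open>Vector spaces and tensor products\<close>

text \<open>The ground field is a type of class \<^class>\<open>field\<close>. A vector space is a
  linear subspace \<open>carr\<close> of an ambient vector space that lives on a whole type.\<close>

record ('k, 'v) vs =
  carr :: "'v set"
  scal :: "'k \<Rightarrow> 'v \<Rightarrow> 'v"

definition vspace :: "('k::field, 'v::ab_group_add, 'z) vs_scheme \<Rightarrow> bool" where
  "vspace V \<longleftrightarrow> vector_space (scal V) \<and> module.subspace (scal V) (carr V)"

definition ground :: "('k::field, 'k) vs" where
  "ground = \<lparr>carr = UNIV, scal = (*)\<rparr>"

definition lin_map ::
  "('k::field, 'v::ab_group_add, 'y) vs_scheme \<Rightarrow> ('k, 'w::ab_group_add, 'z) vs_scheme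
    \<Rightarrow> ('v \<Rightarrow> 'w) \<Rightarrow> bool" where
  "lin_map V W f \<longleftrightarrow>
     (\<forall>x\<in>carr V. f x \<in> carr W) \<and>
     (\<forall>x\<in>carr V. \<forall>y\<in>carr V. f (x + y) = f x + f y) \<and>
     (\<forall>c. \<forall>x\<in>carr V. f (scal V c x) = scal W c (f x))"

definition bilin_map ::
  "('k::field, 'v::ab_group_add, 'x) vs_scheme \<Rightarrow> ('k, 'w::ab_group_add, 'y) vs_scheme
    \<Rightarrow> ('k, 'u::ab_group_add, 'z) vs_scheme \<Rightarrow> ('v \<Rightarrow> 'w \<Rightarrow> 'u) \<Rightarrow> bool" where
  "bilin_map V W U f \<longleftrightarrow>
     (\<forall>x\<in>carr V. lin_map W U (f x)) \<and> (\<forall>y\<in>carr W. lin_map V U (\<lambda>x. f x y))"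

text \<open>Over a field, \<open>V \<otimes> W\<close> embeds into the dual of the space of bilinear forms on
  \<open>V \<times> W\<close>; it is realised here as the span of the evaluation functionals
  \<open>v \<otimes> w = (f \<mapsto> f v w)\<close>.\<close>

type_synonym ('k, 'v, 'w) tens = "('v \<Rightarrow> 'w \<Rightarrow> 'k) \<Rightarrow> 'k"

definition fun_scal :: "'k::field \<Rightarrow> ('a \<Rightarrow> 'k) \<Rightarrow> 'a \<Rightarrow> 'k" where
  "fun_scal c t = (\<lambda>f. c * t f)"

definition tpure ::
  "('k::field, 'v::ab_group_add, 'y) vs_scheme \<Rightarrow> ('k, 'w::ab_group_add, 'z) vs_scheme
    \<Rightarrow> 'v \<Rightarrow> 'w \<Rightarrow> ('k, 'v, 'w) tens" where
  "tpure V W v w = (\<lambda>f. if bilin_map V W ground f then f v w else 0)"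

definition tensor ::
  "('k::field, 'v::ab_group_add, 'y) vs_scheme \<Rightarrow> ('k, 'w::ab_group_add, 'z) vs_scheme
    \<Rightarrow> ('k, ('k, 'v, 'w) tens) vs" where
  "tensor V W =
     \<lparr>carr = module.span fun_scal {tpure V W v w |v w. v \<in> carr V \<and> w \<in> carr W},
      scal = fun_scal\<rparr>"

text \<open>\<open>tlift V W \<phi> t\<close> is the value at \<open>t \<in> V \<otimes> W\<close> of the linear map that sends
  \<open>v \<otimes> w\<close> to \<open>\<phi> v w\<close>, for a bilinear \<open>\<phi>\<close>.\<close>

definition tlift ::
  "('k::field, 'v::ab_group_add, 'y) vs_scheme \<Rightarrow> ('k, 'w::ab_group_add, 'z) vs_scheme
    \<Rightarrow> ('v \<Rightarrow> 'w \<Rightarrow> 'u::ab_group_add) \<Rightarrow> ('k, 'v, 'w) tens \<Rightarrow> 'u" where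
  "tlift V W \<phi> t = (THE u. \<exists>ps. set ps \<subseteq> carr V \<times> carr W \<and>
     t = (\<Sum>(v, w)\<leftarrow>ps. tpure V W v w) \<and> u = (\<Sum>(v, w)\<leftarrow>ps. \<phi> v w))"

text \<open>Tensor products of a nonempty family \<open>(X i)\<close>, \<open>i \<in> I\<close>, in the same way.\<close>

type_synonym ('k, 'i, 'x) mtens = "(('i \<Rightarrow> 'x) \<Rightarrow> 'k) \<Rightarrow> 'k"

definition multilin_form ::
  "'i set \<Rightarrow> ('i \<Rightarrow> ('k::field, 'x::ab_group_add, 'z) vs_scheme) \<Rightarrow> (('i \<Rightarrow> 'x) \<Rightarrow> 'k) \<Rightarrow> bool"
  where
  "multilin_form I X f \<longleftrightarrow>
     (\<forall>x \<in> Pi\<^sub>E I (\<lambda>i. carr (X i)). \<forall>i\<in>I. lin_map (X i) ground (\<lambda>v. f (x(i := v))))"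

definition mpure ::
  "'i set \<Rightarrow> ('i \<Rightarrow> ('k::field, 'x::ab_group_add, 'z) vs_scheme) \<Rightarrow> ('i \<Rightarrow> 'x)
    \<Rightarrow> ('k, 'i, 'x) mtens" where
  "mpure I X x = (\<lambda>f. if multilin_form I X f then f x else 0)"

definition mtensor ::
  "'i set \<Rightarrow> ('i \<Rightarrow> ('k::field, 'x::ab_group_add, 'z) vs_scheme)
    \<Rightarrow> ('k, ('k, 'i, 'x) mtens) vs" where
  "mtensor I X =
     \<lparr>carr = module.span fun_scal (mpure I X ` Pi\<^sub>E I (\<lambda>i. carr (X i))), scal = fun_scal\<rparr>"

definition mlift ::
  "'i set \<Rightarrow> ('i \<Rightarrow> ('k::field, 'x::ab_group_add, 'z) vs_scheme)
    \<Rightarrow> (('i \<Rightarrow> 'x) \<Rightarrow> 'u::ab_group_add) \<Rightarrow> ('k, 'i, 'x) mtens \<Rightarrow> 'u" where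
  "mlift I X \<phi> t = (THE u. \<exists>xs. set xs \<subseteq> Pi\<^sub>E I (\<lambda>i. carr (X i)) \<and>
     t = (\<Sum>x\<leftarrow>xs. mpure I X x) \<and> u = (\<Sum>x\<leftarrow>xs. \<phi> x))"


section \<open>Hopf algebras\<close>

record ('k, 'v) alg = "('k, 'v) vs" +
  mul :: "'v \<Rightarrow> 'v \<Rightarrow> 'v"
  unity :: "'v"

record ('k, 'v) bialg = "('k, 'v) alg" +
  cop :: "'v \<Rightarrow> ('k, 'v, 'v) tens"
  cou :: "'v \<Rightarrow> 'k"

record ('k, 'v) hopf = "('k, 'v) bialg" +
  anti :: "'v \<Rightarrow> 'v"

definition assoc_algebra :: "('k::field, 'v::ab_group_add, 'z) alg_scheme \<Rightarrow> bool" where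
  "assoc_algebra A \<longleftrightarrow>
     vspace A \<and> bilin_map A A A (mul A) \<and> unity A \<in> carr A \<and>
     (\<forall>x\<in>carr A. \<forall>y\<in>carr A. \<forall>z\<in>carr A. mul A (mul A x y) z = mul A x (mul A y z)) \<and>
     (\<forall>x\<in>carr A. mul A (unity A) x = x \<and> mul A x (unity A) = x)"

text \<open>Sweedler sums: \<open>sw H h (\<lambda>h1 h2. \<phi> h1 h2)\<close> stands for \<open>\<phi>(h', h'')\<close>, and
  \<open>sw3\<close> is the version for \<open>h', h'', h'''\<close>.\<close>

definition sw ::
  "('k::field, 'h::ab_group_add, 'z) bialg_scheme \<Rightarrow> 'h \<Rightarrow> ('h \<Rightarrow> 'h \<Rightarrow> 'u::ab_group_add) \<Rightarrow> 'u"
  where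
  "sw H h \<phi> = tlift H H \<phi> (cop H h)"

definition sw3 ::
  "('k::field, 'h::ab_group_add, 'z) bialg_scheme \<Rightarrow> 'h
    \<Rightarrow> ('h \<Rightarrow> 'h \<Rightarrow> 'h \<Rightarrow> 'u::ab_group_add) \<Rightarrow> 'u" where
  "sw3 H h \<phi> = sw H h (\<lambda>h1 g. sw H g (\<lambda>h2 h3. \<phi> h1 h2 h3))"

definition bialgebra :: "('k::field, 'h::ab_group_add, 'z) bialg_scheme \<Rightarrow> bool" where
  "bialgebra H \<longleftrightarrow>
     assoc_algebra H \<and> lin_map H (tensor H H) (cop H) \<and> lin_map H ground (cou H) \<and>
     (\<forall>x\<in>carr H.
        sw H x (\<lambda>y c. sw H y (\<lambda>a b. tpure H (tensor H H) a (tpure H H b c)))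
        = sw H x (\<lambda>a y. tpure H (tensor H H) a (cop H y))) \<and>
     (\<forall>x\<in>carr H. sw H x (\<lambda>a b. scal H (cou H a) b) = x \<and>
                 sw H x (\<lambda>a b. scal H (cou H b) a) = x) \<and>
     (\<forall>x\<in>carr H. \<forall>y\<in>carr H.
        cop H (mul H x y)
        = sw H x (\<lambda>x1 x2. sw H y (\<lambda>y1 y2. tpure H H (mul H x1 y1) (mul H x2 y2)))) \<and>
     cop H (unity H) = tpure H H (unity H) (unity H) \<and>
     (\<forall>x\<in>carr H. \<forall>y\<in>carr H. cou H (mul H x y) = cou H x * cou H y) \<and>
     cou H (unity H) = 1"

definition hopf_algebra :: "('k::field, 'h::ab_group_add, 'z) hopf_scheme \<Rightarrow> bool" where
  "hopf_algebra H \<longleftrightarrow>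
     bialgebra H \<and> lin_map H H (anti H) \<and>
     (\<forall>x\<in>carr H. sw H x (\<lambda>a b. mul H (anti H a) b) = scal H (cou H x) (unity H) \<and>
                 sw H x (\<lambda>a b. mul H a (anti H b)) = scal H (cou H x) (unity H))"

definition anti_inv :: "('k::field, 'h::ab_group_add, 'z) hopf_scheme \<Rightarrow> 'h \<Rightarrow> 'h" where
  "anti_inv H = inv_into (carr H) (anti H)"


section \<open>The dual Hopf algebra and the Drinfeld double\<close>

text \<open>The dual Hopf algebra consists of the linear forms \<open>\<beta>\<close> for which \<open>(a, b) \<mapsto> \<beta>(ab)\<close>
  lies in the algebraic tensor square of the space of linear forms (the finite dual).
  For finite-dimensional \<open>B\<close> these are all linear forms. Forms are extended by \<open>0\<close>
  outside of the carrier of \<open>B\<close>.\<close>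

definition ext0 :: "('k::field, 'b::ab_group_add, 'z) vs_scheme \<Rightarrow> ('b \<Rightarrow> 'k) \<Rightarrow> 'b \<Rightarrow> 'k" where
  "ext0 V f = (\<lambda>b. if b \<in> carr V then f b else 0)"

definition dual_vs ::
  "('k::field, 'b::ab_group_add, 'z) hopf_scheme \<Rightarrow> ('k, 'b \<Rightarrow> 'k) vs" where
  "dual_vs B =
     \<lparr>carr = {\<beta>. lin_map B ground \<beta> \<and> ext0 B \<beta> = \<beta> \<and>
               (\<exists>ps. (\<forall>(f, g) \<in> set ps. lin_map B ground f \<and> lin_map B ground g) \<and>
                     (\<forall>a\<in>carr B. \<forall>b\<in>carr B. \<beta> (mul B a b) = (\<Sum>(f, g)\<leftarrow>ps. f a * g b)))},
      scal = fun_scal\<rparr>"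

definition dual ::
  "('k::field, 'b::ab_group_add, 'z) hopf_scheme \<Rightarrow> ('k, 'b \<Rightarrow> 'k) hopf" where
  "dual B =
     \<lparr>carr = carr (dual_vs B),
      scal = scal (dual_vs B),
      mul = (\<lambda>\<alpha> \<beta>. ext0 B (\<lambda>b. sw B b (\<lambda>b1 b2. \<alpha> b1 * \<beta> b2))),
      unity = ext0 B (cou B),
      cop = (\<lambda>\<beta>. THE t. t \<in> carr (tensor (dual_vs B) (dual_vs B)) \<and>
               (\<forall>a\<in>carr B. \<forall>b\<in>carr B.
                  tlift (dual_vs B) (dual_vs B) (\<lambda>\<beta>1 \<beta>2. \<beta>1 a * \<beta>2 b) t = \<beta> (mul B a b))),
      cou = (\<lambda>\<beta>. \<beta> (unity B)),
      anti = (\<lambda>\<beta>. ext0 B (\<lambda>b. \<beta> (anti B b)))\<rparr>"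

text \<open>Regular actions \<open>b \<rightharpoonup> \<beta>\<close>, \<open>\<beta> \<leftharpoonup> m\<close> and \<open>b \<leftharpoonup> \<mu>\<close>.\<close>

definition hit ::
  "('k::field, 'b::ab_group_add, 'z) hopf_scheme \<Rightarrow> 'b \<Rightarrow> ('b \<Rightarrow> 'k) \<Rightarrow> 'b \<Rightarrow> 'k" where
  "hit B b \<beta> = sw (dual B) \<beta> (\<lambda>\<beta>1 \<beta>2. scal (dual B) (\<beta>2 b) \<beta>1)"

definition hit_right ::
  "('k::field, 'b::ab_group_add, 'z) hopf_scheme \<Rightarrow> ('b \<Rightarrow> 'k) \<Rightarrow> 'b \<Rightarrow> 'b \<Rightarrow> 'k" where
  "hit_right B \<beta> m = sw (dual B) \<beta> (\<lambda>\<beta>1 \<beta>2. scal (dual B) (\<beta>1 m) \<beta>2)"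

definition hit_by_form ::
  "('k::field, 'b::ab_group_add, 'z) hopf_scheme \<Rightarrow> 'b \<Rightarrow> ('b \<Rightarrow> 'k) \<Rightarrow> 'b" where
  "hit_by_form B b \<mu> = sw B b (\<lambda>b1 b2. scal B (\<mu> b1) b2)"

abbreviation double_vs ::
  "('k::field, 'b::ab_group_add, 'z) hopf_scheme \<Rightarrow> ('k, ('k, 'b \<Rightarrow> 'k, 'b) tens) vs" where
  "double_vs B \<equiv> tensor (dual B) B"

definition double ::
  "('k::field, 'b::ab_group_add, 'z) hopf_scheme \<Rightarrow> ('k, ('k, 'b \<Rightarrow> 'k, 'b) tens) bialg" where
  "double B =
     \<lparr>carr = carr (double_vs B),
      scal = scal (double_vs B),
      mul = (\<lambda>s t.
        tlift (dual B) B (\<lambda>\<mu> m.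
          tlift (dual B) B (\<lambda>\<nu> n.
            sw3 B m (\<lambda>m1 m2 m3.
              tpure (dual B) B
                (mul (dual B) \<mu> (hit_right B (hit B m1 \<nu>) (anti_inv B m3)))
                (mul B m2 n))) t) s),
      unity = tpure (dual B) B (unity (dual B)) (unity B),
      cop = tlift (dual B) B (\<lambda>\<mu> m.
        sw (dual B) \<mu> (\<lambda>\<mu>1 \<mu>2. sw B m (\<lambda>m1 m2.
          tpure (double_vs B) (double_vs B)
            (tpure (dual B) B \<mu>2 m1) (tpure (dual B) B \<mu>1 m2)))),
      cou = tlift (dual B) B (\<lambda>\<mu> m. cou (dual B) \<mu> * cou B m)\<rparr>"


section \<open>Yetter--Drinfeld module algebras\<close>

record ('k, 'h, 'x) yd = "('k, 'x) alg" +
  act :: "'h \<Rightarrow> 'x \<Rightarrow> 'x"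
  coact :: "'x \<Rightarrow> ('k, 'h, 'x) tens"

text \<open>\<open>tlift H X (\<lambda>g z. \<phi> g z) (coact X x)\<close> stands for \<open>\<phi>(x_{(-1)}, x_{(0)})\<close>.\<close>

definition yd_module_algebra ::
  "('k::field, 'h::ab_group_add, 'y) bialg_scheme
    \<Rightarrow> ('k, 'h, 'x::ab_group_add, 'z) yd_scheme \<Rightarrow> bool" where
  "yd_module_algebra H X \<longleftrightarrow>
     bialgebra H \<and> assoc_algebra X \<and>
     bilin_map H X X (act X) \<and>
     (\<forall>x\<in>carr X. act X (unity H) x = x) \<and>
     (\<forall>g\<in>carr H. \<forall>h\<in>carr H. \<forall>x\<in>carr X. act X (mul H g h) x = act X g (act X h x)) \<and>
     (\<forall>h\<in>carr H. \<forall>x\<in>carr X. \<forall>y\<in>carr X.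
        act X h (mul X x y) = sw H h (\<lambda>h1 h2. mul X (act X h1 x) (act X h2 y))) \<and>
     (\<forall>h\<in>carr H. act X h (unity X) = scal X (cou H h) (unity X)) \<and>
     lin_map X (tensor H X) (coact X) \<and>
     (\<forall>x\<in>carr X.
        tlift H X (\<lambda>g z. sw H g (\<lambda>g1 g2. tpure H (tensor H X) g1 (tpure H X g2 z))) (coact X x)
        = tlift H X (\<lambda>g z. tpure H (tensor H X) g (coact X z)) (coact X x)) \<and>
     (\<forall>x\<in>carr X. tlift H X (\<lambda>g z. scal X (cou H g) z) (coact X x) = x) \<and>
     (\<forall>x\<in>carr X. \<forall>y\<in>carr X.
        coact X (mul X x y)
        = tlift H X (\<lambda>g z. tlift H X (\<lambda>h w. tpure H X (mul H g h) (mul X z w)) (coact X y))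
            (coact X x)) \<and>
     coact X (unity X) = tpure H X (unity H) (unity X) \<and>
     (\<forall>h\<in>carr H. \<forall>x\<in>carr X.
        sw H h (\<lambda>h1 h2. tlift H X (\<lambda>g z. tpure H X (mul H g h2) z) (coact X (act X h1 x)))
        = sw H h (\<lambda>h1 h2. tlift H X (\<lambda>g z. tpure H X (mul H h1 g) (act X h2 z)) (coact X x)))"

definition braided_commutative ::
  "('k::field, 'h::ab_group_add, 'y) bialg_scheme
    \<Rightarrow> ('k, 'h, 'x::ab_group_add, 'z) yd_scheme \<Rightarrow> bool" where
  "braided_commutative H X \<longleftrightarrow>
     (\<forall>x\<in>carr X. \<forall>y\<in>carr X.
        mul X y x = tlift H X (\<lambda>g z. mul X (act X g x) z) (coact X y))"

definition yd_hom ::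
  "('k::field, 'h::ab_group_add, 'u) bialg_scheme \<Rightarrow> ('k, 'h, 'x::ab_group_add, 'y) yd_scheme
    \<Rightarrow> ('k, 'h, 'w::ab_group_add, 'z) yd_scheme \<Rightarrow> ('x \<Rightarrow> 'w) \<Rightarrow> bool" where
  "yd_hom H X Y f \<longleftrightarrow>
     lin_map X Y f \<and>
     (\<forall>x\<in>carr X. \<forall>y\<in>carr X. f (mul X x y) = mul Y (f x) (f y)) \<and> f (unity X) = unity Y \<and>
     (\<forall>h\<in>carr H. \<forall>x\<in>carr X. f (act X h x) = act Y h (f x)) \<and>
     (\<forall>x\<in>carr X. coact Y (f x) = tlift H X (\<lambda>g z. tpure H Y g (f z)) (coact X x))"


section \<open>Multiple braided products\<close>

text \<open>The factors are indexed by a finite nonempty set \<open>I\<close> of integers, in increasing order.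
  All factors have the same type of elements. \<open>factor_at I X i x\<close> is \<open>x[i]\<close>.\<close>

definition factor_at ::
  "int set \<Rightarrow> (int \<Rightarrow> ('k::field, 'h::ab_group_add, 'x::ab_group_add, 'z) yd_scheme)
    \<Rightarrow> int \<Rightarrow> 'x \<Rightarrow> ('k, int, 'x) mtens" where
  "factor_at I X i x = mpure I X (\<lambda>j\<in>I. if j = i then x else unity (X j))"

definition braided_mult ::
  "('k::field, 'h::ab_group_add, 'y) bialg_scheme \<Rightarrow> int set
    \<Rightarrow> (int \<Rightarrow> ('k, 'h, 'x::ab_group_add, 'z) yd_scheme)
    \<Rightarrow> (('k, int, 'x) mtens \<Rightarrow> ('k, int, 'x) mtens \<Rightarrow> ('k, int, 'x) mtens) \<Rightarrow> bool" where
  "braided_mult H I X m \<longleftrightarrow>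
     assoc_algebra
       \<lparr>carr = carr (mtensor I X), scal = scal (mtensor I X), mul = m,
        unity = mpure I X (\<lambda>i\<in>I. unity (X i))\<rparr> \<and>
     (\<forall>i\<in>I. \<forall>x\<in>carr (X i). \<forall>y\<in>carr (X i).
        m (factor_at I X i x) (factor_at I X i y) = factor_at I X i (mul (X i) x y)) \<and>
     (\<forall>x \<in> Pi\<^sub>E I (\<lambda>i. carr (X i)).
        mpure I X x
        = foldr (\<lambda>i. m (factor_at I X i (x i))) (sorted_list_of_set I)
            (mpure I X (\<lambda>i\<in>I. unity (X i)))) \<and>
     (\<forall>i\<in>I. \<forall>j\<in>I. i > j \<longrightarrow> (\<forall>x\<in>carr (X i). \<forall>y\<in>carr (X j).
        m (factor_at I X i x) (factor_at I X j y)
        = tlift H (X i) (\<lambda>g z. m (factor_at I X j (act (X j) g y)) (factor_at I X i z))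
            (coact (X i) x)))"

text \<open>Diagonal action and codiagonal coaction on \<open>x_1 \<otimes> \<dots> \<otimes> x_N\<close>, going through the list
  of indices; the base cases use the counit axiom and the unit of \<open>H\<close>.\<close>

fun diag_act ::
  "('k::field, 'h::ab_group_add, 'y) bialg_scheme \<Rightarrow> int set
    \<Rightarrow> (int \<Rightarrow> ('k, 'h, 'x::ab_group_add, 'z) yd_scheme) \<Rightarrow> int list
    \<Rightarrow> 'h \<Rightarrow> (int \<Rightarrow> 'x) \<Rightarrow> ('k, int, 'x) mtens" where
  "diag_act H I X [] h x = fun_scal (cou H h) (mpure I X x)"
| "diag_act H I X (i # is) h x =
     sw H h (\<lambda>h1 h2. diag_act H I X is h2 (x(i := act (X i) h1 (x i))))"

fun codiag_coact ::
  "('k::field, 'h::ab_group_add, 'y) bialg_scheme \<Rightarrow> int set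
    \<Rightarrow> (int \<Rightarrow> ('k, 'h, 'x::ab_group_add, 'z) yd_scheme) \<Rightarrow> int list
    \<Rightarrow> 'h \<Rightarrow> (int \<Rightarrow> 'x) \<Rightarrow> ('k, 'h, ('k, int, 'x) mtens) tens" where
  "codiag_coact H I X [] g x = tpure H (mtensor I X) g (mpure I X x)"
| "codiag_coact H I X (i # is) g x =
     tlift H (X i) (\<lambda>h z. codiag_coact H I X is (mul H g h) (x(i := z))) (coact (X i) (x i))"

definition braided_product ::
  "('k::field, 'h::ab_group_add, 'y) bialg_scheme \<Rightarrow> int set
    \<Rightarrow> (int \<Rightarrow> ('k, 'h, 'x::ab_group_add, 'z) yd_scheme)
    \<Rightarrow> ('k, 'h, ('k, int, 'x) mtens) yd" where
  "braided_product H I X =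
     \<lparr>carr = carr (mtensor I X),
      scal = scal (mtensor I X),
      mul = (SOME m. braided_mult H I X m),
      unity = mpure I X (\<lambda>i\<in>I. unity (X i)),
      act = (\<lambda>h. mlift I X (diag_act H I X (sorted_list_of_set I) h)),
      coact = mlift I X (codiag_coact H I X (sorted_list_of_set I) (unity H))\<rparr>"


section \<open>Alternating chains\<close>

definition dual_yd ::
  "('k::field, 'b::ab_group_add, 'z) hopf_scheme
    \<Rightarrow> ('k, ('k, 'b \<Rightarrow> 'k, 'b) tens, 'b \<Rightarrow> 'k) yd" where
  "dual_yd B =
     \<lparr>carr = carr (dual B), scal = scal (dual B), mul = mul (dual B), unity = unity (dual B),
      act = (\<lambda>h \<beta>. tlift (dual B) B (\<lambda>\<mu> m.
        sw (dual B) \<mu> (\<lambda>\<mu>1 \<mu>2.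
          mul (dual B) (mul (dual B) \<mu>2 (hit B m \<beta>)) (anti_inv (dual B) \<mu>1))) h),
      coact = (\<lambda>\<beta>. sw (dual B) \<beta> (\<lambda>\<beta>1 \<beta>2.
        tpure (double B) (dual B) (tpure (dual B) B \<beta>2 (unity B)) \<beta>1))\<rparr>"

definition self_yd ::
  "('k::field, 'b::ab_group_add, 'z) hopf_scheme
    \<Rightarrow> ('k, ('k, 'b \<Rightarrow> 'k, 'b) tens, 'b) yd" where
  "self_yd B =
     \<lparr>carr = carr B, scal = scal B, mul = mul B, unity = unity B,
      act = (\<lambda>h b. tlift (dual B) B (\<lambda>\<mu> m.
        hit_by_form B (sw B m (\<lambda>m1 m2. mul B (mul B m1 b) (anti B m2)))
          (anti_inv (dual B) \<mu>)) h),
      coact = (\<lambda>b. sw B b (\<lambda>b1 b2.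
        tpure (double B) B (tpure (dual B) B (unity (dual B)) b1) b2))\<rparr>"

text \<open>To put both kinds of factors into one family, their elements are represented as
  \<open>(\<beta>, 0)\<close> and \<open>(0, b)\<close>. \<open>transport_yd H sc e p X\<close> is the image of \<open>X\<close> under the injection
  \<open>e\<close> with left inverse \<open>p\<close>, in an ambient space with scalar multiplication \<open>sc\<close>.\<close>

definition transport_yd ::
  "('k::field, 'h::ab_group_add, 'y) bialg_scheme \<Rightarrow> ('k \<Rightarrow> 'w \<Rightarrow> 'w) \<Rightarrow> ('x \<Rightarrow> 'w) \<Rightarrow> ('w \<Rightarrow> 'x)
    \<Rightarrow> ('k, 'h, 'x::ab_group_add, 'z) yd_scheme \<Rightarrow> ('k, 'h, 'w::ab_group_add) yd" where
  "transport_yd H sc e p X =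
     \<lparr>carr = e ` carr X, scal = sc,
      mul = (\<lambda>x y. e (mul X (p x) (p y))), unity = e (unity X),
      act = (\<lambda>h x. e (act X h (p x))),
      coact = (\<lambda>x. tlift H X (\<lambda>g z. tpure H \<lparr>carr = e ` carr X, scal = sc\<rparr> g (e z))
        (coact X (p x)))\<rparr>"

definition chain_factor ::
  "('k::field, 'b::ab_group_add, 'z) hopf_scheme \<Rightarrow> int
    \<Rightarrow> ('k, ('k, 'b \<Rightarrow> 'k, 'b) tens, ('b \<Rightarrow> 'k) \<times> 'b) yd" where
  "chain_factor B i =
     (let sc = (\<lambda>c (\<beta>, b). (scal (dual B) c \<beta>, scal B c b)) in
      if odd i then transport_yd (double B) sc (\<lambda>\<beta>. (\<beta>, 0)) fst (dual_yd B)
      else transport_yd (double B) sc (\<lambda>b. (0, b)) snd (self_yd B))"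

text \<open>\<open>chain B s t\<close> is the alternating chain with factors at the positions \<open>s, \<dots>, t\<close>, with
  \<open>B^{*cop}\<close> at odd and \<open>B\<close> at even positions. Thus \<open>\<H>_N\<close> is \<open>chain B 1 N\<close>, and the chains with
  leftmost factor \<open>B\<close> are those with even \<open>s\<close>.\<close>

definition chain ::
  "('k::field, 'b::ab_group_add, 'z) hopf_scheme \<Rightarrow> int \<Rightarrow> int
    \<Rightarrow> ('k, ('k, 'b \<Rightarrow> 'k, 'b) tens, ('k, int, ('b \<Rightarrow> 'k) \<times> 'b) mtens) yd" where
  "chain B s t = braided_product (double B) {s..t} (chain_factor B)"

definition dual_at ::
  "('k::field, 'b::ab_group_add, 'z) hopf_scheme \<Rightarrow> int \<Rightarrow> int \<Rightarrow> int \<Rightarrow> ('b \<Rightarrow> 'k)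
    \<Rightarrow> ('k, int, ('b \<Rightarrow> 'k) \<times> 'b) mtens" where
  "dual_at B s t i \<beta> = factor_at {s..t} (chain_factor B) i (\<beta>, 0)"

definition self_at ::
  "('k::field, 'b::ab_group_add, 'z) hopf_scheme \<Rightarrow> int \<Rightarrow> int \<Rightarrow> int \<Rightarrow> 'b
    \<Rightarrow> ('k, int, ('b \<Rightarrow> 'k) \<times> 'b) mtens" where
  "self_at B s t i b = factor_at {s..t} (chain_factor B) i (0, b)"

text \<open>Systems of chains are indexed by pairs \<open>(s, t)\<close>; the embeddings insert \<open>1\<close> in the
  additional factors.\<close>

definition chain_le :: "int \<times> int \<Rightarrow> int \<times> int \<Rightarrow> bool" where
  "chain_le d d' \<longleftrightarrow> fst d' \<le> fst d \<and> snd d \<le> snd d'"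

definition chain_embed ::
  "('k::field, 'b::ab_group_add, 'z) hopf_scheme \<Rightarrow> int \<times> int \<Rightarrow> int \<times> int
    \<Rightarrow> ('k, int, ('b \<Rightarrow> 'k) \<times> 'b) mtens \<Rightarrow> ('k, int, ('b \<Rightarrow> 'k) \<times> 'b) mtens" where
  "chain_embed B d d' =
     mlift {fst d..snd d} (chain_factor B) (\<lambda>x.
       mpure {fst d'..snd d'} (chain_factor B)
         (\<lambda>i\<in>{fst d'..snd d'}.
            if i \<in> {fst d..snd d} then x i else unity (chain_factor B i)))"

definition chain_systems :: "(int \<times> int) set set" where
  "chain_systems =
     {{(s, t) |t. s \<le> t} |s. True} \<union> {{(s, t) |s. s \<le> t} |t. True} \<union> {{(s, t) |s t. s \<le> t}}"

text \<open>\<open>L\<close> with the maps \<open>\<iota>\<close> is the inductive limit of a directed system \<open>A\<close> with transition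
  maps \<open>e\<close>: the quotient of the disjoint union of all \<open>A d\<close>, where \<open>x \<in> A d\<close> and
  \<open>y \<in> A d'\<close> are identified if they become equal at some later stage, with
  the structure for which all \<open>\<iota> d\<close> are morphisms.\<close>

definition inductive_limit ::
  "('k::field, 'h::ab_group_add, 'u) bialg_scheme \<Rightarrow> 'd set \<Rightarrow> ('d \<Rightarrow> 'd \<Rightarrow> bool)
    \<Rightarrow> ('d \<Rightarrow> ('k, 'h, 'x::ab_group_add, 'y) yd_scheme) \<Rightarrow> ('d \<Rightarrow> 'd \<Rightarrow> 'x \<Rightarrow> 'x)
    \<Rightarrow> ('k, 'h, 'w::ab_group_add, 'z) yd_scheme \<Rightarrow> ('d \<Rightarrow> 'x \<Rightarrow> 'w) \<Rightarrow> bool" where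
  "inductive_limit H D le A e L \<iota> \<longleftrightarrow>
     (\<forall>d\<in>D. yd_hom H (A d) L (\<iota> d)) \<and>
     carr L = (\<Union>d\<in>D. \<iota> d ` carr (A d)) \<and>
     (\<forall>d\<in>D. \<forall>d'\<in>D. \<forall>x\<in>carr (A d). \<forall>y\<in>carr (A d').
        \<iota> d x = \<iota> d' y \<longleftrightarrow> (\<exists>d''\<in>D. le d d'' \<and> le d' d'' \<and> e d d'' x = e d' d'' y))"

end

(* A vector of a tensor product is determined by the forms f (x) g, for f and g in separating
   families, and the double is separated by the functionals E a ka of B* (x) B that evaluate at
   a in B and at a form ka of B. All identities thus become identities of scalar Sweedler sums in B.
   A braided product is built by splitting off the leftmost factor. It is unique, since the
   relations reorder every product of generators, and therefore the embeddings are multiplicative.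
   The counterexample is k[S_3] (x) k^{S_3}: on group-like elements in two factors of the same
   kind, braided commutativity says that conjugation acts trivially. *)
theory Submission imports Defs
begin

section \<open>Linear forms and tensor products\<close>

text \<open>\<open>tlift\<close> is a definite description, meaningful only once its integrand is
  known to be bilinear, and the sums occurring here are nested many levels deep. With scalar sums
  over chosen representations, sums over different coproducts commute for every integrand, and
  linearity conditions enter where coassociativity, counit or antipode are applied. B may be
  infinite-dimensional, so its dual is the finite dual; elements of B already separate it, which is
  why one slot of \<open>E\<close> is an element of B rather than a form on the dual. The product in
  \<open>braided_product\<close> is an arbitrary choice among those satisfying the relations, so the
  properties of a constructed product pass to it only through uniqueness. The counterexample needs
  noncommuting group-like elements in B and in its dual at once: three consecutive factors contain
  two copies of B or two copies of the dual, according to which kind comes first, and a group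
  algebra alone has commuting characters.\<close>

abbreviation "form V f == lin_map V ground f"

abbreviation "biform V W f == bilin_map V W ground f"

lemma carr_ground [simp]: "x : carr ground" and scal_ground [simp]: "scal ground = (*)"
 by (simp_all add: ground_def)

lemma vs_g [simp]: "vspace (ground :: ('k::field, 'k) vs)"
 unfolding vspace_def
proof
 show vs: "vector_space (scal (ground :: ('k, 'k) vs))"
  by unfold_locales (auto simp: ground_def algebra_simps)
 then interpret vector_space "scal (ground :: ('k, 'k) vs)" .
 have "carr (ground :: ('k, 'k) vs) = UNIV" by auto
 then show "subspace (carr (ground :: ('k, 'k) vs))" using subspace_UNIV by (simp only:)
qed

interpretation fun_vs: vector_space "fun_scal :: 'k::field => ('a => 'k) => 'a => 'k"
 by unfold_locales (auto simp: fun_scal_def fun_eq_iff algebra_simps)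

lemma fun_scal_apply [simp]: "fun_scal c t f = c * t f"
 by (simp add: fun_scal_def)

context
 fixes V :: "('k::field, 'v::ab_group_add, 'z) vs_scheme"
 assumes V: "vspace V"
begin

lemma vs_vector_space: "vector_space (scal V)"
 using V by (simp add: vspace_def)

interpretation vs: vector_space "scal V" by (rule vs_vector_space)

lemma vs_subspace: "vs.subspace (carr V)"
 using V by (simp add: vspace_def)

lemma vs_zero: "0 : carr V" and vs_add: "x : carr V ==> y : carr V ==> x + y : carr V"
 and vs_scal: "x : carr V ==> scal V c x : carr V"
 and vs_diff: "x : carr V ==> y : carr V ==> x - y : carr V"
 using vs_subspace vs.subspace_diff vs.subspace_neg by (auto simp: vs.subspace_def)

lemma vs_scal_add: "scal V c (x + y) = scal V c x + scal V c y"
 and vs_add_scal: "scal V (c + d) x = scal V c x + scal V d x"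
 and vs_scal_scal: "scal V c (scal V d x) = scal V (c * d) x"
 and vs_scal_one: "scal V 1 x = x"
 and vs_scal_0: "scal V c 0 = 0"
 by (simp_all add: vs.scale_right_distrib vs.scale_left_distrib)

lemma vs_sl: "(!!x. x : set xs ==> f x : carr V) ==> (SUM x<-xs. f x) : carr V"
 by (induction xs) (auto intro: vs_zero vs_add)

lemma vs_sum: "(!!x. x : A ==> f x : carr V) ==> (SUM x:A. f x) : carr V"
 by (induction A rule: infinite_finite_induct) (auto intro: vs_zero vs_add)

lemma vs_ssl: "scal V c (SUM x<-xs. f x) = (SUM x<-xs. scal V c (f x))"
 by (induction xs) (auto simp: vs_scal_0 vs_scal_add)

text \<open>A nonzero vector is independent by itself; extending it to a basis gives a form with
  value 1 there.\<close>

lemma f_sep: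
 assumes x: "x : carr V" and f: "!!f. form V f ==> f x = 0"
 shows "x = 0"
proof (rule ccontr)
 assume "x ~= 0"
 interpret p: vector_space_pair "scal V" "(*) :: 'k => 'k => 'k"
  by unfold_locales (auto simp: algebra_simps)
 have "vs.independent {x}" using `x ~= 0` by simp
 from p.linear_independent_extend[OF this, of "%_. 1"] obtain g where g: "Vector_Spaces.linear (scal V) (*) g" "g x = 1" by auto
 interpret g: Vector_Spaces.linear "scal V" "(*)" g by (rule g(1))
 have "form V g" unfolding lin_map_def by (simp add: g.add g.scale)
 from f[OF this] g(2) show False by simp
qed

text \<open>Finite coordinates for the last step of \<open>sep_tensor\<close>: \<open>E\<close> is a
  maximal independent subset of \<open>S\<close>, and the forms \<open>ep\<close> extend its
  coordinate functions to the whole space.\<close>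

lemma coordinates_exist:
 assumes "finite S" "S <= carr V"
 obtains E ep where "finite E" "E <= carr V" "!!e. form V (ep e)" "!!x. x : S ==> x = (SUM e:E. scal V (ep e x) e)"
proof -
 interpret p: vector_space_pair "scal V" "(*) :: 'k => 'k => 'k"
  by unfold_locales (auto simp: algebra_simps)
 obtain E where E: "E <= S" "vs.independent E" "S <= vs.span E"
  using vs.maximal_independent_subset by metis
 have fin: "finite E" using E(1) assms(1) finite_subset by blast
 have "EX g. Vector_Spaces.linear (scal V) (*) g & (ALL x:E. g x = (if x = e then 1 else 0))" for e
  using p.linear_independent_extend[OF E(2), of "%x. if x = e then 1 else 0"] by auto
 then obtain ep where lin: "!!e. Vector_Spaces.linear (scal V) (*) (ep e)"
  and ep: "!!e x. x : E ==> ep e x = (if x = e then 1 else 0)" by metis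
 have "x = (SUM e:E. scal V (ep e x) e)" if "x : S" for x
 proof -
  have "x : vs.span E" using that E(3) by auto
  then show ?thesis
  proof (induction rule: vs.span_induct_alt)
   case base
   then show ?case
    by (simp add: module_hom.zero[OF lin[unfolded Vector_Spaces.linear_iff_module_hom]])
  next
   case (step c x y)
   interpret l: Vector_Spaces.linear "scal V" "(*)" "ep e" for e by (rule lin)
   have "(SUM e:E. scal V (c * ep e x) e) = (SUM e:E. if e = x then scal V c x else 0)"
    by (rule sum.cong) (use step.hyps ep in auto)
   then show ?case using step fin
    by (simp add: l.add l.scale vs_add_scal sum.distrib)
  qed
 qed
 moreover have "form V (ep e)" for e
 proof -
  interpret l: Vector_Spaces.linear "scal V" "(*)" "ep e" by (rule lin)
  show ?thesis unfolding lin_map_def by (simp add: l.add l.scale)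
 qed
 ultimately show thesis using that fin E(1) assms(2) by blast
qed

end

lemma vspace_fun_span: "vspace (|carr = fun_vs.span S, scal = fun_scal|)"
 using fun_vs.vector_space_axioms by (simp add: vspace_def fun_vs.subspace_span)

lemma vs_t [simp]: "vspace (tensor V W)" and vspace_mtensor [simp]: "vspace (mtensor I X)"
 by (simp_all add: tensor_def mtensor_def vspace_fun_span)

lemma scal_tensor [simp]: "scal (tensor V W) = fun_scal"
 and scal_mtensor [simp]: "scal (mtensor I X) = fun_scal"
 by (simp_all add: tensor_def mtensor_def)

subsection \<open>Linear maps\<close>

lemma linD:
 assumes "lin_map V W f"
 shows "x : carr V ==> f x : carr W" "x : carr V ==> y : carr V ==> f (x + y) = f x + f y" "x : carr V ==> f (scal V c x) = scal W c (f x)"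
 using assms by (auto simp: lin_map_def)

lemma lin_0: "lin_map V W f ==> vspace V ==> f 0 = 0"
 using linD(2)[of V W f 0 0] vs_zero by force

lemma lin_map_diff: "lin_map V W f ==> vspace V ==> x : carr V ==> y : carr V ==> f (x - y) = f x - f y"
 using linD(2)[of V W f "x - y" y] vs_diff by force

lemma lin_sl:
 assumes "lin_map V W f" "vspace V" "!!x. x : set xs ==> g x : carr V"
 shows "f (SUM x<-xs. g x) = (SUM x<-xs. f (g x))"
 using assms(3)
proof (induction xs)
 case Nil
 then show ?case using lin_0[OF assms(1,2)] by simp
next
 case (Cons a xs)
 then have "(SUM x<-xs. g x) : carr V" by (intro vs_sl[OF assms(2)]) auto
 with Cons show ?case using linD(2)[OF assms(1)] by auto
qed

lemma lin_map_sum: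
 assumes "lin_map V W f" "vspace V" "!!x. x : A ==> g x : carr V"
 shows "f (SUM x:A. g x) = (SUM x:A. f (g x))"
 using assms(3)
proof (induction A rule: infinite_finite_induct)
 case (insert a A)
 then have "(SUM x:A. g x) : carr V" by (intro vs_sum[OF assms(2)]) auto
 with insert show ?case using linD(2)[OF assms(1)] by auto
qed (use lin_0[OF assms(1,2)] in auto)

lemma lin_o: "lin_map V W f ==> lin_map W U g ==> lin_map V U (%x. g (f x))"
 by (auto simp: lin_map_def)

lemma bil_o: "bilin_map V W U ph ==> lin_map U U' f ==> bilin_map V W U' (%v w. f (ph v w))"
 by (auto simp: bilin_map_def lin_map_def)

text \<open>Records such as \<open>double B\<close> and \<open>tensor (dual B) B\<close> are
  different terms with the same carrier and scaling. These congruences carry facts from one to the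
  other.\<close>

lemma lin_cong: "carr V = carr V' ==> scal V = scal V' ==> carr W = carr W' ==> scal W = scal W' ==> lin_map V W = lin_map V' W'"
 by (auto simp: lin_map_def fun_eq_iff)

lemma bil_cong: "carr V = carr V' ==> scal V = scal V' ==> carr W = carr W' ==> scal W = scal W' ==>
  carr U = carr U' ==> scal U = scal U' ==> bilin_map V W U = bilin_map V' W' U'"
 using lin_cong[of W W' U U'] lin_cong[of V V' U U']
 by (auto simp: bilin_map_def fun_eq_iff)

lemma tp_cong:
 assumes "carr V = carr V'" "scal V = scal V'" "carr W = carr W'" "scal W = scal W'"
 shows "tpure V W = tpure V' W'"
 using bil_cong[OF assms, of ground ground] by (auto simp: tpure_def fun_eq_iff)

lemma t_cong:
 assumes "carr V = carr V'" "scal V = scal V'" "carr W = carr W'" "scal W = scal W'"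
 shows "tensor V W = tensor V' W'"
 unfolding tensor_def tp_cong[OF assms] assms ..

lemma tlift_cong_vs:
 assumes "carr V = carr V'" "scal V = scal V'" "carr W = carr W'" "scal W = scal W'"
 shows "tlift V W = tlift V' W'"
 unfolding tlift_def tp_cong[OF assms] assms ..

lemma bilD:
 assumes "bilin_map V W U f" "x : carr V" "y : carr W"
 shows "f x y : carr U" "x' : carr V ==> f (x + x') y = f x y + f x' y" "y' : carr W ==> f x (y + y') = f x y + f x y'"
  "f (scal V c x) y = scal U c (f x y)" "f x (scal W c y) = scal U c (f x y)"
 using assms by (auto simp: bilin_map_def lin_map_def)

section \<open>Pure tensors and well-definedness of lifts\<close>

lemma tpure_add_left: "v : carr V ==> v' : carr V ==> w : carr W ==> tpure V W (v + v') w = tpure V W v w + tpure V W v' w"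
 and tpure_add_right: "v : carr V ==> w : carr W ==> w' : carr W ==> tpure V W v (w + w') = tpure V W v w + tpure V W v w'"
 and tp_scL: "v : carr V ==> w : carr W ==> tpure V W (scal V c v) w = fun_scal c (tpure V W v w)"
 and tpure_scal_right: "v : carr V ==> w : carr W ==> tpure V W v (scal W c w) = fun_scal c (tpure V W v w)"
 by (auto simp: tpure_def fun_eq_iff bilD)

lemma tpI: "v : carr V ==> w : carr W ==> tpure V W v w : carr (tensor V W)"
 by (auto simp: tensor_def intro!: fun_vs.span_base)

lemma bilin_tpure: "bilin_map V W (tensor V W) (tpure V W)"
 by (auto simp: bilin_map_def lin_map_def tpI tpure_add_left tpure_add_right tp_scL tpure_scal_right)

definition "tsum V W ps = (SUM (v, w)<-ps. tpure V W v w)"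

lemma tsum_apply: "biform V W f ==> tsum V W ps f = (SUM (v, w)<-ps. f v w)"
 unfolding tsum_def by (induction ps) (auto simp: tpure_def)

lemma tsum_ex:
 assumes V: "vspace V" and t: "t : carr (tensor V W)"
 shows "EX ps. set ps <= carr V \<times> carr W & t = tsum V W ps"
proof -
 have scal: "EX qs. set qs <= carr V \<times> carr W & fun_scal c (tsum V W ps) = tsum V W qs"
  if "set ps <= carr V \<times> carr W" for ps c
  using that
 proof (induction ps)
  case Nil
  show ?case by (intro exI[of _ "[]"]) (auto simp: tsum_def fun_eq_iff)
 next
  case (Cons p ps)
  then have "set ps <= carr V \<times> carr W" by simp
  from Cons.IH[OF this] obtain qs where qs: "set qs <= carr V \<times> carr W" "fun_scal c (tsum V W ps) = tsum V W qs" by blast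
  obtain v w where p: "p = (v, w)" by force
  have "v : carr V" "w : carr W" using Cons.prems p by auto
  moreover from this have "fun_scal c (tsum V W (p # ps)) = tsum V W ((scal V c v, w) # qs)"
   unfolding p using qs(2) by (simp only: tsum_def list.map sum_list.Cons split tp_scL fun_vs.scale_right_distrib)
  ultimately show ?case using qs(1) vs_scal[OF V] by (intro exI[of _ "(scal V c v, w) # qs"]) auto
 qed
 have add: "tsum V W ps + tsum V W qs = tsum V W (ps @ qs)" for ps qs
  by (simp add: tsum_def)
 have "t : fun_vs.span {tpure V W v w |v w. v : carr V & w : carr W}"
  using t by (simp add: tensor_def)
 then show ?thesis
 proof (induction rule: fun_vs.span_induct_alt)
  case base
  show ?case by (intro exI[of _ "[]"]) (auto simp: tsum_def)
 next
  case (step c x y)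
  then obtain v w qs where "v : carr V" "w : carr W" "x = tpure V W v w"
   and qs: "set qs <= carr V \<times> carr W" "y = tsum V W qs" by auto
  then have "set [(v, w)] <= carr V \<times> carr W" "x = tsum V W [(v, w)]" by (auto simp: tsum_def)
  with scal obtain ps where "set ps <= carr V \<times> carr W" "fun_scal c x = tsum V W ps" by metis
  with qs show ?case by (intro exI[of _ "ps @ qs"]) (auto simp: add)
 qed
qed

lemma tsum_in: "set ps <= carr V \<times> carr W ==> tsum V W ps : carr (tensor V W)"
 unfolding tsum_def by (rule vs_sl[OF vs_t]) (auto simp: tpI)

text \<open>\<open>tev V W t \<phi>\<close> sums \<open>\<phi>\<close> over one chosen representation of \<open>t\<close>, so that additivity and
  interchange of sums hold without assumptions on \<open>\<phi>\<close>.\<close>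

definition "trep V W t = (SOME ps. set ps <= carr V \<times> carr W & t = tsum V W ps)"

definition tev :: "('k::field, 'v::ab_group_add, 'y) vs_scheme => ('k, 'w::ab_group_add, 'z) vs_scheme => ('k, 'v, 'w) tens
  => ('v => 'w => 'u::ab_group_add) => 'u" where "tev V W t ph = (SUM (v, w)<-trep V W t. ph v w)"

lemma trep:
 assumes "vspace V" "t : carr (tensor V W)"
 shows "set (trep V W t) <= carr V \<times> carr W" "t = tsum V W (trep V W t)"
 using someI_ex[OF tsum_ex[OF assms]] by (auto simp: trep_def)

text \<open>A tensor is a functional on bilinear forms. For every form f on \<open>U\<close> the
  composite of f with \<open>ph\<close> is a bilinear form, so f takes the same value on both sums,
  and forms separate the points of \<open>U\<close>.\<close>

lemma lift_unique:
 assumes ph: "bilin_map V W U ph" and U: "vspace U"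
  and ps: "set ps <= carr V \<times> carr W" "set qs <= carr V \<times> carr W" "tsum V W ps = tsum V W qs"
 shows "(SUM (v, w)<-ps. ph v w) = (SUM (v, w)<-qs. ph v w)"
proof -
 have in_U: "(SUM (v, w)<-rs. ph v w) : carr U" if "set rs <= carr V \<times> carr W" for rs
  by (rule vs_sl[OF U]) (use that bilD(1)[OF ph] in auto)
 have "(SUM (v, w)<-ps. ph v w) - (SUM (v, w)<-qs. ph v w) = 0"
 proof (rule f_sep[OF U])
  show "(SUM (v, w)<-ps. ph v w) - (SUM (v, w)<-qs. ph v w) : carr U"
   by (intro vs_diff[OF U] in_U ps)
  fix f assume f: "form U f"
  have bf: "biform V W (%v w. f (ph v w))"
   by (rule bil_o[OF ph f])
  have ev: "f (SUM (v, w)<-rs. ph v w) = tsum V W rs (%v w. f (ph v w))"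
   if "set rs <= carr V \<times> carr W" for rs
   unfolding tsum_apply[OF bf]
   by (subst lin_sl[OF f U]) (use that bilD(1)[OF ph] in "auto simp: case_prod_unfold")
  show "f ((SUM (v, w)<-ps. ph v w) - (SUM (v, w)<-qs. ph v w)) = 0"
   by (simp add: lin_map_diff[OF f U] in_U ps ev)
 qed
 then show ?thesis by simp
qed

text \<open>Resolves the definite description in \<open>tlift\<close>; Sweedler sums are then
  computed with \<open>tev\<close>.\<close>

lemma tl_tev:
 assumes ph: "bilin_map V W U ph" and "vspace V" "vspace U" and t: "t : carr (tensor V W)"
 shows "tlift V W ph t = tev V W t ph"
 unfolding tlift_def tev_def tsum_def[symmetric]
proof (rule the_equality)
 show "EX ps. set ps <= carr V \<times> carr W & t = tsum V W ps & (SUM (v, w)<-trep V W t. ph v w) = (SUM (v, w)<-ps. ph v w)"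
  using trep[OF assms(2) t] by blast
next
 fix u assume "EX ps. set ps <= carr V \<times> carr W & t = tsum V W ps & u = (SUM (v, w)<-ps. ph v w)"
 then show "u = (SUM (v, w)<-trep V W t. ph v w)"
  using lift_unique[OF ph assms(3)] trep[OF assms(2) t] by metis
qed

lemma tev_tsum:
 assumes "bilin_map V W U ph" "vspace V" "vspace U" "set ps <= carr V \<times> carr W"
 shows "tev V W (tsum V W ps) ph = (SUM (v, w)<-ps. ph v w)"
 unfolding tev_def
 using lift_unique[OF assms(1,3) trep(1)[OF assms(2)] assms(4)] trep(2)[OF assms(2)] tsum_in[OF assms(4)] by metis

lemma tevp:
 assumes "bilin_map V W U ph" "vspace V" "vspace U" "v : carr V" "w : carr W"
 shows "tev V W (tpure V W v w) ph = ph v w"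
 using tev_tsum[OF assms(1-3), of "[(v, w)]"] assms(4,5) by (simp add: tsum_def)

lemma tev_in:
 assumes "vspace V" "vspace U" "t : carr (tensor V W)"
  and "!!v w. v : carr V ==> w : carr W ==> ph v w : carr U"
 shows "tev V W t ph : carr U"
 unfolding tev_def using assms(4) trep(1)[OF assms(1,3)]
 by (intro vs_sl[OF assms(2)]) auto

lemma tevc:
 assumes "vspace V" "t : carr (tensor V W)"
  and "!!v w. v : carr V ==> w : carr W ==> ph v w = psi v w"
 shows "tev V W t ph = tev V W t psi"
 unfolding tev_def using trep(1)[OF assms(1,2)] assms(3)
 by (intro arg_cong[where f = sum_list] map_cong) auto

lemma tev_pull:
 assumes f: "lin_map U U' f" and U: "vspace U" and V: "vspace V" and t: "t : carr (tensor V W)"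
  and ph: "!!v w. v : carr V ==> w : carr W ==> ph v w : carr U"
 shows "f (tev V W t ph) = tev V W t (%v w. f (ph v w))"
 unfolding tev_def
 by (subst lin_sl[OF f U]) (use trep(1)[OF V t] ph in "auto simp: case_prod_unfold")

lemma tev_add: "tev V W t (%v w. ph v w + psi v w) = tev V W t ph + tev V W t psi"
 unfolding tev_def by (simp add: case_prod_unfold sum_list_addf)

lemma tevL: "c * tev V W t ph = tev V W t (%v w. c * ph v w)"
 and tevR: "tev V W t ph * c = tev V W t (%v w. ph v w * c)"
 for c :: "'k::field"
 unfolding tev_def by (simp_all add: case_prod_unfold sum_list_const_mult sum_list_mult_const)

lemma tevs: "tev V W s (%a b. tev V' W' t (%c d. ph a b c d)) = tev V' W' t (%c d. tev V W s (%a b. ph a b c d))"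
proof -
 have "(SUM x<-xs. SUM y<-ys. g x y) = (SUM y<-ys. SUM x<-xs. g x y)" for xs ys and g :: "_ => _ => 'u::ab_group_add"
  by (induction xs) (auto simp: sum_list_addf)
 from this[of "%x y. ph (fst x) (snd x) (fst y) (snd y)"] show ?thesis
  unfolding tev_def by (simp add: case_prod_unfold)
qed

lemma lin_ta:
 assumes ph: "bilin_map V W U ph" and V: "vspace V" and U: "vspace U"
 shows "lin_map (tensor V W) U (%t. tev V W t ph)"
 unfolding lin_map_def
proof (intro conjI ballI allI)
 fix s assume s: "s : carr (tensor V W)"
 show "tev V W s ph : carr U" by (rule tev_in[OF V U s bilD(1)[OF ph]])
 note rs = trep[OF V s]
 {
  fix t assume t: "t : carr (tensor V W)"
  note rt = trep[OF V t]
  have "s + t = tsum V W (trep V W s @ trep V W t)"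
   using rs rt by (simp add: tsum_def)
  then show "tev V W (s + t) ph = tev V W s ph + tev V W t ph"
   using tev_tsum[OF ph V U, of "trep V W s @ trep V W t"] rs(1) rt(1) by (simp add: tev_def)
 }
 fix c
 let ?qs = "map (%(v, w). (scal V c v, w)) (trep V W s)"
 have qs: "set ?qs <= carr V \<times> carr W" using rs(1) vs_scal[OF V] by auto
 have "fun_scal c (tsum V W (trep V W s)) = tsum V W ?qs"
  unfolding tsum_def vs_ssl[OF vs_t, unfolded scal_tensor]
  using rs(1) by (auto simp: tp_scL subset_iff intro!: arg_cong[where f = sum_list])
 then have "tev V W (fun_scal c s) ph = (SUM (v, w)<-?qs. ph v w)"
  using tev_tsum[OF ph V U qs] rs(2) by simp
 also have "... = scal U c (tev V W s ph)"
  unfolding tev_def vs_ssl[OF U]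
  using rs(1) bilD(4)[OF ph] by (auto simp: subset_iff intro!: arg_cong[where f = sum_list])
 finally show "tev V W (scal (tensor V W) c s) ph = scal U c (tev V W s ph)" by simp
qed

text \<open>Complement of \<open>lin_ta\<close>: there the tensor varies, here a parameter of the
  integrand. Together they give linearity of nested Sweedler sums in every variable.\<close>

lemma lin_tb:
 assumes "vspace A" "vspace U" "t : carr (tensor A C)"
  and ph: "!!a c. a : carr A ==> c : carr C ==> lin_map V U (%x. ph x a c)"
 shows "lin_map V U (%x. tev A C t (ph x))"
proof -
 have "tev A C t (ph x) : carr U" if "x : carr V" for x
  by (rule tev_in[OF assms(1-3)]) (use linD(1)[OF ph] that in auto)
 moreover have "tev A C t (ph (x + y)) = tev A C t (ph x) + tev A C t (ph y)"
  if "x : carr V" "y : carr V" for x y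
  unfolding tev_add[symmetric]
  by (rule tevc[OF assms(1,3)]) (use linD(2)[OF ph] that in auto)
 moreover have "tev A C t (ph (scal V c x)) = scal U c (tev A C t (ph x))" if "x : carr V" for c x
 proof -
  have "tev A C t (ph (scal V c x)) = tev A C t (%a d. scal U c (ph x a d))"
   by (rule tevc[OF assms(1,3)]) (use linD(3)[OF ph] that in auto)
  then show ?thesis unfolding tev_def vs_ssl[OF assms(2)] by (simp add: case_prod_unfold)
 qed
 ultimately show ?thesis by (auto simp: lin_map_def)
qed

lemma lin_tlift:
 assumes "bilin_map V W U ph" "vspace V" "vspace U"
 shows "lin_map (tensor V W) U (tlift V W ph)"
 using lin_ta[OF assms] tl_tev[OF assms]
 by (auto simp: lin_map_def vs_add[OF vs_t] vs_scal[OF vs_t, unfolded scal_tensor])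

lemma tl_pure:
 assumes "bilin_map V W U ph" "vspace V" "vspace U" "v : carr V" "w : carr W"
 shows "tlift V W ph (tpure V W v w) = ph v w"
 using tl_tev[OF assms(1-3) tpI[OF assms(4,5)]] tevp[OF assms] by simp

lemma tlift_in: "bilin_map V W U ph ==> vspace V ==> vspace U ==> t : carr (tensor V W) ==> tlift V W ph t : carr U"
 using linD(1)[OF lin_tlift] by blast

lemma tev_tpure_id: "vspace V ==> t : carr (tensor V W) ==> tev V W t (tpure V W) = t"
 using trep(2)[of V t W] by (simp add: tev_def tsum_def)

lemma lin_tlb:
 assumes "vspace A" "vspace U" "t : carr (tensor A C)"
  and bil: "!!x. x : carr V ==> bilin_map A C U (ph x)"
  and ph: "!!a c. a : carr A ==> c : carr C ==> lin_map V U (%x. ph x a c)"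
  and V: "vspace V"
 shows "lin_map V U (%x. tlift A C (ph x) t)"
 using lin_tb[OF assms(1-3) ph] tl_tev[OF bil assms(1-3)]
 by (auto simp: lin_map_def vs_add[OF V] vs_scal[OF V])

lemma tensor_induct [consumes 3, case_names pure add]:
 assumes "vspace V" "t : carr (tensor V W)" "vspace W"
  and pure: "!!v w. v : carr V ==> w : carr W ==> P (tpure V W v w)"
  and add: "!!s t. s : carr (tensor V W) ==> t : carr (tensor V W) ==> P s ==> P t ==> P (s + t)"
 shows "P t"
proof -
 have "P (tsum V W ps)" if "set ps <= carr V \<times> carr W" for ps
  using that
 proof (induction ps)
  case Nil
  \<comment> \<open>The zero tensor is a pure tensor with left entry 0, so the empty sum falls under
    the case \<open>pure\<close>.\<close>
  have "P (tpure V W 0 w)" if "w : carr W" for w using pure vs_zero[OF assms(1)] that by blast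
  moreover have "tpure V W 0 w = 0" if "w : carr W" for w
   using lin_0[of V "tensor V W" "%v. tpure V W v w", OF _ assms(1)] bilin_tpure[of V W] that
   by (auto simp: bilin_map_def)
  moreover have "carr W ~= {}" using vs_zero[OF assms(3)] by blast
  ultimately have "P 0" by (metis all_not_in_conv)
  then show ?case by (simp only: tsum_def list.map sum_list.Nil)
 next
  case (Cons p ps)
  have "tsum V W (p # ps) = tpure V W (fst p) (snd p) + tsum V W ps"
   by (simp only: tsum_def list.map sum_list.Cons case_prod_unfold)
  moreover have "fst p : carr V" "snd p : carr W" "set ps <= carr V \<times> carr W"
   using Cons.prems by auto
  ultimately show ?case
   using add[OF tpI tsum_in pure Cons.IH] by metis
 qed
 then show ?thesis using tsum_ex[OF assms(1,2)] by auto
qed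

lemma sum_list_sum_swap: "(SUM x<-xs. SUM e:E. g x e) = (SUM e:E. SUM x<-xs. g x e :: 'a::comm_monoid_add)"
 by (induction xs) (auto simp: sum.distrib)

subsection \<open>Separating families of linear forms\<close>

definition "sep V F \<longleftrightarrow> vspace V & (ALL f:F. form V f) & (ALL v:carr V. (ALL f:F. f v = 0) --> v = 0)"

lemma sepD: "sep V F ==> vspace V" "sep V F ==> f : F ==> form V f" "sep V F ==> v : carr V ==> (!!f. f : F ==> f v = 0) ==> v = 0"
 by (auto simp: sep_def)

lemma sep_eqI:
 assumes "sep V F" "x : carr V" "y : carr V" "!!f. f : F ==> f x = f y"
 shows "x = y"
proof -
 have "x - y = 0"
  by (rule sepD(3)[OF assms(1) vs_diff[OF sepD(1)[OF assms(1)] assms(2,3)]])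
   (simp add: lin_map_diff[OF sepD(2)[OF assms(1)] sepD(1)[OF assms(1)]] assms)
 then show ?thesis by simp
qed

lemma sep_forms: "vspace V ==> sep V {f. form V f}"
 using f_sep by (auto simp: sep_def)

lemma form_scal_left: "form V f ==> vspace W ==> w : carr W ==> lin_map V W (%v. scal W (f v) w)"
 by (auto simp: lin_map_def vs_scal vs_add_scal vs_scal_scal)

lemma lin_scal: "lin_map V W f ==> vspace W ==> lin_map V W (%v. scal W c (f v))"
 by (auto simp: lin_map_def vs_scal vs_scal_add vs_scal_scal mult.commute)

lemma fmR: "form V f ==> form V (%v. f v * c)"
 and fmL: "form V f ==> form V (%v. c * f v)"
 by (auto simp: lin_map_def algebra_simps)

text \<open>Contracting the left entries with a form in \<open>F\<close> gives a vector of
  \<open>W\<close> on which \<open>G\<close> vanishes, hence 0; so \<open>G\<close> may be replaced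
  by all forms on \<open>W\<close>, and by symmetry \<open>F\<close> by all forms on
  \<open>V\<close>. A general bilinear form reduces to products of this kind by expanding the
  finitely many left entries of one representation in a basis.\<close>

lemma sep_tensor:
 assumes F: "sep V F" and G: "sep W G"
 shows "sep (tensor V W) {%t. tev V W t (%v w. f v * g w) |f g. f : F & g : G}"
proof -
 note V = sepD(1)[OF F] and W = sepD(1)[OF G]
 have bil: "biform V W (%v w. f v * g w)" if "form V f" "form W g" for f g
  using fmL[OF that(2)] fmR[OF that(1)] by (simp add: bilin_map_def)
 have "t = 0" if t: "t : carr (tensor V W)"
  and 0: "!!f g. f : F ==> g : G ==> tev V W t (%v w. f v * g w) = 0" for t
 proof -
  have 1: "tev V W t (%v w. f v * ka w) = 0" if f: "f : F" and ka: "form W ka" for f ka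
  proof -
   let ?w = "tev V W t (%v w. scal W (f v) w)"
   have in_W: "scal W (f v) w : carr W" if "w : carr W" for v w using vs_scal[OF W that] .
   have eval: "th ?w = tev V W t (%v w. f v * th w)" if th: "form W th" for th
    by (subst tev_pull[OF th W V t in_W], assumption) (rule tevc[OF V t], simp add: linD(3)[OF th])
   have "?w = 0"
    by (rule sepD(3)[OF G tev_in[OF V W t in_W]]) (auto simp: eval sepD(2)[OF G] 0 f)
   then show ?thesis using eval[OF ka] lin_0[OF ka W] by simp
  qed
  have 2: "tev V W t (%v w. th v * ka w) = 0" if th: "form V th" and ka: "form W ka" for th ka
  proof -
   let ?v = "tev V W t (%v w. scal V (ka w) v)"
   have in_V: "scal V (ka w) v : carr V" if "v : carr V" for v w using vs_scal[OF V that] .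
   have eval: "th ?v = tev V W t (%v w. th v * ka w)" if th: "form V th" for th
    by (subst tev_pull[OF th V V t in_V], assumption) (rule tevc[OF V t], simp add: linD(3)[OF th])
   have "?v = 0"
    by (rule sepD(3)[OF F tev_in[OF V V t in_V]]) (auto simp: eval sepD(2)[OF F] 1 ka)
   then show ?thesis using eval[OF th] lin_0[OF th V] by simp
  qed
  have "t ph = 0" for ph
  proof (cases "biform V W ph")
   case True
   define ps where "ps = trep V W t"
   have ps: "set ps <= carr V \<times> carr W" "t = tsum V W ps" using trep[OF V t] by (auto simp: ps_def)
   have "fst ` set ps <= carr V" "finite (fst ` set ps)" using ps(1) by auto
   from coordinates_exist[OF V this(2,1)] obtain E ep where E: "finite E" "E <= carr V"
    and ep: "!!e. form V (ep e)" "!!x. x : fst ` set ps ==> x = (SUM e:E. scal V (ep e x) e)" by metis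
   have "t ph = (SUM (v, w)<-ps. ph v w)" unfolding ps(2) by (rule tsum_apply[OF True])
   also have "... = (SUM (v, w)<-ps. SUM e:E. ep e v * ph e w)"
   proof (intro arg_cong[where f = sum_list] map_cong refl, clarify)
    fix v w assume vw: "(v, w) : set ps"
    then have w: "w : carr W" and v: "v = (SUM e:E. scal V (ep e v) e)"
     using ps(1) ep(2)[of v] by force+
    have l: "form V (%v. ph v w)" using True w by (simp add: bilin_map_def)
    have "ph v w = ph (SUM e:E. scal V (ep e v) e) w" (is "?Z = _") using v by simp
    also have "... = (SUM e:E. ph (scal V (ep e v) e) w)"
     by (rule lin_map_sum[OF l V]) (use E(2) vs_scal[OF V] in auto)
    also have "... = (SUM e:E. ep e v * ph e w)"
     by (rule sum.cong) (use E(2) linD(3)[OF l] in auto)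
    finally show "?Z = ..." .
   qed
   also have "... = (SUM e:E. tev V W t (%v w. ep e v * ph e w))"
    unfolding tev_def ps_def[symmetric] by (simp add: case_prod_unfold sum_list_sum_swap)
   also have "... = 0"
    by (rule sum.neutral) (use E(2) True in "auto simp: bilin_map_def intro!: 2 ep(1)")
   finally show ?thesis .
  next
   case False
   have "tsum V W ps ph = 0" for ps
    unfolding tsum_def by (induction ps) (use False in "auto simp: tpure_def")
   then show ?thesis using trep(2)[OF V t] by metis
  qed
  then show "t = 0" by (simp add: fun_eq_iff)
 qed
 then show ?thesis
  unfolding sep_def
  by (intro conjI ballI impI vs_t) (auto intro!: lin_ta bil V sepD(2)[OF F] sepD(2)[OF G])
qed

lemma tensor_eqI:
 assumes "sep V F" "sep W G" "s : carr (tensor V W)" "t : carr (tensor V W)"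
  and "!!f g. f : F ==> g : G ==> tev V W s (%v w. f v * g w) = tev V W t (%v w. f v * g w)"
 shows "s = t"
 by (rule sep_eqI[OF sep_tensor[OF assms(1,2)] assms(3,4)]) (auto simp: assms(5))

subsection \<open>Rules for linearity\<close>

definition "app V f v = f v"

lemma lin_id: "lin_map V V (%x. x)"
 by (simp add: lin_map_def)

lemma ltpL: "lin_map V A f ==> c : carr C ==> lin_map V (tensor A C) (%x. tpure A C (f x) c)"
 by (auto simp: lin_map_def tpI tpure_add_left tp_scL)

lemma ltpR: "lin_map V C f ==> a : carr A ==> lin_map V (tensor A C) (%x. tpure A C a (f x))"
 by (auto simp: lin_map_def tpI tpure_add_left tpure_add_right tp_scL tpure_scal_right)

lemma lin_tla: "lin_map V (tensor A C) f ==> bilin_map A C U ph ==> vspace A ==> vspace U ==> lin_map V U (%x. tlift A C ph (f x))"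
 using lin_o lin_tlift by blast

lemma lin_ta': "lin_map V (tensor A C) f ==> bilin_map A C U ph ==> vspace A ==> vspace U ==> lin_map V U (%x. tev A C (f x) ph)"
 by (rule lin_o[OF _ lin_ta])

lemma lin_app: "form A mu ==> lin_map V A f ==> form V (%x. app A mu (f x))"
 unfolding app_def using lin_o by blast

lemma lscL: "form V f ==> vspace W ==> w : carr W ==> lin_map V W (%v. scal W (f v) w)"
 by (rule form_scal_left)

lemma lmL: "assoc_algebra A ==> lin_map V A f ==> c : carr A ==> lin_map V A (%x. mul A (f x) c)"
 and lmR: "assoc_algebra A ==> lin_map V A f ==> c : carr A ==> lin_map V A (%x. mul A c (f x))"
 by (auto simp: lin_map_def assoc_algebra_def bilD)

lemma lin_cop: "bialgebra H ==> lin_map V H f ==> lin_map V (tensor H H) (%x. cop H (f x))"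
 and lin_cou: "bialgebra H ==> lin_map V H f ==> form V (%x. cou H (f x))"
 unfolding bialgebra_def using lin_o by blast+

lemmas lin_rules = lin_id ltpL ltpR lin_tla lin_tlb lin_ta' lin_tb lin_app lin_scal lscL lmL lmR lin_cop lin_cou fmL fmR

lemma tl_pull:
 assumes "lin_map U U' f" "bilin_map V W U ph" "vspace V" "vspace U" "t : carr (tensor V W)"
 shows "f (tlift V W ph t) = tev V W t (%v w. f (ph v w))"
 using tl_tev[OF assms(2-5)] tev_pull[OF assms(1,4,3,5) bilD(1)[OF assms(2)]] by simp

lemma algD:
 assumes "assoc_algebra A"
 shows "vspace A" "bilin_map A A A (mul A)" "unity A : carr A" "x : carr A ==> y : carr A ==> mul A x y : carr A"
  "x : carr A ==> y : carr A ==> z : carr A ==> mul A (mul A x y) z = mul A x (mul A y z)"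
  "x : carr A ==> mul A (unity A) x = x" "x : carr A ==> mul A x (unity A) = x"
 using assms by (auto simp: assoc_algebra_def bilD(1))

lemma biaD:
 assumes "bialgebra H"
 shows "assoc_algebra H" "vspace H" "lin_map H (tensor H H) (cop H)" "form H (cou H)" "x : carr H ==> cop H x : carr (tensor H H)"
  "x : carr H ==> y : carr H ==> cou H (mul H x y) = cou H x * cou H y" "cou H (unity H) = 1"
  "cop H (unity H) = tpure H H (unity H) (unity H)"
 using assms by (auto simp: bialgebra_def assoc_algebra_def linD(1))

definition "triform A C D ph \<longleftrightarrow> (ALL c:carr C. ALL d:carr D. form A (%a. ph a c d)) &
   (ALL a:carr A. ALL d:carr D. form C (%c. ph a c d)) & (ALL a:carr A. ALL c:carr C. form D (%d. ph a c d))"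

lemma form_triform:
 assumes ph: "triform A C D ph" and A: "vspace A" "vspace C"
 shows "biform A (tensor C D) (%a s. tev C D s (%c d. ph a c d))" (is ?a)
  "form (tensor A (tensor C D)) (%t. tev A (tensor C D) t (%a s. tev C D s (%c d. ph a c d)))" (is ?b)
proof -
 show ?a
  using ph A by (auto simp: bilin_map_def triform_def lin_ta lin_tb)
 then show ?b
  using A by (simp add: lin_ta)
qed

lemma tev_tpure3:
 assumes ph: "triform A C D ph" and "vspace A" "vspace C" "a : carr A" "c : carr C" "d : carr D"
 shows "tev A (tensor C D) (tpure A (tensor C D) a (tpure C D c d)) (%a s. tev C D s (%c d. ph a c d)) = ph a c d"
 using assms
 by (subst tevp[OF form_triform(1)[OF ph]]) (auto simp: tpI triform_def bilin_map_def intro!: tevp[where U = ground])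

text \<open>The two ways of writing the coassociativity axiom (for coalgebras and for comodules),
  evaluated on a trilinear form.\<close>

lemma coaL:
 assumes ph: "triform A C D ph" and A: "vspace A" "vspace C" "vspace E"
  and D: "vspace D"
  and t: "t : carr (tensor E D)" and de: "lin_map E (tensor A C) de"
 shows "tlift E D (%y c. tlift A C (%a b. tpure A (tensor C D) a (tpure C D b c)) (de y)) t : carr (tensor A (tensor C D))" (is "?in")
  "tev A (tensor C D) (tlift E D (%y c. tlift A C (%a b. tpure A (tensor C D) a (tpure C D b c)) (de y)) t)
    (%a s. tev C D s (%c d. ph a c d)) = tev E D t (%y c. tev A C (de y) (%a b. ph a b c))" (is "?eq")
proof -
 let ?T = "tensor A (tensor C D)"
 let ?f = "%y c. tlift A C (%a b. tpure A (tensor C D) a (tpure C D b c)) (de y)"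
 have b1: "bilin_map A C ?T (%a b. tpure A (tensor C D) a (tpure C D b c))" if "c : carr D" for c
  using that by (auto simp: bilin_map_def lin_rules tpI)
 have b2: "bilin_map E D ?T ?f"
  unfolding bilin_map_def
 proof (intro conjI ballI)
  fix y assume "y : carr E"
  then have y: "de y : carr (tensor A C)" using linD(1)[OF de] by blast
  show "lin_map D ?T (%c. ?f y c)"
   by (rule lin_tlb[OF A(1) vs_t y b1 _ D]) (auto simp: lin_rules tpI)
 next
  fix c assume "c : carr D"
  then show "lin_map E ?T (%y. ?f y c)"
   using lin_o[OF de lin_tlift[OF b1 A(1) vs_t]] by simp
 qed
 show ?in by (rule tlift_in[OF b2 A(3) vs_t t])
 show ?eq
  by (subst tl_pull[OF form_triform(2)[OF ph A(1,2)] b2 A(3) vs_t t], rule tevc[OF A(3) t],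
   subst tl_pull[OF form_triform(2)[OF ph A(1,2)] b1 A(1) vs_t], assumption, rule linD(1)[OF de], assumption, rule tevc[OF A(1)],
   rule linD(1)[OF de], assumption, rule tev_tpure3[OF ph A(1,2)], assumption+)
qed

lemma coaR:
 assumes ph: "triform A C D ph" and A: "vspace A" "vspace C" "vspace D" "vspace E"
  and t: "t : carr (tensor A E)" and de: "lin_map E (tensor C D) de"
 shows "tlift A E (%g z. tpure A (tensor C D) g (de z)) t : carr (tensor A (tensor C D))" (is "?in")
  "tev A (tensor C D) (tlift A E (%g z. tpure A (tensor C D) g (de z)) t) (%a s. tev C D s (%c d. ph a c d))
   = tev A E t (%g z. tev C D (de z) (%c d. ph g c d))" (is "?eq")
proof -
 have b: "bilin_map A E (tensor A (tensor C D)) (%g z. tpure A (tensor C D) g (de z))"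
  using de linD(1)[OF de] by (auto simp: bilin_map_def lin_rules)
 show ?in by (rule tlift_in[OF b A(1) vs_t t])
 show ?eq
  by (subst tl_pull[OF form_triform(2)[OF ph A(1,2)] b A(1) vs_t t], rule tevc[OF A(1) t], rule tevp[OF form_triform(1)[OF ph A(1,2)] A(1) vs_g],
   assumption, rule linD(1)[OF de], assumption)
qed

lemma bil_tm:
 assumes A: "assoc_algebra A" and C: "assoc_algebra C"
  and U: "vspace U" and ph: "bilin_map A C U ph"
 shows "g : carr A ==> z : carr C ==> bilin_map A C U (%h w. ph (mul A g h) (mul C z w))" "t : carr (tensor A C) ==>
   bilin_map A C U (%g z. tev A C t (%h w. ph (mul A g h) (mul C z w)))"
proof -
 note [simp] = algD[OF A] algD[OF C] U
 have l: "lin_map V U (%x. ph (f x) c)" if "lin_map V A f" "c : carr C" for V f c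
  using lin_o[OF that(1), of U "%x. ph x c"] ph that(2) by (simp add: bilin_map_def)
 have r: "lin_map V U (%x. ph c (f x))" if "lin_map V C f" "c : carr A" for V f c
  using lin_o[OF that(1), of U "ph c"] ph that(2) by (simp add: bilin_map_def)
 have l': "lin_map V U (%x. ph (f x) c)" if "lin_map V A f" "c : carr C" for V f c
  using lin_o[OF that(1), of U "%x. ph x c"] ph that(2) by (simp add: bilin_map_def)
 have r': "lin_map V U (%x. ph c (f x))" if "lin_map V C f" "c : carr A" for V f c
  using lin_o[OF that(1), of U "ph c"] ph that(2) by (simp add: bilin_map_def)
 show "g : carr A ==> z : carr C ==> bilin_map A C U (%h w. ph (mul A g h) (mul C z w))"
  by (auto simp: bilin_map_def intro!: l r lmR lin_id A C)
 show "bilin_map A C U (%g z. tev A C t (%h w. ph (mul A g h) (mul C z w)))"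
  if "t : carr (tensor A C)"
  using that by (auto simp: bilin_map_def intro!: l' r' lmL lin_id A C lin_tb)
qed

text \<open>Common to two axioms: multiplicativity of a coproduct and of a coaction both have as
  right hand side the product of two tensors, written with nested lifts.\<close>

lemma tm_eval:
 assumes A: "assoc_algebra A" and C: "assoc_algebra C"
  and s: "s : carr (tensor A C)" and t: "t : carr (tensor A C)"
  and ph: "biform A C ph"
 shows "tlift A C (%g z. tlift A C (%h w. tpure A C (mul A g h) (mul C z w)) t) s : carr (tensor A C)" (is "?in")
  "tev A C (tlift A C (%g z. tlift A C (%h w. tpure A C (mul A g h) (mul C z w)) t) s) ph
   = tev A C s (%g z. tev A C t (%h w. ph (mul A g h) (mul C z w)))" (is "?eq")
proof -
 note VA = algD(1)[OF A] and VC = algD(1)[OF C]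
 let ?T = "tensor A C"
 let ?f = "%g z. tlift A C (%h w. tpure A C (mul A g h) (mul C z w)) t"
 note b = bil_tm[OF A C vs_t bilin_tpure]
 have e: "?f g z = tev A C t (%h w. tpure A C (mul A g h) (mul C z w))" if "g : carr A" "z : carr C" for g z
  by (rule tl_tev[OF b(1)[OF that] VA vs_t t])
 have b2: "bilin_map A C ?T ?f"
  using b(2)[OF t] e algD(1)[OF A] algD(1)[OF C]
  by (auto simp: bilin_map_def lin_map_def vs_add vs_scal)
 show ?in by (rule tlift_in[OF b2 VA vs_t s])
 note p = tl_pull[OF lin_ta[OF ph VA vs_g]]
 show ?eq
  by (subst p[OF b2 VA vs_t s], rule tevc[OF VA s], subst p[OF b(1) VA vs_t t], assumption+, rule tevc[OF VA t], rule tevp[OF ph VA vs_g],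
   auto intro: algD(4) A C)
qed

lemma bilin_zero: "biform A C (%a c. 0)"
 by (simp add: bilin_map_def lin_map_def)

section \<open>Bialgebras\<close>

locale bialg =
 fixes H :: "('k::field, 'h::ab_group_add, 'z) bialg_scheme"
 assumes bialg: "bialgebra H"
begin

lemmas alg = biaD(1)[OF bialg] and vs = biaD(2)[OF bialg]
 and lin_cop_H = biaD(3)[OF bialg] and cou_form = biaD(4)[OF bialg]
 and cop_in = biaD(5)[OF bialg]
 and cou_mul = biaD(6)[OF bialg] and cou_one = biaD(7)[OF bialg]
 and cop_one = biaD(8)[OF bialg]
lemmas one_in = algD(3)[OF alg] and mul_in = algD(4)[OF alg]
 and mul_assoc = algD(5)[OF alg]
 and one_mul = algD(6)[OF alg] and mul_one = algD(7)[OF alg]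

abbreviation "Sw x ph == tev H H (cop H x) ph"
abbreviation "Sw3 x ph == Sw x (%a r. Sw r (%b c. ph a b c))"

lemma sw_eq: "bilin_map H H U ph ==> vspace U ==> x : carr H ==> sw H x ph = Sw x ph"
 unfolding sw_def by (rule tl_tev[OF _ vs _ cop_in])

lemma Swc: "x : carr H ==> (!!a b. a : carr H ==> b : carr H ==> ph a b = psi a b) ==> Sw x ph = Sw x psi"
 by (rule tevc[OF vs cop_in])

lemma coassoc:
 fixes ph :: "'h => 'h => 'h => 'k"
 assumes ph: "triform H H H ph" and x: "x : carr H"
 shows "Sw x (%y c. Sw y (%a b. ph a b c)) = Sw3 x (%a b c. ph a b c)"
proof -
 have "sw H x (%y c. sw H y (%a b. tpure H (tensor H H) a (tpure H H b c))) = sw H x (%a y. tpure H (tensor H H) a (cop H y))"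
  using bialg x by (simp add: bialgebra_def)
 then have "tev H (tensor H H) (sw H x (%y c. sw H y (%a b. tpure H (tensor H H) a (tpure H H b c)))) (%a s. tev H H s (%c d. ph a c d))
   = tev H (tensor H H) (sw H x (%a y. tpure H (tensor H H) a (cop H y))) (%a s. tev H H s (%c d. ph a c d))"
  by simp
 then show ?thesis
  unfolding sw_def coaL(2)[OF ph vs vs vs vs cop_in[OF x] lin_cop_H] coaR(2)[OF ph vs vs vs vs cop_in[OF x] lin_cop_H] .
qed

lemma bilin_counit: "bilin_map H H H (%a b. scal H (cou H a) b)" "bilin_map H H H (%a b. scal H (cou H b) a)"
 by (auto simp: bilin_map_def lin_rules vs cou_form)

lemma couL: assumes f: "form H f" and x: "x : carr H"
 shows "Sw x (%a b. cou H a * f b) = f x" (is "?L = _")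
proof -
 have "f x = f (sw H x (%a b. scal H (cou H a) b))" using bialg x by (simp add: bialgebra_def)
 also have "... = Sw x (%a b. f (scal H (cou H a) b))"
  unfolding sw_def by (rule tl_pull[OF f bilin_counit(1) vs vs cop_in[OF x]])
 also have "... = ?L"
  by (rule Swc[OF x]) (simp add: linD(3)[OF f])
 finally show ?thesis by simp
qed

lemma couR: assumes f: "form H f" and x: "x : carr H"
 shows "Sw x (%a b. cou H b * f a) = f x" (is "?L = _")
proof -
 have "f x = f (sw H x (%a b. scal H (cou H b) a))" using bialg x by (simp add: bialgebra_def)
 also have "... = Sw x (%a b. f (scal H (cou H b) a))"
  unfolding sw_def by (rule tl_pull[OF f bilin_counit(2) vs vs cop_in[OF x]])
 also have "... = ?L"
  by (rule Swc[OF x]) (simp add: linD(3)[OF f])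
 finally show ?thesis by simp
qed

lemma Sw_mul: assumes ph: "biform H H ph" and x: "x : carr H" and y: "y : carr H"
 shows "Sw (mul H x y) ph = Sw x (%x1 x2. Sw y (%y1 y2. ph (mul H x1 y1) (mul H x2 y2)))"
proof -
 have "cop H (mul H x y) = sw H x (%x1 x2. sw H y (%y1 y2. tpure H H (mul H x1 y1) (mul H x2 y2)))"
  using bialg x y by (simp add: bialgebra_def)
 then show ?thesis
  unfolding sw_def by (simp add: tm_eval(2)[OF alg alg cop_in[OF x] cop_in[OF y] ph])
qed

lemma Sw_one: "biform H H ph ==> Sw (unity H) ph = ph (unity H) (unity H)"
 unfolding cop_one by (rule tevp[OF _ vs vs_g one_in one_in])

end

text \<open>Axioms with values in H are tested on \<open>F\<close>, those with values in the tensor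
  square or cube on products of forms from \<open>F\<close>, which separate by
  \<open>sep_tensor\<close>. The remaining obligations are identities of scalars.\<close>

lemma bialgebraI:
 assumes alg: "assoc_algebra H" and cop: "lin_map H (tensor H H) (cop H)" and cou: "form H (cou H)"
  and F: "sep H F"
  and coassoc: "!!x f g h. x : carr H ==> f : F ==> g : F ==> h : F ==>
   tev H H (cop H x) (%y c. tev H H (cop H y) (%a b. f a * (g b * h c)))
   = tev H H (cop H x) (%a y. tev H H (cop H y) (%b c. f a * (g b * h c)))"
  and couL: "!!x f. x : carr H ==> f : F ==> tev H H (cop H x) (%a b. cou H a * f b) = f x"
  and couR: "!!x f. x : carr H ==> f : F ==> tev H H (cop H x) (%a b. cou H b * f a) = f x"
  and cop_mul: "!!x y f g. x : carr H ==> y : carr H ==> f : F ==> g : F ==> tev H H (cop H (mul H x y)) (%a b. f a * g b)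
   = tev H H (cop H x) (%x1 x2. tev H H (cop H y) (%y1 y2. f (mul H x1 y1) * g (mul H x2 y2)))"
  and cop_one: "cop H (unity H) = tpure H H (unity H) (unity H)"
  and cou_mul: "!!x y. x : carr H ==> y : carr H ==> cou H (mul H x y) = cou H x * cou H y"
  and cou_one: "cou H (unity H) = 1"
 shows "bialgebra H"
proof -
 note vs = algD(1)[OF alg]
 note form = sepD(2)[OF F]
 have cop_in: "cop H x : carr (tensor H H)" if "x : carr H" for x using linD(1)[OF cop that] .
 have tri: "triform H H H (%a b c. f a * (g b * h c))" if "f : F" "g : F" "h : F" for f g h
  using that by (auto simp: triform_def form fmL fmR)
 have bi: "biform H H (%a b. f a * g b)" if "f : F" "g : F" for f g
  using that by (auto simp: bilin_map_def form fmL fmR)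
 note S3 = sep_tensor[OF F sep_tensor[OF F F]]
 have "sw H x (%y c. sw H y (%a b. tpure H (tensor H H) a (tpure H H b c)))
    = sw H x (%a y. tpure H (tensor H H) a (cop H y))" if x: "x : carr H" for x
  unfolding sw_def
 proof (rule sep_eqI[OF S3])
  \<comment> \<open>\<open>coaL\<close> and \<open>coaR\<close> give membership and evaluation
    together for a trilinear form; the zero form serves for the membership half.\<close>
  have z: "triform H H H (%a b c. 0)" by (auto simp: triform_def lin_map_def)
  show "tlift H H (%y c. tlift H H (%a b. tpure H (tensor H H) a (tpure H H b c)) (cop H y)) (cop H x) : carr (tensor H (tensor H H))"
   by (rule coaL(1)[OF z vs vs vs vs cop_in[OF x] cop])
  show "tlift H H (%a y. tpure H (tensor H H) a (cop H y)) (cop H x) : carr (tensor H (tensor H H))"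
   by (rule coaR(1)[OF z vs vs vs vs cop_in[OF x] cop])
  fix th assume "th : {%t. tev H (tensor H H) t (%v w. f v * g w) |f g. f : F & g : {%t. tev H H t (%v w. f v * g w) |f g. f : F & g : F}}"
  then obtain f g h where F: "f : F" "g : F" "h : F"
   and th: "th = (%t. tev H (tensor H H) t (%a s. tev H H s (%b c. f a * (g b * h c))))"
   by (auto simp: tevL)
  show "th (tlift H H (%y c. tlift H H (%a b. tpure H (tensor H H) a (tpure H H b c)) (cop H y))
     (cop H x)) = th (tlift H H (%a y. tpure H (tensor H H) a (cop H y)) (cop H x))"
   unfolding th coaL(2)[OF tri[OF F] vs vs vs vs cop_in[OF x] cop]
   coaR(2)[OF tri[OF F] vs vs vs vs cop_in[OF x] cop] by (rule coassoc[OF x F])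
 qed
 moreover have b: "bilin_map H H H (%a b. scal H (cou H a) b)" "bilin_map H H H (%a b. scal H (cou H b) a)"
  by (auto simp: bilin_map_def lin_rules vs cou)
 have "sw H x (%a b. scal H (cou H a) b) = x & sw H x (%a b. scal H (cou H b) a) = x"
  if x: "x : carr H" for x
  unfolding sw_def
 proof
  show "tlift H H (%a b. scal H (cou H a) b) (cop H x) = x"
   by (rule sep_eqI[OF F tlift_in[OF b(1) vs vs cop_in[OF x]] x], subst tl_pull[OF form b(1) vs vs cop_in[OF x]], assumption, subst couL[OF x,
    symmetric], assumption, rule tevc[OF vs cop_in[OF x]], simp add: linD(3)[OF form])
  show "tlift H H (%a b. scal H (cou H b) a) (cop H x) = x"
   by (rule sep_eqI[OF F tlift_in[OF b(2) vs vs cop_in[OF x]] x], subst tl_pull[OF form b(2) vs vs cop_in[OF x]], assumption, subst couR[OF x,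
    symmetric], assumption, rule tevc[OF vs cop_in[OF x]], simp add: linD(3)[OF form])
 qed
 moreover have "cop H (mul H x y) = sw H x (%x1 x2. sw H y (%y1 y2. tpure H H (mul H x1 y1) (mul H x2 y2)))"
  if x: "x : carr H" and y: "y : carr H" for x y
  unfolding sw_def
  by (rule tensor_eqI[OF F F], rule cop_in, rule algD(4)[OF alg x y], rule tm_eval(1)[OF alg alg cop_in[OF x] cop_in[OF y] bilin_zero],
   subst tm_eval(2)[OF alg alg cop_in[OF x] cop_in[OF y] bi], assumption+, rule cop_mul[OF x y], assumption+)
 ultimately show ?thesis
  unfolding bialgebra_def using assms by blast
qed

section \<open>Yetter--Drinfeld module algebras\<close>

lemma bilL: "bilin_map A C U ph ==> lin_map V A f ==> c : carr C ==> lin_map V U (%x. ph (f x) c)"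
 by (auto simp: bilin_map_def lin_map_def)

lemma bilR: "bilin_map A C U ph ==> lin_map V C f ==> a : carr A ==> lin_map V U (%x. ph a (f x))"
 by (auto simp: bilin_map_def lin_map_def)

lemma lin_act_left: "bilin_map H X X (act X) ==> lin_map V H f ==> x : carr X ==> lin_map V X (%v. act X (f v) x)"
 by (rule bilL)

lemma lin_act_right: "bilin_map H X X (act X) ==> lin_map V X f ==> h : carr H ==> lin_map V X (%v. act X h (f v))"
 by (rule bilR)

lemma lin_coact: "lin_map X (tensor H X) (coact X) ==> lin_map V X f ==> lin_map V (tensor H X) (%v. coact X (f v))"
 by (rule lin_o)

lemma ydD:
 assumes "yd_module_algebra H X"
 shows "bialgebra H" "assoc_algebra X" "bilin_map H X X (act X)" "lin_map X (tensor H X) (coact X)" "x : carr X ==> act X (unity H) x = x"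
  "g : carr H ==> h : carr H ==> x : carr X ==> act X (mul H g h) x = act X g (act X h x)"
  "h : carr H ==> act X h (unity X) = scal X (cou H h) (unity X)" "h : carr H ==> x : carr X ==> act X h x : carr X"
  "x : carr X ==> coact X x : carr (tensor H X)" "coact X (unity X) = tpure H X (unity H) (unity X)"
 using assms by (auto simp: yd_module_algebra_def bilD(1) linD(1))

lemma ydc_eval:
 assumes H: "bialgebra H" and vX: "vspace X" and a: "bilin_map H X X (act X)"
  and c: "lin_map X (tensor H X) (coact X)"
  and h: "h : carr H" and x: "x : carr X" and ph: "biform H X ph"
 shows "sw H h (%h1 h2. tlift H X (%g z. tpure H X (mul H g h2) z) (coact X (act X h1 x))) : carr (tensor H X)" (is "?in1")
  "sw H h (%h1 h2. tlift H X (%g z. tpure H X (mul H h1 g) (act X h2 z)) (coact X x)) : carr (tensor H X)" (is "?in2")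
  "tev H X (sw H h (%h1 h2. tlift H X (%g z. tpure H X (mul H g h2) z) (coact X (act X h1 x)))) ph
   = tev H H (cop H h) (%h1 h2. tev H X (coact X (act X h1 x)) (%g z. ph (mul H g h2) z))" (is "?eq1")
  "tev H X (sw H h (%h1 h2. tlift H X (%g z. tpure H X (mul H h1 g) (act X h2 z)) (coact X x))) ph
   = tev H H (cop H h) (%h1 h2. tev H X (coact X x) (%g z. ph (mul H h1 g) (act X h2 z)))" (is "?eq2")
proof -
 let ?f = "%h1 h2. tlift H X (%g z. tpure H X (mul H g h2) z) (coact X (act X h1 x))"
 note vH = biaD(2)[OF H] and alg = biaD(1)[OF H]
 note cop_in = biaD(5)[OF H]
 have act_in: "act X g z : carr X" if "g : carr H" "z : carr X" for g z using bilD(1)[OF a that] .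
 have co_in: "coact X z : carr (tensor H X)" if "z : carr X" for z using linD(1)[OF c that] .
 note [simp] = vH vX algD(4)[OF alg] act_in co_in
 note rules = lin_rules lin_act_left[OF a] lin_act_right[OF a] lin_coact c alg H
 have b1: "bilin_map H X (tensor H X) (%g z. tpure H X (mul H g h2) z)" if "h2 : carr H" for h2
  using that by (auto simp: bilin_map_def rules)
 have b2: "bilin_map H X (tensor H X) (%g z. tpure H X (mul H h1 g) (act X h2 z))"
  if "h1 : carr H" "h2 : carr H" for h1 h2
  using that by (auto simp: bilin_map_def rules)
 have B1: "bilin_map H H (tensor H X) ?f"
  unfolding bilin_map_def
 proof (intro conjI ballI)
  fix h1 assume "h1 : carr H"
  then show "lin_map H (tensor H X) (%h2. ?f h1 h2)"
   using x by (intro lin_tlb b1) (auto simp: rules)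
 next
  fix h2 assume "h2 : carr H"
  then show "lin_map H (tensor H X) (%h1. ?f h1 h2)"
   using x by (intro lin_tla b1) (auto simp: rules)
 qed
 have B2: "bilin_map H H (tensor H X) (%h1 h2. tlift H X (%g z. tpure H X (mul H h1 g) (act X h2 z)) (coact X x))"
  unfolding bilin_map_def
  using x by (intro conjI ballI lin_tlb b2) (auto simp: rules)
 show ?in1 unfolding sw_def by (rule tlift_in[OF B1 vH vs_t cop_in[OF h]])
 show ?in2 unfolding sw_def by (rule tlift_in[OF B2 vH vs_t cop_in[OF h]])
 note p = tl_pull[OF lin_ta[OF ph vH vs_g]]
 show ?eq1 unfolding sw_def
  by (subst p[OF B1 vH vs_t cop_in[OF h]], rule tevc[OF vH cop_in[OF h]], subst p[OF b1 vH vs_t], assumption, simp add: x, rule tevc[OF vH],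
   simp add: x, rule tevp[OF ph vH vs_g], auto)
 show ?eq2 unfolding sw_def
  by (subst p[OF B2 vH vs_t cop_in[OF h]], rule tevc[OF vH cop_in[OF h]], subst p[OF b2 vH vs_t], assumption, assumption, simp add: x,
   rule tevc[OF vH], simp add: x, rule tevp[OF ph vH vs_g], auto)
qed

lemma act_prod_eval:
 assumes H: "bialgebra H" and X: "assoc_algebra X" and a: "bilin_map H X X (act X)"
  and h: "h : carr H" and x: "x : carr X" "y : carr X"
 shows "sw H h (%h1 h2. mul X (act X h1 x) (act X h2 y)) : carr X" (is ?a)
  "form X p ==> p (sw H h (%h1 h2. mul X (act X h1 x) (act X h2 y))) = tev H H (cop H h) (%h1 h2. p (mul X (act X h1 x) (act X h2 y)))"
proof -
 note vH = biaD(2)[OF H] and vX = algD(1)[OF X]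
 note cop_in = biaD(5)[OF H]
 have b: "bilin_map H H X (%h1 h2. mul X (act X h1 x) (act X h2 y))"
  using x by (auto simp: bilin_map_def bilD(1)[OF a] intro!: lmL lmR X lin_act_left[OF a] lin_id)
 show ?a
  unfolding sw_def by (rule tlift_in[OF b vH vX cop_in[OF h]])
 show "form X p ==> p (sw H h (%h1 h2. mul X (act X h1 x) (act X h2 y))) = tev H H (cop H h) (%h1 h2. p (mul X (act X h1 x) (act X h2 y)))"
  unfolding sw_def by (rule tl_pull[OF _ b vH vX cop_in[OF h]])
qed

text \<open>The analogue of \<open>bialgebraI\<close>: axioms with values in \<open>X\<close> are
  tested on \<open>G\<close>, those with values in tensor products on products of forms from
  \<open>F\<close> and \<open>G\<close>.\<close>

lemma yd_module_algebraI:
 assumes H: "bialgebra H" and X: "assoc_algebra X" and a: "bilin_map H X X (act X)"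
  and c: "lin_map X (tensor H X) (coact X)" and F: "sep H F" and G: "sep X G"
  and act_one: "!!x. x : carr X ==> act X (unity H) x = x"
  and act_mul: "!!g h x. g : carr H ==> h : carr H ==> x : carr X ==> act X (mul H g h) x = act X g (act X h x)"
  and act_unity: "!!h. h : carr H ==> act X h (unity X) = scal X (cou H h) (unity X)"
  and act_prod: "!!h x y p. h : carr H ==> x : carr X ==> y : carr X ==> p : G ==>
   p (act X h (mul X x y)) = tev H H (cop H h) (%h1 h2. p (mul X (act X h1 x) (act X h2 y)))"
  and coassoc: "!!x f f' p. x : carr X ==> f : F ==> f' : F ==> p : G ==>
   tev H X (coact X x) (%g z. tev H H (cop H g) (%a b. f a * (f' b * p z)))
   = tev H X (coact X x) (%g z. tev H X (coact X z) (%h w. f g * (f' h * p w)))"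
  and counit: "!!x p. x : carr X ==> p : G ==> tev H X (coact X x) (%g z. cou H g * p z) = p x"
  and co_mul: "!!x y f p. x : carr X ==> y : carr X ==> f : F ==> p : G ==> tev H X (coact X (mul X x y)) (%g z. f g * p z)
   = tev H X (coact X x) (%g z. tev H X (coact X y) (%h w. f (mul H g h) * p (mul X z w)))"
  and co_one: "coact X (unity X) = tpure H X (unity H) (unity X)"
  and yd: "!!h x f p. h : carr H ==> x : carr X ==> f : F ==> p : G ==>
   tev H H (cop H h) (%h1 h2. tev H X (coact X (act X h1 x)) (%g z. f (mul H g h2) * p z))
   = tev H H (cop H h) (%h1 h2. tev H X (coact X x) (%g z. f (mul H h1 g) * p (act X h2 z)))"
 shows "yd_module_algebra H X"
proof -
 note vH = biaD(2)[OF H] and alg = biaD(1)[OF H] and vX = algD(1)[OF X]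
 note cop_in = biaD(5)[OF H]
 have act_in: "act X g z : carr X" if "g : carr H" "z : carr X" for g z using bilD(1)[OF a that] .
 have co_in: "coact X z : carr (tensor H X)" if "z : carr X" for z using linD(1)[OF c that] .
 note formF = sepD(2)[OF F] and formG = sepD(2)[OF G]
 have tri: "triform H H X (%a b c. f a * (g b * p c))" if "f : F" "g : F" "p : G" for f g p
  using that by (auto simp: triform_def formF formG fmL fmR)
 have bi: "biform H X (%a b. f a * p b)" if "f : F" "p : G" for f p
  using that by (auto simp: bilin_map_def formF formG fmL fmR)
 have z3: "triform H H X (%a b c. 0)" by (auto simp: triform_def lin_map_def)
 have 1: "act X h (mul X x y) = sw H h (%h1 h2. mul X (act X h1 x) (act X h2 y))"
  if "h : carr H" "x : carr X" "y : carr X" for h x y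
  by (rule sep_eqI[OF G]) (use that in "auto simp: act_prod_eval(2)[OF H X a that formG] act_prod
   intro!: act_in algD(4)[OF X] act_prod_eval(1)[OF H X a that]")
 have 2: "tlift H X (%g z. sw H g (%g1 g2. tpure H (tensor H X) g1 (tpure H X g2 z))) (coact X x)
    = tlift H X (%g z. tpure H (tensor H X) g (coact X z)) (coact X x)" if x: "x : carr X" for x
  unfolding sw_def
 proof (rule sep_eqI[OF sep_tensor[OF F sep_tensor[OF F G]]])
  show "tlift H X (%g z. tlift H H (%g1 g2. tpure H (tensor H X) g1 (tpure H X g2 z)) (cop H g)) (coact X x) : carr (tensor H (tensor H X))"
   by (rule coaL(1)[OF z3 vH vH vH vX co_in[OF x] biaD(3)[OF H]])
  show "tlift H X (%g z. tpure H (tensor H X) g (coact X z)) (coact X x) : carr (tensor H (tensor H X))"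
   by (rule coaR(1)[OF z3 vH vH vX vX co_in[OF x] c])
  fix th assume "th : {%t. tev H (tensor H X) t (%v w. f v * g w) |f g. f : F & g : {%t. tev H X t (%v w. f v * g w) |f g. f : F & g : G}}"
  then obtain f g h where F: "f : F" "g : F" "h : G"
   and th: "th = (%t. tev H (tensor H X) t (%a s. tev H X s (%b c. f a * (g b * h c))))"
   by (auto simp: tevL)
  show "th (tlift H X (%g z. tlift H H (%g1 g2. tpure H (tensor H X) g1 (tpure H X g2 z)) (cop H g)) (coact X x))
   = th (tlift H X (%g z. tpure H (tensor H X) g (coact X z)) (coact X x))"
   unfolding th coaL(2)[OF tri[OF F] vH vH vH vX co_in[OF x] biaD(3)[OF H]] coaR(2)[OF tri[OF F] vH vH vX vX co_in[OF x] c]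
   by (rule coassoc[OF x F])
 qed
 have b: "bilin_map H X X (%g z. scal X (cou H g) z)"
  by (auto simp: bilin_map_def lin_rules vX biaD(4)[OF H])
 have 3: "tlift H X (%g z. scal X (cou H g) z) (coact X x) = x" if x: "x : carr X" for x
   by (rule sep_eqI[OF G tlift_in[OF b vH vX co_in[OF x]] x], subst tl_pull[OF formG b vH vX co_in[OF x]], assumption, subst counit[OF x, symmetric],
    assumption, rule tevc[OF vH co_in[OF x]], simp add: linD(3)[OF formG])
 have 4: "coact X (mul X x y) = tlift H X (%g z. tlift H X (%h w. tpure H X (mul H g h) (mul X z w)) (coact X y))
      (coact X x)" if x: "x : carr X" and y: "y : carr X" for x y
  by (rule tensor_eqI[OF F G], rule co_in, rule algD(4)[OF X x y], rule tm_eval(1)[OF alg X co_in[OF x] co_in[OF y] bilin_zero],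
   subst tm_eval(2)[OF alg X co_in[OF x] co_in[OF y] bi], assumption+, rule co_mul[OF x y], assumption+)
 have 5: "sw H h (%h1 h2. tlift H X (%g z. tpure H X (mul H g h2) z) (coact X (act X h1 x)))
    = sw H h (%h1 h2. tlift H X (%g z. tpure H X (mul H h1 g) (act X h2 z)) (coact X x))"
  if h: "h : carr H" and x: "x : carr X" for h x
  by (rule tensor_eqI[OF F G], rule ydc_eval(1)[OF H vX a c h x bilin_zero], rule ydc_eval(2)[OF H vX a c h x bilin_zero],
   subst ydc_eval(3)[OF H vX a c h x bi], assumption+, subst ydc_eval(4)[OF H vX a c h x bi], assumption+, rule yd[OF h x], assumption+)
 show ?thesis unfolding yd_module_algebra_def
  using H X a c act_one act_mul 1 act_unity 2 3 4 co_one 5 by (intro conjI ballI) auto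
qed

locale ydalg = bialg H for H :: "('k::field, 'h::ab_group_add, 'z) bialg_scheme" +
 fixes X :: "('k, 'h, 'x::ab_group_add, 'y) yd_scheme"
 assumes yd: "yd_module_algebra H X"
begin

lemmas X_alg = ydD(2)[OF yd] and act_bilin = ydD(3)[OF yd]
 and coact_lin = ydD(4)[OF yd] and act_one = ydD(5)[OF yd]
 and act_mul = ydD(6)[OF yd] and act_unity = ydD(7)[OF yd]
 and act_in = ydD(8)[OF yd] and coact_in = ydD(9)[OF yd]
 and coact_unity = ydD(10)[OF yd]
lemmas X_vs = algD(1)[OF X_alg]
 and X_one_in = algD(3)[OF X_alg] and X_mul_in = algD(4)[OF X_alg]
 and X_mul_assoc = algD(5)[OF X_alg]
 and X_one_mul = algD(6)[OF X_alg] and X_mul_one = algD(7)[OF X_alg]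

abbreviation "Co x ph == tev H X (coact X x) ph"

lemma Co_cong: "x : carr X ==> (!!a b. a : carr H ==> b : carr X ==> ph a b = psi a b) ==> Co x ph = Co x psi"
 by (rule tevc[OF vs coact_in])

lemma act_prod: assumes h: "h : carr H" and x: "x : carr X" "y : carr X" and p: "form X p"
 shows "p (act X h (mul X x y)) = Sw h (%h1 h2. p (mul X (act X h1 x) (act X h2 y)))"
 unfolding act_prod_eval(2)[OF bialg X_alg act_bilin h x p, symmetric]
 using yd h x by (simp add: yd_module_algebra_def)

lemma Co_coassoc:
 assumes ph: "triform H H X ph" and x: "x : carr X"
 shows "Co x (%g z. Sw g (%a b. ph a b z)) = Co x (%g z. Co z (%h w. ph g h w))"
proof -
 have "tlift H X (%g z. sw H g (%g1 g2. tpure H (tensor H X) g1 (tpure H X g2 z))) (coact X x)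
    = tlift H X (%g z. tpure H (tensor H X) g (coact X z)) (coact X x)"
  using yd x by (simp add: yd_module_algebra_def)
 then have "tev H (tensor H X) (tlift H X (%g z. sw H g (%g1 g2. tpure H (tensor H X) g1 (tpure H X g2 z))) (coact X x))
    (%a s. tev H X s (%c d. ph a c d))
   = tev H (tensor H X) (tlift H X (%g z. tpure H (tensor H X) g (coact X z)) (coact X x)) (%a s. tev H X s (%c d. ph a c d))"
  by simp
 then show ?thesis
  unfolding sw_def coaL(2)[OF ph vs vs vs X_vs coact_in[OF x] lin_cop_H] coaR(2)[OF ph vs vs X_vs X_vs coact_in[OF x] coact_lin] .
qed

lemma Co_counit: assumes p: "form X p" and x: "x : carr X"
 shows "Co x (%g z. cou H g * p z) = p x" (is "?L = _")
proof -
 have b: "bilin_map H X X (%g z. scal X (cou H g) z)"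
  by (auto simp: bilin_map_def lin_rules X_vs cou_form)
 have "p x = p (tlift H X (%g z. scal X (cou H g) z) (coact X x))" using yd x by (simp add: yd_module_algebra_def)
 also have "... = Co x (%g z. p (scal X (cou H g) z))"
  by (rule tl_pull[OF p b vs X_vs coact_in[OF x]])
 also have "... = ?L"
  by (rule Co_cong[OF x]) (simp add: linD(3)[OF p])
 finally show ?thesis by simp
qed

lemma Co_mul: assumes ph: "biform H X ph" and x: "x : carr X" and y: "y : carr X"
 shows "Co (mul X x y) ph = Co x (%g z. Co y (%h w. ph (mul H g h) (mul X z w)))"
proof -
 have "coact X (mul X x y) = tlift H X (%g z. tlift H X (%h w. tpure H X (mul H g h) (mul X z w)) (coact X y)) (coact X x)"
  using yd x y by (simp add: yd_module_algebra_def)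
 then show ?thesis
  by (simp add: tm_eval(2)[OF alg X_alg coact_in[OF x] coact_in[OF y] ph])
qed

lemma Co_one: "biform H X ph ==> Co (unity X) ph = ph (unity H) (unity X)"
 unfolding coact_unity by (rule tevp[OF _ vs vs_g one_in X_one_in])

lemma Co_yd: assumes ph: "biform H X ph" and h: "h : carr H" and x: "x : carr X"
 shows "Sw h (%h1 h2. Co (act X h1 x) (%g z. ph (mul H g h2) z)) = Sw h (%h1 h2. Co x (%g z. ph (mul H h1 g) (act X h2 z)))"
proof -
 have "sw H h (%h1 h2. tlift H X (%g z. tpure H X (mul H g h2) z) (coact X (act X h1 x)))
    = sw H h (%h1 h2. tlift H X (%g z. tpure H X (mul H h1 g) (act X h2 z)) (coact X x))"
  using yd h x by (simp add: yd_module_algebra_def)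
 then show ?thesis
  unfolding ydc_eval(3,4)[OF bialg X_vs act_bilin coact_lin h x ph, symmetric] by simp
qed

end

lemma ydalgI: "yd_module_algebra H X ==> ydalg H X"
 by (simp add: bialg_def ydalg_axioms_def ydalg_def ydD(1))

subsection \<open>Transport along morphisms\<close>

lemma ydhD:
 assumes "yd_hom H X Y f"
 shows "lin_map X Y f" "x : carr X ==> y : carr X ==> f (mul X x y) = mul Y (f x) (f y)"
  "f (unity X) = unity Y" "h : carr H ==> x : carr X ==> f (act X h x) = act Y h (f x)"
  "x : carr X ==> coact Y (f x) = tlift H X (%g z. tpure H Y g (f z)) (coact X x)"
 using assms by (auto simp: yd_hom_def)

lemma bil_tpm: "lin_map X Y f ==> bilin_map H X (tensor H Y) (%g z. tpure H Y g (f z))"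
 by (auto simp: bilin_map_def lin_rules linD(1))

lemma coact_hom_eval:
 assumes "vspace H" "lin_map X Y f" "t : carr (tensor H X)"
 shows "tlift H X (%g z. tpure H Y g (f z)) t : carr (tensor H Y)" (is ?a)
  "biform H Y ph ==> tev H Y (tlift H X (%g z. tpure H Y g (f z)) t) ph = tev H X t (%g z. ph g (f z))"
proof -
 note b = bil_tpm[OF assms(2), of H]
 show ?a
  by (rule tlift_in[OF b assms(1) vs_t assms(3)])
 assume ph: "biform H Y ph"
 show "tev H Y (tlift H X (%g z. tpure H Y g (f z)) t) ph = tev H X t (%g z. ph g (f z))"
  by (subst tl_pull[OF lin_ta[OF ph assms(1) vs_g] b assms(1) vs_t assms(3)])
   (auto intro!: tevc assms tevp[OF ph assms(1) vs_g] linD(1)[OF assms(2)])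
qed

text \<open>Every axiom of a Yetter--Drinfeld module algebra involves at most three elements. It therefore
  suffices that any three elements lie in the image of a morphism from a Yetter--Drinfeld module
  algebra.\<close>

lemma yd_module_algebra_local:
 fixes Y :: "('k::field, 'h::ab_group_add, 'y::ab_group_add, 'z) yd_scheme"
  and H :: "('k, 'h, 'u) bialg_scheme"
 assumes H: "bialgebra H" and Y: "vspace Y"
  and loc: "!!x y z. x : carr Y ==> y : carr Y ==> z : carr Y ==>
   EX (X :: ('k, 'h, 'x::ab_group_add, 'w) yd_scheme) f. yd_module_algebra H X & yd_hom H X Y f &
    x : f ` carr X & y : f ` carr X & z : f ` carr X"
 shows "yd_module_algebra H Y"
proof -
 note vH = biaD(2)[OF H] and alg = biaD(1)[OF H]
 have loc': thesis if "x : carr Y" "y : carr Y" "z : carr Y" and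
  "!!(X :: ('k, 'h, 'x::ab_group_add, 'w) yd_scheme) f x' y' z'. ydalg H X ==> yd_hom H X Y f ==>
   x = f x' ==> y = f y' ==> z = f z' ==> x' : carr X ==> y' : carr X ==> z' : carr X ==> thesis"
  for x y z thesis
  using loc[OF that(1-3)] that(4) ydalgI by blast
 have act: "act Y h x : carr Y & act Y h (x + y) = act Y h x + act Y h y & act Y h (scal Y c x) = scal Y c (act Y h x) &
   act Y (h + g) x = act Y h x + act Y g x & act Y (scal H c h) x = scal Y c (act Y h x) &
   act Y (unity H) x = x & act Y (mul H g h) x = act Y g (act Y h x) & act Y h (unity Y) = scal Y (cou H h) (unity Y)"
  if h: "h : carr H" "g : carr H" and x: "x : carr Y" "y : carr Y" for h g x y c
 proof (rule loc'[OF x x(1)], goal_cases)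
  case (1 X f x' y' z') note f = 1(2-5) and X = 1(6,7)
  interpret X: ydalg H X by (rule 1)
  note [simp] = f(2,3) ydhD(4)[OF f(1), symmetric] linD[OF ydhD(1)[OF f(1)]]
   linD(2,3)[OF ydhD(1)[OF f(1)], symmetric] ydhD(3)[OF f(1), symmetric]
  note [simp del] = linD(2,3)[OF ydhD(1)[OF f(1)]]
  show ?thesis using X h
   by (simp add: X.act_in X.X_vs vH vs_add vs_scal X.mul_in X.X_one_in X.act_one X.act_mul X.act_unity X.one_in bilD[OF X.act_bilin])
 qed
 have mul: "mul Y x y : carr Y & mul Y (x + z) y = mul Y x y + mul Y z y & mul Y x (y + z) = mul Y x y + mul Y x z &
   mul Y (scal Y c x) y = scal Y c (mul Y x y) & mul Y x (scal Y c y) = scal Y c (mul Y x y) &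
   mul Y (mul Y x y) z = mul Y x (mul Y y z) & unity Y : carr Y & mul Y (unity Y) x = x & mul Y x (unity Y) = x"
  if x: "x : carr Y" "y : carr Y" "z : carr Y" for x y z c
 proof (rule loc'[OF x], goal_cases)
  case (1 X f x' y' z') note f = 1(2-5) and X = 1(6-8)
  interpret X: ydalg H X by (rule 1)
  note [simp] = f(2-4) ydhD(2)[OF f(1), symmetric] linD(1)[OF ydhD(1)[OF f(1)]]
   linD(2,3)[OF ydhD(1)[OF f(1)], symmetric] ydhD(3)[OF f(1), symmetric]
  show ?thesis using X
   by (simp add: X.X_vs vs_add vs_scal X.X_mul_in X.X_one_in X.X_one_mul X.X_mul_one X.X_mul_assoc bilD[OF algD(2)[OF X.X_alg]])
 qed
 have co: "coact Y x : carr (tensor H Y) & coact Y (x + y) = coact Y x + coact Y y &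
   coact Y (scal Y c x) = fun_scal c (coact Y x) & coact Y (unity Y) = tpure H Y (unity H) (unity Y)"
  if x: "x : carr Y" "y : carr Y" for x y c
 proof (rule loc'[OF x x(1)], goal_cases)
  case (1 X f x' y' z') note f = 1(2-5) and X = 1(6,7)
  interpret X: ydalg H X by (rule 1)
  have l: "lin_map X (tensor H Y) (%x. tlift H X (%g z. tpure H Y g (f z)) (coact X x))"
   by (rule lin_tla[OF X.coact_lin bil_tpm[OF ydhD(1)[OF f(1)]] vH vs_t])
  have "coact Y (f (unity X)) = tpure H Y (unity H) (f (unity X))"
   by (simp add: ydhD(5)[OF f(1)] X.X_one_in X.coact_unity X.one_in vH tl_pure[OF bil_tpm[OF ydhD(1)[OF f(1)]] vH vs_t])
  then show ?thesis
   using linD[OF l] X vs_add[OF X.X_vs] vs_scal[OF X.X_vs]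
   by (simp add: f(2,3) ydhD(5)[OF f(1)] linD(2,3)[OF ydhD(1)[OF f(1)], symmetric] ydhD(3)[OF f(1), symmetric])
 qed
 have ex: "EX x. x : carr Y" using vs_zero[OF Y] by blast
 have algY: "assoc_algebra Y"
  using mul Y ex by (auto simp: assoc_algebra_def bilin_map_def lin_map_def)
 have bilY: "bilin_map H Y Y (act Y)" and linY: "lin_map Y (tensor H Y) (coact Y)"
  using act co by (auto simp: bilin_map_def lin_map_def)
 show ?thesis
 proof (rule yd_module_algebraI[OF H algY bilY linY sep_forms[OF vH] sep_forms[OF Y]])
  fix x assume x: "x : carr Y"
  show "act Y (unity H) x = x" using act[OF algD(3)[OF alg] algD(3)[OF alg] x x] by blast
 next
  fix g h x assume "x : carr Y" "g : carr H" "h : carr H"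
  then show "act Y (mul H g h) x = act Y g (act Y h x)" using act by blast
 next
  fix h assume "h : carr H"
  then show "act Y h (unity Y) = scal Y (cou H h) (unity Y)" using act ex by blast
 next
  fix h x y p assume A: "h : carr H" "x : carr Y" "y : carr Y" "p : {f. form Y f}"
  show "p (act Y h (mul Y x y)) = tev H H (cop H h) (%h1 h2. p (mul Y (act Y h1 x) (act Y h2 y)))"
  proof (rule loc'[OF A(2,3,3)], goal_cases)
   case (1 X f x' y' z') note f = 1(2-5) and X = 1(6,7)
   interpret X: ydalg H X by (rule 1)
   \<comment> \<open>A test form of \<open>Y\<close>, pulled back along the morphism, is a test form
     of \<open>X\<close>; the axiom of \<open>X\<close> evaluated on it is the axiom of
     \<open>Y\<close>.\<close>
   have "form X (%x. p (f x))" using lin_o[OF ydhD(1)[OF f(1)]] A(4) by simp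
   from X.act_prod[OF A(1) X this] show ?thesis
    by (simp add: f(2,3) A(1) X X.X_mul_in X.act_in X.vs X.cop_in ydhD(2,4)[OF f(1), symmetric] cong: tevc)
  qed
 next
  fix x h f' p assume A: "x : carr Y" "h : {f. form H f}" "f' : {f. form H f}" "p : {f. form Y f}"
  show "tev H Y (coact Y x) (%g z. tev H H (cop H g) (%a b. h a * (f' b * p z)))
    = tev H Y (coact Y x) (%g z. tev H Y (coact Y z) (%k w. h g * (f' k * p w)))"
  proof (rule loc'[OF A(1,1,1)], goal_cases)
   case (1 X f x' y' z') note f = 1(2-5) and X = 1(6)
   interpret X: ydalg H X by (rule 1)
   have "form X (%x. p (f x))" using lin_o[OF ydhD(1)[OF f(1)]] A(4) by simp
   then have "triform H H X (%a b c. h a * (f' b * p (f c)))"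
    using A(2,3) by (auto simp: triform_def fmL fmR)
   note * = X.Co_coassoc[OF this X]
   note ev = coact_hom_eval(2)[OF vH ydhD(1)[OF f(1)] X.coact_in]
   have b1: "biform H Y (%g z. tev H H (cop H g) (%a b. h a * (f' b * p z)))"
    unfolding bilin_map_def using A by (auto intro!: lin_rules vH X.cop_in H simp: bilin_map_def)
   have b2: "biform H Y (%k w. h g * (f' k * p w))" for g
    using A by (auto simp: bilin_map_def fmL fmR)
   have b3: "biform H Y (%g z. tev H Y (coact Y z) (%k w. h g * (f' k * p w)))"
    unfolding bilin_map_def using A
    by (auto intro!: lin_rules vH linD(1)[OF linY] linY simp: bilin_map_def)
   show ?thesis
    unfolding f(2) ydhD(5)[OF f(1) X] ev[OF X b1] ev[OF X b3]
    by (subst *, rule X.Co_cong[OF X], simp add: ydhD(5)[OF f(1)] ev[OF _ b2])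
  qed
 next
  fix x p assume A: "x : carr Y" "p : {f. form Y f}"
  show "tev H Y (coact Y x) (%g z. cou H g * p z) = p x"
  proof (rule loc'[OF A(1,1,1)], goal_cases)
   case (1 X f x' y' z') note f = 1(2-5) and X = 1(6)
   interpret X: ydalg H X by (rule 1)
   have "form X (%x. p (f x))" using lin_o[OF ydhD(1)[OF f(1)]] A(2) by simp
   note * = X.Co_counit[OF this X]
   have b: "biform H Y (%g z. cou H g * p z)"
    using A X.cou_form by (auto simp: bilin_map_def fmL fmR)
   show ?thesis unfolding f(2) ydhD(5)[OF f(1) X] coact_hom_eval(2)[OF vH ydhD(1)[OF f(1)] X.coact_in[OF X] b] by (rule *)
  qed
 next
  fix x y h p assume A: "x : carr Y" "y : carr Y" "h : {f. form H f}" "p : {f. form Y f}"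
  show "tev H Y (coact Y (mul Y x y)) (%g z. h g * p z)
    = tev H Y (coact Y x) (%g z. tev H Y (coact Y y) (%k w. h (mul H g k) * p (mul Y z w)))"
  proof (rule loc'[OF A(1,2,2)], goal_cases)
   case (1 X f x' y' z') note f = 1(2-5) and X = 1(6,7)
   interpret X: ydalg H X by (rule 1)
   have p: "form X (%x. p (f x))" using lin_o[OF ydhD(1)[OF f(1)]] A(4) by simp
   then have bX: "biform H X (%g z. h g * p (f z))" and bY: "biform H Y (%g z. h g * p z)"
    using A(3,4) by (auto simp: bilin_map_def fmL fmR)
   note ev = coact_hom_eval(2)[OF vH ydhD(1)[OF f(1)] X.coact_in]
   have yin: "coact Y y : carr (tensor H Y)" using linD(1)[OF linY A(2)] .
   note b3 = bil_tm(2)[OF alg algY vs_g bY yin]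
   show ?thesis
    unfolding f(2,3) ydhD(2)[OF f(1) X, symmetric] ydhD(5)[OF f(1) X(1)] ydhD(5)[OF f(1) X.X_mul_in[OF X]] ev[OF X.X_mul_in[OF X] bY]
    by (subst X.Co_mul[OF bX X], subst ev[OF X(1) b3[unfolded f(3)]], rule X.Co_cong[OF X(1)], simp only: ydhD(5)[OF f(1) X(2)],
     subst ev[OF X(2) bil_tm(1)[OF alg algY vs_g bY]], assumption, rule linD(1)[OF ydhD(1)[OF f(1)]], assumption, rule X.Co_cong[OF X(2)],
     simp add: ydhD(2)[OF f(1)])
  qed
 next
  show "coact Y (unity Y) = tpure H Y (unity H) (unity Y)" using co ex by blast
 next
  fix h x k p assume A: "h : carr H" "x : carr Y" "k : {f. form H f}" "p : {f. form Y f}"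
  show "tev H H (cop H h) (%h1 h2. tev H Y (coact Y (act Y h1 x)) (%g z. k (mul H g h2) * p z))
   = tev H H (cop H h) (%h1 h2. tev H Y (coact Y x) (%g z. k (mul H h1 g) * p (act Y h2 z)))"
  proof (rule loc'[OF A(2,2,2)], goal_cases)
   case (1 X f x' y' z') note f = 1(2-5) and X = 1(6)
   interpret X: ydalg H X by (rule 1)
   have p: "form X (%x. p (f x))" using lin_o[OF ydhD(1)[OF f(1)]] A(4) by simp
   then have bX: "biform H X (%g z. k g * p (f z))"
    using A(3,4) by (auto simp: bilin_map_def fmL fmR)
   have kl: "form V (%x. k (t x))" if "lin_map V H t" for V :: "('k, 'v::ab_group_add, 's) vs_scheme" and t
    using lin_o[OF that] A(3) by simp
   have pl: "form V (%x. p (t x))" if "lin_map V Y t" for V :: "('k, 'v::ab_group_add, 's) vs_scheme" and t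
    using lin_o[OF that] A(4) by simp
   note ev = coact_hom_eval(2)[OF vH ydhD(1)[OF f(1)] X.coact_in]
   have b1: "biform H Y (%g z. k (mul H g h2) * p z)" if "h2 : carr H" for h2
    using A that by (auto simp: bilin_map_def intro!: fmL fmR kl lmL alg lin_id)
   have b2: "biform H Y (%g z. k (mul H h1 g) * p (act Y h2 z))" if "h1 : carr H" "h2 : carr H" for h1 h2
    using A that by (auto simp: bilin_map_def intro!: fmL fmR kl pl lmR lin_act_right[OF bilY] alg lin_id)
   have "tev H H (cop H h) (%h1 h2. tev H Y (coact Y (act Y h1 x)) (%g z. k (mul H g h2) * p z))
     = X.Sw h (%h1 h2. X.Co (act X h1 x') (%g z. k (mul H g h2) * p (f z)))"
    by (rule X.Swc[OF A(1)]) (simp add: f(2) X X.act_in ydhD(4)[OF f(1), symmetric] ydhD(5)[OF f(1)] ev b1)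
   also have "... = X.Sw h (%h1 h2. X.Co x' (%g z. k (mul H h1 g) * p (f (act X h2 z))))"
    by (rule X.Co_yd[OF bX A(1) X])
   also have "... = tev H H (cop H h) (%h1 h2. tev H Y (coact Y x) (%g z. k (mul H h1 g) * p (act Y h2 z)))"
    by (rule X.Swc[OF A(1)]) (auto simp: f(2) X X.act_in ydhD(4)[OF f(1)] ydhD(5)[OF f(1)] ev b2 intro!: X.Co_cong)
   finally show ?thesis .
  qed
 qed
qed

section \<open>The antipode\<close>

lemmas mlin = bilin_map_def triform_def

context bialg
begin

lemmas lin_H = lin_id lmL[OF alg] lmR[OF alg] lin_cop[OF bialg] lin_cou[OF bialg] lin_ta' lin_tb fmL fmR vs mul_in one_in cop_in

text \<open>One notion for the four cancellations S(a)b, aS(b), T(b)a and bT(a) of adjacent legs, so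
  that the two lemmas below serve the antipode and its inverse alike.\<close>

definition "collapses m \<longleftrightarrow> bilin_map H H H m &
   (ALL x:carr H. ALL ph. form H ph --> Sw x (%a b. ph (m a b)) = cou H x * ph (unity H))"

lemma collapse: "collapses m ==> form H ph ==> x : carr H ==> Sw x (%a b. ph (m a b)) = cou H x * ph (unity H)"
 by (simp add: collapses_def)

text \<open>Coassociativity first puts the two leading legs under one coproduct; they cancel to a
  counit, which the remaining leg absorbs.\<close>

lemma collapse_head:
 assumes m: "collapses m" and psi: "biform H H psi" and x: "x : carr H"
 shows "Sw3 x (%a b c. psi (m a b) c) = psi (unity H) x" (is "?L = ?R")
proof -
 have mb: "bilin_map H H H m" using m by (simp add: collapses_def)
 note [simp] = bilD(1)[OF mb] bilL[OF mb] bilR[OF mb] bilL[OF psi] bilR[OF psi]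
 have "?L = Sw x (%p c. Sw p (%a b. psi (m a b) c))"
  by (rule coassoc[symmetric]) (simp_all add: mlin lin_H x)
 also have "... = Sw x (%p c. cou H p * psi (unity H) c)"
  by (rule Swc[OF x], rule collapse[OF m]) (simp_all add: lin_H)
 also have "... = ?R"
  by (rule couL) (simp_all add: lin_H x)
 finally show ?thesis .
qed

text \<open>Counterpart for the last two legs, which already come from one coproduct.\<close>

lemma colT:
 assumes m: "collapses m" and psi: "biform H H psi" and x: "x : carr H"
 shows "Sw3 x (%a b c. psi a (m b c)) = psi x (unity H)" (is "?L = ?R")
proof -
 note [simp] = bilL[OF psi] bilR[OF psi]
 have "?L = Sw x (%a r. cou H r * psi a (unity H))"
  by (rule Swc[OF x], rule collapse[OF m]) (simp_all add: lin_H)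
 also have "... = ?R"
  by (rule couR) (simp_all add: lin_H x)
 finally show ?thesis .
qed

end

locale hopf = bialg B for B :: "('k::field, 'b::ab_group_add, 'z) hopf_scheme" +
 assumes hopf: "hopf_algebra B" and bij: "bij_betw (anti B) (carr B) (carr B)"
begin

abbreviation times :: "'b => 'b => 'b" (infixl "**" 70) where "x**y == mul B x y"
abbreviation S :: "'b => 'b" where "S == anti B"
abbreviation T :: "'b => 'b" where "T == anti_inv B"
abbreviation one :: 'b where "one == unity B"

lemma S_lin: "lin_map B B S"
 using hopf by (simp add: hopf_algebra_def)

lemma S_in: "x : carr B ==> S x : carr B" by (rule linD(1)[OF S_lin])

lemma lin_S: "lin_map V B f ==> lin_map V B (%x. S (f x))" by (rule lin_o[OF _ S_lin])

lemma S_col: "collapses (%a b. S a**b)" (is ?a) "collapses (%a b. a**S b)" (is ?b)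
proof -
 have b: "bilin_map B B B (%a b. S a**b)" "bilin_map B B B (%a b. a**S b)"
  by (simp_all add: mlin lin_H lin_S S_in)
 have "Sw x (%a b. ph (S a**b)) = cou B x * ph one & Sw x (%a b. ph (a**S b)) = cou B x * ph one"
  if x: "x : carr B" and ph: "form B ph" for x ph
 proof -
  have "Sw x (%a b. ph (S a**b)) = ph (sw B x (%a b. S a**b))" "Sw x (%a b. ph (a**S b)) = ph (sw B x (%a b. a**S b))"
   unfolding sw_def by (rule tl_pull[OF ph _ vs vs cop_in[OF x], symmetric], rule b)+
  then show ?thesis
   using hopf x linD(3)[OF ph one_in] by (simp add: hopf_algebra_def)
 qed
 then show ?a ?b
  using b by (auto simp: collapses_def)
qed

lemma eq_by_forms: "x : carr B ==> y : carr B ==> (!!ph. form B ph ==> ph x = ph y) ==> x = y"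
 by (rule sep_eqI[OF sep_forms[OF vs]]) auto

lemma S_one: "S one = one"
proof (rule eq_by_forms)
 fix ph assume ph: "form B ph"
 have "biform B B (%a b. ph (S a**b))"
  by (simp add: mlin lin_H lin_S S_in lin_o[OF _ ph])
 then have "ph (S one**one) = Sw one (%a b. ph (S a**b))" by (simp add: Sw_one)
 also have "... = ph one" using collapse[OF S_col(1) ph one_in] by (simp add: cou_one)
 finally show "ph (S one) = ph one" by (simp add: mul_one S_in one_in)
qed (simp_all add: S_in one_in)

text \<open>Left and right convolution inverses of the multiplication coincide. \<open>?E\<close> is
  \<open>ph\<close> at S(x'y')x''y''S(y''')S(x'''): cancelling on the right leaves S(xy), cancelling
  S(x'y') against x''y'' leaves S(y)S(x).\<close>

lemma S_mul: assumes x: "x : carr B" and y: "y : carr B"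
 shows "S (x**y) = S y**S x"
proof (rule eq_by_forms)
 fix ph assume ph: "form B ph"
 note [simp] = lin_H lin_S S_in lin_o[OF _ ph] x y mul_one one_mul
 let ?E = "Sw3 x (%x1 x2 x3. Sw y (%y1 s. Sw s (%y2 y3. ph (S (x1**y1)**(x2**((y2**S y3)**S x3))))))"
 have "?E = Sw3 x (%x1 x2 x3. ph (S (x1**y)**(x2**(one**S x3))))"
  by (rule Swc[OF x], rule Swc, assumption, rule colT[OF S_col(2), where psi = "%y1 u. ph (S (_**y1)**(_**(u**S _)))"]) (simp_all add: mlin)
 also have "... = Sw3 x (%x1 x2 x3. ph (S (x1**y)**(x2**S x3)))"
  by (intro Swc x) simp_all
 also have "... = ph (S (x**y)**one)"
  by (rule colT[OF S_col(2), where psi = "%x1 u. ph (S (x1**y)**u)"]) (simp_all add: mlin)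
 finally have 1: "?E = ph (S (x**y))" by simp
 have "?E = Sw3 x (%x1 x2 x3. Sw y (%q y3. Sw q (%y1 y2. ph (S (x1**y1)**(x2**((y2**S y3)**S x3))))))"
  by (rule Swc[OF x], rule Swc, assumption, rule coassoc[symmetric]) (simp_all add: mlin)
 also have "... = Sw x (%p x3. Sw p (%x1 x2. Sw y (%q y3. Sw q (%y1 y2. ph (S (x1**y1)**(x2**((y2**S y3)**S x3)))))))"
  by (rule coassoc[symmetric]) (simp_all add: mlin)
 also have "... = Sw x (%p x3. Sw y (%q y3. Sw (p**q) (%u v. ph ((S u**v)**(S y3**S x3)))))"
  by (rule Swc[OF x], subst tevs, rule Swc[OF y], subst Sw_mul, simp_all add: mlin, rule Swc, assumption, rule Swc, assumption, simp add: mul_assoc)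
 also have "... = Sw x (%p x3. Sw y (%q y3. cou B (p**q) * ph (one**(S y3**S x3))))"
  by (rule Swc[OF x], rule Swc[OF y], rule collapse[OF S_col(1)]) simp_all
 also have "... = Sw x (%p x3. cou B p * Sw y (%q y3. cou B q * ph (S y3**S x3)))"
  unfolding tevL by (intro Swc x y) (simp_all add: cou_mul)
 also have "... = Sw x (%p x3. cou B p * ph (S y**S x3))"
  by (rule Swc[OF x], subst couL) simp_all
 also have "... = ph (S y**S x)"
  by (subst couL) simp_all
 finally show "ph (S (x**y)) = ph (S y**S x)" using 1 by simp
qed (simp_all add: S_in mul_in x y)

lemma cou_S: assumes x: "x : carr B" shows "cou B (S x) = cou B x"
proof -
 note [simp] = lin_H lin_S S_in x
 have "cou B (S x) = Sw x (%a b. cou B b * cou B (S a))"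
  by (rule couR[symmetric]) simp_all
 also have "... = Sw x (%a b. cou B (S a**b))"
  by (rule Swc[OF x]) (simp add: cou_mul)
 also have "... = cou B x" using collapse[OF S_col(1) cou_form x] by (simp add: cou_one)
 finally show ?thesis .
qed

text \<open>The same argument for convolution inverses of the coproduct. With five legs, the
  coproduct of S(x1) is multiplied by x2 S(x5) and x3 S(x4). Cancelling x3 S(x4) and then the outer
  pair leaves the coproduct of S(x). Merging x2, x3 into one coproduct cancels them against S(x1)
  and leaves S applied to both legs in reverse order.\<close>

lemma Sw_S: assumes ph: "biform B B ph" and x: "x : carr B"
 shows "Sw (S x) ph = Sw x (%a b. ph (S b) (S a))" (is "_ = ?R")
proof -
 note [simp] = lin_H lin_S S_in bilL[OF ph] bilR[OF ph] x mul_one one_mul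
 let ?E = "Sw3 x (%x1 x2 s. Sw s (%x3 t. Sw t (%x4 x5. Sw (S x1) (%u v. ph (u**(x2**S x5)) (v**(x3**S x4))))))"
 have "?E = Sw3 x (%x1 x2 s. Sw (S x1) (%u v. ph (u**(x2**S s)) (v**one)))"
  by (rule Swc[OF x], rule Swc, assumption, rule collapse_head[OF S_col(2),
   where psi = "%p x5. Sw (S _) (%u v. ph (u**(_**S x5)) (v**p))"]) (simp_all add: mlin)
 also have "... = Sw (S x) (%u v. ph (u**one) (v**one))"
  by (rule colT[OF S_col(2), where psi = "%x1 p. Sw (S x1) (%u v. ph (u**p) (v**one))"]) (simp_all add: mlin)
 also have "... = Sw (S x) ph" by (rule Swc) simp_all
 finally have 1: "?E = Sw (S x) ph" .
 have "?E = Sw3 x (%x1 w t. Sw w (%x2 x3. Sw t (%x4 x5. Sw (S x1) (%u v. ph (u**(x2**S x5)) (v**(x3**S x4))))))"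
  by (rule Swc[OF x], rule coassoc[symmetric]) (simp_all add: mlin)
 also have "... = Sw3 x (%x1 w t. Sw t (%x4 x5. Sw (S x1**w) (%u v. ph (u**S x5) (v**S x4))))"
  by (intro Swc x, assumption, subst tevs, rule Swc, assumption, subst Sw_mul, simp_all add: mlin, subst tevs, intro Swc, simp_all add: mul_assoc)
 also have "... = Sw x (%x4 x5. Sw one (%u v. ph (u**S x5) (v**S x4)))"
  by (rule collapse_head[OF S_col(1), where psi = "%p t. Sw t (%x4 x5. Sw p (%u v. ph (u**S x5) (v**S x4)))"]) (simp_all add: mlin)
 also have "... = ?R"
  by (rule Swc[OF x], subst Sw_one) (simp_all add: mlin)
 finally show ?thesis using 1 by simp
qed

lemma T_in: "x : carr B ==> T x : carr B"
 and S_T: "x : carr B ==> S (T x) = x"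
 and T_S: "x : carr B ==> T (S x) = x"
 using bij unfolding anti_inv_def bij_betw_def
 by (auto intro: inv_into_into f_inv_into_f)

lemma T_eqI: "x : carr B ==> y : carr B ==> S y = x ==> T x = y"
 using T_S by blast

lemma T_lin: "lin_map B B T"
 unfolding lin_map_def
 by (auto intro!: T_eqI simp: T_in vs vs_add vs_scal linD[OF S_lin] S_T)

lemma lin_T: "lin_map V B f ==> lin_map V B (%x. T (f x))" by (rule lin_o[OF _ T_lin])

lemma T_one: "T one = one" by (simp add: T_eqI one_in S_one)

lemma T_mul: "x : carr B ==> y : carr B ==> T (x**y) = T y**T x"
 by (rule T_eqI) (simp_all add: T_in mul_in S_mul S_T)

lemma cou_T: "x : carr B ==> cou B (T x) = cou B x"
 using cou_S[of "T x"] by (simp add: T_in S_T)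

lemmas lin_B = lin_H lin_S S_in lin_T T_in

lemma Sw_T: assumes ph: "biform B B ph" and x: "x : carr B"
 shows "Sw (T x) ph = Sw x (%a b. ph (T b) (T a))"
proof -
 note [simp] = lin_B bilL[OF ph] bilR[OF ph] x
 have "Sw (S (T x)) (%a b. ph (T b) (T a)) = Sw (T x) (%a b. ph (T (S a)) (T (S b)))"
  by (rule Sw_S) (simp_all add: mlin)
 also have "... = Sw (T x) ph" by (rule Swc) (simp_all add: T_S)
 finally show ?thesis by (simp add: S_T)
qed

text \<open>\<open>T\<close> reverses products and undoes \<open>S\<close>, so it carries S(a)b to
  T(b)a and aS(b) to bT(a).\<close>

lemma T_col: "collapses (%a b. T b**a)" (is ?a) "collapses (%a b. b**T a)" (is ?b)
proof -
 have b: "bilin_map B B B (%a b. T b**a)" "bilin_map B B B (%a b. b**T a)"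
  by (simp_all add: mlin lin_B)
 have "Sw x (%a b. ph (T b**a)) = cou B x * ph one & Sw x (%a b. ph (b**T a)) = cou B x * ph one"
  if x: "x : carr B" and ph: "form B ph" for x ph
 proof -
  have f: "form B (%y. ph (T y))" by (rule lin_o[OF T_lin ph])
  have "Sw x (%a b. ph (T b**a)) = Sw x (%a b. ph (T (S a**b)))" "Sw x (%a b. ph (b**T a)) = Sw x (%a b. ph (T (a**S b)))"
   by (rule Swc[OF x]; simp add: T_mul S_in T_S)+
  then show ?thesis
   using collapse[OF S_col(1) f x] collapse[OF S_col(2) f x] by (simp add: T_one)
 qed
 then show ?a ?b
  using b by (auto simp: collapses_def)
qed

end

section \<open>The finite dual\<close>

lemma tev_sum: "tev V W t (%a b. SUM i:J. ph i a b) = (SUM i:J. tev V W t (ph i))"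
 unfolding tev_def by (simp add: case_prod_unfold sum_list_sum_swap)

text \<open>A function of two variables of finite rank is a sum of products of linear combinations of
  its own slices (Gaussian elimination: subtract a rank one function made of two slices).\<close>

lemma finite_rank_by_slices:
 fixes ph :: "'a => 'a => 'k::field" and C :: "('a => 'k) set"
 assumes add: "!!u v. u : C ==> v : C ==> u + v : C" and scal: "!!c u. u : C ==> fun_scal c u : C"
  and "finite J" and "!!a b. a : A ==> b : A ==> ph a b = (SUM j:J. f j a * g j b)"
  and "!!b. b : A ==> (%a. if a : A then ph a b else 0) : C"
  and "!!a. a : A ==> (%b. if b : A then ph a b else 0) : C"
 shows "EX qs. set qs <= C \<times> C & (ALL a:A. ALL b:A. ph a b = (SUM (u, v)<-qs. u a * v b))"
 using assms(3-6)
proof (induction "card J" arbitrary: J f g ph rule: less_induct)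
 case less
 note J = less.prems(1) and ph = less.prems(2) and sl1 = less.prems(3) and sl2 = less.prems(4)
 show ?case
 proof (cases "ALL a:A. ALL b:A. ph a b = 0")
  case True
  then show ?thesis by (intro exI[of _ "[]"]) auto
 next
  case False
  then obtain a0 b0 where ab: "a0 : A" "b0 : A" "ph a0 b0 ~= 0" by blast
  define c where "c = ph a0 b0"
  have c: "c ~= 0" using ab by (simp add: c_def)
  have "EX j:J. g j b0 ~= 0"
  proof (rule ccontr)
   assume "~ ?thesis"
   then have "ph a0 b0 = 0" using ph[OF ab(1,2)] by simp
   with ab show False by simp
  qed
  then obtain k where k: "k : J" "g k b0 ~= 0" by blast
  define h where "h j a = f j a - f j a0 * ph a b0 / c" for j a
  define psi where "psi a b = ph a b - ph a b0 * ph a0 b / c" for a b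
  \<comment> \<open>The remainder \<open>psi\<close> vanishes at \<open>b0\<close>. This is a linear
    relation among the \<open>h j\<close> with nonzero coefficient at \<open>k\<close>, so
    \<open>h k\<close> can be eliminated and \<open>psi\<close> has one term fewer.\<close>
  have rel: "(SUM j:J. h j a * g j b0) = 0" if "a : A" for a
  proof -
   have "(SUM j:J. h j a * g j b0) = (SUM j:J. f j a * g j b0) - (SUM j:J. f j a0 * g j b0) * (ph a b0 / c)"
    by (simp add: h_def sum_subtractf algebra_simps sum_distrib_left sum_distrib_right)
   then show ?thesis using ph[OF that ab(2)] ph[OF ab(1,2)] c by (simp add: c_def)
  qed
  have psi1: "psi a b = (SUM j:J. h j a * g j b)" if "a : A" "b : A" for a b
  proof -
   have "(SUM j:J. h j a * g j b) = (SUM j:J. f j a * g j b) - (SUM j:J. f j a0 * g j b) * (ph a b0 / c)"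
    by (simp add: h_def sum_subtractf algebra_simps sum_distrib_left sum_distrib_right)
   then show ?thesis using ph[OF that] ph[OF ab(1) that(2)] by (simp add: psi_def)
  qed
  have psi2: "psi a b = (SUM j:J - {k}. h j a * (g j b - g j b0 / g k b0 * g k b))"
   if "a : A" "b : A" for a b
  proof -
   have "(SUM j:J - {k}. h j a * (g j b - g j b0 / g k b0 * g k b)) = (SUM j:J. h j a * (g j b - g j b0 / g k b0 * g k b))"
    using J k by (simp add: sum.remove[OF J k(1)])
   also have "... = (SUM j:J. h j a * g j b) - (SUM j:J. h j a * g j b0) * (g k b / g k b0)"
    by (simp add: sum_subtractf algebra_simps sum_distrib_left sum_distrib_right)
   finally show ?thesis using rel[OF that(1)] psi1[OF that] by simp
  qed
  have eq1: "(%a. if a : A then psi a b else 0) = (%a. if a : A then ph a b else 0)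
    + fun_scal (- ph a0 b / c) (%a. if a : A then ph a b0 else 0)" for b
   by (auto simp: psi_def fun_eq_iff)
  have eq2: "(%b. if b : A then psi a b else 0) = (%b. if b : A then ph a b else 0)
    + fun_scal (- ph a b0 / c) (%b. if b : A then ph a0 b else 0)" for a
   by (auto simp: psi_def fun_eq_iff)
  have "EX qs. set qs <= C \<times> C & (ALL a:A. ALL b:A. psi a b = (SUM (u, v)<-qs. u a * v b))"
  proof (rule less.hyps)
   show "card (J - {k}) < card J" using J k(1) by (rule card_Diff1_less)
   show "finite (J - {k})" using J by simp
   show "(%a. if a : A then psi a b else 0) : C" if "b : A" for b
    unfolding eq1 by (intro add scal sl1 that ab)
   show "(%b. if b : A then psi a b else 0) : C" if "a : A" for a
    unfolding eq2 by (intro add scal sl2 that ab)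
  qed (rule psi2)
  then obtain qs where qs: "set qs <= C \<times> C" "!!a b. a : A ==> b : A ==> psi a b = (SUM (u, v)<-qs. u a * v b)"
   by blast
  let ?q = "(fun_scal (1 / c) (%a. if a : A then ph a b0 else 0), %b. if b : A then ph a0 b else 0)"
  show ?thesis
   using qs(1) sl1[OF ab(2)] sl2[OF ab(1)] scal
   by (intro exI[of _ "?q # qs"]) (auto simp: qs(2)[symmetric] psi_def)
 qed
qed

context hopf
begin

definition "finrank ph \<longleftrightarrow> (EX ps. (ALL (f, g) : set ps. form B f & form B g) &
   (ALL a:carr B. ALL b:carr B. ph a b = (SUM (f, g)<-ps. f a * g b)))"

lemma finrankI:
 assumes "finite J" "!!j. j : J ==> form B (f j)" "!!j. j : J ==> form B (g j)"
  "!!a b. a : carr B ==> b : carr B ==> ph a b = (SUM j:J. f j a * g j b)"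
 shows "finrank ph"
proof -
 obtain js where js: "set js = J" "distinct js" using finite_distinct_list[OF assms(1)] by blast
 have "ph a b = (SUM (f, g)<-map (%j. (f j, g j)) js. f a * g b)" if "a : carr B" "b : carr B" for a b
  unfolding assms(4)[OF that] js(1)[symmetric]
  by (simp add: sum_list_distinct_conv_sum_set[OF js(2), symmetric] o_def)
 then show ?thesis unfolding finrank_def
  using assms(2,3) js(1) by (intro exI[of _ "map (%j. (f j, g j)) js"]) auto
qed

lemma finrankE:
 assumes "finrank ph"
 obtains n :: nat and f g where "!!i. i < n ==> form B (f i)" "!!i. i < n ==> form B (g i)"
  "!!a b. a : carr B ==> b : carr B ==> ph a b = (\<Sum>i<n. f i a * g i b)"
proof -
 obtain ps where ps: "ALL (f, g) : set ps. form B f & form B g" "ALL a:carr B. ALL b:carr B. ph a b = (SUM (f, g)<-ps. f a * g b)"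
  using assms unfolding finrank_def by blast
 have "(SUM (f, g)<-ps. f a * g b) = (\<Sum>i<length ps. fst (ps ! i) a * snd (ps ! i) b)" for a b
  by (simp add: sum_list_sum_nth case_prod_unfold atLeast0LessThan)
 then show thesis
  using ps by (intro that[of "length ps" "%i. fst (ps ! i)" "%i. snd (ps ! i)"]) (auto simp: case_prod_unfold)
qed

abbreviation "D == dual B"
abbreviation "SwD be == tev D D (cop D be)"

lemma scal_dual [simp]: "scal D = fun_scal"
 by (simp add: dual_def dual_vs_def)

lemma dual_carr: "be : carr D \<longleftrightarrow> form B be & ext0 B be = be & finrank (%a b. be (a**b))"
 by (simp add: dual_def dual_vs_def finrank_def)

lemma dform: "be : carr D ==> form B be" by (simp add: dual_carr)

lemma dual_rankE:
 assumes "be : carr D"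
 obtains n :: nat and f g where "!!i. i < n ==> form B (f i)" "!!i. i < n ==> form B (g i)"
  "!!a b. a : carr B ==> b : carr B ==> be (a**b) = (\<Sum>i<n. f i a * g i b)"
proof (rule finrankE[of "%a b. be (a**b)"])
 show "finrank (%a b. be (a**b))" using assms by (simp add: dual_carr)
qed (rule that)

lemma dual_eqI: "aa : carr D ==> be : carr D ==> (!!b. b : carr B ==> aa b = be b) ==> aa = be"
 unfolding dual_carr ext0_def fun_eq_iff by metis

lemma ext0_apply: "b : carr B ==> ext0 B f b = f b"
 by (simp add: ext0_def)

lemma ext0_in_dual:
 assumes f: "form B f" and "finrank (%a b. f (a**b))"
 shows "ext0 B f : carr D"
proof -
 have "form B (ext0 B f)"
  using f by (auto simp: lin_map_def ext0_def vs vs_add vs_scal)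
 moreover have "ext0 B (ext0 B f) = ext0 B f" by (auto simp: ext0_def)
 moreover have "finrank (%a b. ext0 B f (a**b))"
  using assms(2) by (simp add: finrank_def ext0_apply mul_in)
 ultimately show ?thesis by (simp add: dual_carr)
qed

lemma finrank_add: assumes "finrank ph" "finrank psi" shows "finrank (%a b. ph a b + psi a b)"
proof -
 obtain ps where 1: "ALL (f, g) : set ps. form B f & form B g" "ALL a:carr B. ALL b:carr B. ph a b = (SUM (f, g)<-ps. f a * g b)"
  using assms(1) unfolding finrank_def by blast
 obtain qs where 2: "ALL (f, g) : set qs. form B f & form B g" "ALL a:carr B. ALL b:carr B. psi a b = (SUM (f, g)<-qs. f a * g b)"
  using assms(2) unfolding finrank_def by blast
 show ?thesis unfolding finrank_def by (intro exI[of _ "ps @ qs"]) (use 1 2 in auto)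
qed

lemma finrank_scal: assumes "finrank ph" shows "finrank (%a b. c * ph a b)"
proof -
 obtain ps where "ALL (f, g) : set ps. form B f & form B g" "ALL a:carr B. ALL b:carr B. ph a b = (SUM (f, g)<-ps. f a * g b)"
  using assms unfolding finrank_def by blast
 then show ?thesis unfolding finrank_def
  by (intro exI[of _ "map (%(f, g). (%a. c * f a, g)) ps"]) (auto simp: fmL o_def case_prod_unfold sum_list_const_mult mult.assoc)
qed

lemma vsD: "vspace D"
proof -
 have ext0_iff: "ext0 B be = be \<longleftrightarrow> (ALL x. x ~: carr B --> be x = 0)" for be
  unfolding ext0_def fun_eq_iff by metis
 have "0 : carr D"
  unfolding dual_carr ext0_iff by (auto simp: lin_map_def intro: finrankI[of "{}"])
 moreover have "aa + be : carr D" if "aa : carr D" "be : carr D" for aa be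
  using that finrank_add[of "%a b. aa (a**b)" "%a b. be (a**b)"]
  unfolding dual_carr ext0_iff by (simp add: lin_map_def algebra_simps)
 moreover have "fun_scal c be : carr D" if "be : carr D" for c be
  using that finrank_scal[of "%a b. be (a**b)" c]
  unfolding dual_carr ext0_iff by (simp add: lin_map_def algebra_simps)
 ultimately show ?thesis
  unfolding vspace_def using fun_vs.vector_space_axioms by (auto simp: fun_vs.subspace_def)
qed

lemmas fsD = vs_scal[OF vsD, unfolded scal_dual]

lemma form_eval: "a : carr B ==> form D (%be. be a)"
 by (auto simp: lin_map_def)

lemma sep_dual: "sep D {%be. be a |a. a : carr B}"
 unfolding sep_def using vsD form_eval
 by (auto intro!: dual_eqI vs_zero[OF vsD])

subsection \<open>Coproduct and regular actions\<close>

text \<open>The forms in a finite rank decomposition of \<open>be\<close> are arbitrary linear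
  forms. The slices of \<open>be\<close> belong to the finite dual, by associativity, and the
  coproduct is written in terms of them.\<close>

lemma slices_in_dual:
 assumes be: "be : carr D" and b: "b : carr B"
 shows "ext0 B (%a. be (a**b)) : carr D" (is ?a) "ext0 B (%a. be (b**a)) : carr D" (is ?b)
proof -
 note f = dform[OF be]
 obtain n :: nat and h g where 1: "!!i. i < n ==> form B (h i)" "!!i. i < n ==> form B (g i)"
  "!!a b. a : carr B ==> b : carr B ==> be (a**b) = (\<Sum>i<n. h i a * g i b)"
  by (rule dual_rankE[OF be]) blast
 have l: "lin_map B B (%a. a**b)" "lin_map B B (%a. b**a)" by (simp_all add: lin_H b)
 show ?a
 proof (rule ext0_in_dual[OF lin_o[OF l(1) f]], rule finrankI[of "{..<n}" h "%i a. g i (a**b)"])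
  show "form B (%a. g i (a**b))" if "i : {..<n}" for i
   using that by (intro lin_o[OF l(1) 1(2)]) simp
 qed (simp_all add: 1 b mul_in mul_assoc)
 show ?b
 proof (rule ext0_in_dual[OF lin_o[OF l(2) f]], rule finrankI[of "{..<n}" "%i a. h i (b**a)" g])
  show "form B (%a. h i (b**a))" if "i : {..<n}" for i
   using that by (intro lin_o[OF l(2) 1(1)]) simp
 qed (simp_all add: 1 b mul_in mul_assoc[symmetric])
qed

lemma biform_eval2: "a : carr B ==> b : carr B ==> biform D D (%aa be. aa a * be b)"
 by (auto simp: bilin_map_def fmL fmR form_eval)

text \<open>Gives a meaning to the definite description in the coproduct of \<open>dual\<close>.
  Existence comes from \<open>finite_rank_by_slices\<close>, uniqueness because pairs of elements of
  B separate the tensor square of the dual.\<close>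

lemma cop_dual_ex1:
 assumes be: "be : carr D"
 shows "\<exists>!t. t : carr (tensor D D) & (ALL a:carr B. ALL b:carr B. tlift D D (%be1 be2. be1 a * be2 b) t = be (a**b))"
proof (rule ex_ex1I)
 obtain n :: nat and f g where 1: "!!i. i < n ==> form B (f i)" "!!i. i < n ==> form B (g i)"
  "!!a b. a : carr B ==> b : carr B ==> be (a**b) = (\<Sum>i<n. f i a * g i b)"
  by (rule dual_rankE[OF be]) blast
 have "EX qs. set qs <= carr D \<times> carr D & (ALL a:carr B. ALL b:carr B. be (a**b) = (SUM (u, v)<-qs. u a * v b))"
  by (rule finite_rank_by_slices[OF _ _ finite_lessThan[of n], of _ _ _ f g])
   (use 1 vs_add[OF vsD] vs_scal[OF vsD] slices_in_dual[OF be] in "auto simp: ext0_def")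
 then obtain qs where qs: "set qs <= carr D \<times> carr D"
  "!!a b. a : carr B ==> b : carr B ==> be (a**b) = (SUM (u, v)<-qs. u a * v b)" by blast
 have "tlift D D (%be1 be2. be1 a * be2 b) (tsum D D qs) = be (a**b)"
  if "a : carr B" "b : carr B" for a b
  unfolding tl_tev[OF biform_eval2[OF that] vsD vs_g tsum_in[OF qs(1)]] tev_tsum[OF biform_eval2[OF that] vsD vs_g qs(1)] qs(2)[OF that] ..
 then show "EX t. t : carr (tensor D D) & (ALL a:carr B. ALL b:carr B. tlift D D (%be1 be2. be1 a * be2 b) t = be (a**b))"
  using tsum_in[OF qs(1)] by blast
next
 fix s t
 assume s: "s : carr (tensor D D) & (ALL a:carr B. ALL b:carr B. tlift D D (%be1 be2. be1 a * be2 b) s = be (a**b))"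
  and t: "t : carr (tensor D D) & (ALL a:carr B. ALL b:carr B. tlift D D (%be1 be2. be1 a * be2 b) t = be (a**b))"
 note e = tl_tev[OF biform_eval2 vsD vs_g]
 show "s = t"
  by (rule tensor_eqI[OF sep_dual sep_dual]) (use s t e in auto)
qed

lemma dual_vs_eq: "carr (dual_vs B) = carr D" "scal (dual_vs B) = scal D"
 by (simp_all add: dual_def)

lemma copD:
 assumes be: "be : carr D"
 shows "cop D be : carr (tensor D D)" (is ?a) "a : carr B ==> b : carr B ==> SwD be (%be1 be2. be1 a * be2 b) = be (a**b)"
proof -
 have "cop D be = (THE t. t : carr (tensor (dual_vs B) (dual_vs B)) & (ALL a:carr B. ALL b:carr B.
   tlift (dual_vs B) (dual_vs B) (%be1 be2. be1 a * be2 b) t = be (a**b)))"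
  by (simp add: dual_def)
 also have "... = (THE t. t : carr (tensor D D) & (ALL a:carr B. ALL b:carr B. tlift D D (%be1 be2. be1 a * be2 b) t = be (a**b)))"
  unfolding t_cong[OF dual_vs_eq dual_vs_eq] tlift_cong_vs[OF dual_vs_eq dual_vs_eq] ..
 finally have 1: "cop D be : carr (tensor D D) & (ALL a:carr B. ALL b:carr B. tlift D D (%be1 be2. be1 a * be2 b) (cop D be) = be (a**b))"
  using theI'[OF cop_dual_ex1[OF be]] by simp
 then show in': ?a by blast
 show "a : carr B ==> b : carr B ==> SwD be (%be1 be2. be1 a * be2 b) = be (a**b)"
  using 1 tl_tev[OF biform_eval2 vsD vs_g in'] by metis
qed

lemma SwDc: "be : carr D ==> (!!a b. a : carr D ==> b : carr D ==> ph a b = psi a b) ==> SwD be ph = SwD be psi"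
 by (rule tevc[OF vsD copD(1)])

lemma lin_cop_dual: "lin_map D (tensor D D) (cop D)"
 unfolding lin_map_def
proof (intro conjI ballI allI)
 fix be assume be: "be : carr D"
 show "cop D be : carr (tensor D D)" by (rule copD(1)[OF be])
 note l = linD[OF lin_ta[OF biform_eval2 vsD vs_g]]
 {
  fix ga assume ga: "ga : carr D"
  show "cop D (be + ga) = cop D be + cop D ga"
   by (rule tensor_eqI[OF sep_dual sep_dual]) (use be ga in "auto simp: l(2) copD vs_add vsD")
 }
 fix c
 show "cop D (scal D c be) = scal (tensor D D) c (cop D be)"
  using be l(3) vs_scal[OF vsD be, of c] vs_scal[OF vs_t copD(1)[OF be], of c]
  by (intro tensor_eqI[OF sep_dual sep_dual]) (auto simp: copD)
qed

lemma hit_bilin: "b : carr B ==> bilin_map D D D (%be1 be2. scal D (be2 b) be1)"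
 "b : carr B ==> bilin_map D D D (%be1 be2. scal D (be1 b) be2)"
 unfolding bilin_map_def
 by (intro conjI ballI lin_scal lscL lin_id form_eval vsD; assumption)+

lemma hit_in: assumes "b : carr B" "be : carr D" shows "hit B b be : carr D"
 unfolding hit_def sw_def by (rule tlift_in[OF hit_bilin(1)[OF assms(1)] vsD vsD copD(1)[OF assms(2)]])

lemma hit_right_in: assumes "b : carr B" "be : carr D" shows "hit_right B be b : carr D"
 unfolding hit_right_def sw_def
 by (rule tlift_in[OF hit_bilin(2)[OF assms(1)] vsD vsD copD(1)[OF assms(2)]])

lemma hit_apply: assumes b: "b : carr B" and be: "be : carr D" and a: "a : carr B"
 shows "hit B b be a = be (a**b)"
proof -
 have "hit B b be a = SwD be (%be1 be2. scal D (be2 b) be1 a)"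
  unfolding hit_def sw_def
  by (rule tl_pull[OF form_eval[OF a] hit_bilin(1)[OF b] vsD vsD copD(1)[OF be]])
 also have "... = be (a**b)"
  using copD(2)[OF be a b] by (simp add: mult.commute)
 finally show ?thesis .
qed

lemma hit_right_apply: assumes b: "b : carr B" and be: "be : carr D" and a: "a : carr B"
 shows "hit_right B be b a = be (b**a)"
proof -
 have "hit_right B be b a = SwD be (%be1 be2. scal D (be1 b) be2 a)"
  unfolding hit_right_def sw_def
  by (rule tl_pull[OF form_eval[OF a] hit_bilin(2)[OF b] vsD vsD copD(1)[OF be]])
 also have "... = be (b**a)" using copD(2)[OF be b a] by simp
 finally show ?thesis .
qed

subsection \<open>Product and antipode\<close>

lemma bif_f: "form B f ==> form B g ==> biform B B (%a b. f a * g b)"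
 by (auto simp: bilin_map_def fmL fmR)

lemma dmulE: assumes "aa : carr D" "be : carr D" "b : carr B"
 shows "mul D aa be b = Sw b (%b1 b2. aa b1 * be b2)"
 using sw_eq[OF bif_f[OF dform dform] vs_g, of aa be b] assms
 by (simp add: dual_def ext0_apply)

lemma d1E: "b : carr B ==> unity D b = cou B b"
 by (simp add: dual_def ext0_apply)

text \<open>With multiplicativity of the coproduct of B (\<open>Sw_mul\<close>) this says that the
  finite dual is closed under convolution: finite sums of products multiply out.\<close>

lemma finrank_mult:
 assumes "finrank ph" "finrank psi"
 shows "finrank (%a b. Sw a (%a1 a2. Sw b (%b1 b2. ph a1 b1 * psi a2 b2)))"
proof -
 obtain n :: nat and f g where 1: "!!i. i < n ==> form B (f i)" "!!i. i < n ==> form B (g i)"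
  "!!a b. a : carr B ==> b : carr B ==> ph a b = (\<Sum>i<n. f i a * g i b)"
  by (rule finrankE[OF assms(1)]) blast
 obtain m :: nat and f' g' where 2: "!!i. i < m ==> form B (f' i)" "!!i. i < m ==> form B (g' i)"
  "!!a b. a : carr B ==> b : carr B ==> psi a b = (\<Sum>i<m. f' i a * g' i b)"
  by (rule finrankE[OF assms(2)]) blast
 show ?thesis
 proof (rule finrankI[of "{..<n} \<times> {..<m}" "%(i, j) a. Sw a (%a1 a2. f i a1 * f' j a2)"
    "%(i, j) b. Sw b (%b1 b2. g i b1 * g' j b2)"])
  fix a b assume ab: "a : carr B" "b : carr B"
  have "Sw a (%a1 a2. Sw b (%b1 b2. ph a1 b1 * psi a2 b2))
   = Sw a (%a1 a2. Sw b (%b1 b2. \<Sum>(i, j)\<in>{..<n} \<times> {..<m}. (f i a1 * f' j a2) * (g i b1 * g' j b2)))" (is "?Z = _")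
   by (rule Swc[OF ab(1)], rule Swc[OF ab(2)]) (simp only: 1(3) 2(3) sum_product sum.cartesian_product case_prod_unfold, simp add: mult_ac)
  also have "... = (SUM ij:{..<n} \<times> {..<m}. (case ij of (i, j) => %a. Sw a (%a1 a2. f i a1 * f' j a2)) a
    * (case ij of (i, j) => %b. Sw b (%b1 b2. g i b1 * g' j b2)) b)"
   unfolding case_prod_unfold tev_sum tevL[symmetric] tevR[symmetric] ..
  finally show "?Z = ..." .
 qed (auto intro!: lin_ta' lin_cop bialg lin_id vs bif_f 1 2)
qed

lemma dmul_in: assumes aa: "aa : carr D" and be: "be : carr D"
 shows "mul D aa be : carr D"
proof -
 note bi = bif_f[OF dform[OF aa] dform[OF be]]
 have "mul D aa be = ext0 B (%b. Sw b (%b1 b2. aa b1 * be b2))"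
  using dmulE[OF assms] by (auto simp: ext0_def dual_def fun_eq_iff)
 moreover have "... : carr D"
 proof (rule ext0_in_dual)
  show "form B (%b. Sw b (%b1 b2. aa b1 * be b2))"
   by (intro lin_ta' lin_cop bialg lin_id vs bi vs_g)
  have "finrank (%a b. Sw a (%a1 a2. Sw b (%b1 b2. aa (a1**b1) * be (a2**b2))))"
   by (rule finrank_mult) (use assms in "auto simp: dual_carr")
  then show "finrank (%a b. Sw (a**b) (%b1 b2. aa b1 * be b2))"
   unfolding finrank_def by (simp add: Sw_mul[OF bi])
 qed
 ultimately show ?thesis by simp
qed

lemma d1_in: "unity D : carr D"
proof -
 have "ext0 B (cou B) : carr D"
  by (rule ext0_in_dual[OF cou_form], rule finrankI[of "{()}" "%_. cou B" "%_. cou B"]) (auto simp: cou_form cou_mul)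
 then show ?thesis by (simp add: dual_def)
qed

lemma dual_alg: "assoc_algebra D"
 unfolding assoc_algebra_def
proof (intro conjI ballI)
 show "vspace D" by (rule vsD)
 show "unity D : carr D" by (rule d1_in)
 show "bilin_map D D D (mul D)"
  unfolding bilin_map_def lin_map_def
  by (auto intro!: dual_eqI dmul_in vs_add vsD fsD simp: dmulE vs_add vsD fsD algebra_simps tev_add tevL)
 fix aa assume aa: "aa : carr D"
 note f = dform[OF aa]
 show "mul D (unity D) aa = aa"
 proof (rule dual_eqI)
  fix b assume b: "b : carr B"
  have "mul D (unity D) aa b = Sw b (%b1 b2. cou B b1 * aa b2)"
   unfolding dmulE[OF d1_in aa b] by (rule Swc[OF b]) (simp add: d1E)
  then show "mul D (unity D) aa b = aa b" by (simp add: couL[OF f b])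
 qed (simp_all add: aa dmul_in d1_in)
 show "mul D aa (unity D) = aa"
 proof (rule dual_eqI)
  fix b assume b: "b : carr B"
  have "mul D aa (unity D) b = Sw b (%b1 b2. cou B b2 * aa b1)"
   unfolding dmulE[OF aa d1_in b] by (rule Swc[OF b]) (simp add: d1E)
  then show "mul D aa (unity D) b = aa b" by (simp add: couR[OF f b])
 qed (simp_all add: aa dmul_in d1_in)
 fix be ga assume be: "be : carr D" and ga: "ga : carr D"
 show "mul D (mul D aa be) ga = mul D aa (mul D be ga)"
 proof (rule dual_eqI)
  fix b assume b: "b : carr B"
  have "mul D (mul D aa be) ga b = Sw b (%y b3. Sw y (%b1 b2. aa b1 * be b2 * ga b3))" (is "?Z = _")
   unfolding dmulE[OF dmul_in[OF aa be] ga b]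
   by (rule Swc[OF b]) (simp add: dmulE aa be tevR)
  also have "... = Sw3 b (%b1 b2 b3. aa b1 * be b2 * ga b3)"
   by (rule coassoc[OF _ b]) (auto simp: triform_def f dform[OF be] dform[OF ga] intro!: fmL fmR)
  also have "... = mul D aa (mul D be ga) b"
   unfolding dmulE[OF aa dmul_in[OF be ga] b]
   by (rule Swc[OF b]) (simp add: dmulE ga be tevL mult_ac)
  finally show "?Z = ..." .
 qed (simp_all add: aa be ga dmul_in)
qed

text \<open>An anti-multiplicative map exchanges the two sides of a finite rank decomposition.
  Applied to both \<open>S\<close> and \<open>T\<close>.\<close>

lemma dual_precomp_in:
 assumes R: "lin_map B B R" "!!x y. x : carr B ==> y : carr B ==> R (x**y) = R y**R x"
  and be: "be : carr D"
 shows "ext0 B (%b. be (R b)) : carr D"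
proof (rule ext0_in_dual)
 show "form B (%b. be (R b))" by (rule lin_o[OF R(1) dform[OF be]])
 obtain n :: nat and f g where 1: "!!i. i < n ==> form B (f i)" "!!i. i < n ==> form B (g i)"
  "!!a b. a : carr B ==> b : carr B ==> be (a**b) = (\<Sum>i<n. f i a * g i b)"
  by (rule dual_rankE[OF be]) blast
 show "finrank (%a b. be (R (a**b)))"
  by (rule finrankI[of "{..<n}" "%i a. g i (R a)" "%i b. f i (R b)"]) (auto simp: R linD(1)[OF R(1)] 1 mult.commute intro!: lin_o[OF R(1)])
qed

lemma anti_dual: "anti D be = ext0 B (%b. be (S b))"
 by (simp add: dual_def)

abbreviation T' :: "('b => 'k) => 'b => 'k" where "T' == anti_inv D"

text \<open>\<open>anti_inv\<close> is an \<open>inv_into\<close>, so the antipode of the dual is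
  first shown to be injective, by evaluation at T(b); precomposition with \<open>T\<close> is then a
  preimage of \<open>be\<close>.\<close>

lemma anti_inv_dual: assumes be: "be : carr D" shows "T' be = ext0 B (%b. be (T b))"
proof -
 let ?ga = "ext0 B (%b. be (T b))"
 have in': "?ga : carr D" by (rule dual_precomp_in[OF T_lin T_mul be])
 have inj: "inj_on (anti D) (carr D)"
 proof (rule inj_onI)
  fix aa aa' assume a: "aa : carr D" "aa' : carr D" "anti D aa = anti D aa'"
  show "aa = aa'"
  proof (rule dual_eqI[OF a(1,2)])
   fix b assume b: "b : carr B"
   have "anti D aa (T b) = anti D aa' (T b)" using a(3) by simp
   then show "aa b = aa' b" by (simp add: anti_dual ext0_apply b T_in S_T)
  qed
 qed
 have "anti D ?ga = be"
  by (rule dual_eqI) (auto simp: anti_dual ext0_apply S_in T_S be intro!: dual_precomp_in[OF S_lin S_mul in'])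
 then have "T' be = T' (anti D ?ga)" by simp
 also have "... = ?ga" using inv_into_f_f[OF inj in'] by (simp only: anti_inv_def[of D])
 finally show ?thesis .
qed

lemma T'_in: "be : carr D ==> T' be : carr D"
 using anti_inv_dual dual_precomp_in[OF T_lin T_mul] by simp

lemma T'_apply: "be : carr D ==> b : carr B ==> T' be b = be (T b)"
 by (simp add: anti_inv_dual ext0_apply)

lemma T'_lin: "lin_map D D T'"
 unfolding lin_map_def
 by (auto intro!: T'_in vs_add vsD fsD dual_eqI simp: T'_apply vs_add vsD fsD)

end

section \<open>The Drinfeld double\<close>

lemma tlift_cong:
 assumes "!!v w. v : carr V ==> w : carr W ==> ph v w = psi v w"
 shows "tlift V W ph t = tlift V W psi t"
proof -
 have "(SUM (v, w)<-ps. ph v w) = (SUM (v, w)<-ps. psi v w)" if "set ps <= carr V \<times> carr W" for ps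
  using that assms by (intro arg_cong[where f = sum_list] map_cong) auto
 then show ?thesis unfolding tlift_def by (metis (mono_tags, lifting))
qed

lemma lin_map_eq_on_pure:
 assumes "vspace V" "vspace W" "lin_map (tensor V W) U f" "lin_map (tensor V W) U g"
  and "!!v w. v : carr V ==> w : carr W ==> f (tpure V W v w) = g (tpure V W v w)"
  and "t : carr (tensor V W)"
 shows "f t = g t"
 using assms(1,6,2)
proof (induction rule: tensor_induct)
 case (add s t)
 then show ?case using linD(2)[OF assms(3)] linD(2)[OF assms(4)] by metis
qed (rule assms(5))

context hopf
begin

abbreviation "Db == double B"
abbreviation "SwDb h == tev Db Db (cop Db h)"
abbreviation pr :: "('b => 'k) => 'b => ('k, 'b => 'k, 'b) tens" (infix "><" 65) where "mu >< m == tpure D B mu m"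

lemma Db_vs: "carr Db = carr (tensor D B)" "scal Db = scal (tensor D B)"
 by (simp_all add: double_def)

lemma scal_double [simp]: "scal Db = fun_scal" by (simp add: Db_vs)

lemma vsDb: "vspace Db"
 using vs_t[of D B] by (simp add: vspace_def Db_vs)

lemma linDb: "lin_map Db W = lin_map (tensor D B) W" "lin_map V Db = lin_map V (tensor D B)" "bilin_map V W Db = bilin_map V W (tensor D B)"
 by (rule lin_cong bil_cong; simp add: Db_vs)+

lemma tensor_double: "tensor (tensor D B) (tensor D B) = tensor Db Db" "tpure (tensor D B) (tensor D B) = tpure Db Db"
 by (rule t_cong tp_cong; simp add: Db_vs)+

definition "E a ka t = tev D B t (%mu m. mu a * ka m)"

lemma E_biform: "a : carr B ==> form B ka ==> biform D B (%mu m. mu a * ka m)"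
 by (auto simp: bilin_map_def fmL fmR form_eval)

lemma E_form: "a : carr B ==> form B ka ==> form Db (E a ka)"
 unfolding linDb E_def by (rule lin_ta[OF E_biform vsD vs_g])

lemma E_pure: "a : carr B ==> form B ka ==> mu : carr D ==> m : carr B ==> E a ka (mu >< m) = mu a * ka m"
 unfolding E_def by (rule tevp[OF E_biform vsD vs_g])

definition "EF = {E a ka |a ka. a : carr B & form B ka}"

lemma sep_double: "sep Db EF"
proof -
 note S = sep_tensor[OF sep_dual sep_forms[OF vs]]
 have "v = 0" if v: "v : carr (tensor D B)" "ALL f:EF. f v = 0" for v
 proof -
  have "E a ka v = 0" if "a : carr B" "form B ka" for a ka using v(2) that by (auto simp: EF_def)
  then show "v = 0" by (intro sepD(3)[OF S v(1)]) (auto simp flip: E_def)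
 qed
 then show ?thesis
  unfolding sep_def using vsDb by (auto simp: EF_def Db_vs intro: E_form)
qed

lemma double_eqI: "s : carr Db ==> t : carr Db ==> (!!a ka. a : carr B ==> form B ka ==> E a ka s = E a ka t) ==> s = t"
 by (rule sep_eqI[OF sep_double]) (auto simp: EF_def)

lemma pr_in: "mu : carr D ==> m : carr B ==> mu >< m : carr Db"
 by (simp add: Db_vs tpI)

lemma hit_map_bilin: "bilin_map B D D (hit B)"
 unfolding bilin_map_def lin_map_def
 by (auto intro!: dual_eqI hit_in vs_add vs vsD fsD vs_scal[OF vs] simp: hit_apply vs_add vsD vs fsD vs_scal[OF vs]
   bilD[OF algD(2)[OF alg]] mul_in linD(2)[OF dform] linD(3)[OF dform])

lemma hit_right_map_bilin: "bilin_map D B D (hit_right B)"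
 unfolding bilin_map_def lin_map_def
 by (auto intro!: dual_eqI hit_right_in vs_add vs vsD fsD vs_scal[OF vs] simp: hit_right_apply vs_add vsD vs fsD vs_scal[OF vs]
   bilD[OF algD(2)[OF alg]] mul_in linD(2)[OF dform] linD(3)[OF dform])

lemmas lin_D = lin_id ltpL ltpR bilL[OF hit_map_bilin] bilR[OF hit_map_bilin]
 bilL[OF hit_right_map_bilin] bilR[OF hit_right_map_bilin] hit_in hit_right_in lmL[OF dual_alg] lmR[OF dual_alg] dmul_in d1_in vsD
 lmL[OF alg] lmR[OF alg] lin_S S_in lin_T T_in T'_in lin_o[OF _ T'_lin]
 mul_in one_in cop_in vs lin_cop[OF bialg] lin_cou[OF bialg] copD(1) lin_o[OF _ lin_cop_dual]
 lin_ta' lin_tb fmL fmR lin_o[OF _ form_eval] tpI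

subsection \<open>Product\<close>

definition "dterm mu m nu n m1 m2 m3 = mul D mu (hit_right B (hit B m1 nu) (T m3)) >< (m2**n)"

definition "dmul mu m nu n = Sw3 m (%m1 m2 m3. dterm mu m nu n m1 m2 m3)"

lemma dterm_sw3: assumes "mu : carr D" "m : carr B" "nu : carr D" "n : carr B"
 shows "sw3 B m (%m1 m2 m3. tpure D B (mul D mu (hit_right B (hit B m1 nu) (T m3))) (m2**n)) = dmul mu m nu n"
proof -
 note [simp] = lin_D assms
 \<comment> \<open>The inner \<open>sw\<close> of \<open>sw3\<close> agrees with \<open>Sw\<close>
   only on carriers. The case distinction makes the two integrands equal as functions, after which
   \<open>sw_eq\<close> applies to the outer sum.\<close>
 let ?i = "%m1 r. if m1 : carr B & r : carr B then Sw r (%m2 m3. dterm mu m nu n m1 m2 m3) else sw B r (%m2 m3. dterm mu m nu n m1 m2 m3)"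
 have "sw B r (%m2 m3. dterm mu m nu n m1 m2 m3) = Sw r (%m2 m3. dterm mu m nu n m1 m2 m3)"
  if "r : carr B" "m1 : carr B" for r m1
  by (rule sw_eq[where U = "tensor D B", OF _ vs_t that(1)]) (simp add: mlin that dterm_def)
 then have "sw3 B m (%m1 m2 m3. dterm mu m nu n m1 m2 m3) = sw B m ?i"
  unfolding sw3_def by (intro arg_cong[where f = "sw B m"] ext) simp
 also have "... = Sw m ?i"
 proof (rule sw_eq[where U = "tensor D B", OF _ vs_t assms(2)])
  have "bilin_map B B (tensor D B) (%m1 r. Sw r (%m2 m3. dterm mu m nu n m1 m2 m3))"
   by (simp add: mlin dterm_def)
  then show "bilin_map B B (tensor D B) ?i"
   by (simp add: bilin_map_def lin_map_def vs_add vs_scal)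
 qed
 also have "... = dmul mu m nu n" unfolding dmul_def by (rule Swc[OF assms(2)]) simp
 finally show ?thesis by (simp add: dterm_def)
qed

lemma dmul_bilin: "mu : carr D ==> m : carr B ==> bilin_map D B (tensor D B) (dmul mu m)"
 "nu : carr D ==> n : carr B ==> bilin_map D B (tensor D B) (%mu m. dmul mu m nu n)"
 unfolding dmul_def dterm_def by (simp_all add: mlin lin_D)

lemma double_mul_eq: "mul Db s t = tlift D B (%mu m. tlift D B (%nu n. dmul mu m nu n) t) s"
 unfolding double_def bialg.simps alg.simps
 by (auto intro!: tlift_cong simp: dterm_sw3)

lemma double_mul_bilin1: "t : carr Db ==> bilin_map D B (tensor D B) (%mu m. tlift D B (dmul mu m) t)"
 unfolding bilin_map_def
 by (intro conjI ballI lin_tlb) (auto simp: vsD vs dmul_bilin Db_vs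
  intro: dmul_bilin(2)[unfolded bilin_map_def, THEN conjunct1, rule_format]
   dmul_bilin(2)[unfolded bilin_map_def, THEN conjunct2, rule_format])

lemma Db_bil: "bilin_map Db Db Db (mul Db)"
 unfolding bilin_map_def linDb double_mul_eq
proof (intro conjI ballI)
 fix s assume s: "s : carr Db"
 show "lin_map (tensor D B) (tensor D B) (%t. tlift D B (%mu m. tlift D B (dmul mu m) t) s)"
  by (intro lin_tlb double_mul_bilin1 lin_tlift dmul_bilin) (use s in "auto simp: vsD vs Db_vs")
 show "lin_map (tensor D B) (tensor D B) (%t. tlift D B (%mu m. tlift D B (dmul mu m) s) t)"
  by (intro lin_tlift double_mul_bilin1) (use s in "auto simp: vsD")
qed

lemma Db_in: "s : carr Db ==> t : carr Db ==> mul Db s t : carr Db"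
 by (rule bilD(1)[OF Db_bil])

lemma double_mul_pure: "mu : carr D ==> m : carr B ==> nu : carr D ==> n : carr B ==> mul Db (mu >< m) (nu >< n) = dmul mu m nu n"
 unfolding double_mul_eq
 by (simp add: tl_pure[OF double_mul_bilin1 vsD vs_t] pr_in tl_pure[OF dmul_bilin(1) vsD vs_t])

text \<open>The two regular actions move into the argument of nu: m' acting from the left and
  T(m''') from the right turn nu(a'') into nu(T(m''')a''m').\<close>

lemma E_dmul:
 assumes a: "a : carr B" and ka: "form B ka" and mu: "mu : carr D" and m: "m : carr B"
  and nu: "nu : carr D" and n: "n : carr B"
 shows "E a ka (mul Db (mu >< m) (nu >< n)) = Sw a (%a1 a2. Sw3 m (%m1 m2 m3. mu a1 * (nu (T m3**(a2**m1)) * ka (m2**n))))" (is "?L = ?R")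
proof -
 note [simp] = lin_D assms
 have "?L = Sw3 m (%m1 m2 m3. E a ka (dterm mu m nu n m1 m2 m3))"
  unfolding double_mul_pure[OF mu m nu n] dmul_def
  by (subst tev_pull[OF E_form[OF a ka] vsDb vs cop_in[OF m]], rule tev_in[OF vs vsDb], simp, simp add: dterm_def Db_vs, rule Swc[OF m],
   subst tev_pull[OF E_form[OF a ka] vsDb vs cop_in], simp, simp add: dterm_def Db_vs, rule refl)
 also have "... = Sw3 m (%m1 m2 m3. Sw a (%a1 a2. mu a1 * (nu (T m3**(a2**m1)) * ka (m2**n))))"
  by (rule Swc[OF m], rule Swc, assumption, simp add: dterm_def E_pure dmulE tevR, rule Swc[OF a], simp add: hit_apply hit_right_apply mul_assoc)
 also have "... = ?R"
  by (simp only: tevs[where t = "cop B a"])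
 finally show ?thesis .
qed

text \<open>With one factor pure, the product is evaluated by changing the arguments of the evaluation
  functional of the other factor.\<close>

lemma form_K: assumes "nu : carr D" "form B ka" "a : carr B" "n : carr B"
 shows "form B (%x. Sw3 x (%m1 m2 m3. nu (T m3**(a**m1)) * ka (m2**n)))"
 by (simp add: mlin lin_D lin_o[OF _ assms(2)] lin_o[OF _ dform[OF assms(1)]] assms)

lemma E_mul_right:
 assumes a: "a : carr B" and ka: "form B ka" and s: "s : carr Db"
  and nu: "nu : carr D" and n: "n : carr B"
 shows "E a ka (mul Db s (nu >< n)) = Sw a (%a1 a2. E a1 (%x. Sw3 x (%m1 m2 m3. nu (T m3**(a2**m1)) * ka (m2**n))) s)" (is "?l s = ?r s")
proof (rule lin_map_eq_on_pure[where f = ?l and t = s and g = ?r, OF vsD vs])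
 show "form (tensor D B) ?l"
  using lin_o[OF bilL[OF Db_bil lin_id pr_in[OF nu n]] E_form[OF a ka]]
  by (simp only: linDb)
 show "form (tensor D B) ?r"
  by (rule lin_tb[OF vs vs_g cop_in[OF a]]) (rule E_form[unfolded linDb, OF _ form_K[OF nu ka _ n]])
 show "s : carr (tensor D B)" using s by (simp add: Db_vs)
 fix mu m assume um: "mu : carr D" "m : carr B"
 show "?l (mu >< m) = ?r (mu >< m)"
  unfolding E_dmul[OF a ka um nu n]
  by (rule Swc[OF a]) (simp add: E_pure form_K[OF nu ka _ n] tevL um)
qed

lemma E_mul_left:
 assumes a: "a : carr B" and ka: "form B ka" and t: "t : carr Db"
  and mu: "mu : carr D" and m: "m : carr B"
 shows "E a ka (mul Db (mu >< m) t) = Sw a (%a1 a2. Sw3 m (%m1 m2 m3. mu a1 * E (T m3**(a2**m1)) (%x. ka (m2**x)) t))"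
proof (rule lin_map_eq_on_pure[where f = "%t. E a ka (mul Db (mu >< m) t)" and t = t
   and g = "%t. Sw a (%a1 a2. Sw3 m (%m1 m2 m3. mu a1 * E (T m3**(a2**m1)) (%x. ka (m2**x)) t))", OF vsD vs])
 have k: "form B (%x. ka (m2**x))" if "m2 : carr B" for m2
  by (simp add: lin_D lin_o[OF _ ka] that)
 show "form (tensor D B) (%t. E a ka (mul Db (mu >< m) t))"
  using lin_o[OF bilR[OF Db_bil lin_id pr_in[OF mu m]] E_form[OF a ka]]
  by (simp only: linDb)
 show "form (tensor D B) (%t. Sw a (%a1 a2. Sw m (%m1 r. Sw r (%m2 m3. mu a1 * E (T m3**(a2**m1)) (%x. ka (m2**x)) t))))"
  by (intro lin_tb vs vs_g cop_in a m fmL E_form[unfolded linDb] k mul_in T_in)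
 show "t : carr (tensor D B)" using t by (simp add: Db_vs)
 fix nu n assume n: "nu : carr D" "n : carr B"
 show "E a ka (mul Db (mu >< m) (nu >< n)) = Sw a (%a1 a2. Sw3 m (%m1 m2 m3. mu a1 * E (T m3**(a2**m1)) (%x. ka (m2**x)) (nu >< n)))"
  unfolding E_dmul[OF a ka mu m n]
  by (rule Swc[OF a], rule Swc[OF m], rule Swc) (simp_all add: E_pure k mul_in T_in n)
qed

text \<open>Both sides are brought to the scalar sum of \<open>?b\<close>, with three legs of
  \<open>a\<close>, five of \<open>m\<close> and three of \<open>n\<close>. On the left this splits
  the coproduct of \<open>p**n\<close>, on the right that of \<open>T m3**(q**m1)\<close>, where
  \<open>Sw_T\<close> reverses the legs of \<open>m3\<close>.\<close>

lemma double_assoc_pure: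
 assumes mu: "mu : carr D" and m: "m : carr B" and nu: "nu : carr D" and n: "n : carr B"
  and ro: "ro : carr D" and r: "r : carr B"
 shows "mul Db (mul Db (mu >< m) (nu >< n)) (ro >< r) = mul Db (mu >< m) (mul Db (nu >< n) (ro >< r))"
proof (rule double_eqI)
 fix a ka assume a: "a : carr B" and ka: "form B ka"
 note [simp] = lin_D assms a lin_o[OF _ ka] lin_o[OF _ dform[OF mu]] lin_o[OF _ dform[OF nu]] lin_o[OF _ dform[OF ro]]
 let ?b = "%a1 a2 a3 m1 u1 u2 u3 m5 n1 n2 n3. mu a1 * (nu (T m5**(a2**m1)) * (ro (T n3**(T u3**(a3**(u1**n1)))) * ka (u2**(n2**r))))"
 let ?K = "%a2 x. Sw3 x (%m1 m2 m3. ro (T m3**(a2**m1)) * ka (m2**r))"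
 have K: "?K a3 (p**n) = Sw3 p (%u1 u2 u3. Sw n (%n1 v. Sw v (%n2 n3. ro (T n3**(T u3**(a3**(u1**n1)))) * ka (u2**(n2**r)))))"
  if [simp]: "a3 : carr B" "p : carr B" for a3 p
 proof -
  have "?K a3 (p**n) = Sw p (%u1 u. Sw n (%n1 v. Sw (u**v) (%m2 m3. ro (T m3**(a3**(u1**n1))) * ka (m2**r))))"
   by (subst Sw_mul) (simp_all add: mlin)
  also have "... = Sw p (%u1 u. Sw n (%n1 v. Sw u (%u2 u3. Sw v (%n2 n3. ro (T n3**(T u3**(a3**(u1**n1)))) * ka (u2**(n2**r))))))"
   by (rule Swc, simp, rule Swc, simp, subst Sw_mul, simp_all add: mlin, rule Swc, simp, rule Swc, simp, simp add: T_mul mul_assoc)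
  also have "... = Sw3 p (%u1 u2 u3. Sw n (%n1 v. Sw v (%n2 n3. ro (T n3**(T u3**(a3**(u1**n1)))) * ka (u2**(n2**r)))))"
   by (rule Swc, simp, rule tevs)
  finally show ?thesis .
 qed
 have "E a ka (mul Db (mul Db (mu >< m) (nu >< n)) (ro >< r)) = Sw a (%p a3. E p (?K a3) (mul Db (mu >< m) (nu >< n)))" (is "?Z = _")
  by (rule E_mul_right[OF a ka Db_in ro r]) (simp_all add: pr_in)
 also have "... = Sw a (%p a3. Sw p (%a1 a2. Sw m (%m1 y. Sw y (%q m5. mu a1 * (nu (T m5**(a2**m1)) * ?K a3 (q**n))))))"
  by (rule Swc[OF a], rule E_dmul) (simp_all add: form_K ka)
 also have "... = Sw3 a (%a1 a2 a3. Sw m (%m1 y. Sw y (%p m5. mu a1 * (nu (T m5**(a2**m1)) * ?K a3 (p**n)))))"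
  by (rule coassoc[OF _ a]) (simp_all add: mlin)
 also have "... = Sw3 a (%a1 a2 a3. Sw3 m (%m1 u1 z. Sw z (%u2 w. Sw w (%u3 m5. Sw3 n (%n1 n2 n3. ?b a1 a2 a3 m1 u1 u2 u3 m5 n1 n2 n3)))))"
 proof (rule Swc[OF a], rule Swc, assumption, rule Swc[OF m])
  fix a1 q a2 a3 m1 y assume [simp]: "a1 : carr B" "q : carr B" "a2 : carr B" "a3 : carr B" "m1 : carr B" "y : carr B"
  let ?b' = "?b a1 a2 a3 m1"
  have "Sw y (%p m5. mu a1 * (nu (T m5**(a2**m1)) * ?K a3 (p**n)))
   = Sw y (%p m5. Sw3 p (%u1 u2 u3. Sw3 n (%n1 n2 n3. ?b' u1 u2 u3 m5 n1 n2 n3)))" (is "?Z = _")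
   by (rule Swc) (simp_all add: K tevL)
  also have "... = Sw3 y (%u1 u m5. Sw u (%u2 u3. Sw3 n (%n1 n2 n3. ?b' u1 u2 u3 m5 n1 n2 n3)))"
   by (rule coassoc) (simp_all add: mlin)
  also have "... = Sw3 y (%u1 u2 w. Sw w (%u3 m5. Sw3 n (%n1 n2 n3. ?b' u1 u2 u3 m5 n1 n2 n3)))"
   by (rule Swc, simp, rule coassoc) (simp_all add: mlin)
  finally show "?Z = ..." .
 qed
 finally have L: "?Z = ..." .
 have "E a ka (mul Db (mu >< m) (mul Db (nu >< n) (ro >< r))) = Sw a (%a1 q. Sw3 m (%m1 m2 m3. mu a1 *
     E (T m3**(q**m1)) (%x. ka (m2**x)) (mul Db (nu >< n) (ro >< r))))"
  by (rule E_mul_left[OF a ka Db_in mu m]) (simp_all add: pr_in)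
 also have "... = Sw3 a (%a1 a2 a3. Sw3 m (%m1 u1 z. Sw z (%u2 w. Sw w (%u3 m5. Sw3 n (%n1 n2 n3. ?b a1 a2 a3 m1 u1 u2 u3 m5 n1 n2 n3)))))"
 proof (rule Swc[OF a])
  fix a1 q assume [simp]: "a1 : carr B" "q : carr B"
  let ?N = "%a2 a3 m1 u1 u2 u3 m5. Sw3 n (%n1 n2 n3. ?b a1 a2 a3 m1 u1 u2 u3 m5 n1 n2 n3)"
  have "Sw3 m (%m1 m2 m3. mu a1 * E (T m3**(q**m1)) (%x. ka (m2**x)) (mul Db (nu >< n) (ro >< r)))
   = Sw3 m (%m1 m2 m3. Sw m3 (%s t. Sw q (%a2 a3. Sw m1 (%u w. ?N a2 a3 u w m2 s t))))" (is "?Z = _")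
  proof (rule Swc[OF m], rule Swc, assumption)
   fix m1 y m2 m3 assume [simp]: "m1 : carr B" "y : carr B" "m2 : carr B" "m3 : carr B"
   let ?G = "%b1 b2. Sw3 n (%n1 n2 n3. mu a1 * (nu b1 * (ro (T n3**(b2**n1)) * ka (m2**(n2**r)))))"
   have "mu a1 * E (T m3**(q**m1)) (%x. ka (m2**x)) (mul Db (nu >< n) (ro >< r)) = Sw (T m3**(q**m1)) ?G" (is "?Z = _")
    by (subst E_dmul) (simp_all add: tevL)
   also have "... = Sw m3 (%s t. Sw q (%a2 a3. Sw m1 (%u w. ?G (T t**(a2**u)) (T s**(a3**w)))))"
    by (subst Sw_mul, simp add: mlin, simp, simp, subst Sw_T, simp add: mlin, simp, rule Swc, simp, subst Sw_mul) (simp_all add: mlin)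
   also have "... = Sw m3 (%s t. Sw q (%a2 a3. Sw m1 (%u w. ?N a2 a3 u w m2 s t)))"
    by (rule Swc, simp, rule Swc, simp, rule Swc, simp, rule Swc, simp, rule Swc, simp) (simp add: mul_assoc)
   finally show "?Z = ..." .
  qed
  also have "... = Sw q (%a2 a3. Sw3 m (%m1 m2 m3. Sw m3 (%s t. Sw m1 (%u w. ?N a2 a3 u w m2 s t))))"
   by (simp only: tevs[where t = "cop B q"])
  also have "... = Sw q (%a2 a3. Sw m (%m1 y. Sw m1 (%u w. Sw3 y (%m2 s t. ?N a2 a3 u w m2 s t))))"
  proof (rule Swc, simp, rule Swc[OF m])
   fix a2 a3 m1 y
   show "Sw3 y (%m2 s t. Sw m1 (%u w. ?N a2 a3 u w m2 s t)) = Sw m1 (%u w. Sw3 y (%m2 s t. ?N a2 a3 u w m2 s t))"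
    by (simp only: tevs[where t = "cop B m1"])
  qed
  also have "... = Sw q (%a2 a3. Sw3 m (%u w z. Sw3 z (%m2 s t. ?N a2 a3 u w m2 s t)))"
   by (rule Swc, simp, rule coassoc[OF _ m]) (simp_all add: mlin)
  finally show "?Z = ..." .
 qed
 finally show "E a ka (mul Db (mul Db (mu >< m) (nu >< n)) (ro >< r)) = E a ka (mul Db (mu >< m) (mul Db (nu >< n) (ro >< r)))"
  using L by simp
qed (simp_all add: Db_in pr_in assms)

lemma Db_one: "unity Db = unity D >< one"
 by (simp add: double_def)

lemma E_cong: "t : carr Db ==> (!!m. m : carr B ==> ka m = ka' m) ==> E a ka t = E a ka' t"
 unfolding E_def Db_vs by (rule tevc[OF vsD]) auto

lemma dbl_eqI:
 assumes "lin_map Db U f" "lin_map Db U g" "t : carr Db"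
  and "!!mu m. mu : carr D ==> m : carr B ==> f (mu >< m) = g (mu >< m)"
 shows "f t = g t"
 using lin_map_eq_on_pure[OF vsD vs, of U f g t] assms by (simp add: linDb Db_vs)

lemmas lin_Dbmul = bilL[OF Db_bil] bilR[OF Db_bil]

lemma double_alg: "assoc_algebra Db"
proof -
 have one_in': "unity Db : carr Db" unfolding Db_one by (rule pr_in[OF d1_in one_in])
 have assoc: "mul Db (mul Db x y) z = mul Db x (mul Db y z)" if x: "x : carr Db" and y: "y : carr Db" and z: "z : carr Db" for x y z
  by (rule dbl_eqI[where f = "%x. mul Db (mul Db x y) z" and t = x and U = Db], (intro lin_Dbmul lin_id x y z Db_in)+,
   rule dbl_eqI[where f = "%y. mul Db (mul Db _ y) z" and t = y and U = Db], (intro lin_Dbmul lin_id pr_in x y z Db_in; assumption)+,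
   rule dbl_eqI[where f = "%z. mul Db (mul Db _ _) z" and t = z and U = Db], (intro lin_Dbmul lin_id pr_in x y z Db_in; assumption)+,
   rule double_assoc_pure, assumption+)
 have left: "mul Db (unity Db) x = x" if x: "x : carr Db" for x
 proof (rule dbl_eqI[where f = "%x. mul Db (unity Db) x" and g = "%x. x" and U = Db])
  fix mu m assume mu: "mu : carr D" and m: "m : carr B"
  show "mul Db (unity Db) (mu >< m) = mu >< m"
  proof (rule double_eqI)
   fix a ka assume a: "a : carr B" and ka: "form B ka"
   note [simp] = lin_D mu m a ka lin_o[OF _ ka] lin_o[OF _ dform[OF mu]]
   have "E a ka (mul Db (unity Db) (mu >< m)) = Sw a (%a1 a2. cou B a1 * (mu a2 * ka m))"
    unfolding Db_one E_dmul[OF a ka d1_in one_in mu m]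
    by (rule Swc[OF a], subst Sw_one, simp add: mlin, subst Sw_one, simp add: mlin, simp add: d1E T_one one_mul mul_one)
   also have "... = mu a * ka m"
    by (rule couL) (simp_all add: dform)
   finally show "E a ka (mul Db (unity Db) (mu >< m)) = E a ka (mu >< m)" by (simp add: E_pure)
  qed (simp_all add: Db_in pr_in mu m one_in')
 qed (simp_all add: x lin_id lin_Dbmul one_in')
 have right: "mul Db x (unity Db) = x" if x: "x : carr Db" for x
 proof (rule dbl_eqI[where f = "%x. mul Db x (unity Db)" and g = "%x. x" and U = Db])
  fix mu m assume mu: "mu : carr D" and m: "m : carr B"
  show "mul Db (mu >< m) (unity Db) = mu >< m"
  proof (rule double_eqI)
   fix a ka assume a: "a : carr B" and ka: "form B ka"
   note [simp] = lin_D mu m a ka lin_o[OF _ ka] lin_o[OF _ dform[OF mu]] cou_mul cou_T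
   have "E a ka (mul Db (mu >< m) (unity Db)) = Sw a (%a1 a2. cou B a2 * (mu a1 * Sw m (%m1 r. cou B m1 * Sw r (%m2 m3. cou B m3 * ka m2))))"
    unfolding Db_one E_dmul[OF a ka mu m d1_in one_in]
    by (rule Swc[OF a], simp only: tevL, rule Swc[OF m], rule Swc) (simp_all add: d1E mul_one mult_ac)
   also have "... = Sw a (%a1 a2. cou B a2 * (mu a1 * Sw m (%m1 r. cou B m1 * ka r)))"
    by (rule Swc[OF a], rule arg_cong2[where f = "(*)", OF refl], rule arg_cong2[where f = "(*)", OF refl],
     rule Swc[OF m], rule arg_cong2[where f = "(*)", OF refl], rule couR) simp_all
   also have "... = mu a * ka m"
    by (subst couL[OF ka m], rule couR) (simp_all add: dform)
   finally show "E a ka (mul Db (mu >< m) (unity Db)) = E a ka (mu >< m)" by (simp add: E_pure)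
  qed (simp_all add: Db_in pr_in mu m one_in')
 qed (simp_all add: x lin_id lin_Dbmul one_in')
 show ?thesis
  unfolding assoc_algebra_def using vsDb Db_bil one_in' assoc left right by blast
qed

subsection \<open>Coproduct\<close>

definition "dcop mu m = SwD mu (%mu1 mu2. Sw m (%m1 m2. tpure Db Db (mu2 >< m1) (mu1 >< m2)))"

lemma lin_pr: "lin_map V D f ==> m : carr B ==> lin_map V Db (%x. f x >< m)"
 "lin_map V B g ==> mu : carr D ==> lin_map V Db (%x. mu >< g x)"
 by (simp_all add: linDb ltpL ltpR)

lemma dcop_bilin: "bilin_map D B (tensor Db Db) dcop"
 unfolding dcop_def by (simp add: mlin lin_D lin_pr pr_in)

lemma cop_double_eq: "t : carr Db ==> cop Db t = tlift D B dcop t"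
proof -
 note [simp] = lin_D lin_pr pr_in
 let ?t = "%mu1 mu2 m1 m2. tpure Db Db (mu2 >< m1) (mu1 >< m2)"
 have 1: "sw B m (?t mu1 mu2) = Sw m (?t mu1 mu2)"
  if "m : carr B" "mu1 : carr D" "mu2 : carr D" for m mu1 mu2
  by (rule sw_eq[where U = "tensor Db Db"]) (simp_all add: mlin that)
 have 2: "sw D mu (%mu1 mu2. sw B m (?t mu1 mu2)) = dcop mu m"
  if [simp]: "m : carr B" "mu : carr D" for mu m
 proof -
  have "sw D mu (%mu1 mu2. sw B m (?t mu1 mu2)) = tlift D D (%mu1 mu2. Sw m (?t mu1 mu2)) (cop D mu)"
   unfolding sw_def[of D] by (rule tlift_cong) (simp add: 1)
  also have "... = dcop mu m"
   unfolding dcop_def by (rule tl_tev[where U = "tensor Db Db"]) (simp_all add: mlin)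
  finally show ?thesis .
 qed
 have "cop Db t = tlift D B (%mu m. sw D mu (%mu1 mu2. sw B m (%m1 m2. tpure (tensor D B) (tensor D B) (mu2 >< m1) (mu1 >< m2)))) t"
  by (simp add: double_def)
 then show "cop Db t = tlift D B dcop t"
  unfolding tensor_double(2) using tlift_cong[OF 2] by simp
qed

lemma lin_cop_double: "lin_map Db (tensor Db Db) (cop Db)"
 using lin_tlift[OF dcop_bilin vsD vs_t] cop_double_eq vs_add[OF vsDb] vs_scal[OF vsDb]
 by (simp add: lin_map_def Db_vs)

lemma copDb_in: "t : carr Db ==> cop Db t : carr (tensor Db Db)"
 by (rule linD(1)[OF lin_cop_double])

lemma copDb_p:
 assumes Ph: "biform Db Db Ph" and mu: "mu : carr D" and m: "m : carr B"
 shows "SwDb (mu >< m) Ph = SwD mu (%mu1 mu2. Sw m (%m1 m2. Ph (mu2 >< m1) (mu1 >< m2)))"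
proof -
 note p = tev_pull[OF lin_ta[OF Ph vsDb vs_g] vs_t]
 show ?thesis
  unfolding cop_double_eq[OF pr_in[OF mu m]] tl_pure[OF dcop_bilin vsD vs_t mu m] dcop_def
  by (subst p[OF vsD copD(1)[OF mu]], rule tev_in[OF vs vs_t cop_in[OF m]], simp add: pr_in tpI, rule SwDc[OF mu],
   subst p[OF vs cop_in[OF m]], simp add: pr_in tpI, rule Swc[OF m], rule tevp[OF Ph vsDb vs_g], simp_all add: pr_in)
qed

text \<open>The four scalars reproduce the bracketing in which the legs of \<open>nu\<close> occur
  in a product of two values of \<open>E\<close>, so that the equation can be used for
  rewriting.\<close>

lemma cop_dual2:
 assumes "nu : carr D" "x : carr B" "y : carr B"
 shows "SwD nu (%nu1 nu2. c * (nu2 y * d) * (e * (nu1 x * f))) = nu (x**y) * (c * d * e * f)" (is "?L = _")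
proof -
 have "?L = SwD nu (%nu1 nu2. (c * d * e * f) * (nu1 x * nu2 y))" by (simp add: mult_ac)
 then show ?thesis unfolding tevL[symmetric] using copD(2)[OF assms] by (simp add: mult_ac)
qed

text \<open>Convolution on all linear forms of B, including those outside the finite dual.\<close>

definition "star ka ka' x = Sw x (%x1 x2. ka x1 * ka' x2)"

lemma star_form: "form B ka ==> form B ka' ==> form B (star ka ka')"
 unfolding star_def by (intro lin_ta' lin_cop bialg lin_id vs vs_g bif_f)

lemma EE_biform: "a : carr B ==> b : carr B ==> form B ka ==> form B ka' ==> biform Db Db (%x y. E a ka x * E b ka' y)"
 by (auto simp: bilin_map_def intro!: fmL fmR E_form)

text \<open>The functionals \<open>E\<close> are closed under convolution, so iterated coproducts of
  the double need no expansion. The first arguments appear in the order \<open>b**a\<close> because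
  the coproduct of the double puts mu'' into its first factor.\<close>

lemma copEE:
 assumes a: "a : carr B" and b: "b : carr B" and ka: "form B ka" and ka': "form B ka'" and t: "t : carr Db"
 shows "SwDb t (%x y. E a ka x * E b ka' y) = E (b**a) (star ka ka') t"
proof (rule dbl_eqI[where f = "%t. SwDb t (%x y. E a ka x * E b ka' y)" and U = ground, OF _ _ t])
 show "form Db (%t. SwDb t (%x y. E a ka x * E b ka' y))"
  by (intro lin_ta' lin_cop_double vsDb vs_g EE_biform assms)
 show "form Db (E (b**a) (star ka ka'))" by (intro E_form mul_in star_form assms)
 fix mu m assume mu: "mu : carr D" and m: "m : carr B"
 have "SwDb (mu >< m) (%x y. E a ka x * E b ka' y) = SwD mu (%mu1 mu2. Sw m (%m1 m2. 1 * (mu2 a * ka m1) * (1 * (mu1 b * ka' m2))))"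
  unfolding copDb_p[OF EE_biform[OF a b ka ka'] mu m]
  by (rule SwDc[OF mu], rule Swc[OF m]) (simp add: E_pure a b ka ka')
 also have "... = Sw m (%m1 m2. mu (b**a) * (1 * ka m1 * 1 * ka' m2))"
  by (subst tevs) (simp only: cop_dual2[OF mu b a])
 also have "... = mu (b**a) * star ka ka' m" by (simp add: star_def tevL)
 finally show "SwDb (mu >< m) (%x y. E a ka x * E b ka' y) = E (b**a) (star ka ka') (mu >< m)"
  by (simp add: E_pure a b mu m star_form ka ka' mul_in)
qed

lemma couDbE: assumes t: "t : carr Db" shows "cou Db t = E one (cou B) t"
proof -
 have e: "cou Db t = tlift D B (%mu m. mu one * cou B m) t" by (simp add: double_def dual_def)
 show ?thesis unfolding e E_def
  by (rule tl_tev[OF E_biform[OF one_in cou_form] vsD vs_g]) (use t in "simp add: Db_vs")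
qed

lemma cou_double_form: "form Db (cou Db)"
 using E_form[OF one_in cou_form] couDbE vs_add[OF vsDb] vs_scal[OF vsDb]
 by (simp add: lin_map_def)

text \<open>On the right hand side, joining the two values of nu produces q1 T(m3) from adjacent
  legs of \<open>m\<close>. It cancels by \<open>T_col(2)\<close>, and of the six legs of
  \<open>m\<close> the four of the left hand side remain.\<close>

lemma E_mul_cop_pure:
 assumes a: "a : carr B" and b: "b : carr B" and ka: "form B ka" and ka': "form B ka'"
  and mu: "mu : carr D" and m: "m : carr B" and nu: "nu : carr D" and n: "n : carr B"
 shows "E (b**a) (star ka ka') (mul Db (mu >< m) (nu >< n)) = SwDb (mu >< m) (%s1 s2. SwDb (nu >< n) (%t1 t2.
   E a ka (mul Db s1 t1) * E b ka' (mul Db s2 t2)))" (is "?L = ?R")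
proof -
 note [simp] = lin_D assms lin_o[OF _ ka] lin_o[OF _ ka'] lin_o[OF _ dform[OF mu]] lin_o[OF _ dform[OF nu]] star_form
 let ?b = "%a1 a2 b1 b2 n1 n2 m1 m2 m3 m4. mu (b1**a1) * (nu (T m4**(b2**(a2**m1))) * (ka (m2**n1) * ka' (m3**n2)))"
 let ?C = "Sw b (%b1 b2. Sw a (%a1 a2. Sw n (%n1 n2. Sw3 m (%m1 m2 s. Sw s (%m3 m4. ?b a1 a2 b1 b2 n1 n2 m1 m2 m3 m4)))))"
 have st: "star ka ka' (m2**n) = Sw m2 (%u v. Sw n (%n1 n2. ka (u**n1) * ka' (v**n2)))" if "m2 : carr B" for m2
  unfolding star_def by (rule Sw_mul) (simp_all add: that bif_f)
 have "?L = Sw (b**a) (%c1 c2. Sw3 m (%m1 m2 m3. mu c1 * (nu (T m3**(c2**m1)) * star ka ka' (m2**n))))"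
  by (rule E_dmul) simp_all
 also have "... = Sw b (%b1 b2. Sw a (%a1 a2. Sw m (%m1 r. Sw r (%m2 m3. mu (b1**a1) * (nu (T m3**(b2**a2**m1)) * star ka ka' (m2**n))))))"
  by (rule Sw_mul) (simp_all add: mlin lin_o[OF _ star_form[OF ka ka']])
 also have "... = ?C"
 proof (rule Swc[OF b], rule Swc[OF a])
  fix b1 b2 a1 a2 assume [simp]: "b1 : carr B" "b2 : carr B" "a1 : carr B" "a2 : carr B"
  let ?b' = "%m1 m2 m3 m4. Sw n (%n1 n2. ?b a1 a2 b1 b2 n1 n2 m1 m2 m3 m4)"
  have "Sw3 m (%m1 m2 m3. mu (b1**a1) * (nu (T m3**(b2**a2**m1)) * star ka ka' (m2**n)))
   = Sw3 m (%m1 p m4. Sw p (%m2 m3. ?b' m1 m2 m3 m4))" (is "?Z = _")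
   by (rule Swc[OF m], rule Swc) (simp_all add: st tevL mul_assoc)
  also have "... = Sw3 m (%m1 m2 s. Sw s (%m3 m4. ?b' m1 m2 m3 m4))"
   by (rule Swc[OF m], rule coassoc) (simp_all add: mlin)
  also have "... = Sw n (%n1 n2. Sw3 m (%m1 m2 s. Sw s (%m3 m4. ?b a1 a2 b1 b2 n1 n2 m1 m2 m3 m4)))"
   by (simp only: tevs[where t = "cop B n"])
  finally show "?Z = ..." .
 qed
 finally have L: "?L = ?C" .
 note EE = lin_o[OF _ E_form[OF a ka]] lin_o[OF _ E_form[OF b ka']]
 have bi1: "biform Db Db (%t1 t2. E a ka (mul Db s1 t1) * E b ka' (mul Db s2 t2))" if "s1 : carr Db" "s2 : carr Db" for s1 s2
  by (simp add: mlin fmL fmR EE lin_Dbmul that)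
 have bi2: "biform Db Db (%s1 s2. SwDb (nu >< n) (%t1 t2. E a ka (mul Db s1 t1) * E b ka' (mul Db s2 t2)))"
  by (simp add: mlin fmL fmR EE lin_Dbmul lin_tb vsDb copDb_in pr_in)
 let ?g = "%mu1 mu2 nu1 nu2 n1 n2 a1 a2 m1 m2 m3 b1 b2 q1 q2 q3. mu2 a1 * (nu2 (T m3**(a2**m1)) * ka (m2**n1)) *
   (mu1 b1 * (nu1 (T q3**(b2**q1)) * ka' (q2**n2)))"
 have "?R = SwD mu (%mu1 mu2. Sw m (%p q. SwD nu (%nu1 nu2. Sw n (%n1 n2.
   E a ka (mul Db (mu2 >< p) (nu2 >< n1)) * E b ka' (mul Db (mu1 >< q) (nu1 >< n2))))))"
  unfolding copDb_p[OF bi2 mu m]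
  by (rule SwDc[OF mu], rule Swc[OF m], rule copDb_p[OF bi1]) (simp_all add: pr_in)
 also have "... = SwD mu (%mu1 mu2. Sw m (%p q. SwD nu (%nu1 nu2. Sw n (%n1 n2.
   Sw a (%a1 a2. Sw3 p (%m1 m2 m3. Sw b (%b1 b2. Sw q (%q1 s. Sw s (%q2 q3. ?g mu1 mu2 nu1 nu2 n1 n2 a1 a2 m1 m2 m3 b1 b2 q1 q2 q3)))))))))"
  by (rule SwDc[OF mu], rule Swc[OF m], rule SwDc[OF nu], rule Swc[OF n]) (simp add: E_dmul, simp only: tevR, simp only: tevL)
 also have "... = Sw m (%p q. Sw n (%n1 n2. Sw a (%a1 a2. Sw3 p (%m1 m2 m3. Sw b (%b1 b2. Sw q (%q1 s. Sw s (%q2 q3.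
    SwD mu (%mu1 mu2. SwD nu (%nu1 nu2. ?g mu1 mu2 nu1 nu2 n1 n2 a1 a2 m1 m2 m3 b1 b2 q1 q2 q3)))))))))"
  by (simp only: tevs[where s = "cop D nu"], simp only: tevs[where s = "cop D mu"])
 also have "... = Sw m (%p q. Sw n (%n1 n2. Sw a (%a1 a2. Sw3 p (%m1 m2 m3. Sw b (%b1 b2. Sw q (%q1 s. Sw s (%q2 q3.
    mu (b1**a1) * (nu (T q3**(b2**((q1**T m3)**(a2**m1)))) * (ka (m2**n1) * ka' (q2**n2))))))))))"
  (is "_ = Sw m (%p q. Sw n (%n1 n2. Sw a (%a1 a2. Sw3 p (%m1 m2 m3. Sw b (%b1 b2. Sw q (%q1 s. Sw s (%q2 q3.
    ?h n1 n2 a1 a2 m1 m2 m3 b1 b2 q1 q2 q3)))))))")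
 proof (rule Swc[OF m], rule Swc[OF n], rule Swc[OF a], rule Swc, assumption, rule Swc, assumption,
   rule Swc[OF b], rule Swc, assumption, rule Swc, assumption)
  fix p q n1 n2 a1 a2 m1 r m2 m3 b1 b2 q1 s q2 q3
  assume [simp]: "a1 : carr B" "a2 : carr B" "b1 : carr B" "b2 : carr B" "m1 : carr B" "m3 : carr B" "q1 : carr B" "q3 : carr B"
  have "SwD mu (%mu1 mu2. SwD nu (%nu1 nu2. ?g mu1 mu2 nu1 nu2 n1 n2 a1 a2 m1 m2 m3 b1 b2 q1 q2 q3))
   = SwD mu (%mu1 mu2. nu ((T q3**(b2**q1))**(T m3**(a2**m1))) * (mu2 a1 * ka (m2**n1)) * (1 * (mu1 b1 * ka' (q2**n2))))" (is "?Z = _")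
   by (rule SwDc[OF mu]) (simp add: cop_dual2)
  also have "... = ?h n1 n2 a1 a2 m1 m2 m3 b1 b2 q1 q2 q3"
   unfolding cop_dual2[OF mu `b1 : carr B` `a1 : carr B`] by (simp add: mul_assoc)
  finally show "?Z = ..." .
 qed
 also have "... = Sw b (%b1 b2. Sw a (%a1 a2. Sw n (%n1 n2. Sw m (%p q. Sw3 p (%m1 m2 m3. Sw q (%q1 s. Sw s (%q2 q3.
   ?h n1 n2 a1 a2 m1 m2 m3 b1 b2 q1 q2 q3)))))))"
  by (simp only: tevs[where t = "cop B n"], simp only: tevs[where t = "cop B a"], simp only: tevs[where t = "cop B b"])
 also have "... = ?C"
 proof (rule Swc[OF b], rule Swc[OF a], rule Swc[OF n])
  fix b1 b2 a1 a2 n1 n2 assume [simp]: "b1 : carr B" "b2 : carr B" "a1 : carr B" "a2 : carr B" "n1 : carr B" "n2 : carr B"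
  let ?h' = "%m1 m2 m3 q1 q2 q3. ?h n1 n2 a1 a2 m1 m2 m3 b1 b2 q1 q2 q3"
  have "Sw m (%p q. Sw3 p (%m1 m2 m3. Sw3 q (%q1 q2 q3. ?h' m1 m2 m3 q1 q2 q3)))
   = Sw3 m (%m1 r q. Sw r (%m2 m3. Sw3 q (%q1 q2 q3. ?h' m1 m2 m3 q1 q2 q3)))" (is "?Z = _")
   by (rule coassoc) (simp_all add: mlin)
  also have "... = Sw3 m (%m1 m2 z. Sw3 z (%m3 q1 s. Sw s (%q2 q3. ?h' m1 m2 m3 q1 q2 q3)))"
   by (rule Swc[OF m], rule coassoc) (simp_all add: mlin)
  also have "... = Sw3 m (%m1 m2 z. Sw z (%q2 q3. mu (b1**a1) * (nu (T q3**(b2**(one**(a2**m1)))) * (ka (m2**n1) * ka' (q2**n2)))))"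
   by (rule Swc[OF m], rule Swc, assumption, rule collapse_head[OF T_col(2), where
    psi = "%u s. Sw s (%q2 q3. mu (b1**a1) * (nu (T q3**(b2**(u**(a2**_)))) * (ka (_**n1) * ka' (q2**n2))))"]) (simp_all add: mlin)
  also have "... = Sw3 m (%m1 m2 s. Sw s (%m3 m4. ?b a1 a2 b1 b2 n1 n2 m1 m2 m3 m4))"
   by (rule Swc[OF m], rule Swc, assumption, rule Swc) (simp_all add: one_mul)
  finally show "?Z = ..." .
 qed
 finally have "?R = ?C" .
 with L show ?thesis by simp
qed

lemma cou_mul_pure:
 assumes mu: "mu : carr D" and m: "m : carr B" and nu: "nu : carr D" and n: "n : carr B"
 shows "cou Db (mul Db (mu >< m) (nu >< n)) = cou Db (mu >< m) * cou Db (nu >< n)"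
proof -
 note [simp] = lin_D assms cou_form lin_o[OF _ dform[OF mu]] lin_o[OF _ dform[OF nu]] pr_in Db_in E_pure
 have "E one (cou B) (mul Db (mu >< m) (nu >< n)) = Sw one (%a1 a2. Sw3 m (%m1 m2 m3. mu a1 * (nu (T m3**(a2**m1)) * cou B (m2**n))))"
  by (rule E_dmul) simp_all
 also have "... = Sw3 m (%m1 m2 m3. mu one * (nu (T m3**(one**m1)) * cou B (m2**n)))"
  by (rule Sw_one) (simp add: mlin)
 also have "... = Sw3 m (%m1 m2 m3. cou B m2 * (mu one * (nu (T m3**m1) * cou B n)))"
  by (rule Swc[OF m], rule Swc) (simp_all add: cou_mul one_mul mult_ac)
 also have "... = Sw m (%m1 r. mu one * (nu (T r**m1) * cou B n))"
  by (rule Swc[OF m], rule couL) (simp_all)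
 also have "... = cou B m * (mu one * (nu one * cou B n))"
  by (rule collapse[OF T_col(1), where ph = "%u. mu one * (nu u * cou B n)"]) (simp_all add: dform)
 finally show ?thesis by (simp add: couDbE mult_ac)
qed

text \<open>By \<open>copEE\<close>, coassociativity and the counit laws split into associativity
  and unit of the product of B in the first slot of \<open>E\<close>, and coassociativity and counit
  of B, through \<open>star\<close>, in the second.\<close>

theorem bia_Db: "bialgebra Db"
proof (rule bialgebraI[OF double_alg lin_cop_double cou_double_form sep_double])
 fix x f g h assume x: "x : carr Db" and "f : EF" "g : EF" "h : EF"
 then obtain a ka b ka' c ka'' where abc: "a : carr B" "b : carr B" "c : carr B"
  and k: "form B ka" "form B ka'" "form B ka''" and f: "f = E a ka" "g = E b ka'" "h = E c ka''"
  unfolding EF_def by blast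
 have "SwDb x (%y c. SwDb y (%a b. f a * (g b * h c))) = SwDb x (%y z. E (b**a) (star ka ka') y * E c ka'' z)" (is "?Z = _")
  by (rule tevc[OF vsDb copDb_in[OF x]]) (simp add: f mult.assoc[symmetric] tevR[symmetric] copEE abc k)
 also have "... = E (c**(b**a)) (star (star ka ka') ka'') x"
  by (rule copEE) (simp_all add: abc mul_in star_form k x)
 also have "... = E (c**b**a) (star ka (star ka' ka'')) x"
  unfolding mul_assoc[OF abc(3,2,1)]
 proof (rule E_cong[OF x])
  fix m assume m: "m : carr B"
  show "star (star ka ka') ka'' m = star ka (star ka' ka'') m"
   unfolding star_def tevL tevR mult.assoc
   by (rule coassoc[OF _ m]) (simp add: mlin fmL fmR k)
 qed
 also have "... = SwDb x (%y z. E a ka y * E (c**b) (star ka' ka'') z)"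
  by (rule copEE[symmetric]) (simp_all add: abc mul_in star_form k x)
 also have "... = SwDb x (%a y. SwDb y (%b c. f a * (g b * h c)))"
  by (rule tevc[OF vsDb copDb_in[OF x]]) (simp add: f tevL[symmetric] copEE abc k)
 finally show "?Z = ..." .
next
 fix x f assume x: "x : carr Db" and "f : EF"
 then obtain b ka where b: "b : carr B" and k: "form B ka" and f: "f = E b ka" unfolding EF_def by blast
 have "SwDb x (%u v. cou Db u * f v) = SwDb x (%u v. E one (cou B) u * E b ka v)" (is "?Z = _")
  by (rule tevc[OF vsDb copDb_in[OF x]]) (simp add: f couDbE)
 also have "... = E (b**one) (star (cou B) ka) x" by (rule copEE[OF one_in b cou_form k x])
 also have "... = f x" unfolding f mul_one[OF b]
  by (rule E_cong[OF x]) (simp add: star_def couL k)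
 finally show "?Z = ..." .
 have "SwDb x (%u v. cou Db v * f u) = SwDb x (%u v. E b ka u * E one (cou B) v)" (is "?Z = _")
  by (rule tevc[OF vsDb copDb_in[OF x]]) (simp add: f couDbE)
 also have "... = E (one**b) (star ka (cou B)) x" by (rule copEE[OF b one_in k cou_form x])
 also have "... = f x" unfolding f one_mul[OF b]
  by (rule E_cong[OF x]) (simp add: star_def couR k mult.commute[of _ "cou B _"])
 finally show "?Z = ..." .
next
 fix x y f g assume x: "x : carr Db" and y: "y : carr Db" and "f : EF" "g : EF"
 then obtain a ka b ka' where ab: "a : carr B" "b : carr B" and k: "form B ka" "form B ka'"
  and f: "f = E a ka" "g = E b ka'" unfolding EF_def by blast
 note EE = lin_o[OF _ E_form[OF ab(1) k(1)]] lin_o[OF _ E_form[OF ab(2) k(2)]] lin_o[OF _ E_form[OF mul_in[OF ab(2,1)] star_form[OF k]]]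
 let ?R = "%x y. SwDb x (%s1 s2. SwDb y (%t1 t2. E a ka (mul Db s1 t1) * E b ka' (mul Db s2 t2)))"
 note [simp] = mlin fmL fmR EE lin_Dbmul lin_tb lin_ta' vsDb copDb_in lin_cop_double pr_in Db_in lin_id
 have pure: "E (b**a) (star ka ka') (mul Db (mu >< m) y) = ?R (mu >< m) y" if "mu : carr D" "m : carr B" for mu m
  by (rule dbl_eqI[where f = "%y. E (b**a) (star ka ka') (mul Db (mu >< m) y)" and U = ground and g = "?R (mu >< m)"])
   (use that y ab k in "simp_all add: E_mul_cop_pure")
 have "E (b**a) (star ka ka') (mul Db x y) = ?R x y"
  by (rule dbl_eqI[where f = "%x. E (b**a) (star ka ka') (mul Db x y)" and U = ground and g = "%x. ?R x y"])
   (use x y ab k in "simp_all add: pure")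
 then show "SwDb (mul Db x y) (%a b. f a * g b) = SwDb x (%x1 x2. SwDb y (%y1 y2. f (mul Db x1 y1) * g (mul Db x2 y2)))"
  by (simp add: f copEE[OF ab k] x y)
next
 show "cop Db (unity Db) = tpure Db Db (unity Db) (unity Db)"
 proof (rule tensor_eqI[OF sep_double sep_double])
  have o: "unity Db : carr Db" by (rule algD(3)[OF double_alg])
  then show "cop Db (unity Db) : carr (tensor Db Db)" "tpure Db Db (unity Db) (unity Db) : carr (tensor Db Db)"
   by (simp_all add: copDb_in tpI)
  fix f g assume "f : EF" "g : EF"
  then obtain a ka b ka' where ab: "a : carr B" "b : carr B" and k: "form B ka" "form B ka'"
   and f: "f = E a ka" "g = E b ka'" unfolding EF_def by blast
  have "SwDb (unity Db) (%v w. f v * g w) = E (b**a) (star ka ka') (unity Db)" (is "?Z = _")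
   unfolding f by (rule copEE[OF ab k o])
  also have "... = f (unity Db) * g (unity Db)"
   unfolding f Db_one
   by (simp add: E_pure star_form k ab mul_in d1_in one_in d1E cou_mul star_def Sw_one bif_f)
  also have "... = tev Db Db (tpure Db Db (unity Db) (unity Db)) (%v w. f v * g w)"
   unfolding f by (rule tevp[OF EE_biform[OF ab k] vsDb vs_g o o, symmetric])
  finally show "?Z = ..." .
 qed
next
 fix x y assume x: "x : carr Db" and y: "y : carr Db"
 note [simp] = lin_o[OF _ cou_double_form] lin_Dbmul lin_id pr_in fmL fmR cou_double_form
 have pure: "cou Db (mul Db (mu >< m) y) = cou Db (mu >< m) * cou Db y" if "mu : carr D" "m : carr B" for mu m
  by (rule dbl_eqI[where f = "%y. cou Db (mul Db (mu >< m) y)" and U = ground]) (use that y in "simp_all add: cou_mul_pure")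
 show "cou Db (mul Db x y) = cou Db x * cou Db y"
  by (rule dbl_eqI[where f = "%x. cou Db (mul Db x y)" and U = ground]) (use x y in "simp_all add: pure")
next
 show "cou Db (unity Db) = 1"
  by (simp add: couDbE algD(3)[OF double_alg]) (simp add: Db_one E_pure one_in cou_form d1_in d1E cou_one)
qed

end

section \<open>The two factors\<close>

lemma tev_cong_vs:
 assumes "carr V = carr V'" "scal V = scal V'" "carr W = carr W'" "scal W = scal W'"
 shows "tev V W = tev V' W'"
proof -
 have "tsum V W = tsum V' W'" by (simp add: tsum_def[abs_def] tp_cong[OF assms])
 then have "trep V W = trep V' W'" by (simp add: trep_def[abs_def] assms)
 then show ?thesis by (simp add: tev_def[abs_def])
qed

lemma assoc_algebra_cong:
 assumes "carr A = carr C" "scal A = scal C" "mul A = mul C" "unity A = unity C"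
 shows "assoc_algebra A = assoc_algebra C"
 unfolding assoc_algebra_def vspace_def bil_cong[OF assms(1,2,1,2,1,2)] assms ..

context hopf
begin

lemma lin_E_arg: assumes "h : carr Db" "lin_map V B f" shows "form V (%x. E (f x) ka h)"
 unfolding E_def using assms
 by (intro lin_tb vsD vs_g fmR) (auto simp: Db_vs intro: lin_o dform)

lemma lin_E_form: assumes "h : carr Db" "!!m. m : carr B ==> form V (%x. K x m)" shows "form V (%x. E a (K x) h)"
 unfolding E_def using assms
 by (intro lin_tb vsD vs_g fmL) (auto simp: Db_vs)

lemma lin_E_elem: assumes "lin_map V Db f" "a : carr B" "form B ka" shows "form V (%x. E a ka (f x))"
 by (rule lin_o[OF assms(1) E_form[OF assms(2,3)]])

lemma E_tev: "E a (%m. tev V W t (%u v. K u v m)) h = tev V W t (%u v. E a (K u v) h)"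
 unfolding E_def tevL by (rule tevs)

lemmas lin_E = lin_E_arg lin_E_form lin_E_elem lin_D bilL[OF Db_bil] bilR[OF Db_bil] Db_in pr_in lin_pr vsDb

text \<open>The counit of B is fixed up to a scalar by the regular actions, so the outer legs of
  \<open>m\<close> turn into counits and only m'' survives.\<close>

lemma double_mul_right_pure:
 assumes "mu : carr D" "m : carr B" "n : carr B"
 shows "mul Db (mu >< m) (unity D >< n) = mu >< (m**n)"
proof (rule double_eqI)
 note [simp] = lin_D assms cou_mul cou_T
 fix a ka assume a[simp]: "a : carr B" and ka: "form B ka"
 note [simp] = lin_o[OF _ ka] lin_o[OF _ dform[OF assms(1)]] ka
 have "E a ka (mul Db (mu >< m) (unity D >< n)) = Sw a (%a1 a2. cou B a2 * (mu a1 * Sw m (%m1 r. cou B m1 * Sw r (%m2 m3. cou B m3 * ka (m2**n)))))"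
  unfolding E_dmul[OF a ka assms(1,2) d1_in assms(3)]
  by (rule Swc[OF a], simp only: tevL, rule Swc[OF assms(2)], rule Swc) (simp_all add: d1E mult_ac)
 also have "... = Sw a (%a1 a2. cou B a2 * (mu a1 * Sw m (%m1 r. cou B m1 * ka (r**n))))"
  by (rule Swc[OF a], rule arg_cong2[where f = "(*)", OF refl], rule arg_cong2[where f = "(*)", OF refl],
   rule Swc[OF assms(2)], rule arg_cong2[where f = "(*)", OF refl], rule couR) simp_all
 also have "... = Sw a (%a1 a2. cou B a2 * (mu a1 * ka (m**n)))"
  by (subst couL[where f = "%r. ka (r**n)"]) simp_all
 also have "... = mu a * ka (m**n)"
  by (rule couR) (simp_all add: dform)
 finally show "E a ka (mul Db (mu >< m) (unity D >< n)) = E a ka (mu >< (m**n))" by (simp add: E_pure)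
qed (simp_all add: lin_E assms)

lemma E_mul_dual:
 assumes "mu : carr D" "h : carr Db" "a : carr B" "form B ka"
 shows "E a ka (mul Db (mu >< one) h) = Sw a (%a1 a2. mu a1 * E a2 ka h)"
proof -
 note [simp] = lin_E assms lin_o[OF _ assms(4)] T_one one_mul mul_one
 have E': "E c (%x. ka (one**x)) h = E c ka h" for c by (rule E_cong) simp_all
 show ?thesis
  by (subst E_mul_left[OF assms(3,4,2,1) one_in], rule Swc[OF assms(3)], subst Sw_one, simp add: mlin, subst Sw_one, simp add: mlin, simp add: E')
qed

lemma E_mul_eps:
 assumes "y : carr B" "nu : carr D" "n : carr B" "a : carr B" and ka: "form B ka"
 shows "E a ka (mul Db (unity D >< y) (nu >< n)) = Sw3 y (%u v w. nu (T w**(a**u)) * ka (v**n))" (is "?L = ?R")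
proof -
 note [simp] = lin_E assms lin_o[OF _ ka] lin_o[OF _ dform[OF assms(2)]]
 have "?L = Sw a (%a1 a2. cou B a1 * Sw3 y (%u v w. nu (T w**(a2**u)) * ka (v**n)))"
  unfolding E_dmul[OF assms(4) ka d1_in assms(1-3)]
  by (rule Swc) (simp_all add: d1E tevL)
 also have "... = ?R"
  by (rule couL) (simp_all add: mlin)
 finally show ?thesis .
qed

subsection \<open>The dual as a Yetter--Drinfeld module algebra\<close>

abbreviation "DY == dual_yd B"
abbreviation "CoD be == tev Db D (coact DY be)"

lemma DY_simps: "carr DY = carr D" "scal DY = scal D" "mul DY = mul D" "unity DY = unity D"
 by (simp_all add: dual_yd_def)

lemma DY_vs: "tensor Db DY = tensor Db D" "tpure Db DY = tpure Db D" "tev Db DY = tev Db D"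
 "lin_map V DY = lin_map V D" "lin_map DY W = lin_map D W" "bilin_map Db DY DY = bilin_map Db D D" "sep DY = sep D"
 by (simp_all add: t_cong[OF refl refl DY_simps(1,2)] tp_cong[OF refl refl DY_simps(1,2)]
  tev_cong_vs[OF refl refl DY_simps(1,2)] lin_cong[OF refl refl DY_simps(1,2)]
  lin_cong[OF DY_simps(1,2) refl refl] bil_cong[OF refl refl DY_simps(1,2) DY_simps(1,2)] sep_def[abs_def] vspace_def DY_simps)

abbreviation DG :: "(('b => 'k) => 'k) set" where "DG == {%be. be a |a. a : carr B}"

definition "dact be mu m = SwD mu (%mu1 mu2. mul D (mul D mu2 (hit B m be)) (T' mu1))"

lemma dact_bilin: assumes "be : carr D" shows "bilin_map D B D (dact be)"
 unfolding dact_def by (simp add: mlin lin_D lin_o[OF _ T'_lin] assms)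

lemma dact_lin: assumes "mu : carr D" "m : carr B" shows "lin_map D D (%be. dact be mu m)"
 unfolding dact_def by (simp add: mlin lin_D lin_o[OF _ T'_lin] assms)

lemma DY_act: assumes "be : carr D" shows "act DY h be = tlift D B (dact be) h"
proof -
 have "sw D mu (%mu1 mu2. mul D (mul D mu2 (hit B m be)) (T' mu1)) = dact be mu m"
  if "mu : carr D" "m : carr B" for mu m
  unfolding sw_def dact_def
  by (rule tl_tev[where U = D]) (simp_all add: mlin lin_D lin_o[OF _ T'_lin] assms that)
 then show ?thesis unfolding dual_yd_def yd.simps by (auto intro!: tlift_cong)
qed

lemma DY_act_bilin: "bilin_map Db D D (act DY)"
 unfolding bilin_map_def
proof (intro conjI ballI)
 fix be assume b: "be : carr D"
 show "lin_map Db D (%h. act DY h be)"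
  unfolding DY_act[OF b] linDb by (rule lin_tlift[OF dact_bilin[OF b] vsD vsD])
next
 fix h assume h: "h : carr Db"
 have "lin_map D D (%be. tlift D B (dact be) h)"
  by (rule lin_tlb[OF vsD vsD _ dact_bilin dact_lin vsD]) (use h in "auto simp: Db_vs")
 then show "lin_map D D (act DY h)"
  using vs_add[OF vsD] vs_scal[OF vsD] by (auto simp: lin_map_def DY_act)
qed

lemmas DY_act_in = bilD(1)[OF DY_act_bilin]

text \<open>At b the action of mu and m gives mu''(b')be(b''m)mu'(T(b''')). The two legs of mu
  recombine to mu(T(b''')b'), and the result depends on the acting element only through
  \<open>E\<close>.\<close>

lemma DYaE:
 assumes be: "be : carr D" and h: "h : carr Db" and b: "b : carr B"
 shows "act DY h be b = Sw3 b (%b1 b2 b3. E (T b3**b1) (%m. be (b2**m)) h)" (is "?L = ?R")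
proof -
 note [simp] = lin_D be b lin_o[OF _ T'_lin] lin_o[OF _ dform[OF be]]
 have 1: "dact be mu m b = Sw3 b (%b1 b2 b3. mu (T b3**b1) * be (b2**m))"
  if [simp]: "mu : carr D" "m : carr B" for mu m
 proof -
  note [simp] = lin_o[OF _ dform[OF that(1)]]
  have "dact be mu m b = SwD mu (%mu1 mu2. mul D (mul D mu2 (hit B m be)) (T' mu1) b)"
   unfolding dact_def by (rule tev_pull[OF form_eval[OF b] vsD vsD]) simp_all
  also have "... = SwD mu (%mu1 mu2. Sw b (%p b3. Sw p (%b1 b2. 1 * (mu2 b1 * be (b2**m)) * (1 * (mu1 (T b3) * 1)))))"
   by (rule tevc[OF vsD], simp, simp add: dmulE, rule Swc[OF b], simp add: dmulE tevR T'_apply, rule Swc, simp, simp add: hit_apply)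
  also have "... = Sw b (%p b3. Sw p (%b1 b2. mu (T b3**b1) * be (b2**m)))"
   unfolding tevs[where s = "cop D mu"]
   by (rule Swc[OF b], rule Swc) (simp_all only: cop_dual2 that T_in, simp)
  also have "... = Sw3 b (%b1 b2 b3. mu (T b3**b1) * be (b2**m))"
   by (rule coassoc) (simp_all add: mlin)
  finally show ?thesis .
 qed
 have "?L = tev D B h (%mu m. dact be mu m b)"
  unfolding DY_act[OF be] by (rule tl_pull[OF form_eval[OF b] dact_bilin[OF be] vsD vsD]) (use h in "simp add: Db_vs")
 also have "... = tev D B h (%mu m. Sw3 b (%b1 b2 b3. mu (T b3**b1) * be (b2**m)))"
  by (rule tevc[OF vsD]) (use h 1 in "simp_all add: Db_vs")
 also have "... = ?R"
  unfolding E_def by (simp only: tevs[where s = h])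
 finally show ?thesis .
qed

lemma DY_coact_bilin: "bilin_map D D (tensor Db D) (%be1 be2. tpure Db D (be2 >< one) be1)"
 by (simp add: mlin lin_E)

lemma DY_coact: "coact DY be = tlift D D (%be1 be2. tpure Db D (be2 >< one) be1) (cop D be)"
 by (simp add: dual_yd_def sw_def)

lemma DY_coact_lin: "lin_map D (tensor Db D) (coact DY)"
 unfolding DY_coact[abs_def] by (rule lin_tla[OF lin_cop_dual DY_coact_bilin vsD vs_t])

lemma DY_coact_in: "be : carr D ==> coact DY be : carr (tensor Db D)"
 by (rule linD(1)[OF DY_coact_lin])

lemma DYc_ev:
 assumes ph: "biform Db D ph" and be: "be : carr D"
 shows "CoD be ph = SwD be (%be1 be2. ph (be2 >< one) be1)"
 unfolding DY_coact
 by (subst tl_pull[OF lin_ta[OF ph vsDb vs_g] DY_coact_bilin vsD vs_t copD(1)[OF be]], rule SwDc[OF be], rule tevp[OF ph vsDb vs_g],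
  simp_all add: lin_E)

lemma cop_dual3:
 assumes "nu : carr D" "x : carr B" "y : carr B"
 shows "SwD nu (%nu1 nu2. nu2 y * c * (nu1 x * d)) = nu (x**y) * (c * d)"
 using cop_dual2[OF assms, of 1 c 1 d] by simp

lemma cop_dual4:
 assumes "nu : carr D" "x : carr B" "y : carr B"
 shows "SwD nu (%nu1 nu2. nu2 y * c * nu1 x) = nu (x**y) * c"
 using cop_dual3[OF assms, of c 1] by simp

lemma EV_biform: "a : carr B ==> b : carr B ==> form B ka ==> biform Db D (%g z. E a ka g * z b)"
 by (simp add: mlin lin_E E_form form_eval)

lemma DY_coact_EV:
 assumes "be : carr D" "a : carr B" "b : carr B" "form B ka"
 shows "CoD be (%g z. E a ka g * z b) = be (b**a) * ka one" (is "?L = _")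
proof -
 have "?L = SwD be (%be1 be2. be2 a * ka one * (be1 b * 1))"
  unfolding DYc_ev[OF EV_biform[OF assms(2-4)] assms(1)]
  by (rule SwDc[OF assms(1)]) (simp add: E_pure assms one_in)
 then show ?thesis by (simp only: cop_dual4[OF assms(1,3,2)] mult_1_right)
qed

text \<open>Both sides become \<open>?C\<close>, with five legs of \<open>b\<close> and three of
  \<open>m\<close>: on the left by splitting the coproduct of \<open>T b3**b1\<close>, on the right
  by splitting that of \<open>p**m\<close> and reversing its last leg with \<open>T\<close>.\<close>

lemma DY_act_mul_pure:
 assumes be: "be : carr D" and h: "h : carr Db" and mu: "mu : carr D" and m: "m : carr B"
 shows "act DY (mul Db (mu >< m) h) be = act DY (mu >< m) (act DY h be)"
proof (rule dual_eqI)
 fix b assume b: "b : carr B"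
 note [simp] = lin_E assms b lin_o[OF _ dform[OF be]] lin_o[OF _ dform[OF mu]] DY_act_in dform[OF be]
 let ?b = "%u w e s t m1 m2 m3. mu (T t**u) * E (T m3**(T s**(w**m1))) (%x. be (e**(m2**x))) h"
 let ?N = "%u w e s t. Sw3 m (%m1 m2 m3. ?b u w e s t m1 m2 m3)"
 let ?C = "Sw3 b (%u w q. Sw3 q (%e s t. ?N u w e s t))"
 have "act DY (mul Db (mu >< m) h) be b = Sw3 b (%b1 b2 b3. E (T b3**b1) (%x. be (b2**x)) (mul Db (mu >< m) h))" (is "?Z = _")
  by (rule DYaE) simp_all
 also have "... = Sw3 b (%b1 e b3. Sw b3 (%s t. Sw b1 (%u w. ?N u w e s t)))"
 proof (rule Swc[OF b], rule Swc, assumption)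
  fix b1 r b2 b3 assume [simp]: "b1 : carr B" "b2 : carr B" "b3 : carr B"
  let ?G = "%c1 c2. Sw3 m (%m1 m2 m3. mu c1 * E (T m3**(c2**m1)) (%x. be (b2**(m2**x))) h)"
  have "E (T b3**b1) (%x. be (b2**x)) (mul Db (mu >< m) h) = Sw (T b3**b1) ?G" (is "?Z = _")
   by (rule E_mul_left) simp_all
  also have "... = Sw b3 (%s t. Sw b1 (%u w. ?G (T t**u) (T s**w)))"
   by (subst Sw_mul, simp add: mlin, simp, simp, rule Sw_T) (simp_all add: mlin)
  also have "... = Sw b3 (%s t. Sw b1 (%u w. ?N u w b2 s t))"
   by (rule Swc, simp, rule Swc, simp, rule Swc, simp, rule Swc, simp) (simp add: mul_assoc)
  finally show "?Z = ..." .
 qed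
 also have "... = Sw b (%b1 r. Sw b1 (%u w. Sw3 r (%e s t. ?N u w e s t)))"
 proof (rule Swc[OF b])
  fix b1 r
  show "Sw3 r (%e s t. Sw b1 (%u w. ?N u w e s t)) = Sw b1 (%u w. Sw3 r (%e s t. ?N u w e s t))"
   by (simp only: tevs[where t = "cop B b1"])
 qed
 also have "... = ?C" by (rule coassoc) (simp_all add: mlin)
 finally have L: "?Z = ..." .
 have "act DY (mu >< m) (act DY h be) b = Sw3 b (%b1 b2 b3. E (T b3**b1) (%x. act DY h be (b2**x)) (mu >< m))"
  by (rule DYaE) simp_all
 also have "... = Sw3 b (%u p t. Sw3 p (%w e s. ?N u w e s t))"
 proof (rule Swc[OF b], rule Swc, assumption)
  fix u r p t assume [simp]: "u : carr B" "p : carr B" "t : carr B"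
  have "E (T t**u) (%x. act DY h be (p**x)) (mu >< m) = mu (T t**u) * act DY h be (p**m)" (is "?Z = _")
   by (rule E_pure) (simp_all add: lin_o[OF _ dform[OF DY_act_in]])
  also have "act DY h be (p**m) = Sw3 (p**m) (%c1 c2 c3. E (T c3**c1) (%x. be (c2**x)) h)"
   by (rule DYaE) simp_all
  also have "... = Sw p (%w q. Sw m (%m1 y. Sw (q**y) (%c2 c3. E (T c3**(w**m1)) (%x. be (c2**x)) h)))"
   by (rule Sw_mul) (simp_all add: mlin)
  also have "... = Sw p (%w q. Sw m (%m1 y. Sw q (%e s. Sw y (%m2 m3. E (T m3**(T s**(w**m1))) (%x. be (e**(m2**x))) h))))"
  proof (rule Swc, simp, rule Swc[OF m])
   fix w q m1 y assume [simp]: "w : carr B" "q : carr B" "m1 : carr B" "y : carr B"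
   have "Sw (q**y) (%c2 c3. E (T c3**(w**m1)) (%x. be (c2**x)) h)
    = Sw q (%e s. Sw y (%m2 m3. E (T (s**m3)**(w**m1)) (%x. be (e**m2**x)) h))" (is "?Z = _")
    by (rule Sw_mul) (simp_all add: mlin)
   also have "... = Sw q (%e s. Sw y (%m2 m3. E (T m3**(T s**(w**m1))) (%x. be (e**(m2**x))) h))"
    by (rule Swc, simp, rule Swc, simp, simp add: T_mul mul_assoc, rule E_cong) (simp_all add: mul_assoc)
   finally show "?Z = ..." .
  qed
  also have "mu (T t**u) * ... = Sw p (%w q. Sw m (%m1 y. Sw q (%e s. Sw y (%m2 m3. ?b u w e s t m1 m2 m3))))"
   by (simp only: tevL)
  also have "... = Sw3 p (%w e s. ?N u w e s t)"
   by (rule Swc, simp, rule tevs)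
  finally show "?Z = ..." .
 qed
 also have "... = Sw3 b (%u w z. Sw z (%q t. Sw q (%e s. ?N u w e s t)))"
  by (rule Swc[OF b], rule coassoc) (simp_all add: mlin)
 also have "... = ?C"
  by (rule Swc[OF b], rule Swc, assumption, rule coassoc) (simp_all add: mlin)
 finally show "act DY (mul Db (mu >< m) h) be b = act DY (mu >< m) (act DY h be) b" using L by simp
qed (simp_all add: lin_E assms DY_act_in)

text \<open>\<open>copEE\<close> multiplies the first arguments in reverse order, to T(q3)q1T(p3)p1.
  The legs p3 and q1 are adjacent, so q1T(p3) cancels.\<close>

lemma DY_act_prod:
 assumes h: "h : carr Db" and be: "be : carr D" and ga: "ga : carr D" and b: "b : carr B"
 shows "act DY h (mul D be ga) b = SwDb h (%h1 h2. mul D (act DY h1 be) (act DY h2 ga) b)" (is "?L = ?R")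
proof -
 note [simp] = lin_E assms lin_o[OF _ dform[OF be]] lin_o[OF _ dform[OF ga]] DY_act_in star_form
 let ?K = "%e f. star (%m. be (e**m)) (%m. ga (f**m))"
 let ?C = "Sw3 b (%b1 e s. Sw s (%f b3. E (T b3**b1) (?K e f) h))"
 have star_lin: "form V (%x. ?K (g x) f m)" "form V (%x. ?K f (g x) m)" if "lin_map V B g" "f : carr B" "m : carr B"
  for g f m and V :: "('k, 'b, 'z) hopf_scheme"
  unfolding star_def using that by (simp_all add: mlin)
 have "?L = Sw3 b (%b1 b2 b3. E (T b3**b1) (%m. mul D be ga (b2**m)) h)"
  by (rule DYaE) simp_all
 also have "... = Sw3 b (%b1 b2 b3. Sw b2 (%e f. E (T b3**b1) (?K e f) h))"
 proof (rule Swc[OF b], rule Swc, assumption)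
  fix b1 r b2 b3 assume [simp]: "b1 : carr B" "b2 : carr B" "b3 : carr B"
  have "E (T b3**b1) (%m. mul D be ga (b2**m)) h = E (T b3**b1) (%m. Sw b2 (%e f. ?K e f m)) h" (is "?Z = _")
   by (rule E_cong[OF h]) (simp add: dmulE star_def Sw_mul[OF bif_f] dform)
  also have "... = Sw b2 (%e f. E (T b3**b1) (?K e f) h)" by (rule E_tev)
  finally show "?Z = ..." .
 qed
 also have "... = ?C" by (rule Swc[OF b], rule coassoc) (simp_all add: mlin star_lin)
 finally have L: "?L = ?C" .
 have "?R = SwDb h (%h1 h2. Sw b (%p q. Sw3 p (%p1 p2 p3. Sw q (%q1 s. Sw s (%q2 q3.
   E (T p3**p1) (%m. be (p2**m)) h1 * E (T q3**q1) (%m. ga (q2**m)) h2)))))"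
  by (rule tevc[OF vsDb copDb_in[OF h]], simp add: dmulE, rule Swc[OF b]) (simp add: DYaE, simp only: tevR, simp only: tevL)
 also have "... = Sw b (%p q. Sw3 p (%p1 p2 p3. Sw q (%q1 s. Sw s (%q2 q3. E (T q3**((q1**T p3)**p1)) (?K p2 q2) h))))"
  unfolding tevs[where s = "cop Db h"]
  by (rule Swc[OF b], rule Swc, assumption, rule Swc, assumption, rule Swc, assumption, rule Swc, assumption) (simp add: copEE mul_assoc)
 also have "... = Sw3 b (%p1 r q. Sw r (%p2 p3. Sw q (%q1 s. Sw s (%q2 q3. E (T q3**((q1**T p3)**p1)) (?K p2 q2) h))))"
  by (rule coassoc) (simp_all add: mlin star_lin)
 also have "... = Sw3 b (%p1 p2 z. Sw3 z (%p3 q1 s. Sw s (%q2 q3. E (T q3**((q1**T p3)**p1)) (?K p2 q2) h)))"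
  by (rule Swc[OF b], rule coassoc) (simp_all add: mlin star_lin)
 also have "... = Sw3 b (%p1 p2 z. Sw z (%q2 q3. E (T q3**(one**p1)) (?K p2 q2) h))"
  by (rule Swc[OF b], rule Swc, assumption, rule collapse_head[OF T_col(2), where
    psi = "%u s. Sw s (%q2 q3. E (T q3**(u**_)) (?K _ q2) h)"]) (simp_all add: mlin star_lin)
 also have "... = ?C"
  by (rule Swc[OF b], rule Swc, assumption, rule Swc) (simp_all add: one_mul)
 finally show ?thesis using L by simp
qed

lemma DY_act_unity:
 assumes h: "h : carr Db"
 shows "act DY h (unity D) = fun_scal (cou Db h) (unity D)"
proof (rule dual_eqI)
 fix b assume b: "b : carr B"
 note [simp] = lin_E assms b cou_form
 have "act DY h (unity D) b = Sw3 b (%b1 b2 b3. E (T b3**b1) (%m. unity D (b2**m)) h)"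
  by (rule DYaE) simp_all
 also have "... = Sw3 b (%b1 b2 b3. cou B b2 * E (T b3**b1) (cou B) h)"
 proof (rule Swc[OF b], rule Swc, assumption)
  fix b1 r b2 b3 assume [simp]: "b1 : carr B" "b2 : carr B" "b3 : carr B"
  have "E (T b3**b1) (%m. unity D (b2**m)) h = E (T b3**b1) (%m. cou B b2 * cou B m) h" (is "?Z = _")
   by (rule E_cong[OF h]) (simp add: d1E cou_mul)
  also have "... = cou B b2 * E (T b3**b1) (cou B) h" unfolding E_def tevL by (simp add: mult_ac)
  finally show "?Z = ..." .
 qed
 also have "... = Sw b (%b1 r. E (T r**b1) (cou B) h)"
  by (rule Swc[OF b], rule couL) simp_all
 also have "... = cou B b * E one (cou B) h"
  by (rule collapse[OF T_col(1), where ph = "%u. E u (cou B) h"]) simp_all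
 finally show "act DY h (unity D) b = fun_scal (cou Db h) (unity D) b"
  by (simp add: d1E couDbE mult_ac)
qed (use vs_scal[OF vsD d1_in] in "simp_all add: DY_act_in assms d1_in")

text \<open>Both sides reduce to \<open>?C\<close> by one cancellation each: on the left a4 T(a3)
  from legs of the evaluation point \<open>a\<close>, on the right m4 T(m3) inside the form in the
  second slot of \<open>E\<close>.\<close>

lemma DY_condition:
 assumes h: "h : carr Db" and be: "be : carr D" and a: "a : carr B" and b: "b : carr B" and ka: "form B ka"
 shows "SwDb h (%h1 h2. CoD (act DY h1 be) (%g z. E a ka (mul Db g h2) * z b))
  = SwDb h (%h1 h2. CoD be (%g z. E a ka (mul Db h1 g) * act DY h2 z b))" (is "?L = ?R")
proof -
 note [simp] = lin_E assms lin_o[OF _ dform[OF be]] lin_o[OF _ ka] DY_act_in star_form bilL[OF DY_act_bilin] bilR[OF DY_act_bilin]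
 let ?K = "%e. star (%m. be (e**m)) ka"
 let ?C = "Sw3 b (%b1 b2 b3. Sw a (%a1 a2. E (T b3**(b1**a1)) (?K (b2**a2)) h))"
 let ?v = "%a1 a2 a3 a4. Sw b (%b1 s. Sw s (%b2 b3. E ((a4**T a3)**(T b3**(b1**a1))) (?K (b2**a2)) h))"
 have star_lin: "form V (%x. ?K (g x) m)" if "lin_map V B g" "m : carr B"
  for g m and V :: "('k, 'b, 'z) hopf_scheme"
  unfolding star_def using that by (simp_all add: mlin)
 have bi1: "biform Db D (%g z. E a ka (mul Db g h2) * z b)" if "h2 : carr Db" for h2
  using that by (simp add: mlin form_eval)
 have bi2: "biform Db D (%g z. E a ka (mul Db h1 g) * act DY h2 z b)" if "h1 : carr Db" "h2 : carr Db" for h1 h2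
  using that by (simp add: mlin)
 have "?L = SwDb h (%h1 h2. Sw a (%a1 a2. Sw (b**a1) (%c1 r. Sw r (%c2 c3. E (T c3**c1) (%m. be (c2**m)) h1 * E a2 ka h2))))"
 proof (rule tevc[OF vsDb copDb_in[OF h]])
  fix h1 h2 assume [simp]: "h1 : carr Db" "h2 : carr Db"
  let ?ga = "act DY h1 be"
  have ga: "?ga : carr D" by simp
  have "tev Db D (coact DY ?ga) (%g z. E a ka (mul Db g h2) * z b)
   = tev D D (cop D ?ga) (%ga1 ga2. Sw a (%a1 a2. ga2 a1 * E a2 ka h2 * (ga1 b * 1)))" (is "?Z = _")
   unfolding DYc_ev[OF bi1[OF `h2 : carr Db`] ga]
   by (rule SwDc[OF ga]) (simp add: E_mul_dual tevR)
  also have "... = Sw a (%a1 a2. ?ga (b**a1) * E a2 ka h2)"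
   unfolding tevs[where s = "cop D (act DY h1 be)"]
   by (rule Swc[OF a]) (simp only: cop_dual4[OF ga b] mult_1_right)
  also have "... = Sw a (%a1 a2. Sw (b**a1) (%c1 r. Sw r (%c2 c3. E (T c3**c1) (%m. be (c2**m)) h1 * E a2 ka h2)))"
   by (rule Swc[OF a]) (simp add: DYaE tevR)
  finally show "?Z = ..." .
 qed
 also have "... = Sw a (%a1 a2. Sw3 (b**a1) (%c1 c2 c3. E (a2**(T c3**c1)) (?K c2) h))"
  unfolding tevs[where s = "cop Db h"]
  by (rule Swc[OF a], rule Swc, simp, rule Swc, simp) (simp add: copEE)
 also have "... = Sw a (%p a4. Sw3 p (%a1 a2 a3. ?v a1 a2 a3 a4))"
 proof (rule Swc[OF a])
  fix p a4 assume [simp]: "p : carr B" "a4 : carr B"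
  have "Sw3 (b**p) (%c1 c2 c3. E (a4**(T c3**c1)) (?K c2) h)
   = Sw b (%b1 s. Sw p (%a1 r. Sw (s**r) (%c2 c3. E (a4**(T c3**(b1**a1))) (?K c2) h)))" (is "?Z = _")
   by (rule Sw_mul) (simp_all add: mlin star_lin)
  also have "... = Sw b (%b1 s. Sw p (%a1 r. Sw s (%b2 b3. Sw r (%a2 a3. E (a4**(T (b3**a3)**(b1**a1))) (?K (b2**a2)) h))))"
   by (rule Swc[OF b], rule Swc, simp, rule Sw_mul) (simp_all add: mlin star_lin)
  also have "... = Sw b (%b1 s. Sw p (%a1 r. Sw s (%b2 b3. Sw r (%a2 a3. E ((a4**T a3)**(T b3**(b1**a1))) (?K (b2**a2)) h))))"
   by (rule Swc[OF b], rule Swc, simp, rule Swc, simp, rule Swc, simp) (simp add: T_mul mul_assoc)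
  also have "... = Sw b (%b1 s. Sw3 p (%a1 a2 a3. Sw s (%b2 b3. E ((a4**T a3)**(T b3**(b1**a1))) (?K (b2**a2)) h)))"
   by (rule Swc[OF b], rule Swc, simp, rule tevs)
  also have "... = Sw3 p (%a1 a2 a3. ?v a1 a2 a3 a4)"
   by (simp only: tevs[where s = "cop B b"])
  finally show "?Z = ..." .
 qed
 also have "... = Sw3 a (%a1 r a4. Sw r (%a2 a3. ?v a1 a2 a3 a4))"
  by (rule coassoc) (simp_all add: mlin star_lin)
 also have "... = Sw3 a (%a1 a2 z. Sw z (%a3 a4. ?v a1 a2 a3 a4))"
  by (rule Swc[OF a], rule coassoc) (simp_all add: mlin star_lin)
 also have "... = Sw a (%a1 a2. Sw b (%b1 s. Sw s (%b2 b3. E (one**(T b3**(b1**a1))) (?K (b2**a2)) h)))"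
  by (rule Swc[OF a], rule colT[OF T_col(2), where psi = "%a2 u. Sw3 b (%b1 b2 b3. E (u**(T b3**(b1**_))) (?K (b2**a2)) h)"])
   (simp_all add: mlin star_lin)
 also have "... = Sw a (%a1 a2. Sw3 b (%b1 b2 b3. E (T b3**(b1**a1)) (?K (b2**a2)) h))"
  by (rule Swc[OF a], rule Swc[OF b], rule Swc) (simp_all add: one_mul)
 also have "... = ?C" by (simp only: tevs[where s = "cop B a"])
 finally have L: "?L = ?C" .
 \<comment> \<open>The form into which \<open>E_mul_right\<close> turns \<open>ka\<close> when the
   right factor is \<open>be2 >< one\<close>.\<close>
 let ?J = "%be2 a2 x. Sw3 x (%m1 m2 m3. be2 (T m3**(a2**m1)) * ka (m2**one))"
 have J: "form B (?J be2 a2)" if "be2 : carr D" "a2 : carr B" for be2 a2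
  by (rule form_K[OF that(1) ka that(2) one_in])
 have "?R = SwDb h (%h1 h2. SwD be (%be1 be2. Sw3 b (%b1 b2 b3. Sw a (%a1 a2. E a1 (?J be2 a2) h1 * E (T b3**b1) (%m. be1 (b2**m)) h2))))"
 proof (rule tevc[OF vsDb copDb_in[OF h]])
  fix h1 h2 assume hh[simp]: "h1 : carr Db" "h2 : carr Db"
  show "CoD be (%g z. E a ka (mul Db h1 g) * act DY h2 z b) = SwD be (%be1 be2. Sw3 b (%b1 b2 b3. Sw a (%a1 a2.
   E a1 (?J be2 a2) h1 * E (T b3**b1) (%m. be1 (b2**m)) h2)))"
   unfolding DYc_ev[OF bi2[OF hh] be]
   by (rule SwDc[OF be]) (simp add: E_mul_right DYaE, simp only: tevL, simp only: tevR)
 qed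
 also have "... = Sw3 b (%b1 b2 b3. Sw a (%a1 a2. SwD be (%be1 be2. SwDb h (%h1 h2.
   E a1 (?J be2 a2) h1 * E (T b3**b1) (%m. be1 (b2**m)) h2))))"
  by (simp only: tevs[where s = "cop D be"], simp only: tevs[where s = "cop Db h"])
 also have "... = ?C"
 proof (rule Swc[OF b], rule Swc, assumption, rule Swc[OF a])
  fix b1 r b2 b3 a1 a2 assume bb[simp]: "b1 : carr B" "b2 : carr B" "b3 : carr B" "a1 : carr B" "a2 : carr B"
  have "SwD be (%be1 be2. SwDb h (%h1 h2. E a1 (?J be2 a2) h1 * E (T b3**b1) (%m. be1 (b2**m)) h2))
   = SwD be (%be1 be2. E (T b3**b1**a1) (star (?J be2 a2) (%m. be1 (b2**m))) h)"
   by (rule SwDc[OF be], rule copEE) (simp_all add: J lin_o[OF _ dform])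
  also have "... = E (T b3**b1**a1) (%m. SwD be (%be1 be2. star (?J be2 a2) (%m. be1 (b2**m)) m)) h"
   by (rule E_tev[symmetric])
  also have "... = E (T b3**b1**a1) (?K (b2**a2)) h"
  proof (rule E_cong[OF h])
   fix m assume [simp]: "m : carr B"
   have "SwD be (%be1 be2. star (?J be2 a2) (%m. be1 (b2**m)) m) = Sw m (%p m4. Sw3 p (%m1 m2 m3. SwD be (%be1 be2.
      be2 (T m3**(a2**m1)) * ka (m2**one) * (be1 (b2**m4) * 1))))" (is "?Z = _")
    unfolding star_def tevR by (simp only: tevs[where s = "cop D be"] mult_1_right)
   also have "... = Sw m (%p m4. Sw3 p (%m1 m2 m3. be (b2**((m4**T m3)**(a2**m1))) * ka m2))"
    by (rule Swc, simp, rule Swc, simp, rule Swc, simp, subst cop_dual3[OF be]) (simp_all add: mul_assoc mul_one)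
   also have "... = Sw3 m (%m1 r m4. Sw r (%m2 m3. be (b2**((m4**T m3)**(a2**m1))) * ka m2))"
    by (rule coassoc) (simp_all add: mlin)
   also have "... = Sw3 m (%m1 m2 z. Sw z (%m3 m4. be (b2**((m4**T m3)**(a2**m1))) * ka m2))"
    by (rule Swc, simp, rule coassoc) (simp_all add: mlin)
   also have "... = Sw m (%m1 m2. be (b2**(one**(a2**m1))) * ka m2)"
    by (rule Swc, simp, rule colT[OF T_col(2), where psi = "%m2 u. be (b2**(u**(a2**_))) * ka m2"]) (simp_all add: mlin)
   also have "... = ?K (b2**a2) m"
    unfolding star_def by (rule Swc) (simp_all add: one_mul mul_assoc)
   finally show "?Z = ..." .
  qed
  finally show "SwD be (%be1 be2. SwDb h (%h1 h2.
    E a1 (?J be2 a2) h1 * E (T b3**b1) (%m. be1 (b2**m)) h2)) = E (T b3**(b1**a1)) (?K (b2**a2)) h"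
   by (simp add: mul_assoc)
 qed
 finally show ?thesis using L by simp
qed

text \<open>Tested with \<open>E a ka\<close> and evaluation at b, the coaction of be reads
  be(ba)ka(1). Its coassociativity is then associativity of B, and its multiplicativity that of the
  coproduct of B.\<close>

theorem yd_dual: "yd_module_algebra Db DY"
proof (rule yd_module_algebraI[where H = Db and X = DY, unfolded DY_vs DY_simps, OF bia_Db _ DY_act_bilin DY_coact_lin sep_double sep_dual])
 show "assoc_algebra DY" using dual_alg assoc_algebra_cong[OF DY_simps] by simp
next
 fix be assume be[simp]: "be : carr D"
 have one_in': "unity Db : carr Db" by (rule algD(3)[OF double_alg])
 show "act DY (unity Db) be = be"
 proof (rule dual_eqI)
  fix b assume b: "b : carr B"
  note [simp] = lin_E b lin_o[OF _ dform[OF be]] dform cou_form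
  have "act DY (unity Db) be b = Sw3 b (%b1 b2 b3. E (T b3**b1) (%m. be (b2**m)) (unity Db))"
   by (rule DYaE[OF be one_in' b])
  also have "... = Sw b (%b1 r. cou B b1 * Sw r (%b2 b3. cou B b3 * be b2))"
   unfolding tevL Db_one by (rule Swc[OF b], rule Swc) (simp_all add: E_pure d1E cou_mul cou_T mul_one mult_ac)
  also have "... = Sw b (%b1 r. cou B b1 * be r)"
   by (rule Swc[OF b], subst couR) simp_all
  also have "... = be b" by (rule couL) simp_all
  finally show "act DY (unity Db) be b = be b" .
 qed (simp_all add: DY_act_in one_in')
next
 fix g h be assume g: "g : carr Db" and h: "h : carr Db" and be[simp]: "be : carr D"
 show "act DY (mul Db g h) be = act DY g (act DY h be)"
  by (rule dbl_eqI[where f = "%g. act DY (mul Db g h) be" and U = D])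
   (simp_all add: g h DY_act_mul_pure lin_E lin_id bilL[OF DY_act_bilin] DY_act_in)
next
 fix h assume "h : carr Db"
 then show "act DY h (unity D) = scal D (cou Db h) (unity D)" by (simp add: DY_act_unity)
next
 fix h be ga p assume "h : carr Db" "be : carr D" "ga : carr D" "p : DG"
 then show "p (act DY h (mul D be ga)) = SwDb h (%h1 h2. p (mul D (act DY h1 be) (act DY h2 ga)))"
  by (auto simp: DY_act_prod)
next
 fix be f f' p assume "be : carr D" "f : EF" "f' : EF" "p : DG"
 then obtain a ka c ka' b where abc: "a : carr B" "c : carr B" "b : carr B" and k: "form B ka" "form B ka'"
  and f: "f = E a ka" "f' = E c ka'" "p = (%be. be b)" and be: "be : carr D" unfolding EF_def by blast
 have "CoD be (%g z. SwDb g (%a b. f a * (f' b * p z))) = CoD be (%g z. E (c**a) (star ka ka') g * z b)" (is "?Z = _")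
  by (rule tevc[OF vsDb DY_coact_in[OF be]]) (simp add: f mult.assoc[symmetric] tevR[symmetric] copEE abc k)
 also have "... = be (b**(c**a)) * (ka one * ka' one)"
  by (subst DY_coact_EV) (simp_all add: be abc mul_in star_form k, simp add: star_def Sw_one bif_f k)
 also have "... = CoD be (%g z. E a ka g * z (b**c)) * ka' one"
  by (subst DY_coact_EV) (simp_all add: be abc mul_in k mul_assoc)
 also have "... = CoD be (%g z. CoD z (%h w. f g * (f' h * p w)))"
  unfolding tevR
  by (rule tevc[OF vsDb DY_coact_in[OF be]]) (simp add: f tevL[symmetric] DY_coact_EV abc k)
 finally show "?Z = ..." .
next
 fix be p assume "be : carr D" "p : DG"
 then obtain b where b: "b : carr B" "p = (%be. be b)" and be: "be : carr D" by blast
 have "CoD be (%g z. cou Db g * p z) = CoD be (%g z. E one (cou B) g * z b)"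
  by (rule tevc[OF vsDb DY_coact_in[OF be]]) (simp add: b couDbE)
 then show "CoD be (%g z. cou Db g * p z) = p be"
  by (simp add: DY_coact_EV be b one_in cou_form mul_one cou_one)
next
 fix be ga f p assume "be : carr D" "ga : carr D" "f : EF" "p : DG"
 then obtain a ka b where ab: "a : carr B" "b : carr B" and k: "form B ka"
  and f: "f = E a ka" "p = (%be. be b)" and be: "be : carr D" and ga: "ga : carr D" unfolding EF_def by blast
 note [simp] = lin_E ab k be ga lin_o[OF _ k] form_eval dform
 have bi: "biform Db D (%g z. E a ka g * z b)" by (rule EV_biform) simp_all
 note bi' = bil_tm[OF double_alg dual_alg vs_g bi]
 let ?q = "%a1 a2 b1 b2. SwD be (%be1 be2. SwD ga (%ga1 ga2. be2 a1 * (ga2 a2 * ka one) * (be1 b1 * ga1 b2)))"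
 have "CoD (mul D be ga) (%g z. f g * p z) = Sw (b**a) (%x y. be x * ga y) * ka one" (is "?Z = _")
  by (simp add: f DY_coact_EV dmulE)
 also have "... = Sw b (%b1 b2. Sw a (%a1 a2. be (b1**a1) * (ga (b2**a2) * ka one)))"
  by (subst Sw_mul) (simp_all add: bif_f tevR mult.assoc)
 also have "... = Sw b (%b1 b2. Sw a (%a1 a2. ?q a1 a2 b1 b2))"
 proof (rule Swc, simp, rule Swc, simp)
  fix b1 b2 a1 a2 assume bb[simp]: "b1 : carr B" "b2 : carr B" "a1 : carr B" "a2 : carr B"
  have "?q a1 a2 b1 b2 = SwD be (%be1 be2. be2 a1 * (ga (b2**a2) * ka one) * (be1 b1 * 1))"
  proof (rule SwDc[OF be])
   fix be1 be2
   have "SwD ga (%ga1 ga2. be2 a1 * (ga2 a2 * ka one) * (be1 b1 * ga1 b2))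
    = SwD ga (%ga1 ga2. be2 a1 * (ga2 a2 * ka one) * (be1 b1 * (ga1 b2 * 1)))" (is "?Z = _") by simp
   also have "... = be2 a1 * (ga (b2**a2) * ka one) * (be1 b1 * 1)"
    by (subst cop_dual2[OF ga]) (simp_all add: mult_ac)
   finally show "?Z = ..." .
  qed
  also have "... = be (b1**a1) * (ga (b2**a2) * ka one)" by (subst cop_dual3[OF be]) simp_all
  finally show "be (b1**a1) * (ga (b2**a2) * ka one) = ?q a1 a2 b1 b2" by simp
 qed
 also have "... = SwD be (%be1 be2. SwD ga (%ga1 ga2. E a ka (mul Db (be2 >< one) (ga2 >< one)) * mul D be1 ga1 b))"
 proof -
  have "Sw b (%b1 b2. Sw a (%a1 a2. ?q a1 a2 b1 b2)) = SwD be (%be1 be2. SwD ga (%ga1 ga2. Sw b (%b1 b2. Sw a (%a1 a2.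
    be2 a1 * (ga2 a2 * ka one) * (be1 b1 * ga1 b2)))))"
   by (simp only: tevs[where s = "cop B a"], simp only: tevs[where s = "cop B b"])
  also have "... = SwD be (%be1 be2. SwD ga (%ga1 ga2. E a ka (mul Db (be2 >< one) (ga2 >< one)) * mul D be1 ga1 b))"
   by (rule SwDc[OF be], rule SwDc[OF ga]) (simp add: E_mul_dual dmulE, simp only: tevL, simp only: tevR,
     rule Swc, simp, rule Swc, simp, simp add: E_pure)
  finally show ?thesis .
 qed
 also have "... = CoD be (%g z. CoD ga (%h w. f (mul Db g h) * p (mul D z w)))"
  unfolding f DYc_ev[OF bi'(2)[OF DY_coact_in[OF ga]] be]
  by (rule SwDc[OF be], subst DYc_ev[OF bi'(1) ga]) simp_all
 finally show "?Z = ..." .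
next
 show "coact DY (unity D) = tpure Db D (unity Db) (unity D)"
 proof (rule tensor_eqI[OF sep_double sep_dual])
  have o: "unity Db : carr Db" by (rule algD(3)[OF double_alg])
  show "coact DY (unity D) : carr (tensor Db D)" by (rule DY_coact_in[OF d1_in])
  show "tpure Db D (unity Db) (unity D) : carr (tensor Db D)" by (rule tpI[OF o d1_in])
  fix f g assume "f : EF" "g : DG"
  then obtain a ka b where ab: "a : carr B" "b : carr B" and k: "form B ka"
   and f: "f = E a ka" "g = (%be. be b)" unfolding EF_def by blast
  show "CoD (unity D) (%v w. f v * g w) = tev Db D (tpure Db D (unity Db) (unity D)) (%v w. f v * g w)"
   unfolding f tevp[OF EV_biform[OF ab k] vsDb vs_g o d1_in]
   by (subst DY_coact_EV) (simp_all add: d1_in ab k d1E mul_in cou_mul Db_one E_pure one_in mult_ac)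
 qed
next
 fix h be f p assume "h : carr Db" "be : carr D" "f : EF" "p : DG"
 then show "SwDb h (%h1 h2. CoD (act DY h1 be) (%g z. f (mul Db g h2) * p z))
   = SwDb h (%h1 h2. CoD be (%g z. f (mul Db h1 g) * p (act DY h2 z)))"
  unfolding EF_def using DY_condition by fastforce
qed

subsection \<open>The Hopf algebra itself as a Yetter--Drinfeld module algebra\<close>

text \<open>The action of the double on B is the adjoint action \<open>ad\<close> of its B-part
  followed by \<open>la\<close>, the action of its dual part. The axioms are proved for the two
  separately and joined by the cross relation \<open>ad_la\<close>.\<close>

definition "ad m b = Sw m (%m1 m2. m1**b**S m2)"

definition "la mu b = hit_by_form B b (T' mu)"

lemma ad_bilin: "bilin_map B B B ad"
 unfolding ad_def by (simp add: mlin lin_B)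

lemmas ad_in = bilD(1)[OF ad_bilin]

lemma form_ad: assumes "form B ka" "m : carr B" "b : carr B"
 shows "ka (ad m b) = Sw m (%m1 m2. ka (m1**b**S m2))"
 unfolding ad_def by (rule tev_pull[OF assms(1) vs vs cop_in[OF assms(2)]]) (simp add: lin_B assms)

lemma Sw_ad: assumes "biform B B ph" "m : carr B" "b : carr B"
 shows "Sw (ad m b) ph = Sw m (%m1 m2. Sw (m1**b**S m2) ph)"
 by (rule form_ad[OF lin_ta'[OF lin_cop_H assms(1) vs vs_g] assms(2,3)])

lemma la_bilin1: "mu : carr D ==> bilin_map B B B (%b1 b2. scal B (T' mu b1) b2)"
 by (auto simp: mlin vs dform[OF T'_in] intro!: lin_scal lscL lin_id)

lemma la_eq: "mu : carr D ==> la mu b = tlift B B (%b1 b2. scal B (T' mu b1) b2) (cop B b)"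
 by (simp add: la_def hit_by_form_def sw_def)

lemma form_la: assumes ka: "form B ka" and mu: "mu : carr D" and b: "b : carr B"
 shows "ka (la mu b) = Sw b (%b1 b2. mu (T b1) * ka b2)"
 unfolding la_eq[OF mu]
 by (subst tl_pull[OF ka la_bilin1[OF mu] vs vs cop_in[OF b]], rule Swc[OF b], simp add: linD(3)[OF ka] T'_apply mu)

lemma la_in: "mu : carr D ==> b : carr B ==> la mu b : carr B"
 unfolding la_eq by (rule tlift_in[OF la_bilin1 vs vs cop_in])

lemma la_lin: assumes mu: "mu : carr D" shows "lin_map B B (la mu)"
 unfolding la_eq[OF mu, abs_def] by (rule lin_tla[OF lin_cop_H la_bilin1[OF mu] vs vs])

lemma la_bilin: "bilin_map D B B la"
proof -
 have "lin_map D B (%mu. la mu b)" if b: "b : carr B" for b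
  unfolding lin_map_def
  by (auto intro!: eq_by_forms la_in vs vs_add vs_scal vsD fsD b simp: form_la b vsD vs_add fsD linD(2,3) la_in tev_add tevL algebra_simps)
 then show ?thesis using la_lin by (simp add: bilin_map_def)
qed

lemma Sw_la: assumes ph: "biform B B ph" and "mu : carr D" "b : carr B"
 shows "Sw (la mu b) ph = Sw b (%b1 r. mu (T b1) * Sw r ph)"
 by (rule form_la[OF lin_ta'[OF lin_cop_H ph vs vs_g] assms(2,3)])

lemmas lin_S' = lin_E la_in ad_in bilL[OF la_bilin] bilR[OF la_bilin] bilL[OF ad_bilin] bilR[OF ad_bilin]

text \<open>The legs of \<open>mu\<close> are reversed because T(xy) = T(y)T(x). This matches the
  coproduct of the double, which is coopposite on the dual part.\<close>

lemma form_la_mul: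
 assumes ka: "form B ka" and mu: "mu : carr D" and x: "x : carr B" and y: "y : carr B"
 shows "ka (la mu (x**y)) = SwD mu (%mu1 mu2. ka (la mu2 x**la mu1 y))" (is "?L = ?R")
proof -
 note [simp] = lin_S' assms lin_o[OF _ ka] lin_o[OF _ dform[OF mu]]
 have "?L = Sw (x**y) (%z1 z2. mu (T z1) * ka z2)" by (rule form_la[OF ka mu]) simp
 also have "... = Sw x (%x1 x2. Sw y (%y1 y2. mu (T (x1**y1)) * ka (x2**y2)))"
  by (rule Sw_mul) (simp_all add: mlin)
 also have "... = Sw x (%x1 x2. Sw y (%y1 y2. SwD mu (%mu1 mu2. mu2 (T x1) * ka (x2**y2) * mu1 (T y1))))"
  by (rule Swc[OF x], rule Swc[OF y], subst cop_dual4[OF mu]) (simp_all add: T_mul)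
 also have "... = SwD mu (%mu1 mu2. Sw x (%x1 x2. Sw y (%y1 y2. mu2 (T x1) * ka (x2**y2) * mu1 (T y1))))"
  by (simp only: tevs[where t = "cop D mu"])
 also have "... = ?R"
 proof (rule SwDc[OF mu])
  fix mu1 mu2 assume [simp]: "mu1 : carr D" "mu2 : carr D"
  have "ka (la mu2 x**la mu1 y) = Sw x (%x1 x2. mu2 (T x1) * ka (x2**la mu1 y))"
   by (rule form_la[where ka = "%z. ka (z**la mu1 y)"]) simp_all
  also have "... = Sw x (%x1 x2. mu2 (T x1) * Sw y (%y1 y2. mu1 (T y1) * ka (x2**y2)))"
   by (rule Swc[OF x], rule arg_cong2[where f = "(*)", OF refl], rule form_la[where ka = "%z. ka (_**z)"]) simp_all
  finally show "Sw x (%x1 x2. Sw y (%y1 y2. mu2 (T x1) * ka (x2**y2) * mu1 (T y1))) = ka (la mu2 x**la mu1 y)"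
   by (simp add: tevL mult_ac)
 qed
 finally show ?thesis .
qed

text \<open>By \<open>Sw_T\<close> the legs of T(b') are reversed, so nu is paired with the first
  leg of b, as it is when nu acts first.\<close>

lemma la_la: assumes "mu : carr D" "nu : carr D" "b : carr B"
 shows "la (mul D mu nu) b = la mu (la nu b)"
proof (rule eq_by_forms)
 fix ka assume ka: "form B ka"
 note [simp] = lin_S' assms lin_o[OF _ ka] lin_o[OF _ dform[OF assms(1)]] lin_o[OF _ dform[OF assms(2)]] dform ka
 have "ka (la (mul D mu nu) b) = Sw b (%p b3. Sw p (%b1 b2. nu (T b1) * (mu (T b2) * ka b3)))" (is "?Z = _")
  unfolding form_la[OF ka dmul_in[OF assms(1,2)] assms(3)]
  by (rule Swc, simp, simp add: dmulE Sw_T bif_f, simp only: tevR, rule Swc, simp, simp add: mult_ac)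
 also have "... = Sw3 b (%b1 b2 b3. nu (T b1) * (mu (T b2) * ka b3))"
  by (rule coassoc) (simp_all add: mlin)
 also have "... = ka (la mu (la nu b))"
  by (simp add: form_la, subst Sw_la) (simp_all add: mlin tevL)
 finally show "?Z = ..." .
qed (simp_all add: lin_S' assms)

lemma la_one: assumes "b : carr B" shows "la (unity D) b = b"
proof (rule eq_by_forms)
 fix ka assume ka: "form B ka"
 have "ka (la (unity D) b) = Sw b (%b1 b2. cou B b1 * ka b2)"
  unfolding form_la[OF ka d1_in assms] by (rule Swc[OF assms]) (simp add: d1E T_in cou_T)
 then show "ka (la (unity D) b) = ka b" by (simp add: couL ka assms)
qed (simp_all add: la_in d1_in assms)

lemma la_of_one: assumes "mu : carr D" shows "la mu one = scal B (mu one) one"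
proof (rule eq_by_forms)
 fix ka assume ka: "form B ka"
 show "ka (la mu one) = ka (scal B (mu one) one)"
  unfolding form_la[OF ka assms one_in]
  by (subst Sw_one) (simp_all add: linD(3)[OF ka] one_in T_one lin_S' mlin assms ka lin_o[OF _ dform[OF assms]])
qed (simp_all add: la_in one_in assms vs_scal vs)

lemma ad_ad: assumes "m : carr B" "n : carr B" "b : carr B" shows "ad (m**n) b = ad m (ad n b)"
proof (rule eq_by_forms)
 fix ka assume ka: "form B ka"
 note [simp] = lin_S' assms lin_o[OF _ ka] ka
 have "ka (ad (m**n) b) = Sw (m**n) (%p q. ka (p**b**S q))" (is "?Z = _") by (rule form_ad) simp_all
 also have "... = Sw m (%m1 m2. Sw n (%n1 n2. ka (m1**n1**b**S (m2**n2))))"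
  by (rule Sw_mul) (simp_all add: mlin)
 also have "... = Sw m (%m1 m2. Sw n (%n1 n2. ka (m1**(n1**b**S n2)**S m2)))"
  by (rule Swc, simp, rule Swc) (simp_all add: S_mul mul_assoc)
 also have "... = Sw m (%m1 m2. ka (m1**ad n b**S m2))"
  by (rule Swc, simp, rule form_ad[where ka = "%z. ka (_**z**S _)", symmetric]) simp_all
 also have "... = ka (ad m (ad n b))" by (rule form_ad[symmetric]) simp_all
 finally show "?Z = ..." .
qed (simp_all add: lin_S' assms)

lemma ad_one: assumes "b : carr B" shows "ad one b = b"
proof (rule eq_by_forms)
 fix ka assume ka: "form B ka"
 note [simp] = lin_S' assms lin_o[OF _ ka] ka
 show "ka (ad one b) = ka b"
  by (subst form_ad, simp, simp, simp, subst Sw_one) (simp_all add: mlin S_one one_mul mul_one)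
qed (simp_all add: lin_S' assms)

lemma ad_of_one: assumes "m : carr B" shows "ad m one = scal B (cou B m) one"
proof (rule eq_by_forms)
 fix ka assume ka: "form B ka"
 have "ka (ad m one) = Sw m (%m1 m2. ka (m1**S m2))"
  unfolding form_ad[OF ka assms one_in] by (rule Swc[OF assms]) (simp add: mul_one)
 also have "... = cou B m * ka one" by (rule collapse[OF S_col(2) ka assms])
 finally show "ka (ad m one) = ka (scal B (cou B m) one)" by (simp add: linD(3)[OF ka] one_in)
qed (simp_all add: lin_S' assms vs_scal)

text \<open>Between x and y the adjacent legs of \<open>m\<close> meet as S(p2)q1 and
  cancel.\<close>

lemma form_ad_mul:
 assumes ka: "form B ka" and m: "m : carr B" and x: "x : carr B" and y: "y : carr B"
 shows "ka (ad m (x**y)) = Sw m (%m1 m2. ka (ad m1 x**ad m2 y))" (is "?L = ?R")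
proof -
 note [simp] = lin_S' assms lin_o[OF _ ka]
 have "?R = Sw m (%p q. Sw p (%p1 p2. Sw q (%q1 q2. ka (p1**(x**((S p2**q1)**(y**S q2)))))))"
 proof (rule Swc[OF m])
  fix p q assume [simp]: "p : carr B" "q : carr B"
  have "ka (ad p x**ad q y) = Sw p (%p1 p2. ka ((p1**x**S p2)**ad q y))"
   by (rule form_ad[where ka = "%z. ka (z**ad q y)"]) simp_all
  also have "... = Sw p (%p1 p2. Sw q (%q1 q2. ka ((p1**x**S p2)**(q1**y**S q2))))"
   by (rule Swc, simp, rule form_ad[where ka = "%z. ka (_**z)"]) simp_all
  also have "... = Sw p (%p1 p2. Sw q (%q1 q2. ka (p1**(x**((S p2**q1)**(y**S q2))))))"
   by (rule Swc, simp, rule Swc) (simp_all add: mul_assoc)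
  finally show "ka (ad p x**ad q y) = ..." .
 qed
 also have "... = Sw3 m (%p1 p2 q. Sw q (%q1 q2. ka (p1**(x**((S p2**q1)**(y**S q2))))))"
  by (rule coassoc) (simp_all add: mlin)
 also have "... = Sw m (%p1 r. ka (p1**(x**(one**(y**S r)))))"
  by (rule Swc[OF m], rule collapse_head[OF S_col(1), where psi = "%u q2. ka (_**(x**(u**(y**S q2))))"]) (simp_all add: mlin)
 also have "... = ?L"
  unfolding form_ad[OF ka m mul_in[OF x y]] by (rule Swc[OF m]) (simp add: one_mul mul_assoc)
 finally show ?thesis by simp
qed

text \<open>The cross relation of the double: \<open>m \<nu> = (m' \<rightharpoonup> \<nu> \<leftharpoonup> S\<^sup>-\<^sup>1(m''')) m''\<close>.\<close>

lemma ad_la: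
 assumes ka: "form B ka" and m: "m : carr B" and nu: "nu : carr D" and y: "y : carr B"
 shows "ka (ad m (la nu y)) = Sw3 m (%m1 m2 m3. ka (la (hit_right B (hit B m1 nu) (T m3)) (ad m2 y)))" (is "?L = ?R")
proof -
 note [simp] = lin_S' assms lin_o[OF _ ka] lin_o[OF _ dform[OF nu]]
 let ?b = "%m1 p1 p2 q1 q2 m3. Sw y (%y1 y2. nu ((T m3**q2)**(T y1**(T p1**m1))) * ka (p2**y2**S q1))"
 have "?R = Sw3 m (%m1 m2 m3. Sw m2 (%p q. Sw p (%p1 p2. Sw q (%q1 q2. ?b m1 p1 p2 q1 q2 m3))))"
 proof (rule Swc[OF m], rule Swc, assumption)
  fix m1 r m2 m3 assume [simp]: "m1 : carr B" "m2 : carr B" "m3 : carr B"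
  have "ka (la (hit_right B (hit B m1 nu) (T m3)) (ad m2 y))
   = Sw (ad m2 y) (%c1 c2. hit_right B (hit B m1 nu) (T m3) (T c1) * ka c2)" (is "?Z = _")
   by (rule form_la) simp_all
  also have "... = Sw (ad m2 y) (%c1 c2. nu (T m3**T c1**m1) * ka c2)"
   by (rule Swc) (simp_all add: hit_apply hit_right_apply)
  also have "... = Sw m2 (%p q. Sw (p**y**S q) (%c1 c2. nu (T m3**T c1**m1) * ka c2))"
   by (rule Sw_ad) (simp_all add: mlin)
  also have "... = Sw m2 (%p q. Sw p (%p1 p2. Sw q (%q1 q2. ?b m1 p1 p2 q1 q2 m3)))"
  proof (rule Swc, simp)
   fix p q assume [simp]: "p : carr B" "q : carr B"
   have "Sw (p**y**S q) (%c1 c2. nu (T m3**T c1**m1) * ka c2)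
    = Sw p (%p1 p2. Sw y (%y1 y2. Sw q (%q1 q2. nu (T m3**T (p1**y1**S q2)**m1) * ka (p2**y2**S q1))))" (is "?Z = _")
    by (subst Sw_mul, simp add: mlin, simp, simp, subst Sw_mul, simp add: mlin, simp, simp,
     rule Swc, simp, rule Swc, simp, rule Sw_S) (simp_all add: mlin)
   also have "... = Sw p (%p1 p2. Sw y (%y1 y2. Sw q (%q1 q2. nu ((T m3**q2)**(T y1**(T p1**m1))) * ka (p2**y2**S q1))))"
    by (rule Swc, simp, rule Swc, simp, rule Swc) (simp_all add: T_mul T_S mul_assoc)
   also have "... = Sw p (%p1 p2. Sw q (%q1 q2. ?b m1 p1 p2 q1 q2 m3))"
    by (rule Swc, simp, rule tevs)
   finally show "?Z = ..." .
  qed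
  finally show "?Z = ..." .
 qed
 \<comment> \<open>The legs are regrouped so that first q2 and m3, then m1 and p1, become adjacent;
   T(m3)q2 and T(p1)m1 cancel by \<open>T_col(1)\<close>.\<close>
 also have "... = Sw3 m (%m1 p s. Sw s (%q m3. Sw p (%p1 p2. Sw q (%q1 q2. ?b m1 p1 p2 q1 q2 m3))))"
  by (rule Swc[OF m], rule coassoc) (simp_all add: mlin)
 also have "... = Sw3 m (%m1 p s. Sw p (%p1 p2. Sw s (%q m3. Sw q (%q1 q2. ?b m1 p1 p2 q1 q2 m3))))"
  by (rule Swc[OF m], rule Swc, assumption, rule tevs)
 also have "... = Sw3 m (%m1 p s. Sw p (%p1 p2. Sw3 s (%q1 q2 m3. ?b m1 p1 p2 q1 q2 m3)))"
  by (rule Swc[OF m], rule Swc, assumption, rule Swc, assumption, rule coassoc) (simp_all add: mlin)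
 also have "... = Sw3 m (%m1 p s. Sw p (%p1 p2. Sw y (%y1 y2. nu (one**(T y1**(T p1**m1))) * ka (p2**y2**S s))))"
  by (rule Swc[OF m], rule Swc, assumption, rule Swc, assumption, rule colT[OF T_col(1),
   where psi = "%q1 u. Sw y (%y1 y2. nu (u**(T y1**(T _**_))) * ka (_**y2**S q1))"]) (simp_all add: mlin)
 also have "... = Sw3 m (%m1 p1 z. Sw z (%p2 s. Sw y (%y1 y2. nu (one**(T y1**(T p1**m1))) * ka (p2**y2**S s))))"
  by (rule Swc[OF m], rule coassoc) (simp_all add: mlin)
 also have "... = Sw m (%p2 s. Sw y (%y1 y2. nu (one**(T y1**one)) * ka (p2**y2**S s)))"
  by (rule collapse_head[OF T_col(1), where psi = "%u z. Sw z (%p2 s.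
   Sw y (%y1 y2. nu (one**(T y1**u)) * ka (p2**y2**S s)))"]) (simp_all add: mlin)
 also have "... = Sw m (%p2 s. ka (p2**la nu y**S s))"
 proof (rule Swc[OF m])
  fix p2 s assume [simp]: "p2 : carr B" "s : carr B"
  have "ka (p2**la nu y**S s) = Sw y (%y1 y2. nu (T y1) * ka (p2**y2**S s))"
   by (rule form_la[where ka = "%z. ka (p2**z**S s)"]) simp_all
  then show "Sw y (%y1 y2. nu (one**(T y1**one)) * ka (p2**y2**S s)) = ka (p2**la nu y**S s)"
   by (simp, intro Swc y) (simp_all add: one_mul mul_one)
 qed
 also have "... = ?L" by (rule form_ad[symmetric]) simp_all
 finally show ?thesis by simp
qed

text \<open>The Yetter-Drinfeld condition over B itself, for the adjoint action and the coproduct as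
  coaction. The extra legs on the left hand side meet as S(q2)m2 and cancel.\<close>

lemma ad_condition:
 assumes Ps: "biform B B Ps" and m: "m : carr B" and b: "b : carr B"
 shows "Sw m (%m1 m2. Sw (ad m1 b) (%v r. Ps (v**m2) r)) = Sw m (%m1 m2. Sw b (%b1 b2. Ps (m1**b1) (ad m2 b2)))" (is "?L = ?R")
proof -
 note [simp] = lin_S' assms bilL[OF Ps] bilR[OF Ps]
 let ?b = "%p1 p2 q1 u. Sw b (%b1 b2. Ps (p1**(b1**u)) (p2**b2**S q1))"
 have "?L = Sw m (%m1 m2. Sw m1 (%p q. Sw p (%p1 p2. Sw q (%q1 q2. ?b p1 p2 q1 (S q2**m2)))))"
 proof (rule Swc[OF m])
  fix m1 m2 assume [simp]: "m1 : carr B" "m2 : carr B"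
  have "Sw (ad m1 b) (%v r. Ps (v**m2) r) = Sw m1 (%p q. Sw (p**b**S q) (%v r. Ps (v**m2) r))" (is "?Z = _")
   by (rule Sw_ad) (simp_all add: mlin)
  also have "... = Sw m1 (%p q. Sw p (%p1 p2. Sw b (%b1 b2. Sw q (%q1 q2. Ps (p1**b1**S q2**m2) (p2**b2**S q1)))))"
   by (rule Swc, simp, subst Sw_mul, simp add: mlin, simp, simp, subst Sw_mul, simp add: mlin, simp, simp,
    rule Swc, simp, rule Swc, simp, rule Sw_S) (simp_all add: mlin)
  also have "... = Sw m1 (%p q. Sw p (%p1 p2. Sw b (%b1 b2. Sw q (%q1 q2. Ps (p1**(b1**(S q2**m2))) (p2**b2**S q1)))))"
   by (rule Swc, simp, rule Swc, simp, rule Swc, simp, rule Swc) (simp_all add: mul_assoc)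
  also have "... = Sw m1 (%p q. Sw p (%p1 p2. Sw q (%q1 q2. ?b p1 p2 q1 (S q2**m2))))"
   by (rule Swc, simp, rule Swc, simp, rule tevs)
  finally show "?Z = ..." .
 qed
 also have "... = Sw3 m (%p q m2. Sw p (%p1 p2. Sw q (%q1 q2. ?b p1 p2 q1 (S q2**m2))))"
  by (rule coassoc) (simp_all add: mlin)
 also have "... = Sw m (%p s. Sw p (%p1 p2. Sw s (%q m2. Sw q (%q1 q2. ?b p1 p2 q1 (S q2**m2)))))"
  by (rule Swc[OF m], rule tevs)
 also have "... = Sw m (%p s. Sw p (%p1 p2. Sw3 s (%q1 q2 m2. ?b p1 p2 q1 (S q2**m2))))"
  by (rule Swc[OF m], rule Swc, assumption, rule coassoc) (simp_all add: mlin)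
 also have "... = Sw m (%p s. Sw p (%p1 p2. ?b p1 p2 s one))"
  by (rule Swc[OF m], rule Swc, assumption, rule colT[OF S_col(1),
   where psi = "%q1 u. Sw b (%b1 b2. Ps (_**(b1**u)) (_**b2**S q1))"]) (simp_all add: mlin)
 also have "... = Sw3 m (%p1 p2 s. ?b p1 p2 s one)"
  by (rule coassoc) (simp_all add: mlin)
 also have "... = Sw m (%p1 z. Sw b (%b1 b2. Sw z (%p2 s. Ps (p1**b1) (p2**b2**S s))))"
  by (rule Swc[OF m], subst tevs, rule Swc[OF b], rule Swc) (simp_all add: mul_one)
 also have "... = ?R"
  by (rule Swc[OF m], rule Swc[OF b], rule form_ad[symmetric]) (simp_all add: mlin)
 finally show ?thesis .
qed

abbreviation "BY == self_yd B"
abbreviation "CoB b == tev Db B (coact BY b)"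

lemma BY_simps: "carr BY = carr B" "scal BY = scal B" "mul BY = mul B" "unity BY = unity B"
 by (simp_all add: self_yd_def)

lemma BY_vs: "tensor Db BY = tensor Db B" "tpure Db BY = tpure Db B" "tev Db BY = tev Db B"
 "lin_map V BY = lin_map V B" "lin_map BY W = lin_map B W" "bilin_map Db BY BY = bilin_map Db B B" "sep BY = sep B"
 by (simp_all add: t_cong[OF refl refl BY_simps(1,2)] tp_cong[OF refl refl BY_simps(1,2)]
  tev_cong_vs[OF refl refl BY_simps(1,2)] lin_cong[OF refl refl BY_simps(1,2)]
  lin_cong[OF BY_simps(1,2) refl refl] bil_cong[OF refl refl BY_simps(1,2) BY_simps(1,2)] sep_def[abs_def] vspace_def BY_simps)

lemma BY_act_bilin1: "b : carr B ==> bilin_map D B B (%mu m. la mu (ad m b))"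
 "mu : carr D ==> m : carr B ==> lin_map B B (%b. la mu (ad m b))"
 by (simp_all add: mlin lin_S')

lemma BY_act: assumes b: "b : carr B" shows "act BY h b = tlift D B (%mu m. la mu (ad m b)) h"
proof -
 have "sw B m (%m1 m2. m1**b**S m2) = ad m b" if "m : carr B" for m
  unfolding ad_def by (rule sw_eq[OF _ vs that]) (simp add: mlin lin_B b)
 then show ?thesis unfolding self_yd_def yd.simps la_def by (auto intro!: tlift_cong)
qed

lemma BYa_p: "b : carr B ==> mu : carr D ==> m : carr B ==> act BY (mu >< m) b = la mu (ad m b)"
 by (simp add: BY_act tl_pure[OF BY_act_bilin1(1) vsD vs])

lemma BYa_bil: "bilin_map Db B B (act BY)"
 unfolding bilin_map_def
proof (intro conjI ballI)
 fix b assume b: "b : carr B"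
 show "lin_map Db B (%h. act BY h b)"
  unfolding BY_act[OF b] linDb by (rule lin_tlift[OF BY_act_bilin1(1)[OF b] vsD vs])
next
 fix h assume h: "h : carr Db"
 have "lin_map B B (%b. tlift D B (%mu m. la mu (ad m b)) h)"
  by (rule lin_tlb[OF vsD vs _ BY_act_bilin1(1) BY_act_bilin1(2) vs]) (use h in "auto simp: Db_vs")
 then show "lin_map B B (act BY h)"
  using vs_add[OF vs] vs_scal[OF vs] by (auto simp: lin_map_def BY_act)
qed

lemmas BY_act_in = bilD(1)[OF BYa_bil]

lemma BY_coact_bilin: "bilin_map B B (tensor Db B) (%b1 b2. tpure Db B (unity D >< b1) b2)"
 by (simp add: mlin lin_E)

lemma BY_coact: "coact BY b = tlift B B (%b1 b2. tpure Db B (unity D >< b1) b2) (cop B b)"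
 by (simp add: self_yd_def sw_def)

lemma BY_coact_lin: "lin_map B (tensor Db B) (coact BY)"
 unfolding BY_coact[abs_def] by (rule lin_tla[OF lin_cop_H BY_coact_bilin vs vs_t])

lemma BY_coact_in: "b : carr B ==> coact BY b : carr (tensor Db B)"
 by (rule linD(1)[OF BY_coact_lin])

lemma BYc_ev:
 assumes ph: "biform Db B ph" and b: "b : carr B"
 shows "CoB b ph = Sw b (%b1 b2. ph (unity D >< b1) b2)"
 unfolding BY_coact
 by (subst tl_pull[OF lin_ta[OF ph vsDb vs_g] BY_coact_bilin vs vs_t cop_in[OF b]], rule Swc[OF b], rule tevp[OF ph vsDb vs_g], simp_all add: lin_E)

lemma Ep_biform: "a : carr B ==> form B p ==> form B ka ==> biform Db B (%g z. E a ka g * p z)"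
 by (simp add: mlin lin_E E_form)

lemma BY_coact_Ep:
 assumes "b : carr B" "a : carr B" "form B p" "form B ka"
 shows "CoB b (%g z. E a ka g * p z) = cou B a * star ka p b"
 unfolding BYc_ev[OF Ep_biform[OF assms(2-4)] assms(1)] star_def tevL
 by (rule Swc[OF assms(1)]) (simp add: E_pure assms d1_in d1E mult_ac)

lemma BY_act_mul_pure:
 assumes b: "b : carr B" and mu: "mu : carr D" and m: "m : carr B" and nu: "nu : carr D" and n: "n : carr B"
 shows "act BY (mul Db (mu >< m) (nu >< n)) b = act BY (mu >< m) (act BY (nu >< n) b)"
proof (rule eq_by_forms)
 fix ka assume ka: "form B ka"
 note [simp] = lin_S' assms lin_o[OF _ ka] ka BY_act_in
 have A: "form Db (%h. ka (act BY h b))"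
  by (rule lin_o[OF _ ka]) (use BYa_bil b in "simp add: bilin_map_def")
 have "ka (act BY (mul Db (mu >< m) (nu >< n)) b) = Sw3 m (%m1 m2 m3. ka (act BY (dterm mu m nu n m1 m2 m3) b))"
  unfolding double_mul_pure[OF mu m nu n] dmul_def
  by (subst tev_pull[OF A vsDb vs cop_in[OF m]], rule tev_in[OF vs vsDb], simp, simp add: dterm_def Db_vs, rule Swc[OF m],
   subst tev_pull[OF A vsDb vs cop_in], simp, simp add: dterm_def Db_vs, rule refl)
 also have "... = Sw3 m (%m1 m2 m3. ka (la mu (la (hit_right B (hit B m1 nu) (T m3)) (ad m2 (ad n b)))))"
  by (rule Swc[OF m], rule Swc, assumption) (simp add: dterm_def BYa_p la_la ad_ad)
 also have "... = ka (la mu (ad m (la nu (ad n b))))"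
  by (rule ad_la[where ka = "%z. ka (la mu z)", symmetric]) simp_all
 finally show "ka (act BY (mul Db (mu >< m) (nu >< n)) b) = ka (act BY (mu >< m) (act BY (nu >< n) b))"
  by (simp add: BYa_p)
qed (simp_all add: lin_S' assms BY_act_in)

lemma BY_act_prod_pure:
 assumes mu: "mu : carr D" and m: "m : carr B" and x: "x : carr B" and y: "y : carr B" and ka: "form B ka"
 shows "ka (act BY (mu >< m) (x**y)) = SwDb (mu >< m) (%h1 h2. ka (act BY h1 x**act BY h2 y))" (is "?L = ?R")
proof -
 note [simp] = lin_S' assms lin_o[OF _ ka] BY_act_in bilL[OF BYa_bil]
 have "?L = Sw m (%m1 m2. ka (la mu (ad m1 x**ad m2 y)))"
  unfolding BYa_p[OF mul_in[OF x y] mu m] by (rule form_ad_mul[where ka = "%z. ka (la mu z)"]) simp_all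
 also have "... = Sw m (%m1 m2. SwD mu (%mu1 mu2. ka (la mu2 (ad m1 x)**la mu1 (ad m2 y))))"
  by (rule Swc[OF m], rule form_la_mul) simp_all
 also have "... = SwD mu (%mu1 mu2. Sw m (%m1 m2. ka (la mu2 (ad m1 x)**la mu1 (ad m2 y))))"
  by (rule tevs)
 also have "... = SwD mu (%mu1 mu2. Sw m (%m1 m2. ka (act BY (mu2 >< m1) x**act BY (mu1 >< m2) y)))"
  by (rule SwDc[OF mu], rule Swc[OF m]) (simp add: BYa_p)
 also have "... = ?R"
  by (rule copDb_p[symmetric]) (simp_all add: mlin)
 finally show ?thesis .
qed

text \<open>The part of \<open>mu\<close> is absorbed into the bilinear form \<open>?Ps\<close>,
  after which the claim is \<open>ad_condition\<close>. On the left hand side this needs the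
  cancellation of u T(c1), where u comes from the product in the double and c1 from
  \<open>la\<close>.\<close>

lemma BY_condition_pure:
 assumes mu: "mu : carr D" and m: "m : carr B" and b: "b : carr B" and a: "a : carr B" and ka: "form B ka" and p: "form B p"
 shows "SwDb (mu >< m) (%h1 h2. CoB (act BY h1 b) (%g z. E a ka (mul Db g h2) * p z))
  = SwDb (mu >< m) (%h1 h2. CoB b (%g z. E a ka (mul Db h1 g) * p (act BY h2 z)))" (is "?L = ?R")
proof -
 note [simp] = lin_S' assms lin_o[OF _ ka] lin_o[OF _ p] BY_act_in bilL[OF BYa_bil]
  bilR[OF BYa_bil] lin_o[OF _ dform[OF mu]] lin_o[OF _ BY_coact_lin] BY_coact_in
 let ?Ps = "%v r. ka v * Sw r (%w y. mu (T w**a) * p y)"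
 have bi1: "biform Db B (%g z. E a ka (mul Db g h2) * p z)" if "h2 : carr Db" for h2
  using that by (simp add: mlin)
 have bi2: "biform Db B (%g z. E a ka (mul Db h1 g) * p (act BY h2 z))" if "h1 : carr Db" "h2 : carr Db" for h1 h2
  using that by (simp add: mlin)
 let ?J = "%mu1 m2 c. Sw c (%c0 y. Sw3 c0 (%u v w. mu1 (T w**(a**u)) * (ka (v**m2) * p y)))"
 have J: "form B (?J mu1 m2)" if "mu1 : carr D" "m2 : carr B" for mu1 m2
  using that by (simp add: mlin lin_o[OF _ dform[OF that(1)]])
 have "?L = SwD mu (%mu1 mu2. Sw m (%m1 m2. CoB (act BY (mu2 >< m1) b) (%g z. E a ka (mul Db g (mu1 >< m2)) * p z)))"
  by (rule copDb_p) (simp_all add: mlin)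
 also have "... = SwD mu (%mu1 mu2. Sw m (%m1 m2. Sw (ad m1 b) (%c1 r0. mu2 (T c1) * ?J mu1 m2 r0)))"
 proof (rule SwDc[OF mu], rule Swc[OF m])
  fix mu1 mu2 m1 m2 assume mm[simp]: "mu1 : carr D" "mu2 : carr D" "m1 : carr B" "m2 : carr B"
  have "CoB (act BY (mu2 >< m1) b) (%g z. E a ka (mul Db g (mu1 >< m2)) * p z) = ?J mu1 m2 (la mu2 (ad m1 b))" (is "?Z = _")
   by (subst BYc_ev[OF bi1], simp, simp, simp add: BYa_p, rule Swc, simp)
    (simp add: E_mul_eps, simp only: tevR, rule Swc, simp, rule Swc, simp, simp add: mult_ac)
  also have "... = Sw (ad m1 b) (%c1 r0. mu2 (T c1) * ?J mu1 m2 r0)"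
   by (rule form_la[OF J]) simp_all
  finally show "?Z = ..." .
 qed
 also have "... = Sw m (%m1 m2. Sw3 (ad m1 b) (%c1 c0 y. Sw c0 (%u r. Sw r (%v w.
   SwD mu (%mu1 mu2. mu2 (T c1) * (mu1 (T w**(a**u)) * (ka (v**m2) * p y)))))))"
  by (simp only: tevL, simp only: tevs[where s = "cop D mu"])
 also have "... = Sw m (%m1 m2. Sw (ad m1 b) (%v r. ?Ps (v**m2) r))"
 proof (rule Swc[OF m])
  fix m1 m2 assume mm[simp]: "m1 : carr B" "m2 : carr B"
  let ?c = "ad m1 b"
  let ?b = "%c1 u v w y. mu (T w**(a**(u**T c1))) * (ka (v**m2) * p y)"
  have "Sw ?c (%c1 r0. Sw r0 (%c0 y. Sw c0 (%u r. Sw r (%v w. SwD mu (%mu1 mu2. mu2 (T c1) * (mu1 (T w**(a**u)) * (ka (v**m2) * p y)))))))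
   = Sw ?c (%c1 r0. Sw r0 (%c0 y. Sw3 c0 (%u v w. ?b c1 u v w y)))" (is "?Z = _")
  proof (rule Swc, simp, rule Swc, simp, rule Swc, simp, rule Swc, simp)
   fix c1 r0 c0 y u r v w assume [simp]: "c1 : carr B" "u : carr B" "v : carr B" "w : carr B"
   show "SwD mu (%mu1 mu2. mu2 (T c1) * (mu1 (T w**(a**u)) * (ka (v**m2) * p y))) = ?b c1 u v w y"
    using cop_dual2[OF mu, of "T w**(a**u)" "T c1" 1 1 1 "ka (v**m2) * p y"] by (simp add: mul_assoc)
  qed
  also have "... = Sw ?c (%c1 r0. Sw3 r0 (%u r y. Sw r (%v w. ?b c1 u v w y)))"
   by (rule Swc, simp, rule coassoc) (simp_all add: mlin)
  also have "... = Sw ?c (%r y. Sw r (%v w. mu (T w**(a**one)) * (ka (v**m2) * p y)))"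
   by (rule collapse_head[OF T_col(2), where psi = "%u q. Sw q (%r y. Sw r (%v w. mu (T w**(a**u)) * (ka (v**m2) * p y)))"])
    (simp_all add: mlin)
  also have "... = Sw ?c (%v r. Sw r (%w y. mu (T w**(a**one)) * (ka (v**m2) * p y)))"
   by (rule coassoc) (simp_all add: mlin)
  also have "... = Sw ?c (%v r. ?Ps (v**m2) r)"
   unfolding tevL by (rule Swc, simp, rule Swc) (simp_all add: mul_one mult_ac)
  finally show "?Z = ..." .
 qed
 also have "... = Sw m (%m1 m2. Sw b (%b1 b2. ?Ps (m1**b1) (ad m2 b2)))"
  by (rule ad_condition) (simp_all add: mlin)
 finally have L: "?L = ..." .
 have "?R = SwD mu (%mu1 mu2. Sw m (%m1 m2. CoB b (%g z. E a ka (mul Db (mu2 >< m1) g) * p (act BY (mu1 >< m2) z))))"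
  by (rule copDb_p) (simp_all add: mlin)
 also have "... = SwD mu (%mu1 mu2. Sw m (%m1 m2. Sw b (%b1 b2. Sw (ad m2 b2) (%w y. mu2 a * ka (m1**b1) * (mu1 (T w) * p y)))))"
 proof (rule SwDc[OF mu], rule Swc[OF m])
  fix mu1 mu2 m1 m2 assume mm[simp]: "mu1 : carr D" "mu2 : carr D" "m1 : carr B" "m2 : carr B"
  show "CoB b (%g z. E a ka (mul Db (mu2 >< m1) g) * p (act BY (mu1 >< m2) z))
   = Sw b (%b1 b2. Sw (ad m2 b2) (%w y. mu2 a * ka (m1**b1) * (mu1 (T w) * p y)))"
   by (subst BYc_ev[OF bi2], simp, simp, simp, rule Swc, simp) (simp add: double_mul_right_pure E_pure BYa_p form_la tevL)
 qed
 also have "... = Sw m (%m1 m2. Sw b (%b1 b2. Sw (ad m2 b2) (%w y. SwD mu (%mu1 mu2. mu2 a * ka (m1**b1) * (mu1 (T w) * p y)))))"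
  by (simp only: tevs[where s = "cop D mu"])
 also have "... = Sw m (%m1 m2. Sw b (%b1 b2. ?Ps (m1**b1) (ad m2 b2)))"
  unfolding tevL by (rule Swc[OF m], rule Swc[OF b], rule Swc, simp, subst cop_dual3[OF mu]) (simp_all add: mult_ac)
 finally show ?thesis using L by simp
qed

theorem yd_self: "yd_module_algebra Db BY"
proof (rule yd_module_algebraI[where H = Db and X = BY, unfolded BY_vs BY_simps, OF bia_Db _ BYa_bil
  BY_coact_lin sep_double sep_forms[OF vs]])
 show "assoc_algebra BY" using alg assoc_algebra_cong[OF BY_simps] by simp
next
 fix b assume "b : carr B"
 then show "act BY (unity Db) b = b"
  unfolding Db_one by (simp add: BYa_p d1_in one_in la_one ad_one)
next
 fix g h b assume g: "g : carr Db" and h: "h : carr Db" and b: "b : carr B"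
 note [simp] = lin_E lin_id bilL[OF BYa_bil] bilR[OF BYa_bil] BY_act_in
 have pure: "act BY (mul Db (mu >< m) h) b = act BY (mu >< m) (act BY h b)" if "mu : carr D" "m : carr B" for mu m
  by (rule dbl_eqI[where f = "%h. act BY (mul Db (mu >< m) h) b" and U = B]) (simp_all add: h b that BY_act_mul_pure)
 show "act BY (mul Db g h) b = act BY g (act BY h b)"
  by (rule dbl_eqI[where f = "%g. act BY (mul Db g h) b" and U = B]) (simp_all add: g h b pure)
next
 fix h assume h: "h : carr Db"
 show "act BY h one = scal B (cou Db h) one"
 proof (rule dbl_eqI[where f = "%h. act BY h one" and U = B, OF _ _ h])
  show "lin_map Db B (%h. act BY h one)" by (rule bilL[OF BYa_bil lin_id one_in])
  show "lin_map Db B (%h. scal B (cou Db h) one)" by (rule lscL[OF cou_double_form vs one_in])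
  fix mu m assume "mu : carr D" "m : carr B"
  then show "act BY (mu >< m) one = scal B (cou Db (mu >< m)) one"
   by (simp add: BYa_p one_in ad_of_one linD(3)[OF la_lin] la_of_one vs_scal_scal vs couDbE pr_in E_pure cou_form mult.commute)
 qed
next
 fix h x y p assume h: "h : carr Db" and "x : carr B" "y : carr B" "p : {f. form B f}"
 then have x: "x : carr B" "y : carr B" and p: "form B p" by auto
 note [simp] = lin_E lin_id bilL[OF BYa_bil] bilR[OF BYa_bil] BY_act_in lin_o[OF _ p] x p
 show "p (act BY h (x**y)) = SwDb h (%h1 h2. p (act BY h1 x**act BY h2 y))"
  by (rule dbl_eqI[where f = "%h. p (act BY h (x**y))" and U = ground]) (simp_all add: h BY_act_prod_pure mlin lin_cop_double)
next
 fix b f f' p assume "b : carr B" "f : EF" "f' : EF" "p : {f. form B f}"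
 then obtain a ka c ka' where ac: "a : carr B" "c : carr B" and b: "b : carr B" and k: "form B ka" "form B ka'" "form B p"
  and f: "f = E a ka" "f' = E c ka'" unfolding EF_def by blast
 have "CoB b (%g z. SwDb g (%a b. f a * (f' b * p z))) = CoB b (%g z. E (c**a) (star ka ka') g * p z)" (is "?Z = _")
  by (rule tevc[OF vsDb BY_coact_in[OF b]]) (simp add: f mult.assoc[symmetric] tevR[symmetric] copEE ac k)
 also have "... = cou B (c**a) * star (star ka ka') p b"
  by (rule BY_coact_Ep) (simp_all add: b ac k mul_in star_form)
 also have "star (star ka ka') p b = star ka (star ka' p) b"
  unfolding star_def tevL tevR mult.assoc
  by (rule coassoc[OF _ b]) (simp add: mlin fmL fmR k)
 also have "cou B (c**a) * ... = cou B c * CoB b (%g z. E a ka g * star ka' p z)"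
  by (subst BY_coact_Ep) (simp_all add: b ac k star_form cou_mul)
 also have "... = CoB b (%g z. CoB z (%h w. f g * (f' h * p w)))"
  unfolding tevL
  by (rule tevc[OF vsDb BY_coact_in[OF b]]) (simp only: f tevL[symmetric], simp add: BY_coact_Ep ac k)
 finally show "?Z = ..." .
next
 fix b p assume "b : carr B" "p : {f. form B f}"
 then have b: "b : carr B" and p: "form B p" by auto
 have "CoB b (%g z. cou Db g * p z) = CoB b (%g z. E one (cou B) g * p z)"
  by (rule tevc[OF vsDb BY_coact_in[OF b]]) (simp add: couDbE)
 then show "CoB b (%g z. cou Db g * p z) = p b"
  by (simp add: BY_coact_Ep b p one_in cou_form cou_one star_def couL)
next
 fix x y f p assume "x : carr B" "y : carr B" "f : EF" "p : {f. form B f}"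
 then obtain a ka where a: "a : carr B" and k: "form B ka" "form B p"
  and f: "f = E a ka" and x: "x : carr B" "y : carr B" unfolding EF_def by blast
 note [simp] = lin_E a k x lin_o[OF _ k(1)] lin_o[OF _ k(2)]
 have bi: "biform Db B (%g z. E a ka g * p z)" by (rule Ep_biform) simp_all
 note bi' = bil_tm[OF double_alg alg vs_g bi]
 have "CoB (x**y) (%g z. f g * p z) = Sw (x**y) (%u v. E a ka (unity D >< u) * p v)" (is "?Z = _")
  unfolding f by (rule BYc_ev[OF bi]) simp
 also have "... = Sw x (%x1 x2. Sw y (%y1 y2. E a ka (unity D >< (x1**y1)) * p (x2**y2)))"
  by (rule Sw_mul) (simp_all add: mlin)
 also have "... = Sw x (%x1 x2. Sw y (%y1 y2. E a ka (mul Db (unity D >< x1) (unity D >< y1)) * p (x2**y2)))"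
  by (rule Swc, simp, rule Swc) (simp_all add: double_mul_right_pure)
 also have "... = CoB x (%g z. CoB y (%h w. f (mul Db g h) * p (z**w)))"
  unfolding f
  by (subst BYc_ev[OF bi'(2)[OF BY_coact_in]], simp, simp, rule Swc, simp, subst BYc_ev[OF bi'(1)]) simp_all
 finally show "?Z = ..." .
next
 show "coact BY one = tpure Db B (unity Db) one"
  unfolding BY_coact cop_one Db_one by (rule tl_pure[OF BY_coact_bilin vs vs_t one_in one_in])
next
 fix h b f p assume h: "h : carr Db" and "b : carr B" "f : EF" "p : {f. form B f}"
 then obtain a ka where a: "a : carr B" and k: "form B ka" "form B p"
  and f: "f = E a ka" and b: "b : carr B" unfolding EF_def by blast
 note [simp] = lin_E lin_id bilL[OF BYa_bil] bilR[OF BYa_bil] BY_act_in a b k lin_o[OF _ k(2)] lin_o[OF _ BY_coact_lin] BY_coact_in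
 have "SwDb h (%h1 h2. CoB (act BY h1 b) (%g z. E a ka (mul Db g h2) * p z))
  = SwDb h (%h1 h2. CoB b (%g z. E a ka (mul Db h1 g) * p (act BY h2 z)))"
  by (rule dbl_eqI[where f = "%h. SwDb h (%h1 h2. CoB (act BY h1 b) (%g z. E a ka (mul Db g h2) * p z))" and U = ground, OF _ _ h])
   (simp_all add: BY_condition_pure mlin lin_cop_double)
 then show "SwDb h (%h1 h2. CoB (act BY h1 b) (%g z. f (mul Db g h2) * p z))
   = SwDb h (%h1 h2. CoB b (%g z. f (mul Db h1 g) * p (act BY h2 z)))"
  unfolding f .
qed

end

section \<open>Braided product of two factors\<close>

text \<open>The braided product of two factors: y passes z at the cost of y_(-1) acting on z. The
  factors may have different element types, so that the second can itself be a tensor product over a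
  family.\<close>

definition "bprod H X Y = (|carr = carr (tensor X Y), scal = fun_scal, mul = (%s t. tlift X Y (%x y. tlift X Y (%z w. tlift H Y
    (%g y0. tpure X Y (mul X x (act X g z)) (mul Y y0 w)) (coact Y y)) t) s), unity = tpure X Y (unity X) (unity Y),
   act = (%h. tlift X Y (%x y. sw H h (%h1 h2. tpure X Y (act X h1 x) (act Y h2 y)))), coact = tlift X Y (%x y. tlift H X (%g x0. tlift H Y
    (%k y0. tpure H (tensor X Y) (mul H g k) (tpure X Y x0 y0)) (coact Y y)) (coact X x))|)"

locale yd2 = X: ydalg H X + Y: ydalg H Y
 for H :: "('k::field, 'h::ab_group_add, 'z) bialg_scheme"
  and X :: "('k, 'h, 'x::ab_group_add, 'c) yd_scheme"
  and Y :: "('k, 'h, 'y::ab_group_add, 'd) yd_scheme"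
begin

abbreviation "P == bprod H X Y"
abbreviation "XY == tensor X Y"
abbreviation "PC t == tev H (tensor X Y) (coact P t)"
abbreviation pr :: "'x => 'y => ('k, 'x, 'y) tens" (infix "><" 65) where "x >< y == tpure X Y x y"
abbreviation "Sw h ph == tev H H (cop H h) ph"
abbreviation "Sw3 h ph == Sw h (%a r. Sw r (%b c. ph a b c))"

lemma P_vs: "carr P = carr XY" "scal P = scal XY"
 by (simp_all add: bprod_def)

lemma P_vspace: "vspace P"
 using vs_t[of X Y] by (simp add: vspace_def P_vs del: vs_t)

lemma P_cong: "lin_map V P = lin_map V XY" "lin_map P U = lin_map XY U"
 "tensor H P = tensor H XY" "tpure H P = tpure H XY" "tev H P = tev H XY"
 by (simp_all only: lin_cong[OF refl refl P_vs] lin_cong[OF P_vs refl refl]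
  t_cong[OF refl refl P_vs] tp_cong[OF refl refl P_vs] tev_cong_vs[OF refl refl P_vs])

lemma P_bicong: "bilin_map P P P = bilin_map XY XY XY" "bilin_map H P P = bilin_map H XY XY"
 by (rule bil_cong[OF P_vs P_vs P_vs], rule bil_cong[OF refl refl P_vs P_vs])

lemma P_sep: "sep P F = sep XY F"
 by (simp add: sep_def P_cong P_vs P_vspace)

lemmas lin_XY = lin_id ltpL ltpR X.vs X.X_vs Y.X_vs lmL[OF X.alg] lmR[OF X.alg] lmL[OF X.X_alg] lmR[OF X.X_alg]
 lmL[OF Y.X_alg] lmR[OF Y.X_alg] bilL[OF X.act_bilin] bilR[OF X.act_bilin] bilL[OF Y.act_bilin] bilR[OF Y.act_bilin]
 lin_o[OF _ X.coact_lin] lin_o[OF _ Y.coact_lin] lin_cop[OF X.bialg] lin_cou[OF X.bialg] lin_ta' lin_tb fmL fmR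
 X.mul_in X.one_in X.cop_in X.X_mul_in X.X_one_in Y.X_mul_in Y.X_one_in X.act_in Y.act_in X.coact_in Y.coact_in tpI

lemma eq_on_pure:
 assumes "lin_map XY U f" "lin_map XY U g" "t : carr XY"
  and "!!x y. x : carr X ==> y : carr Y ==> f (x >< y) = g (x >< y)"
 shows "f t = g t"
 using lin_map_eq_on_pure[OF X.X_vs Y.X_vs, of U f g t] assms by simp

definition "FG = {%t. tev X Y t (%x y. p x * q y) |p q. form X p & form Y q}"

lemma sep_FG: "sep XY FG"
 using sep_tensor[OF sep_forms[OF X.X_vs] sep_forms[OF Y.X_vs]] by (simp add: FG_def)

lemma pq_biform: "form X p ==> form Y q ==> biform X Y (%x y. p x * q y)"
 by (simp add: mlin fmL fmR)

lemma FG_E: assumes "p : FG" obtains ph where "biform X Y ph" "!!t. tev X Y t ph = p t"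
 using assms pq_biform unfolding FG_def by fast

lemma XY_eqI: "s : carr XY ==> t : carr XY ==> (!!ph. biform X Y ph ==> tev X Y s ph = tev X Y t ph) ==> s = t"
 by (rule sep_eqI[OF sep_FG]) (auto simp: FG_def pq_biform)

lemma form_tev: "biform X Y ph ==> form XY (%t. tev X Y t ph)"
 by (rule lin_ta[OF _ X.X_vs vs_g])

lemma tev_pure: "biform X Y ph ==> x : carr X ==> y : carr Y ==> tev X Y (x >< y) ph = ph x y"
 by (rule tevp[OF _ X.X_vs vs_g])

subsection \<open>Product\<close>

definition "bm x y z w = Y.Co y (%g y0. mul X x (act X g z) >< mul Y y0 w)"

lemma bm_bilin: "x : carr X ==> y : carr Y ==> bilin_map X Y XY (bm x y)"
 "z : carr X ==> w : carr Y ==> bilin_map X Y XY (%x y. bm x y z w)"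
 unfolding bm_def by (simp_all add: mlin lin_XY)

lemma P_mul: "mul P s t = tlift X Y (%x y. tlift X Y (bm x y) t) s"
proof -
 have "tlift H Y (%g y0. mul X x (act X g z) >< mul Y y0 w) (coact Y y) = bm x y z w"
  if "x : carr X" "y : carr Y" "z : carr X" "w : carr Y" for x y z w
  unfolding bm_def by (rule tl_tev[where U = "XY"]) (simp_all add: mlin lin_XY that)
 then show ?thesis unfolding bprod_def alg.simps by (auto intro!: tlift_cong)
qed

lemma P_mul_bilin1: "t : carr XY ==> bilin_map X Y XY (%x y. tlift X Y (bm x y) t)"
 unfolding bilin_map_def
 by (intro conjI ballI lin_tlb) (auto simp: X.X_vs Y.X_vs bm_bilin intro: bm_bilin(2)[unfolded bilin_map_def, THEN conjunct1, rule_format]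
   bm_bilin(2)[unfolded bilin_map_def, THEN conjunct2, rule_format])

lemma P_mul_bilin: "bilin_map XY XY XY (mul P)"
 unfolding bilin_map_def P_mul
proof (intro conjI ballI)
 fix s assume s: "s : carr XY"
 show "lin_map XY XY (%t. tlift X Y (%x y. tlift X Y (bm x y) t) s)"
  by (intro lin_tlb P_mul_bilin1 lin_tlift bm_bilin) (use s in "auto simp: X.X_vs Y.X_vs")
 show "lin_map XY XY (%t. tlift X Y (%x y. tlift X Y (bm x y) s) t)"
  by (intro lin_tlift P_mul_bilin1) (use s in "auto simp: X.X_vs")
qed

lemmas P_mul_in = bilD(1)[OF P_mul_bilin]
lemmas lin_Pmul = bilL[OF P_mul_bilin] bilR[OF P_mul_bilin]

lemma P_mul_pure: "x : carr X ==> y : carr Y ==> z : carr X ==> w : carr Y ==> mul P (x >< y) (z >< w) = bm x y z w"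
 unfolding P_mul
 by (simp add: tl_pure[OF P_mul_bilin1 X.X_vs vs_t] tpI tl_pure[OF bm_bilin(1) X.X_vs vs_t])

lemma form_bm: assumes "form XY f" "x : carr X" "y : carr Y" "z : carr X" "w : carr Y"
 shows "f (mul P (x >< y) (z >< w)) = Y.Co y (%g y0. f (mul X x (act X g z) >< mul Y y0 w))"
 unfolding P_mul_pure[OF assms(2-5)] bm_def
 by (rule tev_pull[OF assms(1) vs_t X.vs Y.coact_in]) (simp_all add: lin_XY assms)

lemma tev_bm: assumes ph: "biform X Y ph" and "x : carr X" "y : carr Y" "z : carr X" "w : carr Y"
 shows "tev X Y (mul P (x >< y) (z >< w)) ph = Y.Co y (%g y0. ph (mul X x (act X g z)) (mul Y y0 w))"
 unfolding form_bm[OF form_tev[OF ph] assms(2-5)]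
 by (rule Y.Co_cong) (simp_all add: tev_pure ph lin_XY assms)

text \<open>The left side expands by multiplicativity of the coaction of \<open>Y\<close>, the right
  side by the module algebra property of \<open>X\<close>. Coassociativity of the coaction of
  \<open>Y\<close> identifies the results.\<close>

lemma P_assoc_pure:
 assumes "x : carr X" "y : carr Y" "z : carr X" "w : carr Y" "u : carr X" "v : carr Y"
 shows "mul P (mul P (x >< y) (z >< w)) (u >< v) = mul P (x >< y) (mul P (z >< w) (u >< v))"
proof (rule XY_eqI)
 fix ph assume ph: "biform X Y ph"
 note [simp] = lin_XY assms bilL[OF ph] bilR[OF ph] P_mul_in lin_o[OF _ form_tev[OF ph]] lin_Pmul
 let ?f = "%t. tev X Y t ph"
 let ?b = "%g k1 y1 k2 w0. ph (mul X x (mul X (act X g z) (act X (mul H k1 k2) u))) (mul Y y1 (mul Y w0 v))"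
 have "?f (mul P (mul P (x >< y) (z >< w)) (u >< v)) = Y.Co y (%g y0. ?f (mul P (mul X x (act X g z) >< mul Y y0 w) (u >< v)))"
  by (rule form_bm[where f = "%t. ?f (mul P t (u >< v))"]) simp_all
 also have "... = Y.Co y (%g y0. Y.Co (mul Y y0 w) (%k c0. ph (mul X (mul X x (act X g z)) (act X k u)) (mul Y c0 v)))"
  by (rule Y.Co_cong, simp, rule tev_bm[OF ph]) simp_all
 also have "... = Y.Co y (%g y0. Y.Co y0 (%k1 y1. Y.Co w (%k2 w0. ?b g k1 y1 k2 w0)))"
  by (rule Y.Co_cong, simp, subst Y.Co_mul, simp add: mlin, simp, simp, rule Y.Co_cong, simp, rule Y.Co_cong)
   (simp_all add: X.X_mul_assoc Y.X_mul_assoc)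
 finally have L: "?f (mul P (mul P (x >< y) (z >< w)) (u >< v)) = ..." .
 have "?f (mul P (x >< y) (mul P (z >< w) (u >< v))) = Y.Co w (%k w0. ?f (mul P (x >< y) (mul X z (act X k u) >< mul Y w0 v)))"
  by (rule form_bm[where f = "%t. ?f (mul P (x >< y) t)"]) simp_all
 also have "... = Y.Co w (%k w0. Y.Co y (%g y0. ph (mul X x (act X g (mul X z (act X k u)))) (mul Y y0 (mul Y w0 v))))"
  by (rule Y.Co_cong, simp, rule tev_bm[OF ph]) simp_all
 also have "... = Y.Co w (%k w0. Y.Co y (%g y0. Sw g (%g1 g2. ?b g1 g2 y0 k w0)))"
  by (rule Y.Co_cong, simp, rule Y.Co_cong, simp, subst X.act_prod[where p = "%t. ph (mul X x t) _"], simp_all,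
   rule X.Swc) (simp_all add: X.act_mul)
 also have "... = Y.Co y (%g y0. Sw g (%g1 g2. Y.Co w (%k w0. ?b g1 g2 y0 k w0)))"
  by (simp only: tevs[where s = "coact Y w"])
 also have "... = Y.Co y (%g1 y'. Y.Co y' (%g2 y0. Y.Co w (%k w0. ?b g1 g2 y0 k w0)))"
  by (rule Y.Co_coassoc) (simp_all add: mlin)
 finally show "?f (mul P (mul P (x >< y) (z >< w)) (u >< v)) = ?f (mul P (x >< y) (mul P (z >< w) (u >< v)))"
  using L by simp
qed (simp_all add: P_mul_in tpI assms)

lemma P_one: "unity P = unity X >< unity Y" by (simp add: bprod_def)

lemma P_one_in: "unity P : carr XY" by (simp add: P_one lin_XY)

lemma P_left_pure: assumes "x : carr X" "z : carr X" "w : carr Y"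
 shows "mul P (x >< unity Y) (z >< w) = mul X x z >< w"
proof (rule XY_eqI)
 fix ph assume ph: "biform X Y ph"
 note [simp] = lin_XY assms bilL[OF ph] bilR[OF ph]
 show "tev X Y (mul P (x >< unity Y) (z >< w)) ph = tev X Y (mul X x z >< w) ph"
  by (subst tev_bm[OF ph], simp_all, subst Y.Co_one) (simp_all add: mlin tev_pure ph X.act_one Y.X_one_mul)
qed (simp_all add: P_mul_in lin_XY assms)

lemma P_right_pure: assumes "x : carr X" "y : carr Y" "w : carr Y"
 shows "mul P (x >< y) (unity X >< w) = x >< mul Y y w"
proof (rule XY_eqI)
 fix ph assume ph: "biform X Y ph"
 note [simp] = lin_XY assms bilL[OF ph] bilR[OF ph]
 have "tev X Y (mul P (x >< y) (unity X >< w)) ph = Y.Co y (%g y0. cou H g * ph x (mul Y y0 w))"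
  by (subst tev_bm[OF ph], simp_all, rule Y.Co_cong) (simp_all add: X.act_unity bilD(5)[OF algD(2)[OF X.X_alg]] bilD(4)[OF ph] X.X_mul_one)
 also have "... = ph x (mul Y y w)" by (rule Y.Co_counit) simp_all
 finally show "tev X Y (mul P (x >< y) (unity X >< w)) ph = tev X Y (x >< mul Y y w) ph"
  by (simp add: tev_pure ph)
qed (simp_all add: P_mul_in lin_XY assms)

lemma P_alg: "assoc_algebra P"
proof -
 have assoc: "mul P (mul P x y) z = mul P x (mul P y z)"
  if x: "x : carr XY" and y: "y : carr XY" and z: "z : carr XY" for x y z
  by (rule eq_on_pure[where f = "%x. mul P (mul P x y) z" and t = x and U = "XY"], (intro lin_Pmul lin_id x y z P_mul_in)+,
   rule eq_on_pure[where f = "%y. mul P (mul P _ y) z" and t = y and U = "XY"], (intro lin_Pmul lin_id tpI x y z P_mul_in; assumption)+,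
   rule eq_on_pure[where f = "%z. mul P (mul P _ _) z" and t = z and U = "XY"], (intro lin_Pmul lin_id tpI x y z P_mul_in; assumption)+,
   rule P_assoc_pure, assumption+)
 have left: "mul P (unity P) x = x" if x: "x : carr XY" for x
  by (rule eq_on_pure[where f = "%x. mul P (unity P) x" and g = "%x. x" and U = "XY"])
   (simp_all add: lin_Pmul lin_id P_one_in x, simp add: P_one P_left_pure X.X_one_in X.X_one_mul)
 have right: "mul P x (unity P) = x" if x: "x : carr XY" for x
  by (rule eq_on_pure[where f = "%x. mul P x (unity P)" and g = "%x. x" and U = "XY"])
   (simp_all add: lin_Pmul lin_id P_one_in x, simp add: P_one P_right_pure Y.X_one_in Y.X_mul_one)
 show ?thesis
  unfolding assoc_algebra_def P_bicong
  using P_mul_bilin P_one_in assoc left right by (simp add: P_vs P_vspace)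
qed

subsection \<open>Action\<close>

definition "ba h x y = Sw h (%h1 h2. act X h1 x >< act Y h2 y)"

lemma ba_bilin: "h : carr H ==> bilin_map X Y XY (ba h)" "x : carr X ==> y : carr Y ==> lin_map H XY (%h. ba h x y)"
 unfolding ba_def by (simp_all add: mlin lin_XY)

lemma P_act: assumes "h : carr H" shows "act P h t = tlift X Y (ba h) t"
proof -
 have "sw H h (%h1 h2. act X h1 x >< act Y h2 y) = ba h x y" if "x : carr X" "y : carr Y" for x y
  unfolding ba_def by (rule X.sw_eq[where U = "XY"]) (simp_all add: mlin lin_XY that assms)
 then show ?thesis unfolding bprod_def yd.simps by (auto intro!: tlift_cong)
qed

lemma P_act_bilin: "bilin_map H XY XY (act P)"
 unfolding bilin_map_def
proof (intro conjI ballI)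
 fix h assume h: "h : carr H"
 show "lin_map XY XY (act P h)"
  using lin_tlift[OF ba_bilin(1)[OF h] X.X_vs vs_t] by (simp add: lin_map_def P_act[OF h])
next
 fix t assume t: "t : carr XY"
 have "lin_map H XY (%h. tlift X Y (ba h) t)"
  by (rule lin_tlb[OF X.X_vs vs_t t ba_bilin X.vs])
 then show "lin_map H XY (%h. act P h t)"
  using vs_add[OF X.vs] vs_scal[OF X.vs] by (simp add: lin_map_def P_act)
qed

lemmas P_act_in = bilD(1)[OF P_act_bilin]
lemmas lin_Pact = bilL[OF P_act_bilin] bilR[OF P_act_bilin]

lemma P_act_pure: "h : carr H ==> x : carr X ==> y : carr Y ==> act P h (x >< y) = ba h x y"
 by (simp add: P_act tl_pure[OF ba_bilin(1) X.X_vs vs_t])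

lemma form_ba: assumes "form XY f" "h : carr H" "x : carr X" "y : carr Y"
 shows "f (act P h (x >< y)) = Sw h (%h1 h2. f (act X h1 x >< act Y h2 y))"
 unfolding P_act_pure[OF assms(2-4)] ba_def
 by (rule tev_pull[OF assms(1) vs_t X.vs X.cop_in]) (simp_all add: lin_XY assms)

lemma tev_ba: assumes ph: "biform X Y ph" and "h : carr H" "x : carr X" "y : carr Y"
 shows "tev X Y (act P h (x >< y)) ph = Sw h (%h1 h2. ph (act X h1 x) (act Y h2 y))"
 unfolding form_ba[OF form_tev[OF ph] assms(2-4)]
 by (rule X.Swc) (simp_all add: tev_pure ph lin_XY assms)

lemma P_act_one: assumes t: "t : carr XY" shows "act P (unity H) t = t"
proof (rule eq_on_pure[where f = "act P (unity H)" and g = "%t. t" and U = "XY", OF _ lin_id t])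
 show "lin_map XY XY (act P (unity H))"
  using P_act_bilin X.one_in by (simp add: bilin_map_def)
 fix x y assume xy: "x : carr X" "y : carr Y"
 show "act P (unity H) (x >< y) = x >< y"
 proof (rule XY_eqI)
  fix ph assume ph: "biform X Y ph"
  note [simp] = lin_XY xy bilL[OF ph] bilR[OF ph]
  show "tev X Y (act P (unity H) (x >< y)) ph = tev X Y (x >< y) ph"
   by (subst tev_ba[OF ph], simp_all, subst X.Sw_one) (simp_all add: mlin X.act_one Y.act_one tev_pure ph)
 qed (simp_all add: P_act_in lin_XY xy)
qed

lemma P_act_mul: assumes g: "g : carr H" and h: "h : carr H" and t: "t : carr XY"
 shows "act P (mul H g h) t = act P g (act P h t)"
proof (rule eq_on_pure[where f = "%t. act P (mul H g h) t" and U = "XY", OF _ _ t])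
 fix x y assume xy: "x : carr X" "y : carr Y"
 note [simp] = lin_XY xy g h P_act_in lin_Pact
 show "act P (mul H g h) (x >< y) = act P g (act P h (x >< y))"
 proof (rule XY_eqI)
  fix ph assume ph: "biform X Y ph"
  note [simp] = bilL[OF ph] bilR[OF ph] lin_o[OF _ form_tev[OF ph]]
  have "tev X Y (act P (mul H g h) (x >< y)) ph = Sw g (%g1 g2. Sw h (%h1 h2.
    ph (act X (mul H g1 h1) x) (act Y (mul H g2 h2) y)))" (is "?Z = _")
   by (subst tev_ba[OF ph], simp_all, rule X.Sw_mul) (simp_all add: mlin)
  also have "... = Sw h (%h1 h2. Sw g (%g1 g2. ph (act X (mul H g1 h1) x) (act Y (mul H g2 h2) y)))"
   by (rule tevs)
  also have "... = Sw h (%h1 h2. tev X Y (act P g (act X h1 x >< act Y h2 y)) ph)"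
   by (rule X.Swc, simp, subst tev_ba[OF ph], simp_all, rule X.Swc) (simp_all add: X.act_mul Y.act_mul)
  also have "... = tev X Y (act P g (act P h (x >< y))) ph"
   by (rule form_ba[where f = "%t. tev X Y (act P g t) ph", symmetric]) simp_all
  finally show "?Z = ..." .
 qed simp_all
qed (simp_all add: lin_Pact lin_id X.mul_in g h)

lemma P_act_unity: assumes h: "h : carr H" shows "act P h (unity P) = fun_scal (cou H h) (unity P)"
proof (rule XY_eqI)
 fix ph assume ph: "biform X Y ph"
 note [simp] = lin_XY h bilL[OF ph] bilR[OF ph] X.cou_form
 have "tev X Y (act P h (unity P)) ph = Sw h (%h1 h2. cou H h1 * (cou H h2 * ph (unity X) (unity Y)))" (is "?Z = _")
  unfolding P_one by (subst tev_ba[OF ph], simp_all, rule X.Swc) (simp_all add: X.act_unity Y.act_unity bilD(4,5)[OF ph] vs_scal)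
 also have "... = cou H h * ph (unity X) (unity Y)" by (rule X.couL) simp_all
 also have "... = tev X Y (fun_scal (cou H h) (unity P)) ph"
  unfolding P_one using linD(3)[OF form_tev[OF ph], of "unity X >< unity Y" "cou H h"]
  by (simp add: tev_pure ph)
 finally show "?Z = ..." .
qed (use vs_scal[OF vs_t P_one_in] h in "simp_all add: P_act_in P_one_in")

text \<open>The action must pass the coaction of y that is used in the product; this is the
  Yetter-Drinfeld condition of \<open>Y\<close>.\<close>

lemma P_act_prod_pure:
 assumes h: "h : carr H" and xy: "x : carr X" "y : carr Y" "z : carr X" "w : carr Y" and ph: "biform X Y ph"
 shows "tev X Y (act P h (mul P (x >< y) (z >< w))) ph
  = Sw h (%h1 h2. tev X Y (mul P (act P h1 (x >< y)) (act P h2 (z >< w))) ph)" (is "?L = ?R")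
proof -
 note [simp] = lin_XY xy h P_act_in lin_Pact lin_Pmul P_mul_in bilL[OF ph] bilR[OF ph] lin_o[OF _ form_tev[OF ph]]
 let ?b = "%a b g c y0 d. ph (mul X (act X a x) (act X (mul H b g) z)) (mul Y (act Y c y0) (act Y d w))"
 let ?C = "Sw3 h (%a u d. Sw u (%b c. Y.Co y (%g y0. ?b a b g c y0 d)))"
 have "?L = Y.Co y (%g y0. tev X Y (act P h (mul X x (act X g z) >< mul Y y0 w)) ph)"
  by (rule form_bm[where f = "%t. tev X Y (act P h t) ph"]) simp_all
 also have "... = Y.Co y (%g y0. Sw h (%h1 h2. ph (act X h1 (mul X x (act X g z))) (act Y h2 (mul Y y0 w))))"
  by (rule Y.Co_cong, simp, rule tev_ba[OF ph]) simp_all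
 also have "... = Y.Co y (%g y0. Sw h (%h1 h2. Sw h1 (%a b. Sw h2 (%c d. ?b a b g c y0 d))))"
 proof (rule Y.Co_cong, simp, rule X.Swc, simp)
  fix g y0 h1 h2 assume [simp]: "g : carr H" "y0 : carr Y" "h1 : carr H" "h2 : carr H"
  have "ph (act X h1 (mul X x (act X g z))) (act Y h2 (mul Y y0 w))
   = Sw h1 (%a b. ph (mul X (act X a x) (act X b (act X g z))) (act Y h2 (mul Y y0 w)))" (is "?Z = _")
   by (rule X.act_prod[where p = "%t. ph t _"]) simp_all
  also have "... = Sw h1 (%a b. Sw h2 (%c d. ph (mul X (act X a x) (act X b (act X g z))) (mul Y (act Y c y0) (act Y d w))))"
   by (rule X.Swc, simp, rule Y.act_prod[where p = "%t. ph _ t"]) simp_all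
  also have "... = Sw h1 (%a b. Sw h2 (%c d. ?b a b g c y0 d))"
   by (rule X.Swc, simp, rule X.Swc) (simp_all add: X.act_mul)
  finally show "?Z = ..." .
 qed
 also have "... = Sw h (%h1 h2. Sw h1 (%a b. Sw h2 (%c d. Y.Co y (%g y0. ?b a b g c y0 d))))"
  by (simp only: tevs[where s = "coact Y y"])
 also have "... = Sw3 h (%a b s. Sw s (%c d. Y.Co y (%g y0. ?b a b g c y0 d)))"
  by (rule X.coassoc) (simp_all add: mlin)
 also have "... = ?C"
  by (rule X.Swc, simp, rule X.coassoc[symmetric]) (simp_all add: mlin)
 finally have L: "?L = ?C" .
 have "?R = Sw h (%h1 h2. Sw h1 (%a b. Sw h2 (%c d. tev X Y (mul P (act X a x >< act Y b y) (act X c z >< act Y d w)) ph)))"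
 proof (rule X.Swc, simp)
  fix h1 h2 assume [simp]: "h1 : carr H" "h2 : carr H"
  have "tev X Y (mul P (act P h1 (x >< y)) (act P h2 (z >< w))) ph
   = Sw h1 (%a b. tev X Y (mul P (act X a x >< act Y b y) (act P h2 (z >< w))) ph)" (is "?Z = _")
   by (rule form_ba[where f = "%t. tev X Y (mul P t _) ph"]) simp_all
  also have "... = Sw h1 (%a b. Sw h2 (%c d. tev X Y (mul P (act X a x >< act Y b y) (act X c z >< act Y d w)) ph))"
   by (rule X.Swc, simp, rule form_ba[where f = "%t. tev X Y (mul P _ t) ph"]) simp_all
  finally show "?Z = ..." .
 qed
 also have "... = Sw h (%h1 h2. Sw h1 (%a b. Sw h2 (%c d. Y.Co (act Y b y) (%g y0.
   ph (mul X (act X a x) (act X (mul H g c) z)) (mul Y y0 (act Y d w))))))"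
  by (rule X.Swc, simp, rule X.Swc, simp, rule X.Swc, simp, subst tev_bm[OF ph], simp_all, rule Y.Co_cong) (simp_all add: X.act_mul)
 also have "... = Sw3 h (%a b s. Sw s (%c d. Y.Co (act Y b y) (%g y0.
   ph (mul X (act X a x) (act X (mul H g c) z)) (mul Y y0 (act Y d w)))))"
  by (rule X.coassoc) (simp_all add: mlin)
 also have "... = Sw3 h (%a u d. Sw u (%b c. Y.Co (act Y b y) (%g y0.
   ph (mul X (act X a x) (act X (mul H g c) z)) (mul Y y0 (act Y d w)))))"
  by (rule X.Swc, simp, rule X.coassoc[symmetric]) (simp_all add: mlin)
 also have "... = ?C"
  by (rule X.Swc, simp, rule X.Swc, simp, rule Y.Co_yd[where ph = "%g y0. ph (mul X (act X _ x) (act X g z)) (mul Y y0 (act Y _ w))"])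
   (simp_all add: mlin)
 finally show ?thesis using L by simp
qed

subsection \<open>Coaction\<close>

definition "bc x y = X.Co x (%g x0. Y.Co y (%k y0. tpure H XY (mul H g k) (x0 >< y0)))"

lemma bc_bilin: "bilin_map X Y (tensor H XY) bc"
 unfolding bc_def by (simp add: mlin lin_XY)

lemma P_coact: "coact P t = tlift X Y bc t"
proof -
 let ?t = "%g x0 k y0. tpure H XY (mul H g k) (x0 >< y0)"
 have 1: "tlift H Y (?t g x0) (coact Y y) = Y.Co y (?t g x0)"
  if "g : carr H" "x0 : carr X" "y : carr Y" for g x0 y
  by (rule tl_tev[where U = "tensor H XY"]) (simp_all add: mlin lin_XY that)
 have "tlift H X (%g x0. tlift H Y (?t g x0) (coact Y y)) (coact X x) = bc x y" if xy: "x : carr X" "y : carr Y" for x y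
 proof -
  have "tlift H X (%g x0. tlift H Y (?t g x0) (coact Y y)) (coact X x) = tlift H X (%g x0. Y.Co y (?t g x0)) (coact X x)"
   by (rule tlift_cong) (simp add: 1 xy)
  also have "... = bc x y" unfolding bc_def
   by (rule tl_tev[where U = "tensor H XY"]) (simp_all add: mlin lin_XY xy)
  finally show ?thesis .
 qed
 then show ?thesis unfolding bprod_def yd.simps by (auto intro!: tlift_cong)
qed

lemma P_coact_lin: "lin_map XY (tensor H XY) (coact P)"
 unfolding P_coact[abs_def] by (rule lin_tlift[OF bc_bilin X.X_vs vs_t])

lemmas P_coact_in = linD(1)[OF P_coact_lin]

lemma P_coact_pure: "x : carr X ==> y : carr Y ==> coact P (x >< y) = bc x y"
 unfolding P_coact by (rule tl_pure[OF bc_bilin X.X_vs vs_t])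

lemma tev_bc: assumes Ph: "biform H XY Ph" and xy: "x : carr X" "y : carr Y"
 shows "PC (x >< y) Ph = X.Co x (%g x0. Y.Co y (%k y0. Ph (mul H g k) (x0 >< y0)))"
proof -
 note p = tev_pull[OF lin_ta[OF Ph X.vs vs_g] vs_t]
 note [simp] = lin_XY xy
 show ?thesis unfolding P_coact_pure[OF xy] bc_def
  by (subst p[OF X.vs X.coact_in[OF xy(1)]], rule tev_in[OF X.vs vs_t], simp, simp, rule X.Co_cong[OF xy(1)], subst p[OF X.vs Y.coact_in[OF xy(2)]],
   simp, rule Y.Co_cong[OF xy(2)], rule tevp[OF Ph X.vs vs_g], simp_all)
qed

lemma P_coassoc_pure:
 assumes xy: "x : carr X" "y : carr Y" and f: "form H f" "form H f'" and ph: "biform X Y ph"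
 shows "PC (x >< y) (%g z. Sw g (%a b. f a * (f' b * tev X Y z ph)))
  = PC (x >< y) (%g z. PC z (%h w. f g * (f' h * tev X Y w ph)))" (is "?L = ?R")
proof -
 note [simp] = lin_XY xy lin_o[OF _ f(1)] lin_o[OF _ f(2)] lin_o[OF _ form_tev[OF ph]] lin_o[OF _ P_coact_lin]
  P_coact_in bilL[OF ph] bilR[OF ph]
 let ?b = "%g1 g2 x0 k1 k2 y0. f (mul H g1 k1) * (f' (mul H g2 k2) * ph x0 y0)"
 have "?L = X.Co x (%g x0. Y.Co y (%k y0. Sw (mul H g k) (%a b. f a * (f' b * tev X Y (x0 >< y0) ph))))"
  by (rule tev_bc) (simp_all add: mlin)
 also have "... = X.Co x (%g x0. Y.Co y (%k y0. Sw g (%g1 g2. Sw k (%k1 k2. ?b g1 g2 x0 k1 k2 y0))))"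
  by (rule X.Co_cong, simp, rule Y.Co_cong, simp, subst X.Sw_mul) (simp_all add: mlin tev_pure ph)
 also have "... = X.Co x (%g x0. Sw g (%g1 g2. Y.Co y (%k y0. Sw k (%k1 k2. ?b g1 g2 x0 k1 k2 y0))))"
  by (rule X.Co_cong, simp, rule tevs)
 also have "... = X.Co x (%g1 x'. X.Co x' (%g2 x0. Y.Co y (%k y0. Sw k (%k1 k2. ?b g1 g2 x0 k1 k2 y0))))"
  by (rule X.Co_coassoc) (simp_all add: mlin)
 also have "... = X.Co x (%g1 x'. X.Co x' (%g2 x0. Y.Co y (%k1 y'. Y.Co y' (%k2 y0. ?b g1 g2 x0 k1 k2 y0))))"
  by (rule X.Co_cong, simp, rule X.Co_cong, simp, rule Y.Co_coassoc) (simp_all add: mlin)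
 also have "... = X.Co x (%g1 x'. Y.Co y (%k1 y'. X.Co x' (%g2 x0. Y.Co y' (%k2 y0. ?b g1 g2 x0 k1 k2 y0))))"
  by (rule X.Co_cong, simp, rule tevs)
 also have "... = X.Co x (%g1 x'. Y.Co y (%k1 y'. PC (x' >< y') (%h w. f (mul H g1 k1) * (f' h * tev X Y w ph))))"
  by (rule X.Co_cong, simp, rule Y.Co_cong, simp, subst tev_bc, simp add: mlin, simp, simp, rule X.Co_cong, simp, rule Y.Co_cong)
   (simp_all add: tev_pure ph)
 also have "... = ?R"
  by (rule tev_bc[symmetric]) (simp_all add: mlin)
 finally show ?thesis .
qed

lemma P_counit_pure:
 assumes xy: "x : carr X" "y : carr Y" and ph: "biform X Y ph"
 shows "PC (x >< y) (%g z. cou H g * tev X Y z ph) = tev X Y (x >< y) ph" (is "?L = _")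
proof -
 note [simp] = lin_XY xy lin_o[OF _ form_tev[OF ph]] bilL[OF ph] bilR[OF ph]
 have "?L = X.Co x (%g x0. Y.Co y (%k y0. cou H (mul H g k) * tev X Y (x0 >< y0) ph))"
  by (rule tev_bc) (simp_all add: mlin)
 also have "... = X.Co x (%g x0. cou H g * Y.Co y (%k y0. cou H k * ph x0 y0))"
  by (rule X.Co_cong, simp, subst tevL, rule Y.Co_cong) (simp_all add: X.cou_mul tev_pure ph)
 also have "... = X.Co x (%g x0. cou H g * ph x0 y)"
  by (rule X.Co_cong, simp, subst Y.Co_counit) simp_all
 also have "... = ph x y" by (rule X.Co_counit) simp_all
 finally show ?thesis by (simp add: tev_pure ph)
qed

text \<open>Dually to the action, the coaction of y_(-1) acting on z has to be computed; this is the
  Yetter-Drinfeld condition of \<open>X\<close>.\<close>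

lemma P_co_mul_pure:
 assumes xy: "x : carr X" "y : carr Y" "z : carr X" "w : carr Y" and f: "form H f" and ph: "biform X Y ph"
 shows "PC (mul P (x >< y) (z >< w)) (%g t. f g * tev X Y t ph)
  = PC (x >< y) (%g s. PC (z >< w) (%h t. f (mul H g h) * tev X Y (mul P s t) ph))" (is "?L = ?R")
proof -
 note [simp] = lin_XY xy lin_o[OF _ f(1)] lin_o[OF _ form_tev[OF ph]] lin_o[OF _ P_coact_lin]
  P_coact_in bilL[OF ph] bilR[OF ph] P_mul_in lin_Pmul
 let ?w = "%x1 x0 a z0 y1 y0. Y.Co w (%b w0. f (mul H (mul H x1 (mul H a y1)) b) * ph (mul X x0 z0) (mul Y y0 w0))"
 let ?b = "%x1 x0 y1 g y0 a z0 b w0. f (mul H (mul H x1 (mul H y1 a)) b) * ph (mul X x0 (act X g z0)) (mul Y y0 w0)"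
 let ?C = "X.Co x (%x1 x0. Y.Co y (%G y0. Sw G (%y1 g. X.Co z (%a z0. Y.Co w (%b w0. ?b x1 x0 y1 g y0 a z0 b w0)))))"
 have F: "form XY (%t. PC t (%g t. f g * tev X Y t ph))"
  by (simp add: mlin)
 have "?L = Y.Co y (%g y0. PC (mul X x (act X g z) >< mul Y y0 w) (%g t. f g * tev X Y t ph))"
  by (rule form_bm[OF F]) simp_all
 also have "... = Y.Co y (%g y0. X.Co (mul X x (act X g z)) (%a u. Y.Co (mul Y y0 w) (%b v. f (mul H a b) * ph u v)))"
  by (rule Y.Co_cong, simp, subst tev_bc, simp add: mlin, simp, simp, rule X.Co_cong, simp, rule Y.Co_cong) (simp_all add: tev_pure ph)
 also have "... = Y.Co y (%g y'. X.Co x (%x1 x0. X.Co (act X g z) (%a z0. Y.Co y' (%y1 y0. ?w x1 x0 a z0 y1 y0))))"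
 proof (rule Y.Co_cong, simp)
  fix g y' assume [simp]: "g : carr H" "y' : carr Y"
  have "X.Co (mul X x (act X g z)) (%a u. Y.Co (mul Y y' w) (%b v. f (mul H a b) * ph u v))
   = X.Co x (%x1 x0. X.Co (act X g z) (%a z0. Y.Co (mul Y y' w) (%b v. f (mul H (mul H x1 a) b) * ph (mul X x0 z0) v)))" (is "?Z = _")
   by (rule X.Co_mul) (simp_all add: mlin)
  also have "... = X.Co x (%x1 x0. X.Co (act X g z) (%a z0. Y.Co y' (%y1 y0. Y.Co w (%b w0.
   f (mul H (mul H x1 a) (mul H y1 b)) * ph (mul X x0 z0) (mul Y y0 w0)))))"
   by (rule X.Co_cong, simp, rule X.Co_cong, simp, rule Y.Co_mul) (simp_all add: mlin)
  also have "... = X.Co x (%x1 x0. X.Co (act X g z) (%a z0. Y.Co y' (%y1 y0. ?w x1 x0 a z0 y1 y0)))"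
   by (rule X.Co_cong, simp, rule X.Co_cong, simp, rule Y.Co_cong, simp, rule Y.Co_cong) (simp_all add: X.mul_assoc)
  finally show "?Z = ..." .
 qed
 also have "... = X.Co x (%x1 x0. Y.Co y (%g y'. X.Co (act X g z) (%a z0. Y.Co y' (%y1 y0. ?w x1 x0 a z0 y1 y0))))"
  by (rule tevs)
 also have "... = X.Co x (%x1 x0. Y.Co y (%g y'. Y.Co y' (%y1 y0. X.Co (act X g z) (%a z0. ?w x1 x0 a z0 y1 y0))))"
  by (rule X.Co_cong, simp, rule Y.Co_cong, simp, rule tevs)
 also have "... = X.Co x (%x1 x0. Y.Co y (%G y0. Sw G (%g y1. X.Co (act X g z) (%a z0. ?w x1 x0 a z0 y1 y0))))"
  by (rule X.Co_cong, simp, rule Y.Co_coassoc[symmetric]) (simp_all add: mlin)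
 also have "... = ?C"
  by (rule X.Co_cong, simp, rule Y.Co_cong, simp, rule X.Co_yd[where ph = "%u z0. Y.Co w (%b w0.
   f (mul H (mul H _ u) b) * ph (mul X _ z0) (mul Y _ w0))"]) (simp_all add: mlin)
 finally have L: "?L = ?C" .
 have "?R = X.Co x (%x1 x0. Y.Co y (%y1 y'. PC (z >< w) (%h t. f (mul H (mul H x1 y1) h) * tev X Y (mul P (x0 >< y') t) ph)))"
  by (rule tev_bc) (simp_all add: mlin)
 also have "... = X.Co x (%x1 x0. Y.Co y (%y1 y'. X.Co z (%a z0. Y.Co w (%b w0. Y.Co y' (%g y0. ?b x1 x0 y1 g y0 a z0 b w0)))))"
 proof (rule X.Co_cong, simp, rule Y.Co_cong, simp)
  fix x1 x0 y1 y' assume [simp]: "x1 : carr H" "x0 : carr X" "y1 : carr H" "y' : carr Y"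
  have "PC (z >< w) (%h t. f (mul H (mul H x1 y1) h) * tev X Y (mul P (x0 >< y') t) ph)
   = X.Co z (%a z0. Y.Co w (%b w0. f (mul H (mul H x1 y1) (mul H a b)) * tev X Y (mul P (x0 >< y') (z0 >< w0)) ph))" (is "?Z = _")
   by (rule tev_bc) (simp_all add: mlin)
  also have "... = X.Co z (%a z0. Y.Co w (%b w0. Y.Co y' (%g y0. ?b x1 x0 y1 g y0 a z0 b w0)))"
   by (rule X.Co_cong, simp, rule Y.Co_cong, simp, subst tev_bm[OF ph]) (simp_all add: tevL X.mul_assoc)
  finally show "?Z = ..." .
 qed
 also have "... = X.Co x (%x1 x0. Y.Co y (%y1 y'. Y.Co y' (%g y0. X.Co z (%a z0. Y.Co w (%b w0. ?b x1 x0 y1 g y0 a z0 b w0)))))"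
 proof (rule X.Co_cong, simp, rule Y.Co_cong, simp)
  fix x1 x0 y1 y'
  show "X.Co z (%a z0. Y.Co w (%b w0. Y.Co y' (%g y0. ?b x1 x0 y1 g y0 a z0 b w0)))
   = Y.Co y' (%g y0. X.Co z (%a z0. Y.Co w (%b w0. ?b x1 x0 y1 g y0 a z0 b w0)))"
   by (simp only: tevs[where t = "coact Y y'"])
 qed
 also have "... = ?C"
  by (rule X.Co_cong, simp, rule Y.Co_coassoc[symmetric]) (simp_all add: mlin)
 finally show ?thesis using L by simp
qed

text \<open>The last leg of \<open>h\<close> is moved to the left past y by the condition of
  \<open>Y\<close>, then past x by the condition of \<open>X\<close>.\<close>

lemma P_condition_pure:
 assumes h: "h : carr H" and xy: "x : carr X" "y : carr Y" and f: "form H f" and ph: "biform X Y ph"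
 shows "Sw h (%h1 h2. PC (act P h1 (x >< y)) (%g z. f (mul H g h2) * tev X Y z ph))
  = Sw h (%h1 h2. PC (x >< y) (%g z. f (mul H h1 g) * tev X Y (act P h2 z) ph))" (is "?L = ?R")
proof -
 note [simp] = lin_XY xy h lin_o[OF _ f(1)] lin_o[OF _ form_tev[OF ph]] lin_o[OF _ P_coact_lin]
  P_coact_in bilL[OF ph] bilR[OF ph] P_act_in lin_Pact
 let ?u = "%a b c. X.Co (act X a x) (%g x0. Y.Co (act Y b y) (%k y0. f (mul H g (mul H k c)) * ph x0 y0))"
 let ?v = "%a b c. X.Co x (%g x0. Y.Co y (%k y0. f (mul H (mul H a g) k) * ph (act X b x0) (act Y c y0)))"
 have "?L = Sw h (%h1 c. Sw h1 (%a b. ?u a b c))"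
 proof (rule X.Swc, simp)
  fix h1 h2 assume [simp]: "h1 : carr H" "h2 : carr H"
  have F: "form XY (%t. PC t (%g z. f (mul H g h2) * tev X Y z ph))"
   by (simp add: mlin)
  show "PC (act P h1 (x >< y)) (%g z. f (mul H g h2) * tev X Y z ph) = Sw h1 (%a b. ?u a b h2)"
   by (subst form_ba[OF F], simp_all, rule X.Swc, simp, subst tev_bc, simp add: mlin, simp, simp, rule X.Co_cong, simp, rule Y.Co_cong)
    (simp_all add: tev_pure ph X.mul_assoc)
 qed
 also have "... = Sw3 h (%a b c. ?u a b c)"
  by (rule X.coassoc) (simp_all add: mlin)
 also have "... = Sw3 h (%a b c. Y.Co (act Y b y) (%k y0. X.Co (act X a x) (%g x0. f (mul H g (mul H k c)) * ph x0 y0)))"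
  by (rule X.Swc, simp, rule X.Swc, simp, rule tevs)
 also have "... = Sw3 h (%a b c. Y.Co y (%k y0. X.Co (act X a x) (%g x0. f (mul H g (mul H b k)) * ph x0 (act Y c y0))))"
  by (rule X.Swc, simp, rule Y.Co_yd[where ph = "%u y0. X.Co (act X _ x) (%g x0. f (mul H g u) * ph x0 y0)"]) (simp_all add: mlin)
 also have "... = Sw h (%s c. Sw s (%a b. Y.Co y (%k y0. X.Co (act X a x) (%g x0. f (mul H g (mul H b k)) * ph x0 (act Y c y0)))))"
  by (rule X.coassoc[symmetric]) (simp_all add: mlin)
 also have "... = Sw h (%s c. Y.Co y (%k y0. Sw s (%a b. X.Co (act X a x) (%g x0. f (mul H (mul H g b) k) * ph x0 (act Y c y0)))))"
  by (rule X.Swc, simp, subst tevs, rule Y.Co_cong, simp, rule X.Swc, simp, rule X.Co_cong) (simp_all add: X.mul_assoc)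
 also have "... = Sw h (%s c. Y.Co y (%k y0. Sw s (%a b. X.Co x (%g x0. f (mul H (mul H a g) k) * ph (act X b x0) (act Y c y0)))))"
  by (rule X.Swc, simp, rule Y.Co_cong, simp, rule X.Co_yd[where ph = "%u x0. f (mul H u _) * ph x0 (act Y _ _)"]) (simp_all add: mlin)
 also have "... = Sw h (%s c. Sw s (%a b. ?v a b c))"
  by (rule X.Swc, simp) (simp only: tevs[where s = "coact Y y"])
 also have "... = Sw3 h (%a b c. ?v a b c)"
  by (rule X.coassoc) (simp_all add: mlin)
 also have "... = ?R"
 proof (rule X.Swc, simp)
  fix a r assume [simp]: "a : carr H" "r : carr H"
  have "PC (x >< y) (%g z. f (mul H a g) * tev X Y (act P r z) ph)
   = X.Co x (%g x0. Y.Co y (%k y0. f (mul H a (mul H g k)) * tev X Y (act P r (x0 >< y0)) ph))"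
   by (rule tev_bc) (simp_all add: mlin)
  also have "... = X.Co x (%g x0. Y.Co y (%k y0. Sw r (%b c. f (mul H (mul H a g) k) * ph (act X b x0) (act Y c y0))))"
   by (rule X.Co_cong, simp, rule Y.Co_cong, simp, subst tev_ba[OF ph]) (simp_all add: tevL X.mul_assoc)
  also have "... = Sw r (%b c. ?v a b c)"
   by (simp only: tevs[where t = "cop H r"])
  finally show "Sw r (%b c. ?v a b c) = PC (x >< y) (%g z. f (mul H a g) * tev X Y (act P r z) ph)" by simp
 qed
 finally show ?thesis .
qed

theorem yd_bprod: "yd_module_algebra H P"
proof -
 note [simp] = lin_XY P_coact_in P_act_in lin_Pact P_mul_in lin_Pmul lin_o[OF _ P_coact_lin] mlin X.cou_form
 note form = sepD(2)[OF sep_FG]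
 show ?thesis
 proof (rule yd_module_algebraI[where H = H and X = P, unfolded P_vs P_cong P_bicong P_sep, OF X.bialg P_alg P_act_bilin
   P_coact_lin sep_forms[OF X.vs] sep_FG])
  have "coact P (unity P) = bc (unity X) (unity Y)" unfolding P_one by (rule P_coact_pure) simp_all
  also have "... = tpure H XY (unity H) (unity X >< unity Y)"
   unfolding bc_def X.coact_unity Y.coact_unity
   by (subst tevp[where U = "tensor H XY"], simp_all) (subst tevp[where U = "tensor H XY"], simp_all add: X.one_mul)
  finally show "coact P (unity P) = tpure H XY (unity H) (unity P)" unfolding P_one .
 next
  fix h x y p assume [simp]: "h : carr H" "x : carr XY" "y : carr XY" and p: "p : FG"
  obtain ph where ph: "biform X Y ph" "!!t. tev X Y t ph = p t" by (rule FG_E[OF p]) (rule that)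
  note [simp] = lin_o[OF _ form[OF p]]
  have pure: "p (act P h (mul P (u >< v) y)) = Sw h (%h1 h2. p (mul P (act P h1 (u >< v)) (act P h2 y)))"
   if "u : carr X" "v : carr Y" for u v
   by (rule eq_on_pure[where f = "%y. p (act P h (mul P (u >< v) y))" and U = ground])
    (simp_all add: that P_act_prod_pure[OF _ _ _ _ _ ph(1), unfolded ph(2)])
  show "p (act P h (mul P x y)) = Sw h (%h1 h2. p (mul P (act P h1 x) (act P h2 y)))"
   by (rule eq_on_pure[where f = "%x. p (act P h (mul P x y))" and U = ground]) (simp_all add: pure)
 next
  fix x f f' p assume [simp]: "x : carr XY" and f: "f : {f. form H f}" "f' : {f. form H f}" and p: "p : FG"
  obtain ph where ph: "biform X Y ph" "!!t. tev X Y t ph = p t" by (rule FG_E[OF p]) (rule that)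
  note f = f[simplified] note [simp] = lin_o[OF _ form[OF p]] lin_o[OF _ f(1)] lin_o[OF _ f(2)]
  show "PC x (%g z. Sw g (%a b. f a * (f' b * p z))) = PC x (%g z. PC z (%h w. f g * (f' h * p w)))"
   by (rule eq_on_pure[where f = "%x. PC x (%g z. Sw g (%a b. f a * (f' b * p z)))" and U = ground])
    (simp_all add: P_coassoc_pure[OF _ _ f ph(1), unfolded ph(2)])
 next
  fix x p assume [simp]: "x : carr XY" and p: "p : FG"
  obtain ph where ph: "biform X Y ph" "!!t. tev X Y t ph = p t" by (rule FG_E[OF p]) (rule that)
  note [simp] = lin_o[OF _ form[OF p]] form[OF p]
  show "PC x (%g z. cou H g * p z) = p x"
   by (rule eq_on_pure[where f = "%x. PC x (%g z. cou H g * p z)" and g = p and U = ground])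
    (simp_all add: P_counit_pure[OF _ _ ph(1), unfolded ph(2)])
 next
  fix x y f p assume [simp]: "x : carr XY" "y : carr XY" and f: "f : {f. form H f}" and p: "p : FG"
  obtain ph where ph: "biform X Y ph" "!!t. tev X Y t ph = p t" by (rule FG_E[OF p]) (rule that)
  note f = f[simplified] note [simp] = lin_o[OF _ form[OF p]] lin_o[OF _ f]
  have pure: "PC (mul P (u >< v) y) (%g z. f g * p z) = PC (u >< v) (%g z. PC y (%h w. f (mul H g h) * p (mul P z w)))"
   if "u : carr X" "v : carr Y" for u v
   by (rule eq_on_pure[where f = "%y. PC (mul P (u >< v) y) (%g z. f g * p z)" and U = ground])
    (simp_all add: that P_co_mul_pure[OF _ _ _ _ f ph(1), unfolded ph(2)])
  show "PC (mul P x y) (%g z. f g * p z) = PC x (%g z. PC y (%h w. f (mul H g h) * p (mul P z w)))"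
   by (rule eq_on_pure[where f = "%x. PC (mul P x y) (%g z. f g * p z)" and U = ground]) (simp_all add: pure)
 next
  fix h x f p assume [simp]: "h : carr H" "x : carr XY" and f: "f : {f. form H f}" and p: "p : FG"
  obtain ph where ph: "biform X Y ph" "!!t. tev X Y t ph = p t" by (rule FG_E[OF p]) (rule that)
  note f = f[simplified] note [simp] = lin_o[OF _ form[OF p]] lin_o[OF _ f]
  show "Sw h (%h1 h2. PC (act P h1 x) (%g z. f (mul H g h2) * p z)) = Sw h (%h1 h2. PC x (%g z. f (mul H h1 g) * p (act P h2 z)))"
   by (rule eq_on_pure[where f = "%x. Sw h (%h1 h2. PC (act P h1 x) (%g z. f (mul H g h2) * p z))" and U = ground])
    (simp_all add: P_condition_pure[OF _ _ _ f ph(1), unfolded ph(2)])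
 qed (auto simp: P_act_one P_act_mul P_act_unity)
qed

end

section \<open>Tensor products of families\<close>

definition "multilin I X U ph \<longleftrightarrow> (ALL x:Pi\<^sub>E I (%i. carr (X i)). ph x : carr U &
   (ALL i:I. lin_map (X i) U (%v. ph (x(i := v)))))"

abbreviation "PE I X == Pi\<^sub>E I (%i. carr (X i))"

lemma multilinD:
 assumes "multilin I X U ph" "x : PE I X"
 shows "ph x : carr U" "i : I ==> lin_map (X i) U (%v. ph (x(i := v)))"
 using assms by (auto simp: multilin_def)

lemma mlf_eq: "multilin_form I X = multilin I X ground"
 by (simp add: multilin_form_def[abs_def] multilin_def[abs_def])

lemma PE_upd: "x : PE I X ==> i : I ==> v : carr (X i) ==> x(i := v) : PE I X"
 by (auto simp: PiE_iff extensional_def)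

lemma multilin_comp: "multilin I X U ph ==> lin_map U U' f ==> multilin I X U' (%x. f (ph x))"
 using lin_o linD(1) unfolding multilin_def by blast

lemma mlin_mp: "multilin I X (mtensor I X) (mpure I X)"
 unfolding multilin_def
proof (intro ballI conjI)
 fix x assume x: "x : PE I X"
 have in': "mpure I X y : carr (mtensor I X)" if "y : PE I X" for y
  using that by (auto simp: mtensor_def intro!: fun_vs.span_base)
 then show "mpure I X x : carr (mtensor I X)" using x .
 fix i assume i: "i : I"
 show "lin_map (X i) (mtensor I X) (%v. mpure I X (x(i := v)))"
  unfolding lin_map_def
 proof (intro conjI ballI allI)
  fix v assume v: "v : carr (X i)"
  show "mpure I X (x(i := v)) : carr (mtensor I X)" by (rule in'[OF PE_upd[OF x i v]])
  show "mpure I X (x(i := scal (X i) c v)) = scal (mtensor I X) c (mpure I X (x(i := v)))" for c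
   using x i v linD(3)[where W = ground and V = "X i"]
   by (auto simp: mpure_def fun_eq_iff mlf_eq dest!: multilinD(2)[of I X ground _ x i])
  fix w assume w: "w : carr (X i)"
  show "mpure I X (x(i := v + w)) = mpure I X (x(i := v)) + mpure I X (x(i := w))"
   using x i v w linD(2)[where W = ground and V = "X i"]
   by (auto simp: mpure_def fun_eq_iff mlf_eq dest!: multilinD(2)[of I X ground _ x i])
 qed
qed

lemmas mpure_in = multilinD(1)[OF mlin_mp]

definition "msum I X xs = (SUM x<-xs. mpure I X x)"

lemma msum_apply: "multilin_form I X f ==> msum I X xs f = (SUM x<-xs. f x)"
 unfolding msum_def by (induction xs) (auto simp: mpure_def)

lemma msum_in: "set xs <= PE I X ==> msum I X xs : carr (mtensor I X)"
 unfolding msum_def by (rule vs_sl[OF vspace_mtensor]) (auto simp: mpure_in)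

context
 fixes I :: "'i set" and X :: "'i => ('k::field, 'x::ab_group_add, 'z) vs_scheme"
 assumes ne: "I ~= {}" and vX: "!!i. i : I ==> vspace (X i)"
begin

lemma msum_ex:
 assumes t: "t : carr (mtensor I X)"
 shows "EX xs. set xs <= PE I X & t = msum I X xs"
proof -
 obtain i where i: "i : I" using ne by blast
 have scal: "fun_scal c (mpure I X x) = mpure I X (x(i := scal (X i) c (x i)))" if x: "x : PE I X" for c x
  using linD(3)[OF multilinD(2)[OF mlin_mp x i], of "x i" c] x i by (auto simp: PiE_iff)
 have "t : fun_vs.span (mpure I X ` PE I X)"
  using t by (simp add: mtensor_def)
 then show ?thesis
 proof (induction rule: fun_vs.span_induct_alt)
  case base
  show ?case by (intro exI[of _ "[]"]) (auto simp: msum_def)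
 next
  case (step c u y)
  then obtain x xs where x: "x : PE I X" "u = mpure I X x"
   and xs: "set xs <= PE I X" "y = msum I X xs" by auto
  have "x i : carr (X i)" using x(1) i by (auto simp: PiE_iff)
  then have "x(i := scal (X i) c (x i)) : PE I X"
   by (intro PE_upd x i vs_scal vX) auto
  moreover have "fun_scal c u + y = msum I X (x(i := scal (X i) c (x i)) # xs)"
   unfolding x(2) scal[OF x(1)] xs(2) by (simp only: msum_def list.map sum_list.Cons)
  ultimately show ?case using xs(1) by (intro exI[of _ "x(i := scal (X i) c (x i)) # xs"]) auto
 qed
qed

lemma mlift_unique:
 assumes ph: "multilin I X U ph" and U: "vspace U"
  and xs: "set xs <= PE I X" "set ys <= PE I X" "msum I X xs = msum I X ys"
 shows "(SUM x<-xs. ph x) = (SUM x<-ys. ph x)"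
proof -
 have in_U: "(SUM x<-zs. ph x) : carr U" if "set zs <= PE I X" for zs
  by (rule vs_sl[OF U]) (use that multilinD(1)[OF ph] in auto)
 have "(SUM x<-xs. ph x) - (SUM x<-ys. ph x) = 0"
 proof (rule f_sep[OF U])
  show "(SUM x<-xs. ph x) - (SUM x<-ys. ph x) : carr U"
   by (intro vs_diff[OF U] in_U xs)
  fix f assume f: "form U f"
  have bf: "multilin_form I X (%x. f (ph x))"
   unfolding mlf_eq by (rule multilin_comp[OF ph f])
  have ev: "f (SUM x<-zs. ph x) = msum I X zs (%x. f (ph x))" if "set zs <= PE I X" for zs
   unfolding msum_apply[OF bf]
   by (subst lin_sl[OF f U]) (use that multilinD(1)[OF ph] in auto)
  show "f ((SUM x<-xs. ph x) - (SUM x<-ys. ph x)) = 0"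
   by (simp add: lin_map_diff[OF f U] in_U xs ev)
 qed
 then show ?thesis by simp
qed

lemma mlift_msum:
 assumes ph: "multilin I X U ph" and U: "vspace U" and xs: "set xs <= PE I X"
 shows "mlift I X ph (msum I X xs) = (SUM x<-xs. ph x)"
 unfolding mlift_def msum_def[symmetric]
proof (rule the_equality)
 show "EX ys. set ys <= PE I X & msum I X xs = msum I X ys & (SUM x<-xs. ph x) = (SUM x<-ys. ph x)"
  using xs by blast
next
 fix u assume "EX ys. set ys <= PE I X & msum I X xs = msum I X ys & u = (SUM x<-ys. ph x)"
 then show "u = (SUM x<-xs. ph x)" using mlift_unique[OF ph U xs] by metis
qed

lemma mlift_mpure:
 assumes ph: "multilin I X U ph" and U: "vspace U" and x: "x : PE I X"
 shows "mlift I X ph (mpure I X x) = ph x"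
 using mlift_msum[OF ph U, of "[x]"] x by (simp add: msum_def)

lemma lin_mlift:
 assumes ph: "multilin I X U ph" and U: "vspace U"
 shows "lin_map (mtensor I X) U (mlift I X ph)"
 unfolding lin_map_def
proof (intro conjI ballI allI)
 fix s assume "s : carr (mtensor I X)"
 then obtain xs where xs: "set xs <= PE I X" "s = msum I X xs" using msum_ex by blast
 show "mlift I X ph s : carr U"
  unfolding xs(2) mlift_msum[OF ph U xs(1)]
  by (rule vs_sl[OF U]) (use xs(1) multilinD(1)[OF ph] in auto)
 {
  fix t assume "t : carr (mtensor I X)"
  then obtain ys where ys: "set ys <= PE I X" "t = msum I X ys" using msum_ex by blast
  have "s + t = msum I X (xs @ ys)" unfolding xs(2) ys(2) by (simp add: msum_def)
  then show "mlift I X ph (s + t) = mlift I X ph s + mlift I X ph t"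
   using xs ys mlift_msum[OF ph U, of "xs @ ys"] by (simp add: mlift_msum[OF ph U])
 }
 fix c
 obtain i where i: "i : I" using ne by blast
 let ?g = "%x. x(i := scal (X i) c (x i))"
 have x_in: "x i : carr (X i)" if "x : set xs" for x using that xs(1) i by (auto simp: PiE_iff)
 have ys: "set (map ?g xs) <= PE I X"
  using PE_upd[OF subsetD[OF xs(1)] i vs_scal[OF vX[OF i] x_in]] by auto
 have sc: "th (?g x) = scal U' c (th x)" if "multilin I X U' th" "x : set xs"
  for x U' and th :: "('i => 'x) => 'w::ab_group_add"
  using linD(3)[OF multilinD(2)[OF that(1) _ i] x_in[OF that(2)], of x c] that(2) xs(1) by auto
 have "scal (mtensor I X) c s = (SUM x<-xs. scal (mtensor I X) c (mpure I X x))"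
  unfolding xs(2) msum_def by (rule vs_ssl[OF vspace_mtensor])
 also have "... = msum I X (map ?g xs)"
  unfolding msum_def map_map
  by (intro arg_cong[where f = sum_list] map_cong) (simp_all add: sc[OF mlin_mp])
 finally have "mlift I X ph (scal (mtensor I X) c s) = (SUM x<-map ?g xs. ph x)" (is "?Z = _")
  using mlift_msum[OF ph U ys] by simp
 also have "... = (SUM x<-xs. scal U c (ph x))"
  unfolding map_map by (intro arg_cong[where f = sum_list] map_cong) (simp_all add: sc[OF ph])
 also have "... = scal U c (mlift I X ph s)"
  unfolding xs(2) mlift_msum[OF ph U xs(1)] by (rule vs_ssl[OF U, symmetric])
 finally show "?Z = ..." .
qed

lemma mt_eqI:
 assumes f: "lin_map (mtensor I X) U f" and g: "lin_map (mtensor I X) U g"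
  and eq: "!!x. x : PE I X ==> f (mpure I X x) = g (mpure I X x)"
  and t: "t : carr (mtensor I X)"
 shows "f t = g t"
proof -
 obtain xs where xs: "set xs <= PE I X" "t = msum I X xs" using msum_ex[OF t] by blast
 have "f' t = (SUM x<-xs. f' (mpure I X x))" if "lin_map (mtensor I X) U f'" for f'
  unfolding xs(2) msum_def
  by (rule lin_sl[OF that vspace_mtensor]) (rule mpure_in[OF subsetD[OF xs(1)]])
 note this[OF f] this[OF g]
 moreover have "(SUM x<-xs. f (mpure I X x)) = (SUM x<-xs. g (mpure I X x))"
  using xs(1) eq by (intro arg_cong[where f = sum_list] map_cong) auto
 ultimately show ?thesis by simp
qed

lemma mtensor_induct [consumes 1, case_names pure add]:
 assumes t: "t : carr (mtensor I X)"
  and pure: "!!x. x : PE I X ==> P (mpure I X x)"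
  and add: "!!s t. s : carr (mtensor I X) ==> t : carr (mtensor I X) ==> P s ==> P t ==> P (s + t)"
 shows "P t"
proof -
 have "P (msum I X xs)" if "set xs <= PE I X" for xs
  using that
 proof (induction xs)
  case Nil
  obtain i where i: "i : I" using ne by blast
  define x where "x = (\<lambda>i\<in>I. 0 :: 'x)"
  have x: "x : PE I X" using vX by (auto simp: x_def vs_zero)
  have "mpure I X (x(i := 0)) = 0"
   using lin_0[OF multilinD(2)[OF mlin_mp x i] vX[OF i]] .
  moreover have "x(i := 0) = x" using i by (auto simp: x_def)
  ultimately have "P 0" using pure[OF x] by simp
  then show ?case by (simp only: msum_def list.map sum_list.Nil)
 next
  case (Cons x xs)
  have "msum I X (x # xs) = mpure I X x + msum I X xs"
   by (simp only: msum_def list.map sum_list.Cons)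
  moreover have "x : PE I X" "set xs <= PE I X" using Cons.prems by auto
  ultimately show ?case using add[OF mpure_in msum_in pure Cons.IH] by metis
 qed
 then show ?thesis using msum_ex[OF t] by auto
qed

end

lemmas mtensor_induct_pure = mtensor_induct[rotated 2, consumes 1, case_names pure add ne vs]

subsection \<open>Insertion of units\<close>

definition "ext1 I J X x = (\<lambda>i\<in>J. if i : I then x i else unity (X i))"

text \<open>\<open>J\<close> may be infinite: the tensor product over all integers is the ambient
  space of the inductive limits.\<close>

definition "emb I J X = mlift I X (%x. mpure J X (ext1 I J X x))"

lemma ext1_upd: "i : I ==> I <= J ==> ext1 I J X (x(i := v)) = (ext1 I J X x)(i := v)"
 by (auto simp: ext1_def fun_eq_iff)

lemma ext1_in: "I <= J ==> (!!i. i : J ==> unity (X i) : carr (X i)) ==> x : PE I X ==> ext1 I J X x : PE J X"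
 by (auto simp: ext1_def PiE_iff)

locale fam =
 fixes J :: "'i set" and X :: "'i => ('k::field, 'x::ab_group_add, 'z) alg_scheme"
 assumes algs: "!!i. i : J ==> assoc_algebra (X i)"
begin

lemma vsX: "i : J ==> vspace (X i)" and unX: "i : J ==> unity (X i) : carr (X i)"
 using algs by (auto dest: algD)

lemma multilin_ext1: assumes IJ: "I <= J" and ph: "multilin J X U ph"
 shows "multilin I X U (%x. ph (ext1 I J X x))"
 unfolding multilin_def
proof (intro ballI conjI)
 fix x assume x: "x : PE I X"
 note * = ext1_in[OF IJ unX x]
 show "ph (ext1 I J X x) : carr U" by (rule multilinD(1)[OF ph *])
 fix i assume i: "i : I"
 show "lin_map (X i) U (%v. ph (ext1 I J X (x(i := v))))"
  unfolding ext1_upd[OF i IJ] by (rule multilinD(2)[OF ph *]) (use i IJ in auto)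
qed

lemma lin_emb: assumes IJ: "I <= J" and ne: "I ~= {}"
 shows "lin_map (mtensor I X) (mtensor J X) (emb I J X)"
 unfolding emb_def
 by (rule lin_mlift[OF ne _ multilin_ext1[OF IJ mlin_mp] vspace_mtensor]) (use IJ vsX in auto)

lemma emb_mpure: assumes IJ: "I <= J" and ne: "I ~= {}" and x: "x : PE I X"
 shows "emb I J X (mpure I X x) = mpure J X (ext1 I J X x)"
 unfolding emb_def
 by (rule mlift_mpure[OF ne _ multilin_ext1[OF IJ mlin_mp] vspace_mtensor x]) (use IJ vsX in auto)

lemma emb_in: "I <= J ==> I ~= {} ==> t : carr (mtensor I X) ==> emb I J X t : carr (mtensor J X)"
 by (rule linD(1)[OF lin_emb])

text \<open>A multilinear form on the smaller family extends: multiply by forms with value 1 at the units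
  in the additional factors (all but finitely many values being 1).\<close>

lemma emb_inj:
 assumes IJ: "I <= J" and ne: "I ~= {}" and nz: "!!i. i : J ==> unity (X i) ~= 0"
 shows "inj_on (emb I J X) (carr (mtensor I X))"
proof -
 have "EX f. form (X i) f & f (unity (X i)) = 1" if i: "i : J" for i
 proof -
  obtain f where f: "form (X i) f" "f (unity (X i)) ~= 0"
   using f_sep[OF vsX[OF i] unX[OF i]] nz[OF i] by blast
  show ?thesis
   by (rule exI[of _ "%v. inverse (f (unity (X i))) * f v"], rule conjI, rule fmL[OF f(1)]) (simp add: f(2))
 qed
 then obtain l where l: "!!i. i : J ==> form (X i) (l i)" "!!i. i : J ==> l i (unity (X i)) = 1" by metis
 define E where "E g y = (if finite {i : J - I. l i (y i) ~= 1}
  then g (restrict y I) * prod (%i. l i (y i)) {i : J - I. l i (y i) ~= 1} else 0)" for g :: "('i => 'x) => 'k" and y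
 have restr: "restrict y I : PE I X" if "y : PE J X" for y using that IJ by (auto simp: PiE_iff)
 have E: "multilin J X ground (E g)" if g: "multilin I X ground g" for g
  unfolding multilin_def
 proof (intro ballI conjI)
  fix y i assume y: "y : PE J X" and i: "i : J"
  let ?N = "%y. {j : J - I. l j (y j) ~= 1}"
  show "form (X i) (%v. E g (y(i := v)))"
  \<comment> \<open>Changing the entry at \<open>i\<close> alters the set of exceptional positions
    by at most \<open>i\<close>, so both cases are stable; in the infinite case the form is
    constantly 0.\<close>
  proof (cases "finite (?N y)")
   case False
   have "~ finite (?N (y(i := v)))" for v
   proof
    assume "finite (?N (y(i := v)))"
    then have "finite (insert i (?N (y(i := v))))" by simp
    moreover have "?N y <= insert i (?N (y(i := v)))" by auto
    ultimately show False using False finite_subset by blast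
   qed
   then have "E g (y(i := v)) = 0" for v by (simp add: E_def)
   then show ?thesis by (simp add: lin_map_def)
  next
   case True
   have fin: "finite (?N (y(i := v)))" for v
   proof (rule finite_subset)
    show "?N (y(i := v)) <= insert i (?N y)" by auto
   qed (use True in simp)
   show ?thesis
   proof (cases "i : I")
    case iI: True
    have N: "?N (y(i := v)) = ?N y" for v using iI by auto
    have "E g (y(i := v)) = g ((restrict y I)(i := v)) * prod (%j. l j (y j)) (?N y)" for v
    proof -
     have "restrict (y(i := v)) I = (restrict y I)(i := v)" using iI by (auto simp: fun_eq_iff)
     moreover have "prod (%j. l j ((y(i := v)) j)) (?N y) = prod (%j. l j (y j)) (?N y)"
      using iI by (intro prod.cong) auto
     ultimately show ?thesis unfolding E_def N using True by simp
    qed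
    then show ?thesis
     using fmR[OF multilinD(2)[OF g restr[OF y] iI]] by simp
   next
    case iI: False
    have "E g (y(i := v)) = (g (restrict y I) * prod (%j. l j (y j)) (?N y - {i})) * l i v" for v
    proof -
     have r: "restrict (y(i := v)) I = restrict y I" using iI by (auto simp: fun_eq_iff)
     have "prod (%j. l j ((y(i := v)) j)) (?N (y(i := v))) = prod (%j. l j ((y(i := v)) j)) (insert i (?N (y(i := v)) - {i}))"
      by (rule prod.mono_neutral_left) (use fin i iI in auto)
     also have "... = l i v * prod (%j. l j ((y(i := v)) j)) (?N (y(i := v)) - {i})"
      by (subst prod.insert) (use fin in auto)
     also have "prod (%j. l j ((y(i := v)) j)) (?N (y(i := v)) - {i}) = prod (%j. l j (y j)) (?N y - {i})"
      by (rule prod.cong) auto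
     finally show ?thesis unfolding E_def r using fin by (simp add: mult_ac)
    qed
    then show ?thesis using fmL[OF l(1)[OF i]] by simp
   qed
  qed
 qed simp
 have E_ext: "E g (ext1 I J X x) = g x" if "x : PE I X" for g x
 proof -
  have "{j : J - I. l j (ext1 I J X x j) ~= 1} = {}" by (auto simp: ext1_def l(2))
  moreover have "restrict (ext1 I J X x) I = x"
   using that IJ by (auto simp: ext1_def fun_eq_iff PiE_iff extensional_def)
  ultimately show ?thesis unfolding E_def by (simp only: finite.emptyI if_True prod.empty mult_1_right)
 qed
 have vXI: "!!i. i : I ==> vspace (X i)" using IJ vsX by blast
 \<comment> \<open>The image of t determines its value at every multilinear form g, and a tensor
   vanishes at all other functions; hence it determines t.\<close>
 have key: "emb I J X t (E g) = t g" if t: "t : carr (mtensor I X)" and g: "multilin I X ground g" for t g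
  using t
 proof (induction rule: mtensor_induct_pure)
  case (pure x)
  then show ?case using E[OF g] g unfolding emb_mpure[OF IJ ne pure] by (simp add: mpure_def mlf_eq E_ext)
 next
  case (add s t)
  then show ?case using linD(2)[OF lin_emb[OF IJ ne], of s t] by (metis plus_fun_apply)
 qed (use ne vXI in auto)
 show ?thesis
 proof (rule inj_onI)
  fix s t assume s: "s : carr (mtensor I X)" and t: "t : carr (mtensor I X)" and eq: "emb I J X s = emb I J X t"
  have zero: "u g = 0" if "u : carr (mtensor I X)" "~ multilin I X ground g" for u g
   using that(1)
  proof (induction rule: mtensor_induct_pure)
   case (pure x)
   then show ?case using that(2) by (simp add: mpure_def mlf_eq)
  qed (use ne vXI in auto)
  show "s = t"
  proof
   fix g show "s g = t g"
    using key[OF s, of g] key[OF t, of g] zero[OF s, of g] zero[OF t, of g] eq by (cases "multilin I X ground g") auto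
  qed
 qed
qed

lemma emb_id: assumes ne: "J ~= {}" and t: "t : carr (mtensor J X)"
 shows "emb J J X t = t"
proof (rule mt_eqI[OF ne vsX lin_emb[OF subset_refl ne] lin_id _ t])
 fix x assume x: "x : PE J X"
 then have "ext1 J J X x = x" by (auto simp: ext1_def fun_eq_iff PiE_iff extensional_def)
 then show "emb J J X (mpure J X x) = mpure J X x" by (simp add: emb_mpure[OF subset_refl ne x])
qed

lemma emb_emb: assumes IK: "I <= K" and KJ: "K <= J" and ne: "I ~= {}" and t: "t : carr (mtensor I X)"
 shows "emb K J X (emb I K X t) = emb I J X t"
proof -
 interpret K: fam K X by unfold_locales (use KJ algs in blast)
 have neK: "K ~= {}" and IJ: "I <= J" using ne IK KJ by auto
 show ?thesis
 proof (rule mt_eqI[OF ne _ lin_o[OF K.lin_emb[OF IK ne] lin_emb[OF KJ neK]] lin_emb[OF IJ ne] _ t])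
  fix x assume x: "x : PE I X"
  have "ext1 K J X (ext1 I K X x) = ext1 I J X x" using IK by (auto simp: ext1_def fun_eq_iff)
  then show "emb K J X (emb I K X (mpure I X x)) = emb I J X (mpure I X x)"
   by (simp add: emb_mpure[OF IJ ne x] K.emb_mpure[OF IK ne x] emb_mpure[OF KJ neK ext1_in[OF IK K.unX x]])
 qed (use IJ vsX in auto)
qed

end

subsection \<open>Diagonal action and codiagonal coaction\<close>

locale ydfam = bialg H for H :: "('k::field, 'h::ab_group_add, 'u) bialg_scheme" +
 fixes J :: "int set" and X :: "int => ('k, 'h, 'x::ab_group_add, 'z) yd_scheme"
 assumes ydX: "!!i. i : J ==> yd_module_algebra H (X i)"
begin

sublocale fam J X by unfold_locales (rule ydD(2)[OF ydX])

abbreviation "M == mtensor J X"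

lemmas actX = ydD(3)[OF ydX] and coX = ydD(4)[OF ydX]
 and actX_in = ydD(8)[OF ydX] and coX_in = ydD(9)[OF ydX]

lemma PE_in: "x : PE J X ==> i : J ==> x i : carr (X i)"
 by auto

lemma lin_upd: "multilin J X U ph ==> x : PE J X ==> i : J ==> lin_map V (X i) f ==> lin_map V U (%v. ph (x(i := f v)))"
 by (rule lin_o[OF _ multilinD(2)])

lemma diag_body:
 assumes "!!x. x : PE J X ==> lin_map H M (%h. diag_act H J X js h x)"
  and "!!h. h : carr H ==> multilin J X M (diag_act H J X js h)" and i: "i : J" and x: "x : PE J X"
  and v: "v : carr (X i)"
 shows "bilin_map H H M (%h1 h2. diag_act H J X js h2 (x(i := act (X i) h1 v)))"
 unfolding bilin_map_def
 by (intro conjI ballI assms(1) PE_upd[OF x i] lin_upd[OF assms(2) x i] bilL[OF actX[OF i]] lin_id actX_in[OF i] v)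

text \<open>The two statements need a joint induction: the \<open>sw\<close> in the recursive step
  has the intended value for a bilinear integrand, and one variable is the acting element while the
  other enters through a factor.\<close>

lemma diag_lin: "set js <= J ==> x : PE J X ==> lin_map H M (%h. diag_act H J X js h x)"
 and diag_multilin: "set js <= J ==> h : carr H ==> multilin J X M (diag_act H J X js h)"
proof (induction js arbitrary: x h)
 case Nil
 { case 1 then show ?case using lscL[OF cou_form vspace_mtensor mpure_in[of x J X]] by (simp only: diag_act.simps scal_mtensor) }
 { case 2 then show ?case using multilin_comp[OF mlin_mp lin_scal[OF lin_id vspace_mtensor]] by (simp only: diag_act.simps scal_mtensor) }
next
 case (Cons i js)
 { case 1
  then have "i : J" "set js <= J" by auto
  with 1 show ?case unfolding diag_act.simps sw_def
   by (intro lin_tla[OF lin_cop[OF bialg lin_id]] diag_body Cons.IH vs vspace_mtensor PE_in) auto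
  note this = this
 } note 1 = this
 { case 2
  then have i: "i : J" and js: "set js <= J" and h: "h : carr H" by auto
  note b = diag_body[OF Cons.IH(1)[OF js] Cons.IH(2)[OF js]]
  show ?case unfolding multilin_def
  proof (intro ballI conjI)
   fix x assume x: "x : PE J X"
   show "diag_act H J X (i # js) h x : carr M" by (rule linD(1)[OF 1[OF 2(1) x] h])
   fix j assume j: "j : J"
   have m: "lin_map (X j) M (%v. diag_act H J X js h2 (x(j := v, i := act (X i) h1 ((x(j := v)) i))))"
    if "h1 : carr H" "h2 : carr H" for h1 h2
   \<comment> \<open>If the varied entry is the one being acted on, linearity comes through the
     action; otherwise the two updates commute and the induction hypothesis applies.\<close>
   proof (cases "i = j")
    case True
    then show ?thesis using lin_upd[OF Cons.IH(2)[OF js that(2)] x i bilR[OF actX[OF i] lin_id that(1)]]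
     by (simp only: True fun_upd_upd fun_upd_same)
   next
    case False
    then show ?thesis
     using multilinD(2)[OF Cons.IH(2)[OF js that(2)] PE_upd[OF x i actX_in[OF i that(1) PE_in[OF x i]]] j]
     by (simp only: fun_upd_twist[OF False] fun_upd_other[OF False])
   qed
   have "bilin_map H H M (%h1 h2. diag_act H J X js h2 (x(j := v, i := act (X i) h1 ((x(j := v)) i))))"
    if "v : carr (X j)" for v
    by (rule b[OF _ _ i PE_upd[OF x j that] PE_in[OF PE_upd[OF x j that] i]])
   then show "lin_map (X j) M (%v. diag_act H J X (i # js) h (x(j := v)))"
    unfolding diag_act.simps sw_def
    by (intro lin_tlb[OF vs vspace_mtensor cop_in[OF h]] m vsX j)
  qed }
qed

lemma diag_bilin: "i : J ==> set js <= J ==> x : PE J X ==> v : carr (X i) ==>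
  bilin_map H H M (%h1 h2. diag_act H J X js h2 (x(i := act (X i) h1 v)))"
 by (rule diag_body[OF diag_lin diag_multilin])

lemma diag_in: "set js <= J ==> h : carr H ==> x : PE J X ==> diag_act H J X js h x : carr M"
 by (rule linD(1)[OF diag_lin])

lemma diag_Cons: assumes "i : J" "set js <= J" "h : carr H" "x : PE J X"
 shows "diag_act H J X (i # js) h x = Sw h (%h1 h2. diag_act H J X js h2 (x(i := act (X i) h1 (x i))))"
 unfolding diag_act.simps sw_def
 by (rule tl_tev[OF diag_bilin vs vspace_mtensor]) (use assms cop_in in auto)

lemma codiag_body:
 assumes "!!x. x : PE J X ==> lin_map H (tensor H M) (%g. codiag_coact H J X js g x)"
  and "!!g. g : carr H ==> multilin J X (tensor H M) (codiag_coact H J X js g)" and i: "i : J" and x: "x : PE J X"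
  and g: "g : carr H"
 shows "bilin_map H (X i) (tensor H M) (%h z. codiag_coact H J X js (mul H g h) (x(i := z)))"
 unfolding bilin_map_def
 by (intro conjI ballI lin_upd[OF assms(2) x i] lin_o[OF _ assms(1)] lmR alg lin_id g mul_in PE_upd[OF x i])

lemma codiag_lin: "set js <= J ==> x : PE J X ==> lin_map H (tensor H M) (%g. codiag_coact H J X js g x)"
 and codiag_multilin: "set js <= J ==> g : carr H ==> multilin J X (tensor H M) (codiag_coact H J X js g)"
proof (induction js arbitrary: x g)
 case Nil
 { case 1 then show ?case using ltpL[OF lin_id mpure_in[of x J X]] by simp }
 { case 2 then show ?case using multilin_comp[OF mlin_mp ltpR[OF lin_id, of _ H]] by simp }
next
 case (Cons i js)
 { case 1
  then have i: "i : J" and js: "set js <= J" and x: "x : PE J X" by auto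
  note b = codiag_body[OF Cons.IH(1)[OF js] Cons.IH(2)[OF js] i x]
  have "lin_map H (tensor H M) (%g. codiag_coact H J X js (mul H g h) (x(i := z)))" if "h : carr H" "z : carr (X i)" for h z
   by (rule lin_o[OF _ Cons.IH(1)[OF js PE_upd[OF x i that(2)]]]) (rule lmL[OF alg lin_id that(1)])
  then show ?case unfolding codiag_coact.simps
   by (intro lin_tlb[OF vs vs_t coX_in[OF i PE_in[OF x i]]] b vs)
 } note 1 = this
 { case 2
  then have i: "i : J" and js: "set js <= J" and g: "g : carr H" by auto
  note b = codiag_body[OF Cons.IH(1)[OF js] Cons.IH(2)[OF js] i]
  show ?case unfolding multilin_def
  proof (intro ballI conjI)
   fix x assume x: "x : PE J X"
   show "codiag_coact H J X (i # js) g x : carr (tensor H M)" by (rule linD(1)[OF 1[OF 2(1) x] g])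
   fix j assume j: "j : J"
   show "lin_map (X j) (tensor H M) (%v. codiag_coact H J X (i # js) g (x(j := v)))"
   proof (cases "i = j")
    case True
    then show ?thesis unfolding codiag_coact.simps
     using lin_tla[OF coX[OF i] b[OF _ _ x g] vs vs_t] by simp
   next
    case False
    have l: "lin_map (X j) (tensor H M) (%v. codiag_coact H J X js (mul H g h) (x(j := v, i := z)))"
     if "h : carr H" "z : carr (X i)" for h z
     using multilinD(2)[OF Cons.IH(2)[OF js mul_in[OF g that(1)]] PE_upd[OF x i that(2)] j]
     by (simp only: fun_upd_twist[OF False])
    have "lin_map (X j) (tensor H M) (%v. tlift H (X i) (%h z. codiag_coact H J X js (mul H g h) (x(j := v, i := z))) (coact (X i) (x i)))"
     by (intro lin_tlb[OF vs vs_t coX_in[OF i PE_in[OF x i]]] l b PE_upd[OF x j] g vsX j)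
    then show ?thesis using False by simp
   qed
  qed }
qed

lemma codiag_bilin: "i : J ==> set js <= J ==> x : PE J X ==> g : carr H ==>
  bilin_map H (X i) (tensor H M) (%h z. codiag_coact H J X js (mul H g h) (x(i := z)))"
 by (rule codiag_body[OF codiag_lin codiag_multilin])

lemma codiag_in: "set js <= J ==> g : carr H ==> x : PE J X ==> codiag_coact H J X js g x : carr (tensor H M)"
 by (rule linD(1)[OF codiag_lin])

lemma codiag_Cons: assumes "i : J" "set js <= J" "g : carr H" "x : PE J X"
 shows "codiag_coact H J X (i # js) g x = tev H (X i) (coact (X i) (x i)) (%h z. codiag_coact H J X js (mul H g h) (x(i := z)))"
 unfolding codiag_coact.simps
 by (rule tl_tev[OF codiag_bilin vs vs_t]) (use assms coX_in in auto)

lemma Sw_counit_left: "lin_map H U f ==> vspace U ==> h : carr H ==> Sw h (%a b. scal U (cou H a) (f b)) = f h"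
 and Sw_counit_right: "lin_map H U f ==> vspace U ==> h : carr H ==> Sw h (%a b. scal U (cou H b) (f a)) = f h"
proof -
 assume f: "lin_map H U f" and U: "vspace U" and h: "h : carr H"
 have fin: "a : carr H ==> f a : carr U" for a using linD(1)[OF f] .
 note [simp] = vs_scal[OF U] fin
 show "Sw h (%a b. scal U (cou H a) (f b)) = f h"
 proof (rule sep_eqI[OF sep_forms[OF U] tev_in[OF vs U cop_in[OF h]] fin[OF h]], simp)
  fix ka assume "ka : {f. form U f}" then have k: "form U ka" by simp
  show "ka (Sw h (%a b. scal U (cou H a) (f b))) = ka (f h)"
   by (subst tev_pull[OF k U vs cop_in[OF h]], simp, subst couL[OF lin_o[OF f k] h, symmetric], rule Swc[OF h]) (simp add: linD(3)[OF k])
 qed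
 show "Sw h (%a b. scal U (cou H b) (f a)) = f h"
 proof (rule sep_eqI[OF sep_forms[OF U] tev_in[OF vs U cop_in[OF h]] fin[OF h]], simp)
  fix ka assume "ka : {f. form U f}" then have k: "form U ka" by simp
  show "ka (Sw h (%a b. scal U (cou H b) (f a))) = ka (f h)"
   by (subst tev_pull[OF k U vs cop_in[OF h]], simp, subst couR[OF lin_o[OF f k] h, symmetric], rule Swc[OF h]) (simp add: linD(3)[OF k])
 qed
qed

lemma upd_unity: "x i = unity (X i) ==> x(i := unity (X i)) = x"
 by (metis fun_upd_triv)

text \<open>A leg acting on a unit gives its counit, which the neighbouring leg absorbs. This
  compares the action on a chain with that on a longer one containing it.\<close>

lemma diag_filter:
 assumes "set js <= J" "h : carr H" "x : PE J X" "!!j. j : set js ==> ~ Q j ==> x j = unity (X j)" "distinct js"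
 shows "diag_act H J X js h x = diag_act H J X (filter Q js) h x"
 using assms
proof (induction js arbitrary: h x)
 case (Cons i js)
 then have i: "i : J" and js: "set js <= J" and fjs: "set (filter Q js) <= J" and xi: "x i : carr (X i)" by auto
 have step: "diag_act H J X (i # js) h x = Sw h (%h1 h2. diag_act H J X (filter Q js) h2 (x(i := act (X i) h1 (x i))))"
  unfolding diag_Cons[OF i js Cons.prems(2,3)]
 proof (rule Swc[OF Cons.prems(2)], rule Cons.IH[OF js])
  fix h1 h2 assume h: "h1 : carr H" "h2 : carr H"
  show "h2 : carr H" "x(i := act (X i) h1 (x i)) : PE J X" by (intro h PE_upd Cons.prems i actX_in xi)+
  show "(x(i := act (X i) h1 (x i))) j = unity (X j)" if "j : set js" "~ Q j" for j
   using that Cons.prems(4,5) by auto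
 qed (use Cons.prems in auto)
 show ?case
 proof (cases "Q i")
  case True then show ?thesis unfolding step by (simp only: filter.simps if_True diag_Cons[OF i fjs Cons.prems(2,3)])
 next
  case False
  then have u: "x i = unity (X i)" using Cons.prems(4) by simp
  have "act (X i) h1 (x i) = scal (X i) (cou H h1) (x i)" if "h1 : carr H" for h1
   unfolding u by (rule ydD(7)[OF ydX[OF i] that])
  then have "diag_act H J X (i # js) h x = Sw h (%h1 h2. scal M (cou H h1) (diag_act H J X (filter Q js) h2 x))"
   unfolding step by (intro Swc Cons.prems)
    (simp add: linD(3)[OF multilinD(2)[OF diag_multilin[OF fjs] Cons.prems(3) i] xi] del: scal_mtensor)
  also have "... = diag_act H J X (filter Q js) h x"
   by (rule Sw_counit_left[OF diag_lin[OF fjs Cons.prems(3)] vspace_mtensor Cons.prems(2)])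
  finally show ?thesis using False by simp
 qed
qed simp

text \<open>A unit entry contributes the unit of \<open>H\<close> to the accumulated
  product.\<close>

lemma codiag_filter:
 assumes "set js <= J" "g : carr H" "x : PE J X" "!!j. j : set js ==> ~ Q j ==> x j = unity (X j)" "distinct js"
 shows "codiag_coact H J X js g x = codiag_coact H J X (filter Q js) g x"
 using assms
proof (induction js arbitrary: g x)
 case (Cons i js)
 then have i: "i : J" and js: "set js <= J" and fjs: "set (filter Q js) <= J" and xi: "x i : carr (X i)" by auto
 note ci = coX_in[OF i xi]
 have step: "codiag_coact H J X (i # js) g x
  = tev H (X i) (coact (X i) (x i)) (%h z. codiag_coact H J X (filter Q js) (mul H g h) (x(i := z)))"
  unfolding codiag_Cons[OF i js Cons.prems(2,3)]
 proof (rule tevc[OF vs ci], rule Cons.IH[OF js])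
  fix h z assume h: "h : carr H" "z : carr (X i)"
  show "mul H g h : carr H" "x(i := z) : PE J X" by (intro h PE_upd Cons.prems i mul_in)+
  show "(x(i := z)) j = unity (X j)" if "j : set js" "~ Q j" for j using that Cons.prems(4,5) by auto
 qed (use Cons.prems in auto)
 show ?case
 proof (cases "Q i")
  case True then show ?thesis unfolding step by (simp only: filter.simps if_True codiag_Cons[OF i fjs Cons.prems(2,3)])
 next
  case False
  then have u: "x i = unity (X i)" using Cons.prems(4) by simp
  have "codiag_coact H J X (i # js) g x = codiag_coact H J X (filter Q js) (mul H g (unity H)) (x(i := unity (X i)))"
   unfolding step unfolding u ydD(10)[OF ydX[OF i]]
   by (rule tevp[OF codiag_bilin[OF i fjs Cons.prems(3,2)] vs vs_t one_in unX[OF i]])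
  also have "... = codiag_coact H J X (filter Q js) g x" using upd_unity[of x i] u Cons.prems by (simp add: mul_one)
  finally show ?thesis using False by simp
 qed
qed simp

lemma ydfam_subset: "I <= J ==> ydfam H I X"
 by unfold_locales (use ydX in auto)

text \<open>\<open>F\<close> stands for any map that adds entries outside of \<open>I\<close> to
  pure tensors. It is used for the insertion of units and for adjoining one entry at the
  left.\<close>

lemma diag_map:
 assumes IJ: "I <= J" and F: "lin_map (mtensor I X) M F" and Fg: "!!y. y : PE I X ==> F (mpure I X y) = mpure J X (g y)"
  and g: "!!y. y : PE I X ==> g y : PE J X" "!!y i. y : PE I X ==> i : I ==> g y i = y i"
   "!!y i v. y : PE I X ==> i : I ==> g (y(i := v)) = (g y)(i := v)"
  and js: "set js <= I" and h: "h : carr H" and y: "y : PE I X"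
 shows "F (diag_act H I X js h y) = diag_act H J X js h (g y)"
 using js h y
proof (induction js arbitrary: h y)
 case Nil
 then show ?case using linD(3)[OF F mpure_in[OF Nil(3)]] Fg by (simp only: diag_act.simps scal_mtensor)
next
 case (Cons i js)
 interpret I: ydfam H I X by (rule ydfam_subset[OF IJ])
 have i: "i : I" "i : J" and js: "set js <= I" "set js <= J" and h: "h : carr H" and y: "y : PE I X"
  using Cons.prems IJ by auto
 have yi: "y i : carr (X i)" using y i by auto
 show ?case
  unfolding I.diag_Cons[OF i(1) js(1) h y] diag_Cons[OF i(2) js(2) h g(1)[OF y]] g(2)[OF y i(1)]
  by (subst tev_pull[OF F vspace_mtensor vs cop_in[OF h]], rule I.diag_in[OF js(1)], assumption, rule PE_upd[OF y i(1) I.actX_in[OF i(1) _ yi]],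
   assumption, rule Swc[OF h], subst Cons.IH[OF js(1)], assumption, rule PE_upd[OF y i(1) I.actX_in[OF i(1) _ yi]], assumption,
   simp only: g(3)[OF y i(1)])
qed

text \<open>\<open>c\<close> collects the coaction of entries to the left of those in
  \<open>js\<close>.\<close>

lemma codiag_map:
 assumes IJ: "I <= J" and F: "lin_map (tensor H (mtensor I X)) (tensor H M) F"
  and Fg: "!!h y. h : carr H ==> y : PE I X ==> F (tpure H (mtensor I X) h (mpure I X y)) = tpure H M (mul H c h) (mpure J X (f y))"
  and c: "c : carr H"
  and g: "!!y. y : PE I X ==> f y : PE J X" "!!y i. y : PE I X ==> i : I ==> f y i = y i"
   "!!y i v. y : PE I X ==> i : I ==> f (y(i := v)) = (f y)(i := v)"
  and js: "set js <= I" and h: "h : carr H" and y: "y : PE I X"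
 shows "F (codiag_coact H I X js h y) = codiag_coact H J X js (mul H c h) (f y)"
 using js h y
proof (induction js arbitrary: h y)
 case Nil
 then show ?case using Fg by simp
next
 case (Cons i js)
 interpret I: ydfam H I X by (rule ydfam_subset[OF IJ])
 have i: "i : I" "i : J" and js: "set js <= I" "set js <= J" and h: "h : carr H" and y: "y : PE I X"
  using Cons.prems IJ by auto
 have yi: "y i : carr (X i)" using y i by auto
 show ?case
  unfolding I.codiag_Cons[OF i(1) js(1) h y] codiag_Cons[OF i(2) js(2) mul_in[OF c h] g(1)[OF y]] g(2)[OF y i(1)]
  by (subst tev_pull[OF F vs_t vs coX_in[OF i(2) yi]], rule I.codiag_in[OF js(1)], rule mul_in[OF h], assumption, rule PE_upd[OF y i(1)], assumption,
   rule tevc[OF vs coX_in[OF i(2) yi]], subst Cons.IH[OF js(1)], rule mul_in[OF h], assumption, rule PE_upd[OF y i(1)], assumption,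
   simp only: g(3)[OF y i(1)] mul_assoc[OF c h])
qed

end

subsection \<open>Uniqueness of the braided product\<close>

locale brm = ydfam H I X for H :: "('k::field, 'h::ab_group_add, 'u) bialg_scheme"
  and I and X :: "int => ('k, 'h, 'x::ab_group_add, 'z) yd_scheme" +
 fixes m :: "('k, int, 'x) mtens => ('k, int, 'x) mtens => ('k, int, 'x) mtens"
 assumes fin: "finite I" and ne: "I ~= {}" and bm: "braided_mult H I X m"
begin

abbreviation "un == mpure I X (\<lambda>i\<in>I. unity (X i))"
abbreviation "e == factor_at I X"

definition "A = (|carr = carr M, scal = scal M, mul = m, unity = un|)"

lemma A: "assoc_algebra A" using bm by (simp add: braided_mult_def A_def)

lemma A_vs: "carr A = carr M" "scal A = scal M" by (simp_all add: A_def)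

lemma m_bilin: "bilin_map M M M m"
 using algD(2)[OF A] unfolding bil_cong[OF A_vs A_vs A_vs] by (simp add: A_def)

lemmas lin_m = bilL[OF m_bilin] bilR[OF m_bilin]

lemma un_in: "un : carr M" and m_in: "u : carr M ==> v : carr M ==> m u v : carr M"
 and m_assoc: "u : carr M ==> v : carr M ==> w : carr M ==> m (m u v) w = m u (m v w)"
 and un_m: "u : carr M ==> m un u = u" and m_un: "u : carr M ==> m u un = u"
 using algD[OF A] unfolding A_def by simp_all

lemma e_PE: "x : carr (X i) ==> (\<lambda>j\<in>I. if j = i then x else unity (X j)) : PE I X"
 by (auto simp: unX)

lemma e_in: "x : carr (X i) ==> e i x : carr M"
 unfolding factor_at_def by (rule mpure_in[OF e_PE])

lemma lin_e: "i : I ==> lin_map (X i) M (e i)"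
proof -
 assume i: "i : I"
 have "(\<lambda>j\<in>I. if j = i then v else unity (X j)) = (\<lambda>j\<in>I. unity (X j))(i := v)" for v
  using i by (auto simp: fun_eq_iff)
 then show ?thesis using multilinD(2)[OF mlin_mp e_PE[OF unX[OF i]] i]
  unfolding factor_at_def[abs_def] by (simp add: fun_upd_upd)
qed

lemma e_one: "e i (unity (X i)) = un"
 unfolding factor_at_def by (rule arg_cong[where f = "mpure I X"]) auto

lemma e_mul: "i : I ==> x : carr (X i) ==> y : carr (X i) ==> m (e i x) (e i y) = e i (mul (X i) x y)"
 using bm by (simp add: braided_mult_def)

lemma e_rel:
 assumes i: "i : I" and j: "j : I" and "i > j" and x: "x : carr (X i)" and y: "y : carr (X j)"
 shows "m (e i x) (e j y) = tev H (X i) (coact (X i) x) (%g z. m (e j (act (X j) g y)) (e i z))" (is "?L = ?R")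
proof -
 have "?L = tlift H (X i) (%g z. m (e j (act (X j) g y)) (e i z)) (coact (X i) x)"
  using bm assms by (simp add: braided_mult_def)
 also have "... = ?R"
  by (rule tl_tev[where U = M, OF _ vs vspace_mtensor coX_in[OF i x]])
   (simp add: mlin lin_m lin_e i j e_in actX_in[OF j] y lin_o[OF _ lin_e[OF j]] bilL[OF actX[OF j]] lin_id)
 finally show ?thesis .
qed

definition "R ls y = foldr (%i. m (e i (y i))) ls un"

lemma R_simps: "R [] y = un" "R (i # ls) y = m (e i (y i)) (R ls y)"
 by (simp_all add: R_def)

lemma R_cong: "(!!i. i : set ls ==> y i = z i) ==> R ls y = R ls z"
 unfolding R_def by (rule foldr_cong) auto

lemma R_in: "(!!i. i : set ls ==> y i : carr (X i)) ==> R ls y : carr M"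
 by (induction ls) (auto simp: R_simps un_in intro: m_in e_in)

lemma R_all: "x : PE I X ==> R (sorted_list_of_set I) x = mpure I X x"
 using bm by (simp add: braided_mult_def R_def)

lemma R_filter: "(!!i. i : set ls ==> y i : carr (X i)) ==> (!!i. i : set ls ==> ~ Q i ==> y i = unity (X i)) ==>
  R ls y = R (filter Q ls) y"
 by (induction ls) (auto simp: R_simps e_one intro!: un_m R_in)

text \<open>Filling up with units turns an increasing list into the list of all indices, for which
  \<open>braided_mult\<close> prescribes the ordered product.\<close>

lemma R_sorted:
 assumes ls: "sorted ls" "distinct ls" "set ls <= I" and y: "!!i. i : set ls ==> y i : carr (X i)"
 shows "R ls y = mpure I X (\<lambda>j\<in>I. if j : set ls then y j else unity (X j))" (is "_ = mpure I X ?z")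
proof -
 have z: "?z : PE I X" using y by (auto simp: unX)
 have f: "filter (%j. j : set ls) (sorted_list_of_set I) = ls"
  by (rule sorted_distinct_set_unique) (use ls fin in "auto simp: sorted_wrt_filter")
 have "mpure I X ?z = R (sorted_list_of_set I) ?z" by (rule R_all[OF z, symmetric])
 also have "... = R (filter (%j. j : set ls) (sorted_list_of_set I)) ?z"
 proof (rule R_filter)
  fix i assume "i : set (sorted_list_of_set I)"
  then have i: "i : I" using fin by simp
  show "?z i : carr (X i)" by (rule PE_in[OF z i])
  show "~ i : set ls ==> ?z i = unity (X i)" using i by simp
 qed
 also have "... = R ls y" unfolding f by (rule R_cong) (use ls in auto)
 finally show ?thesis ..
qed

end

locale brm_emb = I: brm H I X m + J: brm H J X m'
 for H :: "('k::field, 'h::ab_group_add, 'u) bialg_scheme"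
  and I J and X :: "int => ('k, 'h, 'x::ab_group_add, 'z) yd_scheme" and m m' +
 assumes IJ: "I <= J"
begin

lemma emb_R:
 assumes ls: "sorted ls" "distinct ls" "set ls <= I" and y: "!!i. i : set ls ==> y i : carr (X i)"
 shows "emb I J X (I.R ls y) = J.R ls y"
proof -
 let ?z = "\<lambda>j\<in>I. if j : set ls then y j else unity (X j)"
 have z: "?z : PE I X" using y by (auto simp: I.unX)
 have "ext1 I J X ?z = (\<lambda>j\<in>J. if j : set ls then y j else unity (X j))"
  using ls(3) by (auto simp: ext1_def fun_eq_iff)
 then show ?thesis
  using I.R_sorted[OF ls y] J.R_sorted[OF ls(1,2) subset_trans[OF ls(3) IJ] y] J.emb_mpure[OF IJ I.ne z] by simp
qed

text \<open>Pairs of elements that are given by the same expression in ordered products of generators from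
  factors to the right of \<open>l\<close>.\<close>

inductive_set Gam :: "int => (('k, int, 'x) mtens \<times> ('k, int, 'x) mtens) set" for l where zero: "(0, 0) : Gam l"
| base: "sorted ls ==> distinct ls ==> set ls <= I ==> (!!i. i : set ls ==> l < i) ==> (!!i. i : set ls ==> y i : carr (X i)) ==>
  (I.R ls y, J.R ls y) : Gam l"
| add: "(u, u') : Gam l ==> (v, v') : Gam l ==> (u + v, u' + v') : Gam l"

lemma Gam_in: "(u, u') : Gam l ==> u : carr I.M & u' : carr J.M & u' = emb I J X u"
proof (induction rule: Gam.induct)
 case zero then show ?case
  using lin_0[OF J.lin_emb[OF IJ I.ne] vspace_mtensor] vs_zero[OF vspace_mtensor] by metis
next
 case (base ls y) then show ?case by (auto simp: emb_R intro!: I.R_in J.R_in)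
next
 case (add u u' v v') then show ?case
  using linD(2)[OF J.lin_emb[OF IJ I.ne]] vs_add[OF vspace_mtensor] by metis
qed

lemma Gam_sum_list: "(!!a b. (a, b) : set ps ==> (f a b, g a b) : Gam l) ==> ((SUM (a, b)<-ps. f a b), (SUM (a, b)<-ps. g a b)) : Gam l"
proof (induction ps)
 case (Cons p ps)
 then show ?case by (cases p) (simp only: list.map sum_list.Cons split, rule Gam.add, auto)
qed (simp add: Gam.zero)

text \<open>All indices occurring in an expression over \<open>Gam j\<close> lie beyond
  \<open>j\<close>, so prepending a generator at \<open>j\<close> keeps each list
  increasing.\<close>

lemma Gam_gen:
 assumes "(u, u') : Gam j" and j: "j : I" "l < j" and x: "x : carr (X j)"
 shows "(m (I.e j x) u, m' (J.e j x) u') : Gam l"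
 using assms(1)
proof (induction rule: Gam.induct)
 case zero
 have "j : J" using j IJ by auto
 then show ?case
  using lin_0[OF I.lin_m(2)[OF lin_id I.e_in[OF x]] vspace_mtensor]
   lin_0[OF J.lin_m(2)[OF lin_id J.e_in[OF x]] vspace_mtensor] Gam.zero by metis
next
 case (base ls y)
 have "j ~: set ls" using base(4) by auto
 then have *: "I.R ls (y(j := x)) = I.R ls y" "J.R ls (y(j := x)) = J.R ls y"
  by (auto intro!: I.R_cong J.R_cong)
 have "(I.R (j # ls) (y(j := x)), J.R (j # ls) (y(j := x))) : Gam l"
  by (rule Gam.base) (use base j x in "fastforce+")
 then show ?case by (simp only: I.R_simps J.R_simps * fun_upd_same)
next
 case (add u u' v v')
 then show ?case
  using bilD(3)[OF I.m_bilin I.e_in[OF x], of u v] bilD(3)[OF J.m_bilin J.e_in[OF x], of u' v']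
   Gam_in[OF add(1)] Gam_in[OF add(2)] Gam.add[OF add(3,4)] by metis
qed

text \<open>Insertion of a generator into an ordered product: below the head it is prepended, at the
  head it is multiplied in, and above it the braided relation moves it past the head and the tail is
  treated by induction. Both algebras undergo the same steps, so the results stay paired.\<close>

lemma Gam_step:
 assumes "sorted ls" "distinct ls" "set ls <= I" "!!i. i : set ls ==> l < i" "!!i. i : set ls ==> y i : carr (X i)"
  and "i : I" "l < i" "x : carr (X i)"
 shows "(m (I.e i x) (I.R ls y), m' (J.e i x) (J.R ls y)) : Gam l"
 using assms
proof (induction ls arbitrary: l x)
 case Nil
 have "(I.R [] y, J.R [] y) : Gam i" by (rule Gam.base) auto
 then show ?case by (rule Gam_gen) (use Nil in auto)
next
 case (Cons j ls)
 have jI: "j : I" and lj: "l < j" and yj: "y j : carr (X j)" and jls: "!!k. k : set ls ==> j < k"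
  and ls: "sorted ls" "distinct ls" "set ls <= I" "!!k. k : set ls ==> y k : carr (X k)"
  using Cons.prems by force+
 have iJ: "i : J" and jJ: "j : J" using Cons.prems jI IJ by auto
 have Rin: "I.R ls y : carr I.M" "J.R ls y : carr J.M" using I.R_in[OF ls(4)] J.R_in[OF ls(4)] by auto
 note x = Cons.prems(8)
 note ein = I.e_in[OF x] I.e_in[OF yj] J.e_in[OF x] J.e_in[OF yj]
 show ?case
 proof (cases "i < j")
  case True
  have "(I.R (j # ls) y, J.R (j # ls) y) : Gam i" by (rule Gam.base) (use Cons.prems True in force)+
  then show ?thesis by (rule Gam_gen) (use Cons.prems in auto)
 next
  case False
  show ?thesis
  proof (cases "i = j")
   case True
   have in': "mul (X j) x (y j) : carr (X j)" using algD(4)[OF I.algs[OF jI]] x yj True by simp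
   have "(I.R ls y, J.R ls y) : Gam j" by (rule Gam.base) (use ls jls in auto)
   from Gam_gen[OF this jI lj in']
   have "(m (I.e i (mul (X i) x (y i))) (I.R ls y), m' (J.e i (mul (X i) x (y i))) (J.R ls y)) : Gam l"
    using True by simp
   then show ?thesis
    using True x yj iJ jI by (simp add: I.R_simps J.R_simps I.e_mul[symmetric] J.e_mul[symmetric] I.m_assoc J.m_assoc I.e_in J.e_in Rin)
  next
   case ij: False
   then have ij: "j < i" using False by auto
   have I: "m (I.e i x) (I.R (j # ls) y)
    = (SUM (g, z)<-trep H (X i) (coact (X i) x). m (I.e j (act (X j) g (y j))) (m (I.e i z) (I.R ls y)))"
   proof -
    have "m (I.e i x) (I.R (j # ls) y) = m (m (I.e i x) (I.e j (y j))) (I.R ls y)"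
     by (simp add: I.R_simps I.m_assoc ein Rin)
    also have "... = tev H (X i) (coact (X i) x) (%g z. m (m (I.e j (act (X j) g (y j))) (I.e i z)) (I.R ls y))"
     unfolding I.e_rel[OF Cons.prems(6) jI ij x yj]
     by (rule tev_pull[where U = I.M, OF I.lin_m(1)[OF lin_id Rin(1)] vspace_mtensor I.vs I.coX_in[OF Cons.prems(6) x]])
      (intro I.m_in I.e_in I.actX_in[OF jI] yj)
    also have "... = tev H (X i) (coact (X i) x) (%g z. m (I.e j (act (X j) g (y j))) (m (I.e i z) (I.R ls y)))"
     by (rule tevc[OF I.vs I.coX_in[OF Cons.prems(6) x]]) (simp add: I.m_assoc I.e_in I.actX_in[OF jI] yj Rin)
    finally show ?thesis by (simp add: tev_def)
   qed
   have J: "m' (J.e i x) (J.R (j # ls) y)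
    = (SUM (g, z)<-trep H (X i) (coact (X i) x). m' (J.e j (act (X j) g (y j))) (m' (J.e i z) (J.R ls y)))"
   proof -
    have "m' (J.e i x) (J.R (j # ls) y) = m' (m' (J.e i x) (J.e j (y j))) (J.R ls y)"
     by (simp add: J.R_simps J.m_assoc ein Rin)
    also have "... = tev H (X i) (coact (X i) x) (%g z. m' (m' (J.e j (act (X j) g (y j))) (J.e i z)) (J.R ls y))"
     unfolding J.e_rel[OF iJ jJ ij x yj]
     by (rule tev_pull[where U = J.M, OF J.lin_m(1)[OF lin_id Rin(2)] vspace_mtensor I.vs I.coX_in[OF Cons.prems(6) x]])
      (intro J.m_in J.e_in J.actX_in[OF jJ] yj)
    also have "... = tev H (X i) (coact (X i) x) (%g z. m' (J.e j (act (X j) g (y j))) (m' (J.e i z) (J.R ls y)))"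
     by (rule tevc[OF I.vs I.coX_in[OF Cons.prems(6) x]]) (simp add: J.m_assoc J.e_in J.actX_in[OF jJ] yj Rin)
    finally show ?thesis by (simp add: tev_def)
   qed
   show ?thesis unfolding I J
   proof (rule Gam_sum_list)
    fix g z assume "(g, z) : set (trep H (X i) (coact (X i) x))"
    then have g: "g : carr H" and z: "z : carr (X i)" using trep(1)[OF I.vs I.coX_in[OF Cons.prems(6) x]] by auto
    have "(m (I.e i z) (I.R ls y), m' (J.e i z) (J.R ls y)) : Gam j"
     by (rule Cons.IH) (use ls jls Cons.prems ij z in auto)
    then show "(m (I.e j (act (X j) g (y j))) (m (I.e i z) (I.R ls y)), m' (J.e j (act (X j) g (y j))) (m' (J.e i z) (J.R ls y))) : Gam l"
     by (rule Gam_gen[OF _ jI lj I.actX_in[OF jI g yj]])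
   qed
  qed
 qed
qed

text \<open>By linearity the left factor is an ordered product of generators, which are multiplied
  on one at a time; for one generator and an ordered product the two algebras agree by
  \<open>Gam_step\<close>.\<close>

theorem emb_mult:
 assumes u: "u : carr I.M" and v: "v : carr I.M"
 shows "emb I J X (m u v) = m' (emb I J X u) (emb I J X v)"
proof -
 note E = J.lin_emb[OF IJ I.ne] and Ein = J.emb_in[OF IJ I.ne]
 note lin = lin_o[OF _ E] I.lin_m J.lin_m lin_id E
 let ?s = "sorted_list_of_set I"
 have s: "sorted ?s" "distinct ?s" "set ?s <= I" using I.fin by auto
 have gen: "emb I J X (m (I.e i x) v) = m' (J.e i x) (emb I J X v)"
  if i: "i : I" and x: "x : carr (X i)" and v: "v : carr I.M" for i x v
 proof (rule mt_eqI[where f = "%v. emb I J X (m (I.e i x) v)" and g = "%v. m' (J.e i x) (emb I J X v)" and t = v and U = J.M,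
   OF I.ne I.vsX _ _ _ v])
  fix y assume y: "y : PE I X"
  have yin: "y k : carr (X k)" if "k : set ?s" for k using y that s by auto
  \<comment> \<open>\<open>Min I - 1\<close> lies below every index, so that \<open>Gam\<close>
    allows all factors.\<close>
  have "(m (I.e i x) (I.R ?s y), m' (J.e i x) (J.R ?s y)) : Gam (Min I - 1)"
  proof (rule Gam_step[OF s _ yin i _ x])
   show "Min I - 1 < k" if "k : set ?s" for k
   proof -
    have "k : I" using that I.fin by simp
    from Min_le[OF I.fin this] show ?thesis by linarith
   qed
   show "Min I - 1 < i" using Min_le[OF I.fin i] by simp
  qed
  then show "emb I J X (m (I.e i x) (mpure I X y)) = m' (J.e i x) (emb I J X (mpure I X y))"
   using Gam_in emb_R[OF s yin] I.R_all[OF y] by metis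
 qed (simp_all add: lin I.e_in J.e_in x)
 have R: "emb I J X (m (I.R ls y) v) = m' (J.R ls y) (emb I J X v)"
  if "set ls <= I" "!!k. k : set ls ==> y k : carr (X k)" for ls y
  using that
 proof (induction ls)
  case Nil then show ?case using v Ein[OF v] by (simp add: I.R_simps J.R_simps I.un_m J.un_m)
 next
  case (Cons k ls)
  then have k: "k : I" "y k : carr (X k)" and Rin: "I.R ls y : carr I.M" "J.R ls y : carr J.M"
   by (auto intro!: I.R_in J.R_in)
  have "emb I J X (m (I.R (k # ls) y) v) = m' (J.e k (y k)) (emb I J X (m (I.R ls y) v))"
   unfolding I.R_simps I.m_assoc[OF I.e_in[OF k(2)] Rin(1) v] by (rule gen[OF k I.m_in[OF Rin(1) v]])
  also have "... = m' (J.R (k # ls) y) (emb I J X v)"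
   using Cons J.m_assoc[OF J.e_in[OF k(2)] Rin(2) Ein[OF v]] by (simp add: J.R_simps)
  finally show ?case .
 qed
 show ?thesis
 proof (rule mt_eqI[where f = "%u. emb I J X (m u v)" and g = "%u. m' (emb I J X u) (emb I J X v)" and t = u and U = J.M,
   OF I.ne I.vsX _ _ _ u])
  fix y assume y: "y : PE I X"
  have yin: "y k : carr (X k)" if "k : set ?s" for k using y that s by auto
  show "emb I J X (m (mpure I X y) v) = m' (emb I J X (mpure I X y)) (emb I J X v)"
   using R[OF s(3) yin] emb_R[OF s yin] I.R_all[OF y] by metis
 qed (simp_all add: lin v Ein)
qed

end

text \<open>The case of equal index sets in \<open>emb_mult\<close>, where the embedding is the
  identity.\<close>

lemma braided_mult_unique:
 assumes "brm H I X m" "brm H I X m'" "u : carr (mtensor I X)" "v : carr (mtensor I X)"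
 shows "m u v = m' u v"
proof -
 interpret brm_emb H I I X m m' using assms by (simp add: brm_emb_def brm_emb_axioms_def)
 show ?thesis using emb_mult[OF assms(3,4)] I.emb_id[OF I.ne] assms(3,4) I.m_in by metis
qed

subsection \<open>Existence of the braided product\<close>

lemma yd_surj:
 assumes "bialgebra H" and T: "yd_module_algebra H T" and Y: "vspace Y" and f: "yd_hom H T Y f" and "carr Y <= f ` carr T"
 shows "yd_module_algebra H Y"
 by (rule yd_module_algebra_local[OF assms(1) Y]) (use T f assms(5) in blast)

lemma tev_coact_hom:
 assumes "vspace H" "lin_map X Y f" "t : carr (tensor H X)" and ph: "bilin_map H Y U ph" and U: "vspace U"
 shows "tev H Y (tlift H X (%g z. tpure H Y g (f z)) t) ph = tev H X t (%g z. ph g (f z))"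
 by (subst tl_pull[OF lin_ta[OF ph assms(1) U] bil_tpm[OF assms(2), of H] assms(1) vs_t assms(3)])
  (auto intro!: tevc assms tevp[OF ph assms(1) U] linD(1)[OF assms(2)])

lemma bilin_comp: "bilin_map V W U ph ==> lin_map V' V f ==> lin_map W' W g ==> bilin_map V' W' U (%v w. ph (f v) (g w))"
 by (auto simp: bilin_map_def lin_map_def)

lemma lin_map_add: "lin_map V W f ==> lin_map V W g ==> vspace W ==> lin_map V W (%x. f x + g x)"
 by (auto simp: lin_map_def vs_add vs_scal_add add_ac)

lemma lin_map_congI: "(!!x. x : carr V ==> f x = g x) ==> vspace V ==> lin_map V W g ==> lin_map V W f"
 by (auto simp: lin_map_def vs_add vs_scal)

text \<open>\<open>braided_product\<close> with an explicit product \<open>m\<close> in place of the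
  chosen one, for candidates that arise while existence is being proved.\<close>

definition "bp H I X m = (|carr = carr (mtensor I X), scal = scal (mtensor I X), mul = m, unity = mpure I X (\<lambda>i\<in>I. unity (X i)),
   act = (%h. mlift I X (diag_act H I X (sorted_list_of_set I) h)),
   coact = mlift I X (codiag_coact H I X (sorted_list_of_set I) (unity H))|)"

lemma bp_vs: "carr (bp H I X m) = carr (mtensor I X)" "scal (bp H I X m) = scal (mtensor I X)"
 by (simp_all add: bp_def)

lemma bp_cong: "lin_map V (bp H I X m) = lin_map V (mtensor I X)" "lin_map (bp H I X m) U = lin_map (mtensor I X) U"
 "tensor H (bp H I X m) = tensor H (mtensor I X)" "tpure H (bp H I X m) = tpure H (mtensor I X)"
 "tev H (bp H I X m) = tev H (mtensor I X)" "tlift H (bp H I X m) = tlift H (mtensor I X)"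
 by (simp_all only: lin_cong[OF refl refl bp_vs] lin_cong[OF bp_vs refl refl]
  t_cong[OF refl refl bp_vs] tp_cong[OF refl refl bp_vs] tev_cong_vs[OF refl refl bp_vs] tlift_cong_vs[OF refl refl bp_vs])

lemma vspace_bp: "vspace (bp H I X m)"
 using vspace_mtensor[of I X] by (simp add: vspace_def bp_vs del: vspace_mtensor)

lemma bp_alg: "yd_module_algebra H (bp H I X m) ==> assoc_algebra
  (|carr = carr (mtensor I X), scal = scal (mtensor I X), mul = m, unity = mpure I X (\<lambda>i\<in>I. unity (X i))|)"
 by (drule ydD(2), subst (asm) assoc_algebra_cong) (auto simp: bp_def)

context ydfam
begin

abbreviation "sJ == sorted_list_of_set J"

lemma sJ: "finite J ==> set sJ <= J" by simp

lemma unJ: "(\<lambda>i\<in>J. unity (X i)) : PE J X" by (auto simp: unX)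

lemma fat_PE: "x : carr (X i) ==> (\<lambda>j\<in>J. if j = i then x else unity (X j)) : PE J X"
 by (auto simp: unX)

lemma bp_act: "finite J ==> J ~= {} ==> h : carr H ==> y : PE J X ==> act (bp H J X m) h (mpure J X y) = diag_act H J X sJ h y"
 unfolding bp_def by (simp add: mlift_mpure[OF _ vsX diag_multilin[OF sJ] vspace_mtensor])

lemma lin_bp_act: "finite J ==> J ~= {} ==> h : carr H ==> lin_map M M (act (bp H J X m) h)"
 unfolding bp_def by (simp add: lin_mlift[OF _ vsX diag_multilin[OF sJ] vspace_mtensor])

lemma bp_coact: "finite J ==> J ~= {} ==> y : PE J X ==> coact (bp H J X m) (mpure J X y) = codiag_coact H J X sJ (unity H) y"
 unfolding bp_def by (simp add: mlift_mpure[OF _ vsX codiag_multilin[OF sJ one_in] vs_t])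

lemma lin_bp_coact: "finite J ==> J ~= {} ==> lin_map M (tensor H M) (coact (bp H J X m))"
 unfolding bp_def by (simp add: lin_mlift[OF _ vsX codiag_multilin[OF sJ one_in] vs_t])

lemma lin_factor_at: "i : J ==> lin_map (X i) M (factor_at J X i)"
proof -
 assume i: "i : J"
 have "(\<lambda>j\<in>J. if j = i then v else unity (X j)) = (\<lambda>j\<in>J. unity (X j))(i := v)" for v
  using i by (auto simp: fun_eq_iff)
 then show ?thesis using multilinD(2)[OF mlin_mp unJ i] unfolding factor_at_def[abs_def] by simp
qed

lemma coact_factor_at:
 assumes fin: "finite J" and i: "i : J" and x: "x : carr (X i)"
 shows "coact (bp H J X m) (factor_at J X i x) = tlift H (X i) (%g z. tpure H M g (factor_at J X i z)) (coact (X i) x)" (is "?L = ?R")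
proof -
 let ?y = "%x. \<lambda>j\<in>J. if j = i then x else unity (X j)"
 have f: "filter (%j. j = i) sJ = [i]"
  by (rule sorted_distinct_set_unique) (use fin i in "auto simp: sorted_wrt_filter")
 have "?L = codiag_coact H J X sJ (unity H) (?y x)"
  unfolding factor_at_def by (rule bp_coact[OF fin _ fat_PE[OF x]]) (use i in auto)
 also have "... = codiag_coact H J X (filter (%j. j = i) sJ) (unity H) (?y x)"
  by (rule codiag_filter[OF sJ[OF fin] one_in fat_PE[OF x]]) (use fin in auto)
 also have "... = ?R"
 proof -
  have "(?y x)(i := z) = ?y z" for z using i by (auto simp: fun_eq_iff)
  moreover have "(?y x) i = x" using i by simp
  ultimately show ?thesis unfolding f codiag_coact.simps factor_at_def by (auto intro!: tlift_cong simp: one_mul)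
 qed
 finally show ?thesis .
qed

text \<open>\<open>Ph\<close> is a linear isomorphism with inverse \<open>Ps\<close>. The product is
  carried over along it by definition, whereas action and coaction are already fixed in
  \<open>bp\<close>, so their compatibility is a premise.\<close>

lemma bp_transport:
 assumes T: "yd_module_algebra H T" and fin: "finite J" and ne: "J ~= {}" and Ph: "lin_map T M Ph"
  and Ps: "!!u. u : carr M ==> Ps u : carr T & Ph (Ps u) = u" "!!t. t : carr T ==> Ps (Ph t) = t"
  and un: "Ph (unity T) = mpure J X (\<lambda>i\<in>J. unity (X i))"
  and act: "!!h t. h : carr H ==> t : carr T ==> Ph (act T h t) = act (bp H J X m) h (Ph t)"
  and co: "!!t. t : carr T ==> coact (bp H J X m) (Ph t) = tlift H T (%g z. tpure H M g (Ph z)) (coact T t)"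
  and m: "m = (%u v. Ph (mul T (Ps u) (Ps v)))"
 shows "yd_module_algebra H (bp H J X m)"
proof (rule yd_surj[OF bialg T vspace_bp])
 show "carr (bp H J X m) <= Ph ` carr T" using Ps(1) by (auto simp: bp_vs image_iff) metis
 show "yd_hom H T (bp H J X m) Ph"
  unfolding yd_hom_def bp_cong
  using Ph act co un by (auto simp: m Ps(2)) (auto simp: bp_def Ps(2))
qed

end

lemma braided_mult_single:
 assumes H: "bialgebra H" and X: "yd_module_algebra H (X s)"
 shows "EX m. braided_mult H {s} X m & yd_module_algebra H (bp H {s} X m)"
proof -
 interpret ydfam H "{s}" X by unfold_locales (use H X in auto)
 interpret S: ydalg H "X s" by (rule ydalgI[OF X])
 have PE: "y = (\<lambda>j\<in>{s}. y s)" "y s : carr (X s)" if "y : PE {s} X" for y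
  using that by (auto simp: fun_eq_iff PiE_iff extensional_def)
 let ?Ph = "factor_at {s} X s" and ?Ps = "mlift {s} X (%y. y s)"
 have Ph: "?Ph x = mpure {s} X (\<lambda>j\<in>{s}. x)" for x
  unfolding factor_at_def by (rule arg_cong[where f = "mpure {s} X"]) auto
 have in': "(\<lambda>j\<in>{s}. x) : PE {s} X" if "x : carr (X s)" for x using that by auto
 have ml: "multilin {s} X (X s) (%y. y s)" by (auto simp: multilin_def lin_id)
 have Psm: "?Ps (mpure {s} X y) = y s" if "y : PE {s} X" for y
  by (rule mlift_mpure[OF _ vsX ml S.X_vs that]) auto
 have Psl: "lin_map M (X s) ?Ps" by (rule lin_mlift[OF _ vsX ml S.X_vs]) auto
 have Phl: "lin_map (X s) M ?Ph" by (rule lin_factor_at) simp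
 have PsPh: "?Ps (?Ph x) = x" if "x : carr (X s)" for x unfolding Ph Psm[OF in'[OF that]] by simp
 have PhPs: "?Ph (?Ps u) = u" if u: "u : carr M" for u
 proof (rule mt_eqI[where f = "%u. ?Ph (?Ps u)" and g = "%u. u" and U = M and t = u, OF _ vsX _ _ _ u])
  fix y assume y: "y : PE {s} X"
  show "?Ph (?Ps (mpure {s} X y)) = mpure {s} X y" unfolding Psm[OF y] Ph using PE(1)[OF y] by simp
 qed (auto intro: lin_o[OF Psl Phl] lin_id)
 define m where "m = (%u v. ?Ph (mul (X s) (?Ps u) (?Ps v)))"
 have yd: "yd_module_algebra H (bp H {s} X m)"
 proof (rule bp_transport[OF X _ _ Phl _ PsPh _ _ _ m_def])
  fix h t assume h: "h : carr H" and t: "t : carr (X s)"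
  have "act (bp H {s} X m) h (?Ph t) = diag_act H {s} X [s] h (\<lambda>j\<in>{s}. t)"
   unfolding Ph using bp_act[OF _ _ h in'[OF t]] by simp
  also have "... = Sw h (%h1 h2. diag_act H {s} X [] h2 ((\<lambda>j\<in>{s}. t)(s := act (X s) h1 ((\<lambda>j\<in>{s}. t) s))))"
   by (rule diag_Cons[OF _ _ h in'[OF t]]) auto
  also have "... = Sw h (%h1 h2. scal M (cou H h2) (?Ph (act (X s) h1 t)))"
  proof -
   have "(\<lambda>j\<in>{s}. t)(s := v) = (\<lambda>j\<in>{s}. v)" "(\<lambda>j\<in>{s}. t) s = t" for v by (auto simp: fun_eq_iff)
   then show ?thesis unfolding Ph by (simp only: diag_act.simps scal_mtensor)
  qed
  also have "... = ?Ph (act (X s) h t)"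
   by (rule Sw_counit_right[OF lin_o[OF bilL[OF S.act_bilin lin_id t] Phl] vspace_mtensor h])
  finally show "?Ph (act (X s) h t) = act (bp H {s} X m) h (?Ph t)" ..
 next
  fix t assume "t : carr (X s)"
  then show "coact (bp H {s} X m) (?Ph t) = tlift H (X s) (%g z. tpure H M g (?Ph z)) (coact (X s) t)"
   by (intro coact_factor_at) auto
 qed (use PhPs linD(1)[OF Psl] Ph in \<open>auto intro!: arg_cong[where f = "mpure {s} X"]\<close>)
 have "braided_mult H {s} X m" unfolding braided_mult_def
 proof (intro conjI ballI impI bp_alg[OF yd])
  fix x assume "x : PE {s} X"
  note x = PE[OF this]
  have "foldr (%i. m (factor_at {s} X i (x i))) (sorted_list_of_set {s}) (mpure {s} X (\<lambda>i\<in>{s}. unity (X i)))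
   = m (?Ph (x s)) (mpure {s} X (\<lambda>i\<in>{s}. unity (X i)))" by simp
  also have "... = ?Ph (x s)" unfolding m_def PsPh[OF x(2)] Psm[OF unJ] by (simp add: S.X_mul_one x(2))
  finally show "mpure {s} X x = foldr (%i. m (factor_at {s} X i (x i))) (sorted_list_of_set {s})
    (mpure {s} X (\<lambda>i\<in>{s}. unity (X i)))" unfolding Ph using x(1) by simp
 qed (auto simp: m_def PsPh)
 then show ?thesis using yd by blast
qed

text \<open>Induction step of the existence proof: a factor at \<open>s\<close>, to the left of all
  indices in \<open>I'\<close>, is adjoined by the two-factor product of \<open>X s\<close> with the
  product already built over \<open>I'\<close>.\<close>

locale bstep = N: brm H I' X m' for H :: "('k::field, 'h::ab_group_add, 'u) bialg_scheme"
  and I' and X :: "int => ('k, 'h, 'x::ab_group_add, 'z) yd_scheme" and m' +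
 fixes s :: int
 assumes s: "!!i. i : I' ==> s < i" and ydS: "yd_module_algebra H (X s)" and ydN: "yd_module_algebra H (bp H I' X m')"
begin

abbreviation "I == insert s I'"
abbreviation "Nn == bp H I' X m'"
abbreviation "N' == mtensor I' X"

sublocale T: yd2 H "X s" Nn
 using ydS ydN by (intro yd2.intro ydalgI)

sublocale I: ydfam H I X
 by unfold_locales (use ydS N.ydX in auto)

lemma sI: "s ~: I'" "I' <= I" "sorted_list_of_set I = s # sorted_list_of_set I'" and finI: "finite I" "I ~= {}"
proof -
 show "sorted_list_of_set I = s # sorted_list_of_set I'"
  using sorted_list_of_set.idem_if_sorted_distinct[of "s # sorted_list_of_set I'"] N.fin s
  by (force intro: less_imp_le)
qed (use s N.fin in auto)

lemma Nn_simps [simp]: "carr Nn = carr N'" "unity Nn = N.un" "mul Nn = m'" by (simp_all add: bp_def)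

abbreviation tp (infix "><" 65) where "x >< t == tpure (X s) Nn x t"
abbreviation "TT == tensor (X s) Nn"

lemma upd_s: "y : PE I' X ==> x : carr (X s) ==> y(s := x) : PE I X"
 by (auto simp: PiE_iff extensional_def)

definition "F x = mlift I' X (%y. mpure I X (y(s := x)))"

lemma F_multilin: "x : carr (X s) ==> multilin I' X I.M (%y. mpure I X (y(s := x)))"
 unfolding multilin_def
proof (intro ballI conjI)
 fix y i assume x: "x : carr (X s)" and y: "y : PE I' X" and i: "i : I'"
 then have "s ~= i" using sI by auto
 then have eq: "y(i := v, s := x) = y(s := x, i := v)" for v by auto
 show "lin_map (X i) I.M (%v. mpure I X (y(i := v, s := x)))"
  unfolding eq by (rule multilinD(2)[OF mlin_mp upd_s[OF y x]]) (use i in simp)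
qed (rule mpure_in[OF upd_s])

lemma F_pure: "x : carr (X s) ==> y : PE I' X ==> F x (mpure I' X y) = mpure I X (y(s := x))"
 unfolding F_def by (rule mlift_mpure[OF N.ne N.vsX F_multilin vspace_mtensor])

lemma lin_F: "x : carr (X s) ==> lin_map N' I.M (F x)"
 unfolding F_def by (rule lin_mlift[OF N.ne N.vsX F_multilin vspace_mtensor])

lemma lin_F_left: assumes t: "t : carr N'" shows "lin_map (X s) I.M (%x. F x t)"
 using t
proof (induction rule: mtensor_induct_pure)
 case (pure y)
 have "lin_map (X s) I.M (%x. mpure I X (y(s := x)))"
  using multilinD(2)[OF mlin_mp upd_s[OF pure T.X.X_one_in], of s] by simp
 then show ?case
  using vs_add[OF T.X.X_vs] vs_scal[OF T.X.X_vs] by (simp add: lin_map_def F_pure pure)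
next
 case (add a b)
 show ?case
  by (rule lin_map_congI[OF _ T.X.X_vs lin_map_add[OF add(3,4) vspace_mtensor]]) (rule linD(2)[OF lin_F add(1,2)])
qed (use N.ne N.vsX in auto)

lemma F_bilin: "bilin_map (X s) Nn I.M F"
 by (simp add: bilin_map_def bp_cong lin_F lin_F_left)

text \<open>\<open>Ph\<close> and \<open>Ps\<close> below are the mutually inverse identifications
  of \<open>X s\<close> tensored with the product over \<open>I'\<close> and the tensor product over
  \<open>I\<close>.\<close>

definition "Ph = tlift (X s) Nn F"

lemma lin_Ph: "lin_map TT I.M Ph"
 unfolding Ph_def by (rule lin_tlift[OF F_bilin T.X.X_vs vspace_mtensor])

lemma Ph_pure: "x : carr (X s) ==> t : carr N' ==> Ph (x >< t) = F x t"
 unfolding Ph_def by (rule tl_pure[OF F_bilin T.X.X_vs vspace_mtensor]) simp_all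

lemma tp_in: "x : carr (X s) ==> t : carr N' ==> x >< t : carr TT"
 by (rule tpI) simp_all

lemma T_eq_on_pure:
 assumes f: "lin_map TT U f" and g: "lin_map TT U g"
  and eq: "!!x y. x : carr (X s) ==> y : PE I' X ==> f (x >< mpure I' X y) = g (x >< mpure I' X y)" and t: "t : carr TT"
 shows "f t = g t"
proof (rule T.eq_on_pure[OF f g t])
 fix x u assume x: "x : carr (X s)" and "u : carr Nn"
 then have u: "u : carr N'" by simp
 note l = ltpR[OF lin_id x, of Nn, unfolded bp_cong]
 show "f (x >< u) = g (x >< u)"
  by (rule mt_eqI[where f = "%u. f (x >< u)" and g = "%u. g (x >< u)" and t = u, OF N.ne N.vsX lin_o[OF l f] lin_o[OF l g] eq[OF x] u])
qed

definition "Ps = mlift I X (%z. z s >< mpure I' X (restrict z I'))"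

lemma restr: "z : PE I X ==> restrict z I' : PE I' X" by (auto simp: PiE_iff)

lemma Ps_multilin: "multilin I X TT (%z. z s >< mpure I' X (restrict z I'))"
 unfolding multilin_def
proof (intro ballI conjI)
 fix z assume z: "z : PE I X"
 have zs: "z s : carr (X s)" using z by auto
 show "z s >< mpure I' X (restrict z I') : carr TT" by (rule tp_in[OF zs mpure_in[OF restr[OF z]]])
 fix i assume i: "i : I"
 show "lin_map (X i) TT (%v. (z(i := v)) s >< mpure I' X (restrict (z(i := v)) I'))"
 proof (cases "i = s")
  case True
  then have "restrict (z(i := v)) I' = restrict z I'" for v using sI by (auto simp: fun_eq_iff)
  then show ?thesis using ltpL[OF lin_id, of _ Nn] mpure_in[OF restr[OF z]] True by simp
 next
  case False
  then have *: "restrict (z(i := v)) I' = (restrict z I')(i := v)" "(z(i := v)) s = z s" for v using i by (auto simp: fun_eq_iff)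
  have "i : I'" using False i by simp
  from multilinD(2)[OF mlin_mp restr[OF z] this]
  have "lin_map (X i) Nn (%v. mpure I' X ((restrict z I')(i := v)))" by (simp add: bp_cong)
  from ltpR[OF this zs] show ?thesis unfolding * .
 qed
qed

lemma Ps_pure: "z : PE I X ==> Ps (mpure I X z) = z s >< mpure I' X (restrict z I')"
 unfolding Ps_def by (rule mlift_mpure[OF finI(2) I.vsX Ps_multilin vs_t])

lemma lin_Ps: "lin_map I.M TT Ps"
 unfolding Ps_def by (rule lin_mlift[OF finI(2) I.vsX Ps_multilin vs_t])

lemma PhPs: assumes u: "u : carr I.M" shows "Ph (Ps u) = u"
proof (rule mt_eqI[where f = "%u. Ph (Ps u)" and g = "%u. u" and t = u, OF finI(2) I.vsX lin_o[OF lin_Ps lin_Ph] lin_id _ u])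
 fix z assume z: "z : PE I X"
 then have zs: "z s : carr (X s)" by auto
 have "(restrict z I')(s := z s) = z" using z by (auto simp: fun_eq_iff PiE_iff extensional_def)
 then show "Ph (Ps (mpure I X z)) = mpure I X z"
  by (simp add: Ps_pure[OF z] Ph_pure[OF zs mpure_in[OF restr[OF z]]] F_pure[OF zs restr[OF z]])
qed

lemma PsPh: assumes t: "t : carr TT" shows "Ps (Ph t) = t"
proof (rule T_eq_on_pure[where f = "%t. Ps (Ph t)" and g = "%t. t", OF lin_o[OF lin_Ph lin_Ps] lin_id _ t])
 fix x y assume x: "x : carr (X s)" and y: "y : PE I' X"
 have "restrict (y(s := x)) I' = y" using y sI(1) by (auto simp: fun_eq_iff PiE_iff extensional_def)
 then show "Ps (Ph (x >< mpure I' X y)) = x >< mpure I' X y"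
  by (simp add: Ph_pure[OF x mpure_in[OF y]] F_pure[OF x y] Ps_pure[OF upd_s[OF y x]])
qed

definition "m = (%u v. Ph (mul T.P (Ps u) (Ps v)))"

lemma m_Ph: "a : carr TT ==> b : carr TT ==> m (Ph a) (Ph b) = Ph (mul T.P a b)"
 by (simp add: m_def PsPh)

lemma e_s: assumes x: "x : carr (X s)" shows "factor_at I X s x = Ph (x >< N.un)"
proof -
 have "(\<lambda>i\<in>I'. unity (X i))(s := x) = (\<lambda>j\<in>I. if j = s then x else unity (X j))" using sI by (auto simp: fun_eq_iff)
 then show ?thesis
  by (simp add: Ph_pure[OF x N.un_in] F_pure[OF x N.unJ] factor_at_def del: insert_iff)
qed

lemma e_i: assumes i: "i : I'" and x: "x : carr (X i)" shows "factor_at I X i x = Ph (unity (X s) >< N.e i x)"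
proof -
 have "(\<lambda>j\<in>I'. if j = i then x else unity (X j))(s := unity (X s)) = (\<lambda>j\<in>I. if j = i then x else unity (X j))"
  using sI i by (auto simp: fun_eq_iff)
 then show ?thesis
  using Ph_pure[OF T.X.X_one_in N.e_in[OF x]] F_pure[OF T.X.X_one_in N.fat_PE[OF x]]
  by (simp add: factor_at_def del: insert_iff)
qed

lemma Ph_one: "Ph (unity T.P) = mpure I X (\<lambda>i\<in>I. unity (X i))"
proof -
 have "(\<lambda>i\<in>I'. unity (X i))(s := unity (X s)) = (\<lambda>i\<in>I. unity (X i))" by (auto simp: fun_eq_iff)
 then show ?thesis
  by (simp add: T.P_one Ph_pure[OF T.X.X_one_in N.un_in] F_pure[OF T.X.X_one_in N.unJ] del: insert_iff)
qed

lemma Ph_act: assumes h: "h : carr H" and t: "t : carr TT" shows "Ph (act T.P h t) = act (bp H I X m) h (Ph t)"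
proof (rule T_eq_on_pure[where f = "%t. Ph (act T.P h t)" and g = "%t. act (bp H I X m) h (Ph t)" and U = I.M, OF _ _ _ t])
 show "lin_map TT I.M (%t. Ph (act T.P h t))"
  by (rule lin_o[OF _ lin_Ph]) (rule T.lin_Pact(2)[OF lin_id h])
 show "lin_map TT I.M (%t. act (bp H I X m) h (Ph t))"
  by (rule lin_o[OF lin_Ph I.lin_bp_act[OF finI h]])
 fix x y assume x: "x : carr (X s)" and y: "y : PE I' X"
 have js: "set (sorted_list_of_set I') <= I" "set (sorted_list_of_set I') <= I'" using N.fin by auto
 have "Ph (act T.P h (x >< mpure I' X y)) = Ph (N.Sw h (%h1 h2. act (X s) h1 x >< act Nn h2 (mpure I' X y)))" (is "?Z = _")
  by (subst T.P_act_pure[OF h x]) (simp_all add: mpure_in[OF y] T.ba_def)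
 also have "... = N.Sw h (%h1 h2. Ph (act (X s) h1 x >< act Nn h2 (mpure I' X y)))"
  by (rule tev_pull[OF lin_Ph vs_t N.vs N.cop_in[OF h]])
   (intro tp_in T.X.act_in x linD(1)[OF N.lin_bp_act[OF N.fin N.ne]] mpure_in[OF y], assumption+)
 also have "... = N.Sw h (%h1 h2. diag_act H I X (sorted_list_of_set I') h2 (y(s := act (X s) h1 x)))"
 proof (rule N.Swc[OF h])
  fix h1 h2 assume h12: "h1 : carr H" "h2 : carr H"
  note a = T.X.act_in[OF h12(1) x]
  have "Ph (act (X s) h1 x >< act Nn h2 (mpure I' X y)) = F (act (X s) h1 x) (diag_act H I' X (sorted_list_of_set I') h2 y)" (is "?Z = _")
   unfolding N.bp_act[OF N.fin N.ne h12(2) y] by (rule Ph_pure[OF a N.diag_in[OF js(2) h12(2) y]])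
  also have "... = diag_act H I X (sorted_list_of_set I') h2 (y(s := act (X s) h1 x))"
   by (rule I.diag_map[where g = "%y. y(s := act (X s) h1 x)", OF sI(2) lin_F[OF a] F_pure[OF a] _ _ _ js(2) h12(2) y])
    (use upd_s[OF _ a] sI(1) in "auto simp: fun_eq_iff")
  finally show "?Z = ..." .
 qed
 also have "... = diag_act H I X (s # sorted_list_of_set I') h (y(s := x))"
  by (subst I.diag_Cons[OF _ js(1) h upd_s[OF y x]]) simp_all
 also have "... = act (bp H I X m) h (Ph (x >< mpure I' X y))"
  unfolding Ph_pure[OF x mpure_in[OF y]] F_pure[OF x y] I.bp_act[OF finI h upd_s[OF y x]] sI(3) ..
 finally show "?Z = ..." .
qed

end

lemma foldr_transfer:
 assumes "!!i t. i : set ls ==> t : C ==> g i t : C & f i (h t) = h (g i t)" "u : C"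
 shows "foldr f ls (h u) = h (foldr g ls u)"
proof -
 have "foldr g ls u : C & foldr f ls (h u) = h (foldr g ls u)"
  using assms(1) by (induction ls) (auto simp: assms(2))
 then show ?thesis ..
qed

context bstep
begin

lemma Ph_coact:
 assumes t: "t : carr TT" shows "coact (bp H I X m) (Ph t) = tlift H T.P (%g z. tpure H I.M g (Ph z)) (coact T.P t)"
proof -
 have TP: "tlift H T.P = tlift H TT" by (rule tlift_cong_vs[OF refl refl T.P_vs])
 note b = bil_tpm[OF lin_Ph, of H]
 let ?G = "tlift H TT (%g z. tpure H I.M g (Ph z))"
 have G: "lin_map (tensor H TT) (tensor H I.M) ?G" by (rule lin_tlift[OF b N.vs vs_t])
 show ?thesis unfolding TP
 proof (rule T_eq_on_pure[where f = "%t. coact (bp H I X m) (Ph t)" and g = "%t. ?G (coact T.P t)" and U = "tensor H I.M", OF _ _ _ t])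
  show "lin_map TT (tensor H I.M) (%t. coact (bp H I X m) (Ph t))"
   by (rule lin_o[OF lin_Ph I.lin_bp_coact[OF finI]])
  show "lin_map TT (tensor H I.M) (%t. ?G (coact T.P t))" by (rule lin_o[OF T.P_coact_lin G])
  fix x y assume x: "x : carr (X s)" and y: "y : PE I' X"
  have js: "set (sorted_list_of_set I') <= I" "set (sorted_list_of_set I') <= I'" using N.fin by auto
  have yin: "mpure I' X y : carr Nn" using mpure_in[OF y] by simp
  note xc = T.X.coact_in[OF x] and yc = T.Y.coact_in[OF yin]
  have "?G (coact T.P (x >< mpure I' X y)) = tev H (X s) (coact (X s) x) (%g x0.
    ?G (tev H Nn (coact Nn (mpure I' X y)) (%k y0. tpure H TT (mul H g k) (x0 >< y0))))"
   unfolding T.P_coact_pure[OF x yin] T.bc_def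
   by (rule tev_pull[OF G vs_t N.vs xc]) (intro tev_in[OF N.vs vs_t yc] tpI N.mul_in)
  also have "... = tev H (X s) (coact (X s) x) (%g x0. codiag_coact H I X (sorted_list_of_set I') g (y(s := x0)))"
  proof (rule tevc[OF N.vs xc])
   fix g x0 assume g: "g : carr H" and x0: "x0 : carr (X s)"
   have bK: "bilin_map H Nn (tensor H I.M) (%k y0. tpure H I.M (mul H g k) (F x0 y0))"
    by (rule bilin_comp[OF bilin_tpure lmR[OF N.alg lin_id g]]) (simp add: bp_cong lin_F[OF x0])
   have "?G (tev H Nn (coact Nn (mpure I' X y)) (%k y0. tpure H TT (mul H g k) (x0 >< y0)))
    = tev H Nn (coact Nn (mpure I' X y)) (%k y0. ?G (tpure H TT (mul H g k) (x0 >< y0)))" (is "?Z = _")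
    by (rule tev_pull[OF G vs_t N.vs yc]) (intro tpI N.mul_in g x0)
   also have "... = tev H Nn (coact Nn (mpure I' X y)) (%k y0. tpure H I.M (mul H g k) (F x0 y0))"
    by (rule tevc[OF N.vs yc], subst tl_pure[OF b N.vs vs_t]) (simp_all add: N.mul_in g tp_in x0 Ph_pure)
   \<comment> \<open>The coaction component \<open>g\<close> of the new leftmost entry plays the
     role of the prefix \<open>c\<close> in \<open>codiag_map\<close>.\<close>
   also have "... = codiag_coact H I X (sorted_list_of_set I') (mul H g (unity H)) (y(s := x0))"
    unfolding N.bp_coact[OF N.fin N.ne y]
   proof (rule I.codiag_map[where f = "%y. y(s := x0)" and F = "%t. tev H Nn t (%k y0. tpure H I.M (mul H g k) (F x0 y0))",
      OF sI(2) _ _ g _ _ _ js(2) N.one_in y])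
    show "lin_map (tensor H N') (tensor H I.M) (%t. tev H Nn t (%k y0. tpure H I.M (mul H g k) (F x0 y0)))"
     using lin_ta[OF bK N.vs vs_t] by (simp add: bp_cong)
    fix h z assume h: "h : carr H" and z: "z : PE I' X"
    show "tev H Nn (tpure H N' h (mpure I' X z)) (%k y0. tpure H I.M (mul H g k) (F x0 y0))
     = tpure H I.M (mul H g h) (mpure I X (z(s := x0)))"
     using tevp[OF bK N.vs vs_t h, of "mpure I' X z"] mpure_in[OF z] F_pure[OF x0 z]
     by (simp only: bp_cong Nn_simps)
   qed (use upd_s[OF _ x0] sI(1) in "auto simp: fun_eq_iff")
   also have "... = codiag_coact H I X (sorted_list_of_set I') g (y(s := x0))" by (simp only: N.mul_one[OF g])
   finally show "?Z = ..." .
  qed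
  also have "... = codiag_coact H I X (s # sorted_list_of_set I') (unity H) (y(s := x))"
   unfolding I.codiag_Cons[OF insertI1 js(1) N.one_in upd_s[OF y x]] fun_upd_same
   by (rule tevc[OF N.vs xc]) (simp only: N.one_mul fun_upd_upd)
  also have "... = coact (bp H I X m) (Ph (x >< mpure I' X y))"
   unfolding Ph_pure[OF x mpure_in[OF y]] F_pure[OF x y] I.bp_coact[OF finI upd_s[OF y x]] sI(3) ..
  finally show "coact (bp H I X m) (Ph (x >< mpure I' X y)) = ?G (coact T.P (x >< mpure I' X y))" ..
 qed
qed

lemma yd_m: "yd_module_algebra H (bp H I X m)"
 by (rule I.bp_transport[where T = T.P and Ph = Ph and Ps = Ps, OF T.yd_bprod finI _ _ _ Ph_one _ _ m_def])
  (use PhPs PsPh linD(1)[OF lin_Ps] Ph_act Ph_coact lin_Ph in "auto simp: T.P_vs T.P_cong")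

lemma m_left: "x : carr (X s) ==> z : carr (X s) ==> w : carr N' ==> m (Ph (x >< N.un)) (Ph (z >< w)) = Ph (mul (X s) x z >< w)"
 using T.P_left_pure[of x z w] N.un_in by (simp add: m_Ph tp_in)

lemma m_right: "x : carr (X s) ==> t : carr N' ==> w : carr N' ==> m (Ph (x >< t)) (Ph (unity (X s) >< w)) = Ph (x >< m' t w)"
 using T.P_right_pure[of x t w] by (simp add: m_Ph tp_in T.X.X_one_in)

lemma foldr_m:
 assumes "set ls <= I'" and xi: "!!i. i : I' ==> x i : carr (X i)"
 shows "foldr (%i. m (factor_at I X i (x i))) ls (Ph (unity (X s) >< N.un)) = Ph (unity (X s) >< N.R ls x)" (is "?L = _")
proof -
 have "?L = Ph (unity (X s) >< foldr (%i. m' (N.e i (x i))) ls N.un)"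
 proof (rule foldr_transfer[where C = "carr N'" and h = "%t. Ph (unity (X s) >< t)"])
  fix i t assume "i : set ls" and t: "t : carr N'"
  then have i: "i : I'" using assms(1) by auto
  note ein = N.e_in[OF xi[OF i]]
  show "m' (N.e i (x i)) t : carr N' & m (factor_at I X i (x i)) (Ph (unity (X s) >< t)) = Ph (unity (X s) >< m' (N.e i (x i)) t)"
   using m_right[OF T.X.X_one_in ein t] N.m_in[OF ein t] by (simp only: e_i[OF i xi[OF i]])
 qed (rule N.un_in)
 then show ?thesis by (simp only: N.R_def)
qed

lemma bm_m: "braided_mult H I X m"
 unfolding braided_mult_def
proof (intro conjI ballI impI bp_alg[OF yd_m])
 note one = T.X.X_one_in
 fix i x y assume i: "i : I" and x: "x : carr (X i)" and y: "y : carr (X i)"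
 show "m (factor_at I X i x) (factor_at I X i y) = factor_at I X i (mul (X i) x y)"
 proof (cases "i = s")
  case True
  then show ?thesis using x y by (simp add: e_s m_left N.un_in T.X.X_mul_in del: insert_iff)
 next
  case False
  then have i: "i : I'" using i by simp
  show ?thesis using x y i algD(4)[OF N.algs[OF i] x y]
   by (simp add: e_i m_right N.e_in one N.e_mul)
 qed
next
 fix x assume x: "x : PE I X"
 have xs: "x s : carr (X s)" and xi: "!!i. i : I' ==> x i : carr (X i)" using x by auto
 note one = T.X.X_one_in
 have "N.R (sorted_list_of_set I') x = N.R (sorted_list_of_set I') (restrict x I')" (is "?Z = _")
  by (rule N.R_cong) (use N.fin in simp)
 also have "... = mpure I' X (restrict x I')" by (rule N.R_all[OF restr[OF x]])
 finally have R: "?Z = ..." .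
 have "(restrict x I')(s := x s) = x" using x by (auto simp: fun_eq_iff PiE_iff extensional_def)
 then have "mpure I X x = Ph (x s >< mpure I' X (restrict x I'))" (is "?Z = _")
  by (simp add: Ph_pure[OF xs mpure_in[OF restr[OF x]]] F_pure[OF xs restr[OF x]])
 also have "... = m (factor_at I X s (x s)) (Ph (unity (X s) >< N.R (sorted_list_of_set I') x))"
  using m_left[OF xs one mpure_in[OF restr[OF x]]] by (simp add: e_s[OF xs] R T.X.X_mul_one xs)
 also have "... = foldr (%i. m (factor_at I X i (x i))) (sorted_list_of_set I) (mpure I X (\<lambda>i\<in>I. unity (X i)))"
  using foldr_m[of "sorted_list_of_set I'" x] xi N.fin Ph_one by (simp add: sI(3) T.P_one)
 finally show "?Z = ..." .
next
 note one = T.X.X_one_in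
 fix i j x y assume i: "i : I" and j: "j : I" and ij: "j < i" and x: "x : carr (X i)" and y: "y : carr (X j)"
 then have i': "i : I'" using s by force
 note xc = N.coX_in[OF i' x]
 let ?R = "tlift H (X i) (%g z. m (factor_at I X j (act (X j) g y)) (factor_at I X i z)) (coact (X i) x)"
 show "m (factor_at I X i x) (factor_at I X j y) = ?R"
 \<comment> \<open>Here \<open>i\<close> differs from \<open>s\<close>, the least index. For
   \<open>j = s\<close> the relation is the definition of the two-factor product; otherwise it is
   the relation over \<open>I'\<close>, carried over by \<open>Ph\<close>.\<close>
 proof (cases "j = s")
  case True
  then have y: "y : carr (X s)" using y by simp
  have eN: "N.e i x : carr Nn" using N.e_in[OF x] by simp
  have b: "bilin_map H Nn I.M (%g y0. Ph (act (X s) g y >< y0))"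
   by (rule bil_o[OF bilin_comp[OF bilin_tpure bilL[OF T.X.act_bilin lin_id y] lin_id] lin_Ph])
  have le: "lin_map (X i) Nn (N.e i)" unfolding bp_cong by (rule N.lin_e[OF i'])
  have "m (factor_at I X i x) (factor_at I X j y) = Ph (T.bm (unity (X s)) (N.e i x) y N.un)"
   unfolding True e_i[OF i' x] e_s[OF y]
   using m_Ph[OF tp_in[OF one N.e_in[OF x]] tp_in[OF y N.un_in]] T.P_mul_pure[OF one eN y, of N.un] N.un_in by simp
  also have "... = tev H Nn (coact Nn (N.e i x)) (%g y0. Ph (mul (X s) (unity (X s)) (act (X s) g y) >< mul Nn y0 N.un))"
   unfolding T.bm_def by (rule tev_pull[OF lin_Ph vs_t N.vs T.Y.coact_in[OF eN]])
    (use N.un_in N.m_in in "auto intro!: tpI T.X.X_mul_in one T.X.act_in y")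
  also have "... = tev H Nn (coact Nn (N.e i x)) (%g y0. Ph (act (X s) g y >< y0))"
   by (rule tevc[OF N.vs T.Y.coact_in[OF eN]]) (simp add: T.X.X_one_mul T.X.act_in y N.m_un)
  also have "... = tev H (X i) (coact (X i) x) (%g z. Ph (act (X s) g y >< N.e i z))"
   using tev_coact_hom[OF N.vs le xc b vspace_mtensor] N.coact_factor_at[OF N.fin i' x] by (simp add: bp_cong)
  also have "... = tlift H (X i) (%g z. Ph (act (X s) g y >< N.e i z)) (coact (X i) x)"
   by (rule tl_tev[symmetric, OF bilin_comp[OF b lin_id le] N.vs vspace_mtensor xc])
  also have "... = ?R"
   by (rule tlift_cong) (simp add: True e_s e_i i' T.X.act_in y m_right N.un_in N.e_in N.un_m)
  finally show ?thesis .
 next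
  case False
  then have j': "j : I'" using j by simp
  let ?f = "%t. Ph (unity (X s) >< t)"
  have l: "lin_map N' I.M ?f"
   by (rule lin_o[OF ltpR[OF lin_id one, of Nn, unfolded bp_cong] lin_Ph])
  have b: "bilin_map H (X i) I.M (%g z. ?f (m' (N.e j (act (X j) g y)) (N.e i z)))"
   by (rule bil_o[OF bilin_comp[OF N.m_bilin lin_o[OF bilL[OF N.actX[OF j'] lin_id y] N.lin_e[OF j']] N.lin_e[OF i']] l])
  have "m (factor_at I X i x) (factor_at I X j y) = ?f (m' (N.e i x) (N.e j y))"
   by (simp add: e_i i' j' x y m_right one N.e_in)
  also have "... = tev H (X i) (coact (X i) x) (%g z. ?f (m' (N.e j (act (X j) g y)) (N.e i z)))"
   unfolding N.e_rel[OF i' j' ij x y]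
   by (rule tev_pull[OF l vspace_mtensor N.vs xc]) (intro N.m_in N.e_in N.actX_in[OF j'] y)
  also have "... = tlift H (X i) (%g z. ?f (m' (N.e j (act (X j) g y)) (N.e i z))) (coact (X i) x)"
   by (rule tl_tev[symmetric, OF b N.vs vspace_mtensor xc])
  also have "... = ?R"
   by (rule tlift_cong) (simp add: e_i i' j' N.actX_in[OF j'] y m_right one N.e_in)
  finally show ?thesis .
 qed
qed

end

theorem braided_mult_exists:
 assumes H: "bialgebra H" and "finite I" "I ~= {}" "!!i. i : I ==> yd_module_algebra H (X i)"
 shows "EX m. braided_mult H I X m & yd_module_algebra H (bp H I X m)"
 using assms(2-)
proof (induction I rule: finite_linorder_min_induct)
 case (insert s I')
 show ?case
 proof (cases "I' = {}")
  case True then show ?thesis using braided_mult_single[OF H, of X s] insert.prems by simp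
 next
  case False
  then obtain m' where m': "braided_mult H I' X m'" "yd_module_algebra H (bp H I' X m')" using insert by auto
  interpret bstep H I' X m' s by unfold_locales (use m' insert False H in auto)
  show ?thesis using bm_m yd_m by blast
 qed
qed simp

subsection \<open>The multiple braided product and its embeddings\<close>

locale brp = ydfam H I X for H :: "('k::field, 'h::ab_group_add, 'u) bialg_scheme"
  and I and X :: "int => ('k, 'h, 'x::ab_group_add, 'z) yd_scheme" +
 assumes finI: "finite I" and neI: "I ~= {}"
begin

abbreviation "BP == braided_product H I X"

lemma BP_bp: "BP = bp H I X (mul BP)" by (simp add: braided_product_def bp_def)

lemma BP_simps: "carr BP = carr M" "unity BP = mpure I X (\<lambda>i\<in>I. unity (X i))"
 by (simp_all add: braided_product_def)

lemma ex: "EX m. braided_mult H I X m & yd_module_algebra H (bp H I X m)"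
 by (rule braided_mult_exists[OF bialg finI neI ydX])

lemma braided_mult_BP: "braided_mult H I X (mul BP)"
proof -
 have "EX m. braided_mult H I X m" using ex by blast
 from someI_ex[OF this] show ?thesis by (simp add: braided_product_def)
qed

sublocale brm H I X "mul BP" by unfold_locales (rule finI, rule neI, rule braided_mult_BP)

text \<open>The chosen product may differ from the constructed one outside of the carrier. On the
  carrier they agree by uniqueness, so the identity is a surjective morphism and transfers the
  axioms.\<close>

lemma yd_BP: "yd_module_algebra H BP"
proof -
 obtain m where m: "braided_mult H I X m" "yd_module_algebra H (bp H I X m)"
  using ex by blast
 interpret m: brm H I X m by unfold_locales (rule finI, rule neI, rule m)
 have "brm H I X (mul BP)" "brm H I X m" by unfold_locales
 note u = braided_mult_unique[OF this(2,1)]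
 have "yd_module_algebra H (bp H I X (mul BP))"
 proof (rule yd_surj[OF bialg m(2) vspace_bp])
  show "yd_hom H (bp H I X m) (bp H I X (mul BP)) (%x. x)"
   unfolding yd_hom_def bp_cong
  proof (intro conjI ballI lin_id)
   fix x assume "x : carr (bp H I X m)"
   then have "coact (bp H I X m) x : carr (tensor H M)" using ydD(9)[OF m(2)] by (simp add: bp_cong)
   then have "tlift H M (tpure H M) (coact (bp H I X m) x) = coact (bp H I X m) x"
    using tl_tev[OF bilin_tpure vs vs_t] tev_tpure_id[OF vs] by metis
   then show "coact (bp H I X (mul BP)) x = tlift H M (%g z. tpure H M g z) (coact (bp H I X m) x)"
    by (simp add: bp_def)
  qed (use u in "auto simp: bp_def")
 qed (auto simp: bp_vs)
 then show ?thesis using BP_bp by simp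
qed

end

text \<open>Multiplicativity is \<open>emb_mult\<close>. For action and coaction the recursion over
  \<open>J\<close> is reduced to that over \<open>I\<close> by filtering out the unit entries, which
  the embedding then respects entry by entry.\<close>

lemma yd_hom_emb:
 assumes "brp H I X" "brp H J X" and IJ: "I <= J"
 shows "yd_hom H (braided_product H I X) (braided_product H J X) (emb I J X)"
proof -
 interpret I: brp H I X by (rule assms)
 interpret J: brp H J X by (rule assms)
 interpret brm_emb H I J X "mul I.BP" "mul J.BP" by unfold_locales (rule IJ)
 note E = J.lin_emb[OF IJ I.ne]
 have js: "set (sorted_list_of_set J) <= J" "distinct (sorted_list_of_set J)" "set (sorted_list_of_set I) <= I"
  using J.fin I.fin by auto
 have f: "filter (%j. j : I) (sorted_list_of_set J) = sorted_list_of_set I"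
  by (rule sorted_distinct_set_unique) (use I.fin J.fin IJ in "auto simp: sorted_wrt_filter")
 have g: "ext1 I J X y : PE J X" "i : I ==> ext1 I J X y i = y i" "i : I ==> ext1 I J X (y(i := v)) = (ext1 I J X y)(i := v)"
  and g1: "j : set (sorted_list_of_set J) ==> j ~: I ==> ext1 I J X y j = unity (X j)"
  if "y : PE I X" for y i j v
  using ext1_in[OF IJ J.unX that] IJ ext1_upd[OF _ IJ, of i X y v] js(1) by (auto simp: ext1_def)
 have act: "emb I J X (act I.BP h t) = act J.BP h (emb I J X t)" if h: "h : carr H" and t: "t : carr I.M" for h t
 proof (rule mt_eqI[where f = "%t. emb I J X (act I.BP h t)" and g = "%t. act J.BP h (emb I J X t)" and t = t and U = J.M,
   OF I.ne I.vsX _ _ _ t])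
  show "lin_map I.M J.M (%t. emb I J X (act I.BP h t))"
   by (subst I.BP_bp) (rule lin_o[OF I.lin_bp_act[OF I.fin I.ne h] E])
  show "lin_map I.M J.M (%t. act J.BP h (emb I J X t))"
   by (subst J.BP_bp) (rule lin_o[OF E J.lin_bp_act[OF J.fin J.ne h]])
  fix y assume y: "y : PE I X"
  have "emb I J X (act I.BP h (mpure I X y)) = emb I J X (diag_act H I X (sorted_list_of_set I) h y)" (is "?Z = _")
   by (subst I.BP_bp) (simp only: I.bp_act[OF I.fin I.ne h y])
  also have "... = diag_act H J X (sorted_list_of_set I) h (ext1 I J X y)"
   by (rule J.diag_map[OF IJ E J.emb_mpure[OF IJ I.ne] g js(3) h y])
  also have "... = diag_act H J X (sorted_list_of_set J) h (ext1 I J X y)"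
   unfolding f[symmetric] by (rule J.diag_filter[symmetric, OF js(1) h g(1)[OF y] g1[OF y] js(2)])
  also have "... = act J.BP h (emb I J X (mpure I X y))"
   by (subst J.BP_bp) (simp only: J.emb_mpure[OF IJ I.ne y] J.bp_act[OF J.fin J.ne h g(1)[OF y]])
  finally show "?Z = ..." .
 qed
 have eqT: "tlift H I.BP = tlift H I.M" "tpure H J.BP = tpure H J.M" by (subst I.BP_bp J.BP_bp, rule bp_cong)+
 note b = bil_tpm[OF E, of H]
 let ?G = "tlift H I.M (%g z. tpure H J.M g (emb I J X z))"
 have G: "lin_map (tensor H I.M) (tensor H J.M) ?G" by (rule lin_tlift[OF b I.vs vs_t])
 have co: "coact J.BP (emb I J X t) = ?G (coact I.BP t)" if t: "t : carr I.M" for t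
 proof (rule mt_eqI[where f = "%t. coact J.BP (emb I J X t)" and g = "%t. ?G (coact I.BP t)" and t = t and U = "tensor H J.M",
   OF I.ne I.vsX _ _ _ t])
  show "lin_map I.M (tensor H J.M) (%t. ?G (coact I.BP t))"
   by (subst I.BP_bp) (rule lin_o[OF I.lin_bp_coact[OF I.fin I.ne] G])
  show "lin_map I.M (tensor H J.M) (%t. coact J.BP (emb I J X t))"
   by (subst J.BP_bp) (rule lin_o[OF E J.lin_bp_coact[OF J.fin J.ne]])
  fix y assume y: "y : PE I X"
  have "?G (coact I.BP (mpure I X y)) = ?G (codiag_coact H I X (sorted_list_of_set I) (unity H) y)"
   by (subst I.BP_bp) (simp only: I.bp_coact[OF I.fin I.ne y])
  also have "... = codiag_coact H J X (sorted_list_of_set I) (mul H (unity H) (unity H)) (ext1 I J X y)"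
   by (rule J.codiag_map[OF IJ G _ I.one_in g js(3) I.one_in y])
    (simp only: tl_pure[OF b I.vs vs_t _ mpure_in] J.emb_mpure[OF IJ I.ne] I.one_mul)
  also have "... = codiag_coact H J X (sorted_list_of_set J) (unity H) (ext1 I J X y)"
   unfolding f[symmetric] I.one_mul[OF I.one_in]
   by (rule J.codiag_filter[symmetric, OF js(1) I.one_in g(1)[OF y] g1[OF y] js(2)])
  also have "... = coact J.BP (emb I J X (mpure I X y))"
   by (subst J.BP_bp) (simp only: J.emb_mpure[OF IJ I.ne y] J.bp_coact[OF J.fin J.ne g(1)[OF y]])
  finally show "coact J.BP (emb I J X (mpure I X y)) = ?G (coact I.BP (mpure I X y))" ..
 qed
 have l: "lin_map I.BP J.BP (emb I J X)" by (subst I.BP_bp, subst J.BP_bp) (simp only: bp_cong E)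
 have "ext1 I J X (\<lambda>i\<in>I. unity (X i)) = (\<lambda>i\<in>J. unity (X i))" using IJ by (auto simp: ext1_def fun_eq_iff)
 then have "emb I J X (unity I.BP) = unity J.BP"
  unfolding I.BP_simps J.BP_simps by (simp only: J.emb_mpure[OF IJ I.ne I.unJ])
 then show ?thesis unfolding yd_hom_def eqT
  using emb_mult act co l by (simp only: I.BP_simps) blast
qed

lemma yd_transport:
 fixes X :: "('k::field, 'h::ab_group_add, 'x::ab_group_add, 'z) yd_scheme"
 assumes H: "bialgebra H" and X: "yd_module_algebra H X" and V: "vspace (|carr = e ` carr X, scal = sc|)"
  and e: "lin_map X (|carr = e ` carr X, scal = sc|) e" and p: "!!x. x : carr X ==> p (e x) = x"
 shows "yd_hom H X (transport_yd H sc e p X) e" "yd_module_algebra H (transport_yd H sc e p X)"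
proof -
 let ?Y = "transport_yd H sc e p X" and ?V = "(|carr = e ` carr X, scal = sc|)"
 have vs: "carr ?Y = carr ?V" "scal ?Y = scal ?V" by (simp_all add: transport_yd_def)
 have t: "tpure H ?Y = tpure H ?V" by (rule tp_cong[OF refl refl vs])
 show hom: "yd_hom H X ?Y e"
  unfolding yd_hom_def t lin_cong[OF refl refl vs] using e p by (simp add: transport_yd_def)
 have "vspace ?Y" using V by (simp add: vspace_def vs)
 then show "yd_module_algebra H ?Y" by (rule yd_surj[OF H X _ hom]) (simp add: vs)
qed

lemma sw3_form:
 fixes V :: "('k::field, 'v::ab_group_add, 'z) bialg_scheme"
 assumes V: "vspace V" and c: "lin_map V (tensor V V) (cop V)" and W: "vspace W" and x: "x : carr V" and ka: "form W ka"
  and Ph: "!!b c. b : carr V ==> c : carr V ==> lin_map V W (%a. Ph a b c)"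
   "!!a c. a : carr V ==> c : carr V ==> lin_map V W (%b. Ph a b c)" "!!a b. a : carr V ==> b : carr V ==> lin_map V W (%c. Ph a b c)"
 shows "sw3 V x Ph : carr W" "ka (sw3 V x Ph) = tev V V (cop V x) (%a g. tev V V (cop V g) (%b c. ka (Ph a b c)))"
proof -
 note cin = linD(1)[OF c]
 have b1: "bilin_map V V W (Ph a)" if "a : carr V" for a using Ph(2,3) that by (simp add: bilin_map_def)
 have b2: "bilin_map V V W (%a g. sw V g (Ph a))"
  unfolding sw_def bilin_map_def using lin_tla[OF c b1 V W] Ph(1)
  by (auto intro!: lin_tlb[OF V W cin] b1 V)
 show "sw3 V x Ph : carr W" unfolding sw3_def sw_def[of V x] by (rule tlift_in[OF b2 V W cin[OF x]])
 have "ka (sw3 V x Ph) = tev V V (cop V x) (%a g. ka (sw V g (Ph a)))"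
  unfolding sw3_def sw_def[of V x] by (rule tl_pull[OF ka b2 V W cin[OF x]])
 also have "... = tev V V (cop V x) (%a g. tev V V (cop V g) (%b c. ka (Ph a b c)))"
  unfolding sw_def by (rule tevc[OF V cin[OF x]], rule tl_pull[OF ka b1 V W cin])
 finally show "ka (sw3 V x Ph) = ..." .
qed

text \<open>The factors of a chain are transported copies in a common type. Stated along the
  morphisms \<open>f\<close> and \<open>f'\<close>, the defining relation uses the original actions
  and coactions.\<close>

lemma (in brp) rel_form:
 assumes i: "i : I" and j: "j : I" and ij: "i > j" and f: "yd_hom H X0 (X i) f" and f': "yd_hom H Y0 (X j) f'"
  and X0: "yd_module_algebra H X0" and Y0: "yd_module_algebra H Y0" and x: "x : carr X0" and y: "y : carr Y0" and ka: "form M ka"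
 shows "ka (mul BP (e i (f x)) (e j (f' y))) = tev H X0 (coact X0 x) (%g z. ka (mul BP (e j (f' (act Y0 g y))) (e i (f z))))" (is "?L = ?R")
proof -
 note fx = linD(1)[OF ydhD(1)[OF f] x] and fy = linD(1)[OF ydhD(1)[OF f'] y]
 note xc = ydD(9)[OF X0 x]
 have b: "biform H (X i) (%g z. ka (mul BP (e j (act (X j) g (f' y))) (e i z)))"
  by (rule bil_o[OF bilin_comp[OF m_bilin lin_o[OF bilL[OF actX[OF j] lin_id fy] lin_e[OF j]] lin_e[OF i]] ka])
 have "?L = tev H (X i) (coact (X i) (f x)) (%g z. ka (mul BP (e j (act (X j) g (f' y))) (e i z)))"
  unfolding e_rel[OF i j ij fx fy]
  by (rule tev_pull[OF ka vspace_mtensor vs coX_in[OF i fx]]) (intro m_in e_in actX_in[OF j] fy)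
 also have "... = tev H X0 (coact X0 x) (%g z. ka (mul BP (e j (act (X j) g (f' y))) (e i (f z))))"
  unfolding ydhD(5)[OF f x] by (rule coact_hom_eval(2)[OF vs ydhD(1)[OF f] xc b])
 also have "... = ?R"
  by (rule tevc[OF vs xc]) (simp add: ydhD(4)[OF f' _ y])
 finally show ?thesis .
qed

section \<open>Alternating chains\<close>

context hopf
begin

abbreviation "C == chain_factor B"

lemma vspace_pairs: fixes psc defines "psc == %c (be, b). (scal D c be, scal B c b)"
 shows "vspace (|carr = (%be. (be, 0)) ` carr D, scal = psc|)" (is ?a) "vspace (|carr = (%b. (0, b)) ` carr B, scal = psc|)" (is ?b)
proof -
 have v: "vector_space psc"
  by unfold_locales (auto simp: psc_def vs_scal_add[OF vsD] vs_scal_add[OF vs] vs_add_scal[OF vsD]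
   vs_add_scal[OF vs] vs_scal_scal[OF vsD] vs_scal_scal[OF vs] vs_scal_one[OF vsD] vs_scal_one[OF vs] simp del: scal_dual)
 then interpret vector_space psc .
 have "subspace ((%be. (be, 0)) ` carr D)" "subspace ((%b. (0, b)) ` carr B)"
  unfolding subspace_def
  using vs_zero[OF vsD] vs_zero[OF vs] vs_add[OF vsD] vs_add[OF vs] vs_scal[OF vsD] vs_scal[OF vs]
  by (auto simp: psc_def vs_scal_0[OF vsD] vs_scal_0[OF vs] zero_prod_def image_iff simp del: scal_dual)
 then show ?a ?b
  using v by (simp_all only: vspace_def vs.select_convs)
qed

lemma ch_odd: assumes "odd i"
 shows "yd_hom Db DY (C i) (%be. (be, 0))" (is ?a) "yd_module_algebra Db (C i)" (is ?b)
proof -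
 have c: "C i = transport_yd Db (%c (be, b). (scal D c be, scal B c b)) (%be. (be, 0)) fst DY"
  using assms by (simp add: chain_factor_def)
 note t = yd_transport[OF bia_Db yd_dual, where e = "%be. (be, 0)" and p = fst
   and sc = "%c (be, b). (scal D c be, scal B c b)", unfolded DY_simps, OF vspace_pairs(1)]
 show ?a ?b
  unfolding c by (rule t; auto simp: lin_map_def DY_simps vs_scal_0[OF vs])+
qed

lemma ch_even: assumes "even i"
 shows "yd_hom Db BY (C i) (%b. (0, b))" (is ?a) "yd_module_algebra Db (C i)" (is ?b)
proof -
 have c: "C i = transport_yd Db (%c (be, b). (scal D c be, scal B c b)) (%b. (0, b)) snd BY"
  using assms by (simp add: chain_factor_def)
 note t = yd_transport[OF bia_Db yd_self, where e = "%b. (0, b)" and p = snd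
   and sc = "%c (be, b). (scal D c be, scal B c b)", unfolded BY_simps, OF vspace_pairs(2)]
 show ?a ?b
  unfolding c by (rule t; auto simp: lin_map_def BY_simps vs_scal_0[OF vsD] simp del: scal_dual)+
qed

lemma yd_chain_factor: "yd_module_algebra Db (C i)"
 using ch_odd(2) ch_even(2) by blast

lemma unity_chain_factor: "unity (C i) ~= 0"
proof (cases "even i")
 case True
 have "one ~= 0" using cou_one lin_0[OF cou_form vs] by auto
 moreover have "unity (C i) = (0, one)" using ydhD(3)[OF ch_even(1)[OF True]] by (simp add: BY_simps)
 ultimately show ?thesis by (simp add: zero_prod_def)
next
 case False
 have "unity D one = 1" by (simp add: d1E one_in cou_one)
 then have "unity D ~= 0" by force
 moreover have "unity (C i) = (unity D, 0)" using ydhD(3)[OF ch_odd(1)[OF False]] by (simp add: DY_simps)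
 ultimately show ?thesis by (simp add: zero_prod_def)
qed

lemma hit_hit: "a : carr B ==> b : carr B ==> be : carr D ==> hit B a (hit B b be) = hit B (a**b) be"
 by (rule dual_eqI) (simp_all add: hit_in hit_apply mul_in mul_assoc)

lemma hit_one: "be : carr D ==> hit B one be = be"
 by (rule dual_eqI) (simp_all add: hit_in hit_apply one_in mul_one)

lemma cop_hit: assumes "form D th" "be : carr D" "a : carr B"
 shows "SwD be (%be1 be2. be2 a * th be1) = th (hit B a be)"
 unfolding hit_def sw_def
 by (subst tl_pull[OF assms(1) hit_bilin(1)[OF assms(3)] vsD vsD copD(1)[OF assms(2)]],
  rule SwDc[OF assms(2)]) (simp add: linD(3)[OF assms(1), unfolded scal_dual] del: fun_scal_apply)

lemma DY_act_one: assumes m: "m : carr B" and be: "be : carr D" shows "act DY (unity D >< m) be = hit B m be"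
proof (rule dual_eqI)
 fix b assume b: "b : carr B"
 note [simp] = lin_D m be b lin_o[OF _ dform[OF be]] lin_o[OF _ cou_form]
 have "act DY (unity D >< m) be b = Sw3 b (%b1 b2 b3. E (T b3**b1) (%m. be (b2**m)) (unity D >< m))"
  by (rule DYaE) (simp_all add: pr_in)
 also have "... = Sw b (%b1 r. cou B b1 * Sw r (%b2 b3. cou B b3 * be (b2**m)))"
  unfolding tevL by (rule Swc[OF b], rule Swc) (simp_all add: E_pure d1E cou_mul cou_T mult_ac)
 also have "... = Sw b (%b1 r. cou B b1 * be (r**m))"
  by (rule Swc[OF b], subst couR) simp_all
 also have "... = be (b**m)" by (rule couL) simp_all
 finally show "act DY (unity D >< m) be b = hit B m be b" by (simp add: hit_apply)
qed (simp_all add: DY_act_in pr_in hit_in d1_in m be)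

lemma dual_collapse:
 assumes aa: "aa : carr D" and be: "be : carr D" and th: "form D th"
 shows "SwD aa (%aa1 g. SwD g (%aa2 aa3. th (mul D (mul D (mul D aa3 be) (T' aa2)) aa1))) = th (mul D aa be)"
proof -
 note [simp] = lin_D aa be lin_o[OF _ dform[OF aa]] lin_o[OF _ dform[OF be]]
 let ?w = "%aa1 g. SwD g (%aa2 aa3. mul D (mul D (mul D aa3 be) (T' aa2)) aa1)"
 have w: "?w aa1 g : carr D" if "aa1 : carr D" "g : carr D" for aa1 g by (rule tev_in[OF vsD vsD]) (simp_all add: that)
 have W: "SwD aa ?w : carr D" by (rule tev_in[OF vsD vsD]) (simp_all add: w)
 have ev: "f (SwD aa ?w) = SwD aa (%aa1 g. SwD g (%aa2 aa3. f (mul D (mul D (mul D aa3 be) (T' aa2)) aa1)))"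
  if f: "form D f" for f
  by (subst tev_pull[OF f vsD vsD copD(1)[OF aa] w], assumption, assumption, rule SwDc[OF aa], rule tev_pull[OF f vsD vsD]) simp_all
 have "SwD aa ?w = mul D aa be"
 proof (rule dual_eqI[OF W])
  fix b assume b[simp]: "b : carr B"
  have "SwD aa ?w b = SwD aa (%aa1 g. SwD g (%aa2 aa3.
    Sw b (%p b4. Sw p (%q b3. Sw q (%b1 b2. aa3 b1 * (be b2 * aa1 b4) * (aa2 (T b3) * 1))))))"
   unfolding ev[OF form_eval[OF b]]
   by (rule tevc[OF vsD], simp, rule tevc[OF vsD], simp, subst dmulE, simp, simp, simp,
    rule Swc, simp, subst dmulE, simp, simp, simp, simp only: tevR, rule Swc, simp, subst dmulE, simp, simp, simp, simp only: tevR,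
    rule Swc) (simp_all add: T'_apply mult_ac)
  also have "... = SwD aa (%aa1 g. Sw b (%p b4. Sw p (%q b3. Sw q (%b1 b2. g (T b3**b1) * (be b2 * 1) * (aa1 b4 * 1)))))"
  proof (rule tevc[OF vsD], simp)
   fix aa1 g assume [simp]: "aa1 : carr D" "g : carr D"
   show "SwD g (%aa2 aa3. Sw b (%p b4. Sw p (%q b3. Sw q (%b1 b2. aa3 b1 * (be b2 * aa1 b4) * (aa2 (T b3) * 1)))))
    = Sw b (%p b4. Sw p (%q b3. Sw q (%b1 b2. g (T b3**b1) * (be b2 * 1) * (aa1 b4 * 1))))"
    unfolding tevs[where s = "cop D g"]
    by (rule Swc, simp, rule Swc, simp, rule Swc, simp, subst cop_dual3) simp_all
  qed
  also have "... = Sw b (%p b4. Sw p (%q b3. Sw q (%b1 b2. aa ((b4**T b3)**b1) * be b2)))"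
   unfolding tevs[where s = "cop D aa"]
   by (rule Swc, simp, rule Swc, simp, rule Swc, simp, subst cop_dual3) (simp_all add: mul_assoc)
  also have "... = Sw3 b (%q b3 b4. Sw q (%b1 b2. aa ((b4**T b3)**b1) * be b2))"
   by (rule coassoc) (simp_all add: mlin)
  also have "... = Sw b (%b1 b2. aa (one**b1) * be b2)"
   by (rule colT[OF T_col(2), where psi = "%q u. Sw q (%b1 b2. aa (u**b1) * be b2)"]) (simp_all add: mlin)
  also have "... = mul D aa be b" by (subst dmulE, simp, simp, simp, rule Swc) (simp_all add: one_mul)
  finally show "SwD aa ?w b = mul D aa be b" .
 qed simp
 with ev[OF th] show ?thesis by simp
qed

text \<open>The corresponding fact for two equal positions of B.\<close>

lemma self_collapse:
 assumes a: "a : carr B" and b: "b : carr B" and th: "form B th"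
 shows "Sw3 a (%a1 a2 a3. th (a1**b**S a2**a3)) = th (a**b)" (is "?L = _")
proof -
 note [simp] = lin_B a b lin_o[OF _ th]
 have "?L = Sw3 a (%a1 a2 a3. th (a1**b**(S a2**a3)))"
  by (rule Swc, simp, rule Swc) (simp_all add: mul_assoc)
 also have "... = th (a**b**one)"
  by (rule colT[OF S_col(1), where psi = "%a1 u. th (a1**b**u)"]) (simp_all add: mlin)
 finally show ?thesis by (simp add: mul_one)
qed

end

section \<open>Commutation relations in alternating chains\<close>

locale chn = hopf B for B :: "('k::field, 'b::ab_group_add, 'z) hopf_scheme" +
 fixes s t :: int
 assumes st: "s <= t"
begin

sublocale ch: brp Db "{s..t}" C
 by unfold_locales (use bia_Db yd_chain_factor st in auto)

abbreviation "m == mul ch.BP"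
abbreviation "d == dual_at B s t"
abbreviation "f == self_at B s t"

text \<open>The simplifier unfolds the zero form in \<open>(0, b)\<close>, so \<open>d\<close> and \<open>f\<close> are kept folded.\<close>

lemmas df = dual_at_def self_at_def

lemma lin_d: "odd i ==> i : {s..t} ==> lin_map V D g ==> lin_map V ch.M (%x. d i (g x))"
 and lin_f: "even i ==> i : {s..t} ==> lin_map V B g' ==> lin_map V ch.M (%x. f i (g' x))"
 unfolding df using lin_o[OF _ lin_o[OF ydhD(1)[OF ch_odd(1), unfolded DY_vs] ch.lin_e]]
  lin_o[OF _ lin_o[OF ydhD(1)[OF ch_even(1), unfolded BY_vs] ch.lin_e]] by blast+

lemma d_in: "odd i ==> i : {s..t} ==> be : carr D ==> d i be : carr ch.M"
 and f_in: "even i ==> i : {s..t} ==> b : carr B ==> f i b : carr ch.M"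
 using linD(1)[OF lin_d[OF _ _ lin_id]] linD(1)[OF lin_f[OF _ _ lin_id]] by auto

lemma biform_m: "form ch.M ka ==> lin_map V ch.M u ==> lin_map W ch.M w ==> biform V W (%a c. ka (m (u a) (w c)))"
 by (rule bil_o[OF bilin_comp[OF ch.m_bilin]])

lemma form_m: "form ch.M ka ==> lin_map V ch.M u ==> w : carr ch.M ==> form V (%a. ka (m (u a) w))"
 "form ch.M ka ==> lin_map V ch.M u ==> w : carr ch.M ==> form V (%a. ka (m w (u a)))"
 by (rule lin_o[OF ch.lin_m(1)], assumption+, rule lin_o[OF ch.lin_m(2)])

lemma M_eqI: "u : carr ch.M ==> v : carr ch.M ==> (!!ka. form ch.M ka ==> ka u = ka v) ==> u = v"
 by (rule sep_eqI[OF sep_forms[OF vspace_mtensor]]) auto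

lemmas lin_ch = lin_S' lin_d lin_f d_in f_in ch.lin_m ch.m_in lin_D

lemma act_DY_bif: "be : carr D ==> lin_map Db D (%g. act DY g be)" and act_BY_bif: "b : carr B ==> lin_map Db B (%g. act BY g b)"
 by (rule bilL[OF DY_act_bilin lin_id], assumption, rule bilL[OF BYa_bil lin_id])

text \<open>For i > j the coaction of b contributes \<open>unity D >< b1\<close>. It acts on the
  dual by the regular action and on B by the adjoint action.\<close>

lemma from_self:
 assumes "even i" "i : {s..t}" "b : carr B" "form ch.M ka" "j : {s..t}" "i > j"
 shows "odd j ==> be : carr D ==> ka (m (f i b) (d j be)) = Sw b (%b1 b2. ka (m (d j (hit B b1 be)) (f i b2)))"
  "even j ==> c : carr B ==> ka (m (f i b) (f j c)) = Sw b (%b1 b2. ka (m (f j (ad b1 c)) (f i b2)))"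
proof -
 note rel = ch.rel_form[OF assms(2,5,6) ch_even(1)[OF assms(1)] _ yd_self _ _ _ assms(4), unfolded BY_simps BY_vs]
 { assume j: "odd j" and b: "be : carr D"
  have bf: "biform Db B (%g z. ka (m (d j (act DY g be)) (f i z)))"
   by (rule biform_m[OF assms(4)]) (intro lin_d lin_f lin_id act_DY_bif assms b j)+
  show "ka (m (f i b) (d j be)) = Sw b (%b1 b2. ka (m (d j (hit B b1 be)) (f i b2)))"
   using rel[OF ch_odd(1)[OF j] yd_dual assms(3), unfolded DY_simps, OF b, folded df]
   by (simp only: BYc_ev[OF bf assms(3)]) (rule Swc[OF assms(3)], simp add: DY_act_one b) }
 { assume j: "even j" and c: "c : carr B"
  have bf: "biform Db B (%g z. ka (m (f j (act BY g c)) (f i z)))"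
   by (rule biform_m[OF assms(4)]) (intro lin_f lin_id act_BY_bif assms c j)+
  show "ka (m (f i b) (f j c)) = Sw b (%b1 b2. ka (m (f j (ad b1 c)) (f i b2)))"
   using rel[OF ch_even(1)[OF j] yd_self assms(3), unfolded BY_simps, OF c, folded df]
   by (simp only: BYc_ev[OF bf assms(3)]) (rule Swc[OF assms(3)], simp add: BYa_p c d1_in la_one ad_in) }
qed

text \<open>Here the coaction contributes \<open>g >< one\<close> for the second leg g of
  \<open>aa\<close>. It acts on the dual by conjugation (\<open>dact\<close>) and on B by
  \<open>la\<close>.\<close>

lemma from_dual:
 assumes "odd i" "i : {s..t}" "aa : carr D" "form ch.M ka" "j : {s..t}" "i > j"
 shows "odd j ==> be : carr D ==> ka (m (d i aa) (d j be)) = SwD aa (%aa1 g. ka (m (d j (dact be g one)) (d i aa1)))"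
  "even j ==> c : carr B ==> ka (m (d i aa) (f j c)) = SwD aa (%aa1 g. ka (m (f j (la g c)) (d i aa1)))"
proof -
 note rel = ch.rel_form[OF assms(2,5,6) ch_odd(1)[OF assms(1)] _ yd_dual _ _ _ assms(4), unfolded DY_simps DY_vs]
 { assume j: "odd j" and b: "be : carr D"
  have bf: "biform Db D (%g z. ka (m (d j (act DY g be)) (d i z)))"
   by (rule biform_m[OF assms(4)]) (intro lin_d lin_f lin_id act_DY_bif assms b j)+
  show "ka (m (d i aa) (d j be)) = SwD aa (%aa1 g. ka (m (d j (dact be g one)) (d i aa1)))"
   using rel[OF ch_odd(1)[OF j] yd_dual assms(3), unfolded DY_simps, OF b, folded df]
   by (simp only: DYc_ev[OF bf assms(3)]) (rule SwDc[OF assms(3)], simp add: DY_act tl_pure[OF dact_bilin vsD vsD] b one_in) }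
 { assume j: "even j" and c: "c : carr B"
  have bf: "biform Db D (%g z. ka (m (f j (act BY g c)) (d i z)))"
   by (rule biform_m[OF assms(4)]) (intro lin_d lin_f lin_id act_BY_bif assms c j)+
  show "ka (m (d i aa) (f j c)) = SwD aa (%aa1 g. ka (m (f j (la g c)) (d i aa1)))"
   using rel[OF ch_even(1)[OF j] yd_self assms(3), unfolded BY_simps, OF c, folded df]
   by (simp only: DYc_ev[OF bf assms(3)]) (rule SwDc[OF assms(3)], simp add: BYa_p c one_in ad_one) }
qed

text \<open>For \<open>i < j\<close>, the relation is the inverse of the defining one; it is obtained by reordering the
  right hand side.\<close>

lemma self_dual:
 assumes i: "even i" "i : {s..t}" and j: "odd j" "j : {s..t}" and b: "b : carr B" and be: "be : carr D"
 shows "m (f i b) (d j be) = sw B b (%b1 b2. m (d j (hit B b1 be)) (f i b2))" (is "_ = ?R")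
proof -
 note [simp del] = atLeastAtMost_iff
 note [simp] = lin_ch i j b be
 have bil: "bilin_map B B ch.M (%b1 b2. m (d j (hit B b1 be)) (f i b2))" by (simp add: mlin)
 show ?thesis
 proof (rule M_eqI)
  show "m (f i b) (d j be) : carr ch.M" by simp
  show "?R : carr ch.M"
   unfolding sw_def by (rule tlift_in[OF bil vs vspace_mtensor cop_in[OF b]])
  fix ka assume ka: "form ch.M ka"
  note [simp] = ka form_m[OF ka]
  have R: "ka ?R = Sw b (%b1 b2. ka (m (d j (hit B b1 be)) (f i b2)))"
   unfolding sw_def by (rule tl_pull[OF ka bil vs vspace_mtensor cop_in[OF b]])
  show "ka (m (f i b) (d j be)) = ka ?R"
  proof (cases "i > j")
   case True then show ?thesis unfolding R by (intro from_self) simp_all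
  next
   case False
   then have ji: "j > i" using i j by (metis linorder_neqE)
   have "Sw b (%b1 b2. ka (m (d j (hit B b1 be)) (f i b2))) = Sw3 b (%b1 x y. ka (m (f i y) (d j (hit B (T x**b1) be))))"
   proof (rule Swc[OF b])
    fix b1 r assume [simp]: "b1 : carr B" "r : carr B"
    have "ka (m (d j (hit B b1 be)) (f i r)) = SwD (hit B b1 be) (%be1 g. ka (m (f i (la g r)) (d j be1)))" (is "?Z = _")
     by (rule from_dual) (simp_all add: ji)
    also have "... = SwD (hit B b1 be) (%be1 g. Sw r (%x y. g (T x) * ka (m (f i y) (d j be1))))"
     by (rule tevc[OF vsD], simp, rule form_la[where ka = "%y. ka (m (f i y) (d j _))"]) simp_all
    also have "... = Sw r (%x y. ka (m (f i y) (d j (hit B (T x**b1) be))))"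
     unfolding tevs[where s = "cop D (hit B b1 be)"]
     by (rule Swc, simp, subst cop_hit[where th = "%be1. ka (m (f i _) (d j be1))"]) (simp_all add: hit_hit)
    finally show "?Z = ..." .
   qed
   \<comment> \<open>Reordering has placed T(x) next to b1, with b1 and x adjacent legs of
     \<open>b\<close>; they cancel, so the two exchanges undo each other.\<close>
   also have "... = ka (m (f i b) (d j (hit B one be)))"
    by (rule collapse_head[OF T_col(1), where psi = "%u y. ka (m (f i y) (d j (hit B u be)))"]) (simp_all add: mlin)
   finally show ?thesis unfolding R by (simp add: hit_one)
  qed
 qed
qed

text \<open>For i > j this is the defining relation with the action written out; for i = j both
  sides lie in one factor and \<open>dual_collapse\<close> applies.\<close>

lemma dual_dual:
 assumes i: "odd i" "i : {s..t}" and j: "odd j" "j : {s..t}" and ij: "i >= j" and aa: "aa : carr D" and be: "be : carr D"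
 shows "m (d i aa) (d j be) = sw3 D aa (%aa1 aa2 aa3. m (d j (mul D (mul D aa3 be) (T' aa2))) (d i aa1))" (is "_ = ?R")
proof -
 note [simp del] = atLeastAtMost_iff
 note [simp] = lin_ch i j aa be
 have R: "?R : carr ch.M" "ka ?R = SwD aa (%aa1 g. SwD g (%aa2 aa3. ka (m (d j (mul D (mul D aa3 be) (T' aa2))) (d i aa1))))"
  if "form ch.M ka" for ka
  by (rule sw3_form[OF vsD lin_cop_dual vspace_mtensor aa that]; simp)+
 show ?thesis
 proof (rule M_eqI)
  show "m (d i aa) (d j be) : carr ch.M" by simp
  have "form ch.M (%_. 0)" by (simp add: lin_map_def)
  from R(1)[OF this] show "?R : carr ch.M" .
  fix ka assume ka: "form ch.M ka"
  note [simp] = ka form_m[OF ka]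
  show "ka (m (d i aa) (d j be)) = ka ?R"
  proof (cases "i = j")
   case True
   have m: "m (d j aa) (d j be) = d j (mul D aa be)" if "aa : carr D" "be : carr D" for aa be
    using ch.e_mul[OF j(2), of "(aa, 0)" "(be, 0)"] ydhD(2)[OF ch_odd(1)[OF j(1)], of aa be]
     linD(1)[OF ydhD(1)[OF ch_odd(1)[OF j(1)]]] that by (simp only: DY_simps df)
   have "ka (m (d i aa) (d j be)) = SwD aa (%aa1 g. SwD g (%aa2 aa3. ka (d j (mul D (mul D (mul D aa3 be) (T' aa2)) aa1))))"
    unfolding True m[OF aa be] by (rule dual_collapse[symmetric, where th = "%u. ka (d j u)"])
     (simp_all add: lin_o[OF lin_d[OF j lin_id] ka])
   also have "... = ka ?R"
    unfolding R(2)[OF ka] unfolding True by (rule tevc[OF vsD], simp, rule tevc[OF vsD]) (simp_all add: m)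
   finally show ?thesis .
  next
   case False
   then have ij: "i > j" using ij by simp
   have "ka (m (d i aa) (d j be)) = SwD aa (%aa1 g. ka (m (d j (dact be g one)) (d i aa1)))"
    by (rule from_dual) (simp_all add: ij)
   also have "... = SwD aa (%aa1 g. SwD g (%aa2 aa3. ka (m (d j (mul D (mul D aa3 be) (T' aa2))) (d i aa1))))"
    unfolding dact_def by (rule tevc[OF vsD], simp,
     subst tev_pull[where f = "%u. ka (m (d j u) (d i _))" and U = D and U' = ground]) (simp_all add: hit_one)
   finally show ?thesis unfolding R(2)[OF ka] .
  qed
 qed
qed

text \<open>Same division into cases as for two dual factors, with \<open>self_collapse\<close> at
  equal positions.\<close>

lemma self_self:
 assumes i: "even i" "i : {s..t}" and j: "even j" "j : {s..t}" and ij: "i >= j" and a: "a : carr B" and b: "b : carr B"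
 shows "m (f i a) (f j b) = sw3 B a (%a1 a2 a3. m (f j (a1**b**S a2)) (f i a3))" (is "_ = ?R")
proof -
 note [simp del] = atLeastAtMost_iff
 note [simp] = lin_ch i j a b
 have R: "?R : carr ch.M" "ka ?R = Sw3 a (%a1 a2 a3. ka (m (f j (a1**b**S a2)) (f i a3)))" if "form ch.M ka" for ka
  by (rule sw3_form[OF vs lin_cop_H vspace_mtensor a that]; simp)+
 show ?thesis
 proof (rule M_eqI)
  show "m (f i a) (f j b) : carr ch.M" by simp
  have "form ch.M (%_. 0)" by (simp add: lin_map_def)
  from R(1)[OF this] show "?R : carr ch.M" .
  fix ka assume ka: "form ch.M ka"
  note [simp] = ka form_m[OF ka]
  show "ka (m (f i a) (f j b)) = ka ?R"
  proof (cases "i = j")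
   case True
   have m: "m (f j a) (f j b) = f j (a**b)" if "a : carr B" "b : carr B" for a b
    using ch.e_mul[OF j(2), of "(0, a)" "(0, b)"] ydhD(2)[OF ch_even(1)[OF j(1)], of a b]
     linD(1)[OF ydhD(1)[OF ch_even(1)[OF j(1)]]] that by (simp only: BY_simps df)
   have "ka (m (f i a) (f j b)) = Sw3 a (%a1 a2 a3. ka (f j (a1**b**S a2**a3)))"
    unfolding True m[OF a b] by (rule self_collapse[symmetric, where th = "%u. ka (f j u)"]) (simp_all add: lin_o[OF lin_f[OF j lin_id] ka])
   also have "... = ka ?R"
    unfolding R(2)[OF ka] unfolding True by (rule Swc, simp, rule Swc) (simp_all add: m)
   finally show ?thesis .
  next
   case False
   then have ij: "i > j" using ij by simp
   have "ka (m (f i a) (f j b)) = Sw a (%a1 a2. ka (m (f j (ad a1 b)) (f i a2)))"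
    by (rule from_self) (simp_all add: ij)
   also have "... = Sw a (%p a3. Sw p (%a1 a2. ka (m (f j (a1**b**S a2)) (f i a3))))"
    by (rule Swc, simp, rule form_ad[where ka = "%u. ka (m (f j u) (f i _))"]) simp_all
   also have "... = Sw3 a (%a1 a2 a3. ka (m (f j (a1**b**S a2)) (f i a3)))"
    by (rule coassoc) (simp_all add: mlin)
   finally show ?thesis unfolding R(2)[OF ka] .
  qed
 qed
qed

end

section \<open>Inductive limits\<close>

text \<open>The limit is realised as the union of the images of all stages in an ambient vector space.\<close>

locale dirsys = bialg H for H :: "('k::field, 'h::ab_group_add, 'u) bialg_scheme" +
 fixes D :: "'d set" and le :: "'d => 'd => bool" and A :: "'d => ('k, 'h, 'x::ab_group_add, 'y) yd_scheme"
  and e :: "'d => 'd => 'x => 'x" and V :: "('k, 'w::ab_group_add, 'v) vs_scheme" and io :: "'d => 'x => 'w"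
 assumes ydA: "!!d. d : D ==> yd_module_algebra H (A d)" and V: "vspace V" and ne: "D ~= {}"
  and dir: "!!d d'. d : D ==> d' : D ==> EX d'':D. le d d'' & le d' d''"
  and hom: "!!d d'. d : D ==> d' : D ==> le d d' ==> yd_hom H (A d) (A d') (e d d')"
  and io_lin: "!!d. d : D ==> lin_map (A d) V (io d)" and io_inj: "!!d. d : D ==> inj_on (io d) (carr (A d))"
  and io_e: "!!d d' x. d : D ==> d' : D ==> le d d' ==> x : carr (A d) ==> io d' (e d d' x) = io d x"
begin

definition "LC = (\<Union>d\<in>D. io d ` carr (A d))"
definition "VL = (|carr = LC, scal = scal V|)"

lemma e_in: "d : D ==> d' : D ==> le d d' ==> x : carr (A d) ==> e d d' x : carr (A d')"
 by (rule linD(1)[OF ydhD(1)[OF hom]])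

lemma two:
 assumes "x : LC" "y : LC"
 obtains d a b where "d : D" "a : carr (A d)" "b : carr (A d)" "x = io d a" "y = io d b"
proof -
 obtain d a d' b where 1: "d : D" "a : carr (A d)" "x = io d a" "d' : D" "b : carr (A d')" "y = io d' b"
  using assms by (auto simp: LC_def)
 obtain d'' where "d'' : D" "le d d''" "le d' d''" using dir 1 by blast
 then show thesis using 1 that[of d'' "e d d'' a" "e d' d'' b"] by (simp add: e_in io_e)
qed

lemma three:
 assumes "x : LC" "y : LC" "z : LC"
 shows "EX d:D. x : io d ` carr (A d) & y : io d ` carr (A d) & z : io d ` carr (A d)"
proof -
 obtain d a b where 1: "d : D" "a : carr (A d)" "b : carr (A d)" "x = io d a" "y = io d b" using two[OF assms(1,2)] .
 obtain d' c where 2: "d' : D" "c : carr (A d')" "z = io d' c" using assms(3) by (auto simp: LC_def)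
 obtain d'' where 3: "d'' : D" "le d d''" "le d' d''" using dir 1 2 by blast
 have "x = io d'' (e d d'' a)" "y = io d'' (e d d'' b)" "z = io d'' (e d' d'' c)" using 1 2 3 io_e by auto
 then show ?thesis using 1 2 3 e_in by blast
qed

lemma LC_I: "d : D ==> a : carr (A d) ==> io d a : LC" by (auto simp: LC_def)

lemma vspace_VL: "vspace VL"
proof -
 interpret vector_space "scal V" by (rule vs_vector_space[OF V])
 have A: "vspace (A d)" if "d : D" for d by (rule algD(1)[OF ydD(2)[OF ydA[OF that]]])
 have "subspace LC" unfolding subspace_def
 proof (intro conjI ballI allI)
  obtain d where d: "d : D" using ne by blast
  show "0 : LC" using LC_I[OF d vs_zero[OF A[OF d]]] lin_0[OF io_lin[OF d] A[OF d]] by simp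
  fix x assume x: "x : LC"
  then obtain d a where d: "d : D" "a : carr (A d)" "x = io d a" by (auto simp: LC_def)
  show "scal V c x : LC" for c
   using LC_I[OF d(1) vs_scal[OF A[OF d(1)] d(2)]] linD(3)[OF io_lin[OF d(1)] d(2)] d(3) by metis
  fix y assume y: "y : LC"
  obtain d a b where d: "d : D" "a : carr (A d)" "b : carr (A d)" "x = io d a" "y = io d b" using two[OF x y] .
  then show "x + y : LC"
   using LC_I[OF d(1) vs_add[OF A[OF d(1)] d(2,3)]] linD(2)[OF io_lin[OF d(1)] d(2,3)] by simp
 qed
 then show ?thesis using vector_space_axioms by (simp add: vspace_def VL_def)
qed

lemma io_lin': "d : D ==> lin_map (A d) VL (io d)"
 using io_lin[of d] LC_I by (auto simp: lin_map_def VL_def)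

text \<open>The value is computed on representatives at a common stage. Action and coaction are
  unary and are obtained by giving both arguments the same element.\<close>

definition "op G x y = (THE z. EX d:D. EX a:carr (A d). EX b:carr (A d). x = io d a & y = io d b & z = G d a b)"

lemma op_eq:
 assumes G: "!!d d' a b. d : D ==> d' : D ==> le d d' ==> a : carr (A d) ==> b : carr (A d) ==> G d' (e d d' a) (e d d' b) = G d a b"
  and d: "d : D" "a : carr (A d)" "b : carr (A d)"
 shows "op G (io d a) (io d b) = G d a b"
 unfolding op_def
proof (rule the_equality)
 fix z assume "EX d':D. EX a':carr (A d'). EX b':carr (A d'). io d a = io d' a' & io d b = io d' b' & z = G d' a' b'"
 then obtain d' a' b' where d': "d' : D" "a' : carr (A d')" "b' : carr (A d')" "io d a = io d' a'" "io d b = io d' b'"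
  and z: "z = G d' a' b'" by blast
 \<comment> \<open>At a common later stage injectivity of \<open>io k\<close> makes the two pairs of
   representatives equal, and naturality of \<open>G\<close> compares the values.\<close>
 obtain k where k: "k : D" "le d k" "le d' k" using dir d(1) d'(1) by blast
 have "e d k a = e d' k a'" "e d k b = e d' k b'"
  using io_inj[OF k(1)] d d' k by (auto simp: inj_on_def e_in io_e)
 then show "z = G d a b" using G[OF d(1) k(1,2) d(2,3)] G[OF d'(1) k(1,3) d'(2,3)] z by simp
qed (use d in blast)

definition "Gc d a = tlift H (A d) (%g z. tpure H VL g (io d z)) (coact (A d) a)"

lemma Gc_nat:
 assumes d: "d : D" "d' : D" "le d d'" and a: "a : carr (A d)"
 shows "Gc d' (e d d' a) = Gc d a"
proof -
 note ca = ydD(9)[OF ydA[OF d(1)] a] and ca' = ydD(9)[OF ydA[OF d(2)] e_in[OF d a]]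
 note b = bil_tpm[OF io_lin'[OF d(1)], of H] bil_tpm[OF io_lin'[OF d(2)], of H]
 have "Gc d' (e d d' a) = tev H (A d') (coact (A d') (e d d' a)) (%g z. tpure H VL g (io d' z))"
  unfolding Gc_def by (rule tl_tev[OF b(2) vs vs_t ca'])
 also have "... = tev H (A d) (coact (A d) a) (%g z. tpure H VL g (io d' (e d d' z)))"
  unfolding ydhD(5)[OF hom[OF d] a] by (rule tev_coact_hom[OF vs ydhD(1)[OF hom[OF d]] ca b(2) vs_t])
 also have "... = tev H (A d) (coact (A d) a) (%g z. tpure H VL g (io d z))"
  by (rule tevc[OF vs ca]) (simp add: io_e[OF d])
 also have "... = Gc d a" unfolding Gc_def by (rule tl_tev[symmetric, OF b(1) vs vs_t ca])
 finally show ?thesis .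
qed

definition "d0 = (SOME d. d : D)"

definition L :: "('k, 'h, 'w) yd" where
 "L = (|carr = LC, scal = scal V, mul = op (%d a b. io d (mul (A d) a b)), unity = io d0 (unity (A d0)),
  act = (%h x. op (%d a b. io d (act (A d) h a)) x x), coact = (%x. op (%d a b. Gc d a) x x)|)"

lemma L_vs: "carr L = carr VL" "scal L = scal VL" by (simp_all add: L_def VL_def)

lemma yd_hom_io: assumes d: "d : D" shows "yd_hom H (A d) L (io d)"
proof -
 have d0: "d0 : D" unfolding d0_def using ne some_in_eq by blast
 note D = algD[OF ydD(2)[OF ydA]]
 have one: "io d (unity (A d)) = unity L"
 proof -
  obtain k where k: "k : D" "le d k" "le d0 k" using dir d d0 by blast
  show ?thesis
   using io_e[OF d k(1,2) D(3)[OF d]] io_e[OF d0 k(1,3) D(3)[OF d0]] ydhD(3)[OF hom[OF d k(1,2)]]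
    ydhD(3)[OF hom[OF d0 k(1,3)]] by (simp add: L_def)
 qed
 have mul: "mul L (io d a) (io d b) = io d (mul (A d) a b)" if "a : carr (A d)" "b : carr (A d)" for a b
  unfolding L_def yd.simps alg.simps
  by (rule op_eq[OF _ d that, where G = "%d a b. io d (mul (A d) a b)"]) (simp add: ydhD(2)[OF hom, symmetric] io_e D(4))
 have act: "act L h (io d a) = io d (act (A d) h a)" if "h : carr H" "a : carr (A d)" for h a
  unfolding L_def yd.simps
  by (rule op_eq[OF _ d that(2,2), where G = "%d a b. io d (act (A d) h a)"])
   (simp add: ydhD(4)[OF hom, symmetric] that io_e ydD(8)[OF ydA])
 have co: "coact L (io d a) = Gc d a" if "a : carr (A d)" for a
  unfolding L_def yd.simps
  by (rule op_eq[OF _ d that that, where G = "%d a b. Gc d a"]) (rule Gc_nat)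
 show ?thesis unfolding yd_hom_def lin_cong[OF refl refl L_vs] tp_cong[OF refl refl L_vs]
  using io_lin'[OF d] one mul act co by (simp add: Gc_def)
qed

text \<open>Any three elements of the union come from one stage, so the axioms follow from
  \<open>yd_module_algebra_local\<close>. Identification at a later stage is equality of images
  because the maps into the ambient space are injective.\<close>

theorem limit: "yd_module_algebra H L" "inductive_limit H D le A e L io" (is ?a)
proof -
 have vL: "vspace L" using vspace_VL by (simp add: vspace_def L_vs)
 have cL: "carr L = LC" by (simp add: L_def)
 show "yd_module_algebra H L"
 proof (rule yd_module_algebra_local[OF bialg vL, unfolded cL])
  fix x y z assume "x : LC" "y : LC" "z : LC"
  from three[OF this] obtain d where "d : D" "x : io d ` carr (A d)" "y : io d ` carr (A d)" "z : io d ` carr (A d)" by blast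
  then show "EX (X :: ('k, 'h, 'x, 'y) yd_scheme) f. yd_module_algebra H X & yd_hom H X L f & x : f ` carr X & y : f ` carr X & z : f ` carr X"
   by (intro exI[of _ "A d"] exI[of _ "io d"]) (simp add: ydA yd_hom_io)
 qed
 show ?a
  unfolding inductive_limit_def cL
 proof (intro conjI ballI)
  fix d d' x y assume d: "d : D" "d' : D" and xy: "x : carr (A d)" "y : carr (A d')"
  show "io d x = io d' y \<longleftrightarrow> (EX d'':D. le d d'' & le d' d'' & e d d'' x = e d' d'' y)"
  proof
   assume eq: "io d x = io d' y"
   obtain k where k: "k : D" "le d k" "le d' k" using dir d by blast
   have "e d k x = e d' k y" using io_inj[OF k(1)] eq d xy k by (auto simp: inj_on_def e_in io_e)
   then show "EX d'':D. le d d'' & le d' d'' & e d d'' x = e d' d'' y" using k by blast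
  qed (use io_e d xy in metis)
 qed (auto simp: LC_def yd_hom_io)
qed

end

section \<open>Inductive limits of chains\<close>

lemma chain_systems_dir:
 assumes D: "D : chain_systems"
 shows "D ~= {}" "d : D ==> fst d <= snd d" "d : D ==> d' : D ==> EX d'':D. chain_le d d'' & chain_le d' d''"
proof -
 consider (a) s where "D = {(s, t) |t. s <= t}" | (b) t where "D = {(s, t) |s. s <= t}" | (c) "D = {(s, t) |s t. s <= t}"
  using D unfolding chain_systems_def by blast
 then have "D ~= {} & (ALL d:D. fst d <= snd d) & (ALL d:D. ALL d':D. (min (fst d) (fst d'), max (snd d) (snd d')) : D)"
  by cases (force simp: min_def max_def)+
 moreover have "chain_le d (min (fst d) (fst d'), max (snd d) (snd d'))"
  "chain_le d' (min (fst d) (fst d'), max (snd d) (snd d'))" by (auto simp: chain_le_def)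
 ultimately show "D ~= {}" "d : D ==> fst d <= snd d" "d : D ==> d' : D ==> EX d'':D. chain_le d d'' & chain_le d' d''" by blast+
qed

context hopf
begin

lemma brp_chain: "s <= t ==> brp Db {s..t::int} C"
 by unfold_locales (use bia_Db yd_chain_factor in auto)

lemma ce_emb: "chain_embed B d d' = emb {fst d..snd d} {fst d'..snd d'} C"
 by (simp add: chain_embed_def emb_def ext1_def)

lemma chain_embed_hom: assumes "s' <= s" "s <= t" "t <= t'"
 shows "yd_hom Db (chain B s t) (chain B s' t') (chain_embed B (s, t) (s', t'))"
 unfolding chain_def ce_emb fst_conv snd_conv by (rule yd_hom_emb) (use assms brp_chain in auto)

lemma chain_vs: "carr (chain B s t) = carr (mtensor {s..t} C)" "scal (chain B s t) = scal (mtensor {s..t} C)"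
 by (simp_all add: chain_def braided_product_def)

lemma fam_C: "fam J C" by unfold_locales (rule ydD(2)[OF yd_chain_factor])

text \<open>All chains embed, by insertion of units, into the tensor product over all integers;
  injectivity holds because the units of the factors are nonzero.\<close>

lemma chain_limit:
 assumes Q: "Q : chain_systems"
 shows "EX (L :: ('k, ('k, 'b => 'k, 'b) tens, ('k, int, ('b => 'k) \<times> 'b) mtens) yd) io. yd_module_algebra Db L &
   inductive_limit Db Q chain_le (%(s, t). chain B s t) (chain_embed B) L io"
proof -
 interpret U: fam UNIV C by (rule fam_C)
 define io where "io = (%d. emb {fst d..snd d} UNIV C)"
 note S = chain_systems_dir[OF Q]
 interpret ds: dirsys Db Q chain_le "%(s, t). chain B s t" "chain_embed B" "mtensor UNIV C" io
 proof
  show "bialgebra Db" by (rule bia_Db)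
  show "vspace (mtensor UNIV C)" by simp
  show "Q ~= {}" by (rule S)
  fix d assume d: "d : Q"
  then have st: "fst d <= snd d" by (rule S)
  then have ne: "{fst d..snd d} ~= {}" by simp
  have c: "(case d of (s, t) => chain B s t) = chain B (fst d) (snd d)" by (simp add: case_prod_unfold)
  show "yd_module_algebra Db (case d of (s, t) => chain B s t)"
   unfolding c unfolding chain_def by (rule brp.yd_BP[OF brp_chain[OF st]])
  show "lin_map (case d of (s, t) => chain B s t) (mtensor UNIV C) (io d)"
   unfolding c lin_cong[OF chain_vs refl refl] io_def by (rule U.lin_emb[OF subset_UNIV ne])
  show "inj_on (io d) (carr (case d of (s, t) => chain B s t))"
   unfolding c chain_vs io_def by (rule U.emb_inj[OF subset_UNIV ne unity_chain_factor])
  fix d' assume d': "d' : Q"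
  then have st': "fst d' <= snd d'" by (rule S)
  have c': "(case d' of (s, t) => chain B s t) = chain B (fst d') (snd d')" by (simp add: case_prod_unfold)
  show "EX d'':Q. chain_le d d'' & chain_le d' d''" by (rule S(3)[OF d d'])
  assume le: "chain_le d d'"
  show "yd_hom Db (case d of (s, t) => chain B s t) (case d' of (s, t) => chain B s t) (chain_embed B d d')"
   unfolding c c' using chain_embed_hom[of "fst d'" "fst d" "snd d" "snd d'"] le st by (simp add: chain_le_def)
  fix x assume "x : carr (case d of (s, t) => chain B s t)"
  then have x: "x : carr (mtensor {fst d..snd d} C)" unfolding c chain_vs .
  show "io d' (chain_embed B d d' x) = io d x"
   unfolding ce_emb io_def by (rule U.emb_emb[OF _ subset_UNIV ne x]) (use le in "auto simp: chain_le_def")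
 qed
 show ?thesis using ds.limit by blast
qed

end

section \<open>Failure of braided commutativity\<close>

lemma lin_map_sum_fun:
 assumes "vspace W" "!!p. p : P ==> lin_map V W (ph p)"
 shows "lin_map V W (%x. SUM p:P. ph p x)"
proof -
 have z: "lin_map V W (%_. 0)" using vs_zero[OF assms(1)] vs_scal_0[OF assms(1)] by (simp add: lin_map_def)
 show ?thesis using assms(2)
  by (induction P rule: infinite_finite_induct) (auto simp: z intro!: lin_map_add assms(1))
qed

text \<open>The Hopf algebra \<open>k[G] >< k^G\<close> of a finite group in coordinates: \<open>x (c (u, g))\<close> is the coefficient
  of \<open>\<delta>_u g\<close>, where \<open>c\<close> numbers the pairs; \<open>kt\<close> only fixes the type of the field.\<close>

locale fgrp =
 fixes G :: "'g set" and tm :: "'g => 'g => 'g" (infixl "\<bullet>" 70) and i :: 'g and iv :: "'g => 'g" and c :: "'g \<times> 'g => nat" and kt :: "'k::field itself"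
 assumes fin: "finite G" and i: "i : G" and tm: "!!x y. x : G ==> y : G ==> x \<bullet> y : G" and iv: "!!x. x : G ==> iv x : G"
  and assoc: "!!x y z. x : G ==> y : G ==> z : G ==> x \<bullet> y \<bullet> z = x \<bullet> (y \<bullet> z)"
  and i_left: "!!x. x : G ==> i \<bullet> x = x" and iv_left: "!!x. x : G ==> iv x \<bullet> x = i"
  and c: "inj_on c (G \<times> G)"
begin

lemma iv_right: assumes x: "x : G" shows "x \<bullet> iv x = i"
proof -
 have "x \<bullet> iv x = iv (iv x) \<bullet> iv x \<bullet> (x \<bullet> iv x)" using x by (simp add: iv iv_left i_left tm)
 also have "... = iv (iv x) \<bullet> (iv x \<bullet> x \<bullet> iv x)" using x by (simp add: iv tm assoc)
 also have "... = i" using x by (simp add: iv iv_left i_left)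
 finally show ?thesis .
qed

lemma i_right: "x : G ==> x \<bullet> i = x"
 by (metis assoc i_left iv iv_left iv_right)

lemma iv_iv: "x : G ==> iv (iv x) = x"
 by (metis assoc i_left i_right iv iv_left)

lemma solve: "l : G ==> k : G ==> h : G ==> iv l \<bullet> k = h \<longleftrightarrow> k = l \<bullet> h"
 by (metis assoc i_left iv iv_left iv_right)

lemma iv_mul: "x : G ==> y : G ==> iv l \<bullet> x = iv l \<bullet> y \<longleftrightarrow> x = y" if "l : G"
 by (metis assoc i_left iv iv_right that)

lemma tm_bij: assumes l: "l : G" shows "bij_betw (%g. iv l \<bullet> g) G G"
 by (rule bij_betw_byWitness[where f' = "%g. l \<bullet> g"]) (use l in "auto simp: tm iv assoc[symmetric] iv_left iv_right i_left")

lemma sum_iv: "(SUM g:G. f (iv g)) = (SUM g:G. f g)"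
 by (rule sum.reindex_bij_witness[where i = iv and j = iv]) (auto simp: iv iv_iv)

definition K :: "('g \<times> 'g => 'k) => nat => 'k" where
 "K ph n = (if n : c ` (G \<times> G) then ph (inv_into (G \<times> G) c n) else 0)"

definition bs :: "'g => 'g => nat => 'k" where "bs u g = K (%p. if p = (u, g) then 1 else 0)"

text \<open>The underlying space has its own name because the coproduct of \<open>HA\<close> refers
  to it.\<close>

definition VA :: "('k, nat => 'k) vs" where "VA = (|carr = {x. ALL n. n ~: c ` (G \<times> G) --> x n = 0}, scal = fun_scal|)"

text \<open>The product convolves in the group variable g and is pointwise in u; the coproduct keeps
  g and splits u into products v w. Numbering the pairs places the algebra in the type
  \<open>nat => 'k\<close> whatever the type of the group.\<close>

definition HA :: "('k, nat => 'k) hopf" where "HA = (|carr = carr VA, scal = fun_scal,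
  mul = (%x y. K (%(u, k). SUM g:G. x (c (u, g)) * y (c (u, iv g \<bullet> k)))), unity = K (%(u, g). if g = i then 1 else 0),
  cop = (%x. \<Sum>(v, w, g)\<in>G \<times> G \<times> G. fun_scal (x (c (v \<bullet> w, g))) (tpure VA VA (bs v g) (bs w g))),
  cou = (%x. SUM g:G. x (c (i, g))), anti = (%x. K (%(u, g). x (c (iv u, iv g))))|)"

lemma K_c [simp]: "u : G ==> g : G ==> K ph (c (u, g)) = ph (u, g)"
 by (simp add: K_def inv_into_f_f[OF c])

lemma bs_c: "u : G ==> g : G ==> v : G ==> h : G ==> bs v h (c (u, g)) = (if v = u then if h = g then 1 else 0 else 0)"
 by (auto simp: bs_def)

lemma HA_simps [simp]: "scal HA = fun_scal" "u : G ==> k : G ==> mul HA x y (c (u, k)) = (SUM g:G. x (c (u, g)) * y (c (u, iv g \<bullet> k)))"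
 "u : G ==> g : G ==> unity HA (c (u, g)) = (if g = i then 1 else 0)" "cou HA x = (SUM g:G. x (c (i, g)))"
 "u : G ==> g : G ==> anti HA x (c (u, g)) = x (c (iv u, iv g))"
 by (simp_all add: HA_def)

lemma HA_VA: "carr HA = carr VA" "scal HA = scal VA" by (simp_all add: HA_def VA_def)

lemma K_in [simp]: "K ph : carr HA" by (simp add: HA_def VA_def K_def)

lemma ops_in [simp]: "mul HA x y : carr HA" "unity HA : carr HA" "anti HA x : carr HA" "bs u g : carr HA"
 by (simp_all add: HA_def VA_def K_def bs_def)

lemma HA_eqI: "x : carr HA ==> y : carr HA ==> (!!u g. u : G ==> g : G ==> x (c (u, g)) = y (c (u, g))) ==> x = y"
 by (rule ext, rename_tac n, case_tac "n : c ` (G \<times> G)") (auto simp: HA_def VA_def)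

lemma vspace_HA: "vspace HA"
 using fun_vs.vector_space_axioms by (simp add: vspace_def fun_vs.subspace_def HA_def VA_def)

definition cf :: "((nat => 'k) => 'k) set" where "cf = {%x. x (c (u, g)) |u g. u : G & g : G}"

lemma form_c: "form HA (%x. x n)" by (simp add: lin_map_def)

lemma sep_HA: "sep HA cf"
 unfolding sep_def
proof (intro conjI vspace_HA ballI impI)
 fix x :: "nat => 'k" assume x: "x : carr HA" and 0: "ALL f:cf. f x = 0"
 have "x (c (u, g)) = 0" if "u : G" "g : G" for u g using 0 that by (auto simp: cf_def)
 then show "x = 0" by (intro HA_eqI x vs_zero[OF vspace_HA]) simp
qed (auto simp: cf_def form_c)

lemma cop_HA: "cop HA x = (\<Sum>(v, w, g)\<in>G \<times> G \<times> G. scal (tensor HA HA) (x (c (v \<bullet> w, g))) (tpure HA HA (bs v g) (bs w g)))"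
 unfolding tp_cong[OF HA_VA HA_VA] scal_tensor by (simp add: HA_def)

lemma cop_in: "cop HA x : carr (tensor HA HA)"
 unfolding cop_HA by (rule vs_sum[OF vs_t]) (auto intro!: vs_scal[OF vs_t] tpI simp del: scal_tensor)

lemma cop_lin: "lin_map HA (tensor HA HA) (cop HA)"
 unfolding cop_HA[abs_def] case_prod_unfold
 by (rule lin_map_sum_fun[OF vs_t], rule lscL[OF form_c vs_t]) (auto intro!: tpI)

lemma tev_cop: assumes ph: "biform HA HA ph"
 shows "tev HA HA (cop HA x) ph = (\<Sum>(v, w, g)\<in>G \<times> G \<times> G. x (c (v \<bullet> w, g)) * ph (bs v g) (bs w g))" (is "?L = ?R")
proof -
 note l = lin_ta[OF ph vspace_HA vs_g]
 have "?L = (SUM p:G \<times> G \<times> G. tev HA HA (case p of (v, w, g) =>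
   scal (tensor HA HA) (x (c (v \<bullet> w, g))) (tpure HA HA (bs v g) (bs w g))) ph)"
  unfolding cop_HA by (rule lin_map_sum[OF l vs_t]) (auto intro!: vs_scal[OF vs_t] tpI simp del: scal_tensor)
 also have "... = ?R"
  by (rule sum.cong) (auto simp: linD(3)[OF l tpI] tevp[OF ph vspace_HA vs_g] simp del: scal_tensor)
 finally show ?thesis .
qed

lemma bf: "biform HA HA (%a b. f a * h b)" if "form HA f" "form HA h"
 using that by (simp add: mlin fmL fmR)

lemma sum3: "(\<Sum>(v, w, g)\<in>G \<times> G \<times> G. F v w g) = (SUM v:G. SUM w:G. SUM g:G. F v w g)"
 by (simp add: sum.cartesian_product case_prod_unfold)

lemma EVf: assumes "u : G" "g : G" and h: "form HA h"
 shows "tev HA HA (cop HA x) (%a b. a (c (u, g)) * h b) = (SUM w:G. x (c (u \<bullet> w, g)) * h (bs w g))" (is ?a)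
  "tev HA HA (cop HA x) (%a b. h a * b (c (u, g))) = (SUM v:G. x (c (v \<bullet> u, g)) * h (bs v g))" (is ?b)
proof -
 have d: "(SUM k:G. if k = g then F k else 0) = (F g :: 'k)" "(SUM k:G. if k = u then F k else 0) = F u" for F
  using assms fin by simp_all
 have p: "(SUM k:G. if P then F k else 0) = (if P then SUM k:G. F k else (0 :: 'k))" for P F by simp
 show ?a ?b
  unfolding tev_cop[OF bf[OF form_c h]] tev_cop[OF bf[OF h form_c]] sum3
  by (simp_all add: bs_c assms d p if_distrib[of "%t. t * _"] if_distrib[of "%t. _ * t"] cong: if_cong sum.cong)
qed

lemma EV: assumes "u : G" "g : G" "u' : G" "g' : G"
 shows "tev HA HA (cop HA x) (%a b. a (c (u, g)) * b (c (u', g'))) = (if g = g' then x (c (u \<bullet> u', g)) else 0)"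
proof -
 have "tev HA HA (cop HA x) (%a b. a (c (u, g)) * b (c (u', g'))) = (SUM w:G. if w = u' then if g = g' then x (c (u \<bullet> w, g)) else 0 else 0)"
  unfolding EVf(1)[OF assms(1,2) form_c] by (rule sum.cong) (auto simp: bs_c assms)
 then show ?thesis using assms fin by simp
qed

lemma tev_msum: "tev V W t (%a b. SUM i:J. ph i a b) = (SUM i:J. tev V W t (ph i))"
 unfolding tev_def by (simp add: case_prod_unfold sum_list_sum_swap)

lemma alg_HA: "assoc_algebra HA"
 unfolding assoc_algebra_def
proof (intro conjI ballI vspace_HA)
 note add = vs_add[OF vspace_HA] and sc = vs_scal[OF vspace_HA, unfolded HA_simps(1)]
 show "bilin_map HA HA HA (mul HA)"
  unfolding bilin_map_def lin_map_def
  by (auto intro!: HA_eqI add sc simp: tm iv algebra_simps sum.distrib sum_distrib_left)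
 fix x y z :: "nat => 'k" assume x: "x : carr HA"
 show "mul HA (mul HA x y) z = mul HA x (mul HA y z)"
 proof (rule HA_eqI)
  fix u k assume [simp]: "u : G" "k : G"
  have "mul HA (mul HA x y) z (c (u, k)) = (SUM h:G. SUM g:G. x (c (u, g)) * y (c (u, iv g \<bullet> h)) * z (c (u, iv h \<bullet> k)))" (is "?Z = _")
   by (simp add: sum_distrib_right)
  also have "... = (SUM g:G. SUM h:G. x (c (u, g)) * y (c (u, iv g \<bullet> h)) * z (c (u, iv h \<bullet> k)))" by (rule sum.swap)
  also have "... = (SUM g:G. SUM h:G. x (c (u, g)) * (y (c (u, h)) * z (c (u, iv h \<bullet> (iv g \<bullet> k)))))"
  proof (rule sum.cong[OF refl])
   fix g assume g: "g : G"
   \<comment> \<open>Left translation by the inverse of g permutes the group; this identity is what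
     the substitution does to the third factor.\<close>
   have e: "iv (iv g \<bullet> h) \<bullet> (iv g \<bullet> k) = iv h \<bullet> k" if h: "h : G" for h
    by (subst solve) (use g h in \<open>auto simp: tm iv assoc\<close>, metis assoc i_left iv iv_right tm `k : G`)
   show "(SUM h:G. x (c (u, g)) * y (c (u, iv g \<bullet> h)) * z (c (u, iv h \<bullet> k)))
    = (SUM h:G. x (c (u, g)) * (y (c (u, h)) * z (c (u, iv h \<bullet> (iv g \<bullet> k)))))"
    using sum.reindex_bij_betw[OF tm_bij[OF g], of "%h. x (c (u, g)) * (y (c (u, h)) * z (c (u, iv h \<bullet> (iv g \<bullet> k))))"]
    by (simp add: e mult.assoc)
  qed
  also have "... = mul HA x (mul HA y z) (c (u, k))" by (simp add: sum_distrib_left tm iv)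
  finally show "?Z = ..." .
 qed simp_all
 have ii: "iv i = i" by (metis i i_right iv iv_left)
 show "mul HA (unity HA) x = x"
  by (rule HA_eqI) (use x in \<open>simp_all add: if_distrib[of "%a. a * _"] sum.delta'[OF fin] fin i ii i_left cong: if_cong\<close>)
 show "mul HA x (unity HA) = x"
 proof (rule HA_eqI)
  fix u k assume "u : G" "k : G"
  then have "mul HA x (unity HA) (c (u, k)) = (SUM g:G. if g = k then x (c (u, g)) else 0)"
   by (auto simp: tm iv solve i i_right intro!: sum.cong)
  then show "mul HA x (unity HA) (c (u, k)) = x (c (u, k))" using fin `k : G` by simp
 qed (simp_all add: x)
qed simp

lemma bialg_HA: "bialgebra HA"
proof (rule bialgebraI[OF alg_HA cop_lin _ sep_HA])
 show cou: "form HA (cou HA)"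
  by (simp add: lin_map_def sum.distrib sum_distrib_left)
 have cb: "cou HA (bs v g) = (if v = i then 1 else 0 :: 'k)" if "v : G" "g : G" for v g
  using that fin i by (simp add: bs_c)
 fix x :: "nat => 'k" and f g h :: "(nat => 'k) => 'k" assume x: "x : carr HA" and "f : cf"
 then obtain u k where f: "u : G" "k : G" "f = (%x. x (c (u, k)))" by (auto simp: cf_def)
 show "tev HA HA (cop HA x) (%a b. cou HA a * f b) = f x"
  unfolding f(3) EVf(2)[OF f(1,2) cou] using f fin i
  by (simp del: HA_simps(4) add: cb if_distrib[of "%a. _ * a"] i_left cong: if_cong)
 have "tev HA HA (cop HA x) (%a b. cou HA b * f a) = tev HA HA (cop HA x) (%a b. f a * cou HA b)" (is "?Z = _") by (simp only: mult.commute)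
 also have "... = f x"
  unfolding f(3) EVf(1)[OF f(1,2) cou] using f fin i
  by (simp del: HA_simps(4) add: cb if_distrib[of "%a. _ * a"] i_right cong: if_cong)
 finally show "?Z = ..." .
 assume "g : cf"
 then obtain u' k' where g: "u' : G" "k' : G" "g = (%x. x (c (u', k')))" by (auto simp: cf_def)
 {
  assume "h : cf"
  then obtain u'' k'' where h: "u'' : G" "k'' : G" "h = (%x. x (c (u'', k'')))" by (auto simp: cf_def)
  have "tev HA HA (cop HA x) (%y c. tev HA HA (cop HA y) (%a b. f a * (g b * h c)))
   = tev HA HA (cop HA x) (%y z. (if k = k' then 1 else 0) * (y (c (u \<bullet> u', k)) * z (c (u'', k''))))" (is "?Z = _")
   unfolding mult.assoc[symmetric] tevR[symmetric] f(3) g(3) h(3) EV[OF f(1,2) g(1,2)] by (simp add: if_distrib cong: if_cong)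
  also have "... = tev HA HA (cop HA x) (%a y. (if k' = k'' then 1 else 0) * (a (c (u, k)) * y (c (u' \<bullet> u'', k'))))"
   unfolding tevL[symmetric] by (simp add: EV f g h tm assoc)
  also have "... = tev HA HA (cop HA x) (%a y. tev HA HA (cop HA y) (%b c. f a * (g b * h c)))"
   unfolding tevL[symmetric] f(3) g(3) h(3) EV[OF g(1,2) h(1,2)] unfolding tevL by (rule arg_cong[where f = "tev HA HA (cop HA x)"]) (auto simp: fun_eq_iff)
  finally show "?Z = ..." .
 }
 fix y :: "nat => 'k"
 have "tev HA HA (cop HA x) (%x1 x2. tev HA HA (cop HA y) (%y1 y2. f (mul HA x1 y1) * g (mul HA x2 y2)))
  = tev HA HA (cop HA x) (%x1 x2. tev HA HA (cop HA y) (%y1 y2. SUM l:G. SUM m:G.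
    (x1 (c (u, l)) * x2 (c (u', m))) * (y1 (c (u, iv l \<bullet> k)) * y2 (c (u', iv m \<bullet> k')))))"
  using f g by (simp add: sum_product mult_ac)
 also have "... = (SUM l:G. SUM m:G. tev HA HA (cop HA x) (%x1 x2. x1 (c (u, l)) * x2 (c (u', m)))
    * tev HA HA (cop HA y) (%y1 y2. y1 (c (u, iv l \<bullet> k)) * y2 (c (u', iv m \<bullet> k'))))"
  by (simp only: tev_msum tevL[symmetric] tevR[symmetric])
 also have "... = (SUM l:G. SUM m:G. if l = m then if k = k' then x (c (u \<bullet> u', l)) * y (c (u \<bullet> u', iv l \<bullet> k)) else 0 else 0)"
  by (intro sum.cong refl) (auto simp: EV f g tm iv iv_mul)
 also have "... = tev HA HA (cop HA (mul HA x y)) (%a b. f a * g b)"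
  using fin unfolding f(3) g(3) EV[OF f(1,2) g(1,2)] by (simp add: tm f g)
 finally show "tev HA HA (cop HA (mul HA x y)) (%a b. f a * g b)
  = tev HA HA (cop HA x) (%x1 x2. tev HA HA (cop HA y) (%y1 y2. f (mul HA x1 y1) * g (mul HA x2 y2)))" ..
next
 show "cop HA (unity HA) = tpure HA HA (unity HA) (unity HA)"
 proof (rule tensor_eqI[OF sep_HA sep_HA cop_in])
  fix f g :: "(nat => 'k) => 'k" assume "f : cf" "g : cf"
  then show "tev HA HA (cop HA (unity HA)) (%v w. f v * g w) = tev HA HA (tpure HA HA (unity HA) (unity HA)) (%v w. f v * g w)"
   by (auto simp: cf_def EV tm tevp[OF bf[OF form_c form_c] vspace_HA vs_g])
 qed (auto intro: tpI)
 fix x y :: "nat => 'k"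
 have "cou HA (mul HA x y) = (SUM k:G. SUM g:G. x (c (i, g)) * y (c (i, iv g \<bullet> k)))" (is "?Z = _") using i by simp
 also have "... = (SUM g:G. SUM k:G. x (c (i, g)) * y (c (i, iv g \<bullet> k)))" by (rule sum.swap)
 also have "... = cou HA x * cou HA y"
  unfolding HA_simps sum_product sum_distrib_left[symmetric]
  by (rule sum.cong) (auto simp: sum.reindex_bij_betw[OF tm_bij, of _ "%k. y (c (i, k))"])
 finally show "?Z = ..." .
 show "cou HA (unity HA) = (1 :: 'k)" using i fin by simp
qed

lemma hopf_HA: "hopf_algebra HA"
proof -
 interpret bialg HA by (rule bialg.intro[OF bialg_HA])
 have lin: "lin_map HA HA (anti HA)"
  unfolding lin_map_def by (auto intro!: HA_eqI vs_add[OF vspace_HA] vs_scal[OF vspace_HA, unfolded HA_simps(1)] simp: iv)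
 note la = lmL[OF alg_HA] lmR[OF alg_HA] lin_o[OF _ lin] lin_id
 have b: "bilin_map HA HA HA (%a b. mul HA (anti HA a) b)" "bilin_map HA HA HA (%a b. mul HA a (anti HA b))"
  by (simp_all add: mlin la)
 have in': "sw HA x (%a b. mul HA (anti HA a) b) : carr HA" "sw HA x (%a b. mul HA a (anti HA b)) : carr HA" for x :: "nat => 'k"
  unfolding sw_def by (rule tlift_in[OF b(1) vspace_HA vspace_HA fgrp.cop_in[OF fgrp_axioms]], rule tlift_in[OF b(2) vspace_HA vspace_HA fgrp.cop_in[OF fgrp_axioms]])
 have "sw HA x (%a b. mul HA (anti HA a) b) = scal HA (cou HA x) (unity HA)" if "x : carr HA" for x :: "nat => 'k"
 proof (rule HA_eqI[OF in'(1) vs_scal[OF vspace_HA ops_in(2)]])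
  fix u k assume u[simp]: "u : G" "k : G"
  have e: "iv g = iv g \<bullet> k \<longleftrightarrow> k = i" if g: "g : G" for g
   by (metis assoc g i_left i_right iv iv_right u(2))
  have "sw HA x (%a b. mul HA (anti HA a) b) (c (u, k)) = tev HA HA (cop HA x) (%a b. mul HA (anti HA a) b (c (u, k)))" (is "?Z = _")
   unfolding sw_def by (rule tl_pull[OF form_c b(1) vspace_HA vspace_HA fgrp.cop_in[OF fgrp_axioms]])
  also have "... = (SUM g:G. tev HA HA (cop HA x) (%a b. a (c (iv u, iv g)) * b (c (u, iv g \<bullet> k))))"
   by (simp add: tev_msum)
  also have "... = (SUM g:G. if k = i then x (c (i, iv g)) else 0)"
   by (rule sum.cong) (auto simp: EV tm iv iv_left e)
  also have "... = scal HA (cou HA x) (unity HA) (c (u, k))" using sum_iv[of "%g. x (c (i, g))"] by simp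
  finally show "?Z = ..." .
 qed
 moreover have "sw HA x (%a b. mul HA a (anti HA b)) = scal HA (cou HA x) (unity HA)" if "x : carr HA" for x :: "nat => 'k"
 proof (rule HA_eqI[OF in'(2) vs_scal[OF vspace_HA ops_in(2)]])
  fix u k assume u[simp]: "u : G" "k : G"
  have e: "g = iv (iv g \<bullet> k) \<longleftrightarrow> k = i" if g: "g : G" for g
   by (metis assoc g i_left i_right iv iv_iv iv_left iv_right tm u(2))
  have "sw HA x (%a b. mul HA a (anti HA b)) (c (u, k)) = tev HA HA (cop HA x) (%a b. mul HA a (anti HA b) (c (u, k)))" (is "?Z = _")
   unfolding sw_def by (rule tl_pull[OF form_c b(2) vspace_HA vspace_HA fgrp.cop_in[OF fgrp_axioms]])
  also have "... = (SUM g:G. tev HA HA (cop HA x) (%a b. a (c (u, g)) * b (c (iv u, iv (iv g \<bullet> k)))))"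
   by (simp add: tev_msum tm iv)
  also have "... = (SUM g:G. if k = i then x (c (i, g)) else 0)"
   by (rule sum.cong) (auto simp: EV tm iv iv_right e)
  also have "... = scal HA (cou HA x) (unity HA) (c (u, k))" by simp
  finally show "?Z = ..." .
 qed
 ultimately show ?thesis using bialg_HA lin by (simp add: hopf_algebra_def del: HA_simps)
qed

lemma bij_HA: "bij_betw (anti HA) (carr HA) (carr HA)"
 by (rule bij_betw_byWitness[where f' = "anti HA"]) (auto intro!: HA_eqI simp: iv iv_iv)

lemma hopf_loc: "hopf HA"
 using bialg_HA hopf_HA bij_HA by (simp add: hopf_def hopf_axioms_def bialg_def)

end

section \<open>Criteria for the failure of braided commutativity\<close>

lemma (in ydfam) act_factor_at:
 assumes fin: "finite J" and i: "i : J" and x: "x : carr (X i)" and h: "h : carr H"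
 shows "act (bp H J X m) h (factor_at J X i x) = factor_at J X i (act (X i) h x)" (is "?L = ?R")
proof -
 let ?y = "%x. \<lambda>j\<in>J. if j = i then x else unity (X j)"
 have f: "filter (%j. j = i) sJ = [i]"
  by (rule sorted_distinct_set_unique) (use fin i in "auto simp: sorted_wrt_filter")
 have y: "(?y x)(i := z) = ?y z" "(?y x) i = x" for z using i by (auto simp: fun_eq_iff)
 have "?L = diag_act H J X sJ h (?y x)"
  unfolding factor_at_def by (rule bp_act[OF fin _ h fat_PE[OF x]]) (use i in auto)
 also have "... = diag_act H J X (filter (%j. j = i) sJ) h (?y x)"
  by (rule diag_filter[OF sJ[OF fin] h fat_PE[OF x]]) (use fin in auto)
 also have "... = Sw h (%h1 h2. diag_act H J X [] h2 ((?y x)(i := act (X i) h1 ((?y x) i))))"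
  unfolding f by (rule diag_Cons[OF i _ h fat_PE[OF x]]) simp
 also have "... = Sw h (%h1 h2. scal M (cou H h2) (factor_at J X i (act (X i) h1 x)))"
  unfolding y factor_at_def by (simp only: diag_act.simps scal_mtensor)
 also have "... = ?R"
  by (rule Sw_counit_right[OF lin_o[OF bilL[OF actX[OF i] lin_id x] lin_factor_at[OF i]] vspace_mtensor h])
 finally show ?thesis .
qed

context brp
begin

lemma prod_form: assumes F: "!!i. i : I ==> form (X i) (F i)"
 shows "multilin_form I X (%z. \<Prod>i\<in>I. F i (z i))"
 unfolding multilin_form_def
proof (intro ballI)
 fix z i assume i: "i : I"
 have "(\<Prod>j\<in>I. F j ((z(i := v)) j)) = F i v * (\<Prod>j\<in>I - {i}. F j (z j))" for v
  by (subst prod.remove[OF finI i]) (auto intro!: prod.cong)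
 then show "form (X i) (%v. \<Prod>j\<in>I. F j ((z(i := v)) j))" using fmR[OF F[OF i]] by simp
qed

text \<open>A tensor is a function on forms, and \<open>ph\<close> is a multilinear form at which
  products are evaluated: \<open>p\<close> and \<open>q\<close> at the positions i and j, and forms
  with value 1 at the unit in the other positions. It reads off both entries of a product at
  once.\<close>

lemma two_factors:
 assumes "i : I" "j : I" "i < j" and p: "form (X i) p" and q: "form (X j) q" and nz: "!!k. k : I ==> unity (X k) ~= 0"
 obtains ph where "!!v w. v : carr (X i) ==> w : carr (X j) ==> mul BP (e i v) (e j w) ph = p v * q w"
proof -
 have "EX f. form (X k) f & f (unity (X k)) = 1" if k: "k : I" for k
 proof -
  obtain f where f: "form (X k) f" "f (unity (X k)) ~= 0"
   using f_sep[OF vsX[OF k] unX[OF k]] nz[OF k] by blast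
  show ?thesis
   by (rule exI[of _ "%v. inverse (f (unity (X k))) * f v"], rule conjI, rule fmL[OF f(1)]) (simp add: f(2))
 qed
 then obtain l where l: "!!k. k : I ==> form (X k) (l k)" "!!k. k : I ==> l k (unity (X k)) = 1" by metis
 let ?F = "%k. if k = i then p else if k = j then q else l k"
 have F: "multilin_form I X (%z. \<Prod>k\<in>I. ?F k (z k))" by (rule prod_form) (use p q l in auto)
 show thesis
 proof (rule that)
  fix v w assume v: "v : carr (X i)" and w: "w : carr (X j)"
  let ?y = "%k. if k = i then v else w"
  let ?z = "\<lambda>k\<in>I. if k : set [i, j] then ?y k else unity (X k)"
  have "mul BP (e i v) (e j w) = R [i, j] ?y" using assms w by (simp add: R_simps m_un e_in)
  also have "... = mpure I X ?z" by (rule R_sorted) (use assms v w in auto)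
  finally have "mul BP (e i v) (e j w) (%z. \<Prod>k\<in>I. ?F k (z k)) = (\<Prod>k\<in>I. ?F k (?z k))" (is "?Z = _")
   using F by (simp add: mpure_def)
  also have "... = (\<Prod>k\<in>{i, j}. ?F k (?z k))"
   by (rule prod.mono_neutral_right[OF finI]) (use assms l in auto)
  also have "... = p v * q w" using assms by simp
  finally show "?Z = ..." .
 qed
qed

text \<open>For \<open>i < j\<close>, braided commutativity of \<open>u(b)[i]\<close> and \<open>u'(a)[j]\<close> says that the double braiding
  fixes \<open>b >< a\<close>.\<close>

lemma not_braided_commutative:
 assumes i: "i : I" and j: "j : I" and ij: "i < j" and nz: "!!k. k : I ==> unity (X k) ~= 0"
  and u: "yd_hom H X0 (X i) u" and u': "yd_hom H X0 (X j) u'" and X0: "yd_module_algebra H X0"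
  and b: "b : carr X0" and a: "a : carr X0" and hb: "hb : carr H" and hc: "hc : carr H"
  and cb: "coact X0 b = tpure H X0 hb b" and cc: "coact X0 (act X0 hb a) = tpure H X0 hc (act X0 hb a)"
  and p: "form (X i) p" "p (u b) = 1" "p (u (act X0 hc b)) = 1"
  and q: "form (X j) q" "q (u' a) ~= q (u' (act X0 hb a))"
 shows "~ braided_commutative H BP"
proof
 assume bc: "braided_commutative H BP"
 let ?c = "act X0 hb a"
 note ul = ydhD(1)[OF u] and ul' = ydhD(1)[OF u']
 note ain = ydD(8)[OF X0]
 note ub = linD(1)[OF ul b] and ua = linD(1)[OF ul' a] and uc = linD(1)[OF ul' ain[OF hb a]]
 have tl: "tlift H BP = tlift H M" by (subst BP_bp) (rule bp_cong)
 have co: "coact (X k) (v x) = tpure H (X k) h (v x)"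
  if "yd_hom H X0 (X k) v" "x : carr X0" "h : carr H" "coact X0 x = tpure H X0 h x" for k v x h
  using tl_pure[OF bil_tpm[OF ydhD(1)[OF that(1)]] vs vs_t that(3,2)]
  by (simp add: ydhD(5)[OF that(1,2)] that(4))
 have coY: "coact BP (e i (u b)) = tpure H M hb (e i (u b))"
  by (subst BP_bp, subst coact_factor_at[OF finI i ub], subst co[OF u b hb cb]) (rule tl_pure[OF bil_tpm[OF lin_e[OF i]] vs vs_t hb ub])
 have aX: "act BP hb (e j (u' a)) = e j (u' ?c)"
  by (subst BP_bp) (simp add: act_factor_at[OF finI j ua hb] ydhD(4)[OF u' hb a])
 have lc: "lin_map H BP = lin_map H M" by (subst BP_bp) (rule bp_cong)
 have lact: "lin_map H M (%g. act BP g (e j (u' a)))"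
  unfolding lc[symmetric] by (rule bilL[OF ydD(3)[OF yd_BP] lin_id]) (simp only: BP_simps e_in[OF ua])
 have "mul BP (e i (u b)) (e j (u' a)) = tlift H M (%g z. mul BP (act BP g (e j (u' a))) z) (coact BP (e i (u b)))" (is "?Z = _")
  using bc e_in[OF ub] e_in[OF ua] unfolding braided_commutative_def tl BP_simps by blast
 also have "... = mul BP (e j (u' ?c)) (e i (u b))"
  unfolding coY by (subst tl_pure[OF bilin_comp[OF m_bilin lact lin_id] vs vspace_mtensor hb e_in[OF ub]]) (simp only: aX)
 \<comment> \<open>Braided commutativity has exchanged the two elements once; the relation of the
   product, valid since j > i, exchanges them again and restores the order.\<close>
 also have "... = tev H (X j) (tpure H (X j) hc (u' ?c)) (%g z. mul BP (e i (act (X i) g (u b))) (e j z))"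
  unfolding e_rel[OF j i ij uc ub] co[OF u' ain[OF hb a] hc cc] ..
 also have "... = mul BP (e i (act (X i) hc (u b))) (e j (u' ?c))"
  by (rule tevp[OF bilin_comp[OF m_bilin lin_o[OF bilL[OF actX[OF i] lin_id ub] lin_e[OF i]] lin_e[OF j]] vs vspace_mtensor hc uc])
 also have "... = mul BP (e i (u (act X0 hc b))) (e j (u' ?c))" by (simp only: ydhD(4)[OF u hc b])
 finally have eq: "?Z = ..." .
 obtain ph where ph: "!!v w. v : carr (X i) ==> w : carr (X j) ==> mul BP (e i v) (e j w) ph = p v * q w"
  using two_factors[OF i j ij p(1) q(1) nz] by blast
 have "q (u' a) = q (u' ?c)"
  using arg_cong[OF eq, of "%z. z ph"] p(2,3) by (simp add: ph ub ua uc linD(1)[OF ul ain[OF hc b]])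
 with q(2) show False by simp
qed

end

context hopf
begin

text \<open>A group-like element has a pure coaction and acts on B by the adjoint action. The counit
  takes the value 1 at \<open>b\<close> and at its conjugate, so only the comparison of
  \<open>a\<close> with \<open>ad b a\<close> is left.\<close>

lemma not_bc_self:
 assumes i: "even i" "i : {s..t}" "i + 2 : {s..t}" and b: "b : carr B" "cop B b = tpure B B b b" "cou B b = 1"
  and a: "a : carr B" and c: "ad b a ~= a" "cop B (ad b a) = tpure B B (ad b a) (ad b a)" "cou B (ad (ad b a) b) = 1"
 shows "~ braided_commutative Db (chain B s t)"
proof -
 have st: "s <= t" using i by simp
 have co: "coact BY x = tpure Db BY (unity D >< x) x" if x: "x : carr B" "cop B x = tpure B B x x" for x
  unfolding BY_coact x(2) BY_vs by (rule tl_pure[OF BY_coact_bilin vs vs_t x(1) x(1)])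
 have act: "act BY (unity D >< m) x = ad m x" if "m : carr B" "x : carr B" for m x
  using that by (simp add: BYa_p d1_in la_one ad_in)
 have C: "carr (C j) = (%b. (0, b)) ` carr B" "scal (C j) = (%c (be, b). (scal D c be, scal B c b))" if "even j" for j
  using that by (simp_all add: chain_factor_def transport_yd_def BY_simps Let_def)
 have sn: "lin_map (C j) B snd" if "even j" for j
  using that by (auto simp: lin_map_def C vs vs_add vs_scal)
 obtain q where q: "form B q" "q (a - ad b a) ~= 0"
  using f_sep[OF vs vs_diff[OF vs a ad_in[OF b(1) a]]] c(1) by auto
 show ?thesis unfolding chain_def
  by (rule brp.not_braided_commutative[OF brp_chain[OF st] i(2,3) _ unity_chain_factor ch_even(1)[OF i(1)] ch_even(1)[of "i+2"] yd_self,
   where b = b and a = a and hb = "unity D >< b" and hc = "unity D >< ad b a"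
   and p = "%z. cou B (snd z)" and q = "%z. q (snd z)"])
   (use i q b a c in "simp_all add: BY_simps pr_in d1_in ad_in act co lin_o[OF sn cou_form] lin_o[OF sn q(1)] lin_map_diff[OF q(1) vs]")
qed

text \<open>Group-like elements of the dual are the characters of B, acting by conjugation in the
  dual. Evaluation at \<open>one\<close> takes the place of the counit.\<close>

lemma not_bc_dual:
 assumes i: "odd i" "i : {s..t}" "i + 2 : {s..t}" and b: "be : carr D" "!!x y. x : carr B ==> y : carr B ==> be (x**y) = be x * be y" "be one = 1"
  and a: "aa : carr D" and c: "ga = mul D (mul D be aa) (T' be)" "ga ~= aa" "!!x y. x : carr B ==> y : carr B ==> ga (x**y) = ga x * ga y"
   "mul D (mul D ga be) (T' ga) one = 1"
 shows "~ braided_commutative Db (chain B s t)"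
proof -
 have st: "s <= t" using i by simp
 have g: "ga : carr D" by (simp add: c(1) dmul_in T'_in b a)
 have cop: "cop D x = tpure D D x x" if x: "x : carr D" "!!u v. u : carr B ==> v : carr B ==> x (u**v) = x u * x v" for x
  by (rule tensor_eqI[OF sep_dual sep_dual copD(1)[OF x(1)] tpI[OF x(1,1)]]) (auto simp: copD x tevp[OF biform_eval2 vsD vs_g])
 have co: "coact DY x = tpure Db DY (x >< one) x" if x: "x : carr D" "cop D x = tpure D D x x" for x
  unfolding DY_coact x(2) DY_vs by (rule tl_pure[where U = "tensor Db D", OF _ vsD vs_t x(1) x(1)]) (simp add: mlin lin_E one_in)
 have act: "act DY (x >< one) y = mul D (mul D x y) (T' x)" if x: "x : carr D" "cop D x = tpure D D x x" and y: "y : carr D" for x y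
 proof -
  have "act DY (x >< one) y = dact y x one"
   unfolding DY_act[OF y] by (rule tl_pure[OF dact_bilin[OF y] vsD vsD x(1) one_in])
  also have "... = mul D (mul D x y) (T' x)" unfolding dact_def x(2) hit_one[OF y]
   by (rule tevp[OF _ vsD vsD x(1) x(1)]) (simp add: mlin lin_D lin_o[OF _ T'_lin] y)
  finally show ?thesis .
 qed
 have C: "carr (C j) = (%b. (b, 0)) ` carr D" "scal (C j) = (%c (be, b). (scal D c be, scal B c b))" if "odd j" for j
  using that by (simp_all add: chain_factor_def transport_yd_def DY_simps Let_def)
 have fs: "lin_map (C j) D fst" if "odd j" for j
  using that by (auto simp: lin_map_def C vsD vs_add fsD)
 obtain x where x: "x : carr B" "aa x ~= ga x" using dual_eqI[OF a g] c(2) by metis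
 note cb = cop[OF b(1,2)] and cg = cop[OF g c(3)]
 show ?thesis unfolding chain_def
  by (rule brp.not_braided_commutative[OF brp_chain[OF st] i(2,3) _ unity_chain_factor ch_odd(1)[OF i(1)] ch_odd(1)[of "i+2"] yd_dual,
   where b = be and a = aa and hb = "be >< one" and hc = "ga >< one"
   and p = "%z. fst z one" and q = "%z. fst z x"])
   (use i x a b(3) c(4) in "simp_all add: DY_simps pr_in one_in act b(1) g cb cg co c(1)[symmetric] lin_o[OF fs form_eval]")
qed

end

section \<open>Group-like elements and characters of the counterexample\<close>

context fgrp
begin

text \<open>The element 1 tensor g, that is, the sum of delta_u g over all u; it is
  group-like.\<close>

definition Gl :: "'g => nat => 'k" where "Gl g = K (%(u, h). if h = g then 1 else 0)"

lemma Gl_c: "u : G ==> h : G ==> Gl g (c (u, h)) = (if h = g then 1 else 0)" and Gl_in: "Gl g : carr HA"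
 by (simp_all add: Gl_def)

lemma cop_Gl: assumes g: "g : G" shows "cop HA (Gl g) = tpure HA HA (Gl g) (Gl g)"
proof (rule tensor_eqI[OF sep_HA sep_HA cop_in tpI[OF Gl_in Gl_in]])
 fix f h :: "(nat => 'k) => 'k" assume "f : cf" "h : cf"
 then show "tev HA HA (cop HA (Gl g)) (%v w. f v * h w) = tev HA HA (tpure HA HA (Gl g) (Gl g)) (%v w. f v * h w)"
  by (auto simp: cf_def EV tevp[OF bf[OF form_c form_c] vspace_HA vs_g] Gl_in Gl_c tm)
qed

lemma mul_Gl: assumes "g : G" "h : G" shows "mul HA (Gl g) (Gl h) = Gl (g \<bullet> h)"
proof (rule HA_eqI)
 fix u k assume u: "u : G" "k : G"
 have "mul HA (Gl g) (Gl h) (c (u, k)) = (SUM g':G. if g' = g then Gl h (c (u, iv g' \<bullet> k)) else 0)"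
  unfolding HA_simps(2)[OF u] by (rule sum.cong) (auto simp: Gl_c u)
 then show "mul HA (Gl g) (Gl h) (c (u, k)) = Gl (g \<bullet> h) (c (u, k))"
  using assms u fin by (simp add: Gl_c tm iv solve)
qed (simp_all add: Gl_in)

lemma anti_Gl: assumes "g : G" shows "anti HA (Gl g) = Gl (iv g)"
 by (rule HA_eqI) (use assms iv_iv in "auto simp: Gl_in Gl_c iv")

lemma cou_Gl: "g : G ==> cou HA (Gl g) = 1"
 using i fin by (simp add: Gl_c)

abbreviation cs :: "'g => (nat => 'k) => 'k" where "cs u x == SUM g:G. x (c (u, g))"

lemma cs_form: "form HA (cs u)"
 by (rule lin_map_sum_fun[OF vs_g form_c])

lemma cs_mul: assumes u: "u : G" shows "cs u (mul HA x y) = cs u x * cs u y" (is "?L = ?R")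
proof -
 have "?L = (SUM k:G. SUM g:G. x (c (u, g)) * y (c (u, iv g \<bullet> k)))"
  using u by simp
 also have "... = (SUM g:G. SUM k:G. x (c (u, g)) * y (c (u, iv g \<bullet> k)))" by (rule sum.swap)
 also have "... = ?R"
  unfolding sum_product sum_distrib_left[symmetric]
  by (rule sum.cong) (auto simp: sum.reindex_bij_betw[OF tm_bij, of _ "%k. y (c (u, k))"])
 finally show ?thesis .
qed

lemma cs_one: "u : G ==> cs u (unity HA) = 1"
 using i fin by simp

text \<open>The character with value 1 at delta_v g for v = u and 0 otherwise: evaluation at u on
  functions, times the trivial character of the group algebra. As \<open>mul_ch\<close> shows, these
  characters multiply like G.\<close>

definition ch :: "'g => (nat => 'k) => 'k" where "ch u = ext0 HA (cs u)"

lemma ch_apply: "x : carr HA ==> ch u x = cs u x" by (simp add: ch_def ext0_def)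

lemma ch_in: assumes u: "u : G" shows "ch u : carr (dual HA)"
proof -
 interpret hopf HA by (rule hopf_loc)
 show ?thesis unfolding ch_def
  by (rule ext0_in_dual[OF cs_form], rule finrankI[of "{()}" "%_. cs u" "%_. cs u"]) (auto simp: cs_form cs_mul[OF u] simp del: HA_simps)
qed

lemma mul_ch: assumes u: "u : G" "v : G" shows "mul (dual HA) (ch u) (ch v) = (ch (u \<bullet> v) :: (nat => 'k) => 'k)"
proof -
 interpret hopf HA by (rule hopf_loc)
 show ?thesis
 proof (rule dual_eqI[OF dmul_in[OF ch_in ch_in] ch_in])
  fix x :: "nat => 'k" assume x: "x : carr HA"
  have "mul D (ch u) (ch v) x = tev HA HA (cop HA x) (%a b. SUM g:G. SUM h:G. a (c (u, g)) * b (c (v, h)))" (is "?Z = _")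
   unfolding dmulE[OF ch_in[OF u(1)] ch_in[OF u(2)] x]
   by (rule Swc[OF x]) (simp add: ch_apply sum_product)
  also have "... = (SUM g:G. SUM h:G. if g = h then x (c (u \<bullet> v, g)) else 0)"
   unfolding tev_msum by (intro sum.cong refl EV u)
  also have "... = ch (u \<bullet> v) x" using fin by (simp add: ch_apply x)
  finally show "?Z = ..." .
 qed (simp_all add: u tm)
qed

lemma inv_ch: assumes u: "u : G" shows "anti_inv (dual HA) (ch u) = (ch (iv u) :: (nat => 'k) => 'k)"
proof -
 interpret hopf HA by (rule hopf_loc)
 show ?thesis
 proof (rule dual_eqI[OF T'_in[OF ch_in] ch_in])
  fix x :: "nat => 'k" assume x: "x : carr HA"
  have "T x = anti HA x" by (rule T_eqI[OF x]) (auto intro!: HA_eqI x simp: iv iv_iv)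
  then show "T' (ch u) x = ch (iv u) x"
   using sum_iv[of "%g. x (c (iv u, g))"] by (simp add: T'_apply ch_in u x ch_apply)
 qed (simp_all add: u iv)
qed

text \<open>The positions s and s + 2 carry factors of the same kind. For even s the noncommuting
  elements are the group-likes \<open>Gl\<close> in two copies of B, for odd s the characters
  \<open>ch\<close> in two copies of the dual.\<close>

lemma not_braided_commutative_chain:
 assumes g: "g : G" "h : G" "g \<bullet> h \<bullet> iv g ~= h" and st: "s + 2 <= t"
 shows "~ braided_commutative (double HA) (chain HA s t)"
proof -
 interpret hopf HA by (rule hopf_loc)
 let ?k = "g \<bullet> h \<bullet> iv g"
 have k: "?k : G" "?k \<bullet> g \<bullet> iv ?k : G" by (simp_all add: g tm iv)
 have ad: "ad (Gl x) (Gl y) = Gl (x \<bullet> y \<bullet> iv x)" if x: "x : G" "y : G" for x y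
 proof -
  have "ad (Gl x) (Gl y) = mul HA (mul HA (Gl x) (Gl y)) (anti HA (Gl x))" unfolding ad_def cop_Gl[OF x(1)]
   by (rule tevp[OF _ vs vs Gl_in Gl_in]) (simp add: mlin lin_B Gl_in)
  then show ?thesis by (simp add: mul_Gl anti_Gl x tm iv del: HA_simps)
 qed
 have ne: "Gl ?k ~= (Gl h :: nat => 'k)"
 proof
  assume "Gl ?k = (Gl h :: nat => 'k)"
  then have "Gl ?k (c (i, ?k)) = (Gl h (c (i, ?k)) :: 'k)" by simp
  then show False using g(3) by (simp add: Gl_c i k)
 qed
 have nc: "ch ?k ~= (ch h :: (nat => 'k) => 'k)"
 proof
  assume "ch ?k = (ch h :: (nat => 'k) => 'k)"
  then have "ch ?k (bs h i) = (ch h (bs h i) :: 'k)" by simp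
  then show False using g k i fin by (simp add: ch_apply bs_c)
 qed
 show ?thesis
 proof (cases "even s")
  case True
  show ?thesis
   by (rule not_bc_self[OF True, where b = "Gl g" and a = "Gl h"]) (use st g k ne in "simp_all add: Gl_in cop_Gl cou_Gl ad del: HA_simps")
 next
  case False
  show ?thesis
   by (rule not_bc_dual[OF False, where be = "ch g" and aa = "ch h" and ga = "ch ?k"])
    (use st g k nc in "simp_all add: ch_in ch_apply mul_ch inv_ch cs_mul cs_one tm iv del: HA_simps")
 qed
qed

end

text \<open>The symmetric group \<open>S\<^sub>3\<close>: the pair \<open>(a, e)\<close> is the map \<open>x \<mapsto> \<plusminus>x + a\<close> of \<open>Z/3\<close>.\<close>

lemma counterexample: "EX B0 :: ('k::field, nat => 'k) hopf. hopf_algebra B0 & bij_betw (anti B0) (carr B0) (carr B0) &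
  (ALL s t. s + 2 <= t --> ~ braided_commutative (double B0) (chain B0 s t))"
proof -
 let ?G = "{0, 1, 2} \<times> UNIV :: (nat \<times> bool) set"
 let ?tm = "%(a, e) (b, f). ((a + (if e then 2 * b else b)) mod 3 :: nat, e ~= f)"
 let ?iv = "%(a, e). ((if e then a else 2 * a) mod 3 :: nat, e)"
 obtain c :: "_ => nat" where c: "inj_on c (?G \<times> ?G)"
  using finite_imp_inj_to_nat_seg[of "?G \<times> ?G"] by auto
 interpret fgrp ?G ?tm "(0, False)" ?iv c "TYPE('k)"
  by unfold_locales (use c in "auto split: if_splits")
 show ?thesis
  \<comment> \<open>The translation x + 1 and the reflection -x do not commute.\<close>
  using hopf_HA bij_HA not_braided_commutative_chain[of "(1, False)" "(0, True)"] by (intro exI[of _ HA]) auto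
qed

theorem mainTheorem8:
  fixes B :: "('k::field, 'b::ab_group_add) hopf"
  assumes "hopf_algebra B" and "bij_betw (anti B) (carr B) (carr B)"
  shows
    \<comment> \<open>the two kinds of factors\<close>
    "yd_module_algebra (double B) (dual_yd B) \<and> yd_module_algebra (double B) (self_yd B) \<and>
     \<comment> \<open>all chains exist and are Yetter--Drinfeld module algebras\<close>
     (\<forall>s t. s \<le> t \<longrightarrow>
        braided_mult (double B) {s..t} (chain_factor B) (mul (chain B s t)) \<and>
        yd_module_algebra (double B) (chain B s t)) \<and>
     \<comment> \<open>relations\<close>
     (\<forall>s t i j. 2*i \<in> {s..t} \<longrightarrow> 2*j+1 \<in> {s..t} \<longrightarrow>
        (\<forall>b \<in> carr B. \<forall>\<beta> \<in> carr (dual B).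
           mul (chain B s t) (self_at B s t (2*i) b) (dual_at B s t (2*j+1) \<beta>)
           = sw B b (\<lambda>b1 b2.
               mul (chain B s t) (dual_at B s t (2*j+1) (hit B b1 \<beta>))
                 (self_at B s t (2*i) b2)))) \<and>
     (\<forall>s t i j. 2*i+1 \<in> {s..t} \<longrightarrow> 2*j+1 \<in> {s..t} \<longrightarrow> i \<ge> j \<longrightarrow>
        (\<forall>\<alpha> \<in> carr (dual B). \<forall>\<beta> \<in> carr (dual B).
           mul (chain B s t) (dual_at B s t (2*i+1) \<alpha>) (dual_at B s t (2*j+1) \<beta>)
           = sw3 (dual B) \<alpha> (\<lambda>\<alpha>1 \<alpha>2 \<alpha>3.
               mul (chain B s t)
                 (dual_at B s t (2*j+1)
                   (mul (dual B) (mul (dual B) \<alpha>3 \<beta>) (anti_inv (dual B) \<alpha>2)))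
                 (dual_at B s t (2*i+1) \<alpha>1)))) \<and>
     (\<forall>s t i j. 2*i \<in> {s..t} \<longrightarrow> 2*j \<in> {s..t} \<longrightarrow> i \<ge> j \<longrightarrow>
        (\<forall>a \<in> carr B. \<forall>b \<in> carr B.
           mul (chain B s t) (self_at B s t (2*i) a) (self_at B s t (2*j) b)
           = sw3 B a (\<lambda>a1 a2 a3.
               mul (chain B s t)
                 (self_at B s t (2*j) (mul B (mul B a1 b) (anti B a2)))
                 (self_at B s t (2*i) a3)))) \<and>
     \<comment> \<open>the embeddings form directed systems, which have inductive limits\<close>
     (\<forall>s t s' t'. s' \<le> s \<longrightarrow> s \<le> t \<longrightarrow> t \<le> t' \<longrightarrow>
        yd_hom (double B) (chain B s t) (chain B s' t') (chain_embed B (s, t) (s', t')) \<and>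
        inj_on (chain_embed B (s, t) (s', t')) (carr (chain B s t))) \<and>
     (\<forall>s t. s \<le> t \<longrightarrow>
        (\<forall>x \<in> carr (chain B s t). chain_embed B (s, t) (s, t) x = x)) \<and>
     (\<forall>s t s' t' s'' t''. s'' \<le> s' \<longrightarrow> s' \<le> s \<longrightarrow> s \<le> t \<longrightarrow> t \<le> t' \<longrightarrow> t' \<le> t'' \<longrightarrow>
        (\<forall>x \<in> carr (chain B s t).
           chain_embed B (s', t') (s'', t'') (chain_embed B (s, t) (s', t') x)
           = chain_embed B (s, t) (s'', t'') x)) \<and>
     (\<forall>D \<in> chain_systems.
        \<exists>(L :: ('k, ('k, 'b \<Rightarrow> 'k, 'b) tens, ('k, int, ('b \<Rightarrow> 'k) \<times> 'b) mtens) yd) \<iota>.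
          yd_module_algebra (double B) L \<and>
          inductive_limit (double B) D chain_le (\<lambda>(s, t). chain B s t) (chain_embed B) L \<iota>) \<and>
     \<comment> \<open>failure of braided commutativity, in general, for three or more factors\<close>
     (\<exists>B0 :: ('k, nat \<Rightarrow> 'k) hopf.
        hopf_algebra B0 \<and> bij_betw (anti B0) (carr B0) (carr B0) \<and>
        (\<forall>s t. s + 2 \<le> t \<longrightarrow> \<not> braided_commutative (double B0) (chain B0 s t)))"
proof -
  interpret hopf B
    using assms by (simp add: hopf_def hopf_axioms_def bialg_def hopf_algebra_def)
  have chn: "chn B s t" if "s \<le> t" for s t
    using that by unfold_locales
  show ?thesis
  proof (intro conjI allI impI ballI; (rule yd_dual yd_self counterexample; fail)?)
    fix s t :: int
    assume st: "s \<le> t"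
    show "braided_mult Db {s..t} C (mul (chain B s t))" "yd_module_algebra Db (chain B s t)"
      unfolding chain_def by (rule brp.braided_mult_BP[OF brp_chain[OF st]] brp.yd_BP[OF brp_chain[OF st]])+
    fix x assume "x \<in> carr (chain B s t)"
    then show "chain_embed B (s, t) (s, t) x = x"
      unfolding ce_emb chain_vs using fam.emb_id[OF fam_C] st by simp
  next
    fix s t i j :: int and b be
    assume "2*i \<in> {s..t}" "2*j+1 \<in> {s..t}" "b \<in> carr B" "be \<in> carr D"
    then show "mul (chain B s t) (self_at B s t (2*i) b) (dual_at B s t (2*j+1) be)
      = sw B b (\<lambda>b1 b2. mul (chain B s t) (dual_at B s t (2*j+1) (hit B b1 be)) (self_at B s t (2*i) b2))"
      unfolding chain_def by (intro chn.self_dual[OF chn]) auto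
  next
    fix s t i j :: int and aa be
    assume "2*i+1 \<in> {s..t}" "2*j+1 \<in> {s..t}" "i \<ge> j" "aa \<in> carr D" "be \<in> carr D"
    then show "mul (chain B s t) (dual_at B s t (2*i+1) aa) (dual_at B s t (2*j+1) be)
      = sw3 D aa (\<lambda>aa1 aa2 aa3. mul (chain B s t)
          (dual_at B s t (2*j+1) (mul D (mul D aa3 be) (anti_inv D aa2))) (dual_at B s t (2*i+1) aa1))"
      unfolding chain_def by (intro chn.dual_dual[OF chn]) auto
  next
    fix s t i j :: int and a b
    assume "2*i \<in> {s..t}" "2*j \<in> {s..t}" "i \<ge> j" "a \<in> carr B" "b \<in> carr B"
    then show "mul (chain B s t) (self_at B s t (2*i) a) (self_at B s t (2*j) b)
      = sw3 B a (\<lambda>a1 a2 a3. mul (chain B s t)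
          (self_at B s t (2*j) (mul B (mul B a1 b) (anti B a2))) (self_at B s t (2*i) a3))"
      unfolding chain_def by (intro chn.self_self[OF chn]) auto
  next
    fix s t s' t' :: int
    assume le: "s' \<le> s" "s \<le> t" "t \<le> t'"
    show "yd_hom Db (chain B s t) (chain B s' t') (chain_embed B (s, t) (s', t'))"
      by (rule chain_embed_hom[OF le])
    show "inj_on (chain_embed B (s, t) (s', t')) (carr (chain B s t))"
      unfolding ce_emb chain_vs using fam.emb_inj[OF fam_C] unity_chain_factor le by simp
    fix s'' t'' x
    assume "s'' \<le> s'" "t' \<le> t''" "x \<in> carr (chain B s t)"
    then show "chain_embed B (s', t') (s'', t'') (chain_embed B (s, t) (s', t') x)
      = chain_embed B (s, t) (s'', t'') x"
      unfolding ce_emb chain_vs using fam.emb_emb[OF fam_C] le by simp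
  qed (rule chain_limit)
qed

end
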